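(* Let $\Gamma$ be an amenable discrete group and $\mathcal{X}\subseteq\mathrm{Sub}(\Gamma)$ a closed and conjugation-invariant set of subgroups. If either (I) every $X\in\mathcal{X}$ is finite, (II) every $X\in\mathcal{X}$ is co-finite (i.e. has finite index in $\Gamma$), or (III) $\Gamma$ is countable and finite-by-nilpotent, then $\mathcal{X}\in\mathcal{D}_\Gamma$.
   Context: For a discrete group $\Gamma$, $\mathrm{Sub}(\Gamma)$ is the set of subgroups of $\Gamma$ with the Chabauty topology (the subspace topology from $\{0,1\}^\Gamma$ with the product topology via $X\mapsto\mathbbm{1}_X$). For $X\in\mathrm{Sub}(\Gamma)$, $\lambda_{\Gamma/X}$ is the quasi-regular representation on $\ell^2(\Gamma/X)$, $\lambda_{\Gamma/X}(g)\delta_{hX}=\delta_{ghX}$, extended (for amenable $\Gamma$) to $C^*_r(\Gamma)=C^*(\Gamma)$. For $\mathcal{X}\subseteq\mathrm{Sub}(\Gamma)$, $J_{\Gamma,\mathcal{X}}:=\bigcap_{X\in\mathcal{X}}\ker(\lambda_{\Gamma/X})\trianglelefteq C^*_r(\Gamma)$. $\mathcal{D}_\Gamma$ is the set of all closed, conjugation-invariant $\mathcal{X}\subseteq\mathrm{Sub}(\Gamma)$ such that $J_{\Gamma,\mathcal{X}}\cap\mathbb{C}[\Gamma]$ is dense in $J_{\Gamma,\mathcal{X}}$. A group $\Gamma$ is finite-by-nilpotent if there is a finite normal subgroup $N\trianglelefteq\Gamma$ with $\Gamma/N$ nilpotent. *)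

theory Defs
  imports "HOL-Analysis.Analysis" "HOL-Algebra.Left_Coset" "HOL-Algebra.Generated_Groups"
begin

section \<open>The Hilbert space of square-summable functions\<close>

typedef 's ell2 = "{f :: 's \<Rightarrow> complex. (\<lambda>x. (norm (f x))\<^sup>2) summable_on UNIV}"
  morphisms ell2_apply Abs_ell2
  by (rule exI[of _ "\<lambda>_. 0"]) simp

setup_lifting type_definition_ell2

lemma square_summable_add:
  fixes f g :: "'s \<Rightarrow> complex"
  assumes "(\<lambda>x. (norm (f x))\<^sup>2) summable_on UNIV" "(\<lambda>x. (norm (g x))\<^sup>2) summable_on UNIV"
  shows "(\<lambda>x. (norm (f x + g x))\<^sup>2) summable_on UNIV"
proof (rule summable_on_comparison_test)
  show "(\<lambda>x. 2 * (norm (f x))\<^sup>2 + 2 * (norm (g x))\<^sup>2) summable_on UNIV"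
    using assms by (intro summable_on_add summable_on_cmult_right)
  fix x
  have "(norm (f x + g x))\<^sup>2 \<le> (norm (f x) + norm (g x))\<^sup>2"
    by (intro power_mono norm_triangle_ineq) simp
  also have "\<dots> \<le> 2 * (norm (f x))\<^sup>2 + 2 * (norm (g x))\<^sup>2"
    using sum_squares_bound[of "norm (f x)" "norm (g x)"] by (simp add: power2_sum)
  finally show "(norm (f x + g x))\<^sup>2 \<le> 2 * (norm (f x))\<^sup>2 + 2 * (norm (g x))\<^sup>2" .
qed simp

lemma square_summable_cmult:
  fixes f :: "'s \<Rightarrow> complex"
  assumes "(\<lambda>x. (norm (f x))\<^sup>2) summable_on UNIV"
  shows "(\<lambda>x. (norm (c * f x))\<^sup>2) summable_on UNIV"
  using assms by (simp add: norm_mult power_mult_distrib summable_on_cmult_right)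

lemma square_summable_inner:
  fixes f g :: "'s \<Rightarrow> complex"
  assumes "(\<lambda>x. (norm (f x))\<^sup>2) summable_on UNIV" "(\<lambda>x. (norm (g x))\<^sup>2) summable_on UNIV"
  shows "(\<lambda>x. inner (f x) (g x)) summable_on UNIV"
proof -
  have "(\<lambda>x. norm (norm (f x) * norm (g x))) summable_on UNIV"
    by (rule Infinite_Sum.abs_summable_product) (use assms in \<open>simp_all add: power2_eq_square\<close>)
  then have "(\<lambda>x. norm (inner (f x) (g x))) summable_on UNIV"
    by (rule Infinite_Sum.abs_summable_on_comparison_test) (simp add: Cauchy_Schwarz_ineq2)
  then show ?thesis
    by (rule Infinite_Sum.abs_summable_summable)
qed

instantiation ell2 :: (type) real_inner
begin

lift_definition zero_ell2 :: "'a ell2" is "\<lambda>_. 0" by simp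

lift_definition plus_ell2 :: "'a ell2 \<Rightarrow> 'a ell2 \<Rightarrow> 'a ell2" is "\<lambda>f g x. f x + g x"
  by (rule square_summable_add)

lift_definition uminus_ell2 :: "'a ell2 \<Rightarrow> 'a ell2" is "\<lambda>f x. - f x" by simp

definition minus_ell2 :: "'a ell2 \<Rightarrow> 'a ell2 \<Rightarrow> 'a ell2" where "minus_ell2 \<xi> \<eta> = \<xi> + (- \<eta>)"

lift_definition scaleR_ell2 :: "real \<Rightarrow> 'a ell2 \<Rightarrow> 'a ell2" is "\<lambda>r f x. of_real r * f x"
  by (rule square_summable_cmult)

text \<open>The real part of the usual complex inner product; it induces the same norm.\<close>

lift_definition inner_ell2 :: "'a ell2 \<Rightarrow> 'a ell2 \<Rightarrow> real"
  is "\<lambda>f g. \<Sum>\<^sub>\<infinity>x. inner (f x) (g x)" .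

definition norm_ell2 :: "'a ell2 \<Rightarrow> real" where "norm_ell2 \<xi> = sqrt (inner \<xi> \<xi>)"

definition sgn_ell2 :: "'a ell2 \<Rightarrow> 'a ell2" where "sgn_ell2 \<xi> = inverse (norm \<xi>) *\<^sub>R \<xi>"

definition dist_ell2 :: "'a ell2 \<Rightarrow> 'a ell2 \<Rightarrow> real" where "dist_ell2 \<xi> \<eta> = norm (\<xi> - \<eta>)"

definition uniformity_ell2 :: "('a ell2 \<times> 'a ell2) filter"
  where "uniformity_ell2 = (INF e\<in>{0 <..}. principal {(\<xi>, \<eta>). dist \<xi> \<eta> < e})"

definition open_ell2 :: "'a ell2 set \<Rightarrow> bool"
  where "open_ell2 U \<longleftrightarrow> (\<forall>\<xi>\<in>U. \<forall>\<^sub>F (\<xi>', \<eta>) in uniformity. \<xi>' = \<xi> \<longrightarrow> \<eta> \<in> U)"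

instance
proof
  fix \<xi> \<eta> \<zeta> :: "'a ell2" and r s :: real
  show "\<xi> + \<eta> + \<zeta> = \<xi> + (\<eta> + \<zeta>)" by transfer (simp add: add.assoc)
  show "\<xi> + \<eta> = \<eta> + \<xi>" by transfer (simp add: add.commute)
  show "0 + \<xi> = \<xi>" by transfer simp
  show "- \<xi> + \<xi> = 0" by transfer simp
  show "\<xi> - \<eta> = \<xi> + - \<eta>" by (rule minus_ell2_def)
  show "r *\<^sub>R (\<xi> + \<eta>) = r *\<^sub>R \<xi> + r *\<^sub>R \<eta>" by transfer (simp add: distrib_left)
  show "(r + s) *\<^sub>R \<xi> = r *\<^sub>R \<xi> + s *\<^sub>R \<xi>" by transfer (simp add: distrib_right)
  show "r *\<^sub>R s *\<^sub>R \<xi> = (r * s) *\<^sub>R \<xi>" by transfer (simp add: mult.assoc)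
  show "1 *\<^sub>R \<xi> = \<xi>" by transfer simp
  show "inner \<xi> \<eta> = inner \<eta> \<xi>" by transfer (simp add: inner_commute)
  show "inner (\<xi> + \<eta>) \<zeta> = inner \<xi> \<zeta> + inner \<eta> \<zeta>"
    by transfer (simp add: inner_add_left infsum_add square_summable_inner)
  show "inner (r *\<^sub>R \<xi>) \<eta> = r * inner \<xi> \<eta>"
    by transfer (simp add: scaleR_conv_of_real[symmetric] infsum_cmult_right')
  show "0 \<le> inner \<xi> \<xi>" by transfer (simp add: infsum_nonneg)
  show "inner \<xi> \<xi> = 0 \<longleftrightarrow> \<xi> = 0"
  proof
    assume z: "inner \<xi> \<xi> = 0"
    have sq: "(\<lambda>x. (norm (ell2_apply \<xi> x))\<^sup>2) summable_on UNIV"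
      using ell2_apply[of \<xi>] by simp
    have 0: "inner (ell2_apply \<xi> x) (ell2_apply \<xi> x) = 0" for x
    proof (rule nonneg_infsum_le_0D[where A = UNIV and
          f = "\<lambda>x. inner (ell2_apply \<xi> x) (ell2_apply \<xi> x)"])
      show "(\<Sum>\<^sub>\<infinity>x. inner (ell2_apply \<xi> x) (ell2_apply \<xi> x)) \<le> 0"
        using z by (simp add: inner_ell2.rep_eq)
      show "(\<lambda>x. inner (ell2_apply \<xi> x) (ell2_apply \<xi> x)) summable_on UNIV"
        by (rule square_summable_inner[OF sq sq])
    qed (simp_all only: inner_ge_zero UNIV_I)
    have "ell2_apply \<xi> = ell2_apply 0"
      using 0 by (simp add: fun_eq_iff zero_ell2.rep_eq)
    then show "\<xi> = 0"
      by (simp add: ell2_apply_inject)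
  next
    assume "\<xi> = 0"
    then show "inner \<xi> \<xi> = 0"
      by (simp add: inner_ell2.rep_eq zero_ell2.rep_eq)
  qed
qed (rule norm_ell2_def sgn_ell2_def dist_ell2_def uniformity_ell2_def open_ell2_def)+

end

lemma norm_ell2_eq: "norm \<xi> = sqrt (\<Sum>\<^sub>\<infinity>x. (norm (ell2_apply \<xi> x))\<^sup>2)"
  by (simp add: norm_ell2_def inner_ell2.rep_eq power2_norm_eq_inner)

lift_definition delta :: "'s \<Rightarrow> 's ell2" is "\<lambda>s x. if x = s then 1 else 0"
proof -
  fix s :: 's
  have "(\<lambda>x. (norm (if x = s then 1 else 0 :: complex))\<^sup>2) summable_on {s}"
    by simp
  then show "(\<lambda>x. (norm (if x = s then 1 else 0 :: complex))\<^sup>2) summable_on UNIV"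
    by (rule summable_on_cong_neutral[THEN iffD1, rotated -1]) auto
qed

section \<open>Operators\<close>

text \<open>
  The type \<open>'s ell2 \<Rightarrow>\<^sub>L 't ell2\<close> consists of the bounded real-linear operators.  All operators
  used below are complex-linear, and the real and the complex operator norm agree.
\<close>

lift_definition ell2_cmult :: "complex \<Rightarrow> 's ell2 \<Rightarrow> 's ell2" is "\<lambda>c f x. c * f x"
  by (rule square_summable_cmult)

lift_definition cmult_op :: "complex \<Rightarrow> 's ell2 \<Rightarrow>\<^sub>L 's ell2" is ell2_cmult
proof (rule bounded_linear_intro[where K = "norm c" for c])
  fix c :: complex and \<xi> \<eta> :: "'s ell2" and r :: real
  show "ell2_cmult c (\<xi> + \<eta>) = ell2_cmult c \<xi> + ell2_cmult c \<eta>"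
    by transfer (simp add: distrib_left)
  show "ell2_cmult c (r *\<^sub>R \<xi>) = r *\<^sub>R ell2_cmult c \<xi>"
    by transfer (simp add: mult.left_commute)
  show "norm (ell2_cmult c \<xi>) \<le> norm \<xi> * norm c"
    by (simp add: norm_ell2_eq ell2_cmult.rep_eq norm_mult power_mult_distrib
        infsum_cmult_right' real_sqrt_mult)
qed

text \<open>
  For a subset \<open>S\<close> of a type, the Hilbert space over \<open>S\<close> is the closed subspace of \<open>'s ell2\<close> of
  functions vanishing outside \<open>S\<close>, and an operator on it is extended by zero on the orthogonal
  complement, which is isometric and compatible with all algebraic operations.

  \<open>perm_op S \<sigma>\<close> is the unitary of the Hilbert space over \<open>S\<close> with \<open>\<delta>\<^sub>x \<mapsto> \<delta>\<^bsub>\<sigma> x\<^esub>\<close>, for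
  a bijection \<open>\<sigma>\<close> of \<open>S\<close> (and a dummy value otherwise).
\<close>

lemma perm_summable:
  fixes f :: "'s \<Rightarrow> real"
  assumes "f summable_on UNIV" "bij_betw \<sigma> S S"
  shows "(\<lambda>x. f (inv_into S \<sigma> x)) summable_on S"
    and "(\<Sum>\<^sub>\<infinity>x\<in>S. f (inv_into S \<sigma> x)) = (\<Sum>\<^sub>\<infinity>x\<in>S. f x)"
proof -
  have b: "bij_betw (inv_into S \<sigma>) S S" by (rule bij_betw_inv_into[OF assms(2)])
  have "f summable_on S" using assms(1) by (rule summable_on_subset_banach) simp
  then show "(\<lambda>x. f (inv_into S \<sigma> x)) summable_on S"
    by (simp add: summable_on_reindex_bij_betw[OF b])
  show "(\<Sum>\<^sub>\<infinity>x\<in>S. f (inv_into S \<sigma> x)) = (\<Sum>\<^sub>\<infinity>x\<in>S. f x)"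
    by (rule infsum_reindex_bij_betw[OF b])
qed

lift_definition perm_ell2 :: "'s set \<Rightarrow> ('s \<Rightarrow> 's) \<Rightarrow> 's ell2 \<Rightarrow> 's ell2"
  is "\<lambda>S \<sigma> f x. if bij_betw \<sigma> S S \<and> x \<in> S then f (inv_into S \<sigma> x) else 0"
proof -
  fix S and \<sigma> :: "'s \<Rightarrow> 's" and f :: "'s \<Rightarrow> complex"
  assume f: "(\<lambda>x. (norm (f x))\<^sup>2) summable_on UNIV"
  let ?h = "\<lambda>x. (norm (if bij_betw \<sigma> S S \<and> x \<in> S then f (inv_into S \<sigma> x) else 0))\<^sup>2"
  show "?h summable_on UNIV"
  proof (cases "bij_betw \<sigma> S S")
    case True
    have "?h summable_on S \<longleftrightarrow> (\<lambda>x. (norm (f (inv_into S \<sigma> x)))\<^sup>2) summable_on S"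
      by (rule summable_on_cong) (simp add: True)
    then have "?h summable_on S"
      using perm_summable(1)[OF f True] by simp
    then show ?thesis
      by (rule summable_on_cong_neutral[THEN iffD1, rotated -1]) auto
  qed simp
qed

lift_definition perm_op :: "'s set \<Rightarrow> ('s \<Rightarrow> 's) \<Rightarrow> 's ell2 \<Rightarrow>\<^sub>L 's ell2" is perm_ell2
proof (rule bounded_linear_intro[where K = 1])
  fix S and \<sigma> :: "'s \<Rightarrow> 's" and \<xi> \<eta> :: "'s ell2" and r :: real
  show "perm_ell2 S \<sigma> (\<xi> + \<eta>) = perm_ell2 S \<sigma> \<xi> + perm_ell2 S \<sigma> \<eta>"
    by transfer auto
  show "perm_ell2 S \<sigma> (r *\<^sub>R \<xi>) = r *\<^sub>R perm_ell2 S \<sigma> \<xi>"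
    by transfer auto
  show "norm (perm_ell2 S \<sigma> \<xi>) \<le> norm \<xi> * 1"
  proof (cases "bij_betw \<sigma> S S")
    case True
    have s: "(\<lambda>x. (norm (ell2_apply \<xi> x))\<^sup>2) summable_on UNIV"
      using ell2_apply[of \<xi>] by simp
    have "(\<Sum>\<^sub>\<infinity>x. (norm (ell2_apply (perm_ell2 S \<sigma> \<xi>) x))\<^sup>2)
        = (\<Sum>\<^sub>\<infinity>x\<in>S. (norm (ell2_apply \<xi> (inv_into S \<sigma> x)))\<^sup>2)"
      by (rule infsum_cong_neutral) (auto simp: perm_ell2.rep_eq True)
    also have "\<dots> = (\<Sum>\<^sub>\<infinity>x\<in>S. (norm (ell2_apply \<xi> x))\<^sup>2)"
      by (rule perm_summable(2)[OF s True])
    also have "\<dots> \<le> (\<Sum>\<^sub>\<infinity>x. (norm (ell2_apply \<xi> x))\<^sup>2)"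
      using s by (intro infsum_mono2 summable_on_subset_banach[OF s]) auto
    finally show ?thesis by (simp add: norm_ell2_eq)
  next
    case False
    then have "perm_ell2 S \<sigma> \<xi> = 0" by transfer simp
    then show ?thesis by simp
  qed
qed

lemma perm_op_delta:
  assumes "bij_betw \<sigma> S S" "x \<in> S"
  shows "perm_op S \<sigma> (delta x) = delta (\<sigma> x)"
proof -
  have "(y \<in> S \<and> inv_into S \<sigma> y = x) \<longleftrightarrow> y = \<sigma> x" for y
    using assms by (metis bij_betw_apply bij_betw_inv_into_left bij_betw_inv_into_right)
  then have "ell2_apply (perm_ell2 S \<sigma> (delta x)) = ell2_apply (delta (\<sigma> x))"
    using assms by (auto simp: fun_eq_iff perm_ell2.rep_eq delta.rep_eq)
  then show ?thesis
    by (simp add: perm_op.rep_eq ell2_apply_inject)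
qed

section \<open>The reduced group C*-algebra and quasi-regular representations\<close>

definition group_algebra :: "('g, 'b) monoid_scheme \<Rightarrow> ('g \<Rightarrow> complex) set"
  where "group_algebra G = {a. finite {g. a g \<noteq> 0} \<and> {g. a g \<noteq> 0} \<subseteq> carrier G}"

definition regular_rep :: "('g, 'b) monoid_scheme \<Rightarrow> 'g \<Rightarrow> 'g ell2 \<Rightarrow>\<^sub>L 'g ell2"
  where "regular_rep G g = perm_op (carrier G) (\<lambda>h. g \<otimes>\<^bsub>G\<^esub> h)"

definition quasi_regular_rep ::
    "('g, 'b) monoid_scheme \<Rightarrow> 'g set \<Rightarrow> 'g \<Rightarrow> 'g set ell2 \<Rightarrow>\<^sub>L 'g set ell2"
  where "quasi_regular_rep G X g = perm_op (lcosets\<^bsub>G\<^esub> X) (\<lambda>C. g <#\<^bsub>G\<^esub> C)"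

lemma (in group) bij_betw_left_mult:
  assumes "g \<in> carrier G"
  shows "bij_betw (\<lambda>h. g \<otimes> h) (carrier G) (carrier G)"
  by (rule bij_betw_byWitness[where f' = "\<lambda>h. inv g \<otimes> h"])
     (use assms in \<open>auto simp: m_assoc[symmetric]\<close>)

lemma (in group) bij_betw_lcosets:
  assumes "g \<in> carrier G" "subgroup X G"
  shows "bij_betw (\<lambda>C. g <# C) (lcosets X) (lcosets X)"
proof (rule bij_betw_byWitness[where f' = "\<lambda>C. inv g <# C"])
  have X: "X \<subseteq> carrier G" by (rule subgroup.subset[OF assms(2)])
  have *: "k <# (h <# X) = (k \<otimes> h) <# X" if "k \<in> carrier G" "h \<in> carrier G" for k h
    by (rule lcos_m_assoc[OF X that])
  show "\<forall>C\<in>lcosets X. inv g <# (g <# C) = C" "\<forall>C\<in>lcosets X. g <# (inv g <# C) = C"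
    using assms(1) by (auto simp: LCOSETS_def * m_assoc[symmetric])
  have "(\<lambda>C. k <# C) ` (lcosets X) \<subseteq> lcosets X" if "k \<in> carrier G" for k
  proof (rule image_subsetI)
    fix C assume "C \<in> lcosets X"
    then obtain h where h: "h \<in> carrier G" "C = h <# X"
      unfolding LCOSETS_def by blast
    then have "k <# C = (k \<otimes> h) <# X" "k \<otimes> h \<in> carrier G"
      using that by (simp_all add: *)
    then show "k <# C \<in> lcosets X"
      unfolding LCOSETS_def by blast
  qed
  then show "(\<lambda>C. g <# C) ` (lcosets X) \<subseteq> lcosets X"
      "(\<lambda>C. inv g <# C) ` (lcosets X) \<subseteq> lcosets X"
    using assms(1) by auto
qed

lemma (in group) regular_rep_delta:
  assumes "g \<in> carrier G" "h \<in> carrier G"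
  shows "regular_rep G g (delta h) = delta (g \<otimes> h)"
  unfolding regular_rep_def by (rule perm_op_delta[OF bij_betw_left_mult]) (use assms in auto)

lemma (in group) quasi_regular_rep_delta:
  assumes "g \<in> carrier G" "h \<in> carrier G" "subgroup X G"
  shows "quasi_regular_rep G X g (delta (h <# X)) = delta ((g \<otimes> h) <# X)"
proof -
  have "g <# (h <# X) = (g \<otimes> h) <# X"
    by (rule lcos_m_assoc) (use assms subgroup.subset in auto)
  moreover have "h <# X \<in> lcosets X"
    using assms(2) by (auto simp: LCOSETS_def)
  ultimately show ?thesis
    unfolding quasi_regular_rep_def
    using perm_op_delta[OF bij_betw_lcosets[OF assms(1,3)]] by simp
qed

text \<open>Linear extension of a representation to the group algebra.\<close>

definition lin_ext :: "('g \<Rightarrow> 's ell2 \<Rightarrow>\<^sub>L 's ell2) \<Rightarrow> ('g \<Rightarrow> complex) \<Rightarrow> 's ell2 \<Rightarrow>\<^sub>L 's ell2"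
  where "lin_ext \<pi> a = (\<Sum>g | a g \<noteq> 0. cmult_op (a g) o\<^sub>L \<pi> g)"

definition group_algebra_ops :: "('g, 'b) monoid_scheme \<Rightarrow> ('g ell2 \<Rightarrow>\<^sub>L 'g ell2) set"
  where "group_algebra_ops G = lin_ext (regular_rep G) ` group_algebra G"

text \<open>The closure is taken in the operator norm.\<close>

definition reduced_cstar :: "('g, 'b) monoid_scheme \<Rightarrow> ('g ell2 \<Rightarrow>\<^sub>L 'g ell2) set"
  where "reduced_cstar G = closure (group_algebra_ops G)"

text \<open>
  The extension of \<open>\<lambda>\<^bsub>G/X\<^esub>\<close> to the reduced group C*-algebra is the unique continuous map that
  agrees with \<open>\<lambda>\<^bsub>G/X\<^esub>\<close> on the group algebra (by density it is then a \<open>*\<close>-homomorphism).  It exists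
  for amenable groups, where the reduced and the full group C*-algebra coincide; the definition
  is meaningful only in that case.
\<close>

definition quasi_regular_ext ::
    "('g, 'b) monoid_scheme \<Rightarrow> 'g set \<Rightarrow> ('g ell2 \<Rightarrow>\<^sub>L 'g ell2) \<Rightarrow> ('g set ell2 \<Rightarrow>\<^sub>L 'g set ell2)"
  where "quasi_regular_ext G X =
    (THE \<pi>. \<pi> \<in> extensional (reduced_cstar G) \<and> continuous_on (reduced_cstar G) \<pi> \<and>
      (\<forall>a\<in>group_algebra G. \<pi> (lin_ext (regular_rep G) a) = lin_ext (quasi_regular_rep G X) a))"

lemma quasi_regular_ext_eqI:
  assumes "\<pi> \<in> extensional (reduced_cstar G)" "continuous_on (reduced_cstar G) \<pi>"
    and "\<And>a. a \<in> group_algebra G \<Longrightarrow>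
      \<pi> (lin_ext (regular_rep G) a) = lin_ext (quasi_regular_rep G X) a"
  shows "quasi_regular_ext G X = \<pi>"
  unfolding quasi_regular_ext_def
proof (rule the_equality)
  fix \<rho> :: "('a ell2 \<Rightarrow>\<^sub>L 'a ell2) \<Rightarrow> ('a set ell2 \<Rightarrow>\<^sub>L 'a set ell2)"
  assume \<rho>: "\<rho> \<in> extensional (reduced_cstar G) \<and> continuous_on (reduced_cstar G) \<rho> \<and>
      (\<forall>a\<in>group_algebra G. \<rho> (lin_ext (regular_rep G) a) = lin_ext (quasi_regular_rep G X) a)"
  have "\<rho> T - \<pi> T = 0" if "T \<in> reduced_cstar G" for T
  proof (rule continuous_constant_on_closure[where S = "group_algebra_ops G"])
    show "continuous_on (closure (group_algebra_ops G)) (\<lambda>T. \<rho> T - \<pi> T)"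
      using \<rho> assms(2) unfolding reduced_cstar_def by (intro continuous_on_diff) auto
    show "\<rho> U - \<pi> U = 0" if "U \<in> group_algebra_ops G" for U
      using that \<rho> assms(3) unfolding group_algebra_ops_def by auto
    show "T \<in> closure (group_algebra_ops G)"
      using \<open>T \<in> reduced_cstar G\<close> unfolding reduced_cstar_def .
  qed
  then show "\<rho> = \<pi>"
    using \<rho> assms(1) by (intro extensionalityI[of _ "reduced_cstar G"]) auto
qed (use assms in auto)

section \<open>Amenable and finite-by-nilpotent groups\<close>

text \<open>
  An invariant mean is a left-invariant state on the bounded functions on the group, here applied
  to functions on the whole type; by positivity only the values on the carrier matter.
\<close>

definition invariant_mean :: "('g, 'b) monoid_scheme \<Rightarrow> (('g \<Rightarrow> real) \<Rightarrow> real) \<Rightarrow> bool"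
  where "invariant_mean G m \<longleftrightarrow>
    (\<forall>f f'. bounded (f ` carrier G) \<longrightarrow> bounded (f' ` carrier G) \<longrightarrow>
        m (\<lambda>x. f x + f' x) = m f + m f') \<and>
    (\<forall>c f. bounded (f ` carrier G) \<longrightarrow> m (\<lambda>x. c * f x) = c * m f) \<and>
    (\<forall>f. bounded (f ` carrier G) \<longrightarrow> (\<forall>x\<in>carrier G. 0 \<le> f x) \<longrightarrow> 0 \<le> m f) \<and>
    m (\<lambda>_. 1) = 1 \<and>
    (\<forall>g\<in>carrier G. \<forall>f. bounded (f ` carrier G) \<longrightarrow> m (\<lambda>x. f (g \<otimes>\<^bsub>G\<^esub> x)) = m f)"

definition amenable_group :: "('g, 'b) monoid_scheme \<Rightarrow> bool"
  where "amenable_group G \<longleftrightarrow> group G \<and> (\<exists>m. invariant_mean G m)"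

primrec lower_central_series :: "('g, 'b) monoid_scheme \<Rightarrow> nat \<Rightarrow> 'g set"
  where
    "lower_central_series G 0 = carrier G"
  | "lower_central_series G (Suc n) = generate G
      {x \<otimes>\<^bsub>G\<^esub> y \<otimes>\<^bsub>G\<^esub> inv\<^bsub>G\<^esub> x \<otimes>\<^bsub>G\<^esub> inv\<^bsub>G\<^esub> y | x y.
        x \<in> carrier G \<and> y \<in> lower_central_series G n}"

definition nilpotent_group :: "('g, 'b) monoid_scheme \<Rightarrow> bool"
  where "nilpotent_group G \<longleftrightarrow> group G \<and> (\<exists>n. lower_central_series G n = {\<one>\<^bsub>G\<^esub>})"

definition finite_by_nilpotent :: "('g, 'b) monoid_scheme \<Rightarrow> bool"
  where "finite_by_nilpotent G \<longleftrightarrow> (\<exists>N. N \<lhd> G \<and> finite N \<and> nilpotent_group (G Mod N))"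

section \<open>The Chabauty space and the ideals of families of subgroups\<close>

definition chabauty :: "('g, 'b) monoid_scheme \<Rightarrow> 'g set topology"
  where "chabauty G = pullback_topology {X. subgroup X G}
    (\<lambda>X. \<lambda>g\<in>carrier G. indicator X g)
    (product_topology (\<lambda>_. discrete_topology {0, 1 :: nat}) (carrier G))"

lemma topspace_chabauty: "topspace (chabauty G) = {X. subgroup X G}"
  by (auto simp: chabauty_def topspace_pullback_topology indicator_def)

definition conjugation_invariant :: "('g, 'b) monoid_scheme \<Rightarrow> 'g set set \<Rightarrow> bool"
  where "conjugation_invariant G \<X> \<longleftrightarrow>
    (\<forall>X\<in>\<X>. \<forall>g\<in>carrier G. (g <#\<^bsub>G\<^esub> X) #>\<^bsub>G\<^esub> inv\<^bsub>G\<^esub> g \<in> \<X>)"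

text \<open>For \<open>\<X> = {}\<close> the intersection of kernels is the whole reduced group C*-algebra.\<close>

definition J_ideal :: "('g, 'b) monoid_scheme \<Rightarrow> 'g set set \<Rightarrow> ('g ell2 \<Rightarrow>\<^sub>L 'g ell2) set"
  where "J_ideal G \<X> = {T \<in> reduced_cstar G. \<forall>X\<in>\<X>. quasi_regular_ext G X T = 0}"

definition D_set :: "('g, 'b) monoid_scheme \<Rightarrow> 'g set set set"
  where "D_set G = {\<X>. closedin (chabauty G) \<X> \<and> conjugation_invariant G \<X> \<and>
    J_ideal G \<X> \<subseteq> closure (J_ideal G \<X> \<inter> group_algebra_ops G)}"

end

theory Submission
  imports Defs "HOL-Analysis.Finite_Function_Topology"
begin

text \<open>
  Amenability makes every \<open>\<lambda>\<^bsub>G/X\<^esub>\<close> weakly contained in the regular representation \<open>\<lambda>\<close>, so an element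
  of the ideal is a limit of \<open>\<lambda>(a)\<close> with \<open>a\<close> supported in a finitely generated subgroup \<open>\<Lambda>\<close> and all
  \<open>\<lambda>\<^bsub>G/X\<^esub>(a)\<close> of norm at most a small \<open>s\<close>; it suffices to move \<open>a\<close> by about \<open>s\<close> into the common
  kernel.  In each of the three cases compactness of \<open>\<X>\<close> leaves only finitely many minimal traces
  \<open>X \<inter> \<Lambda>\<close>, and all \<open>\<lambda>\<^bsub>G/X\<^esub>(b)\<close> vanish as soon as the sums of \<open>b\<close> over their cosets do.  A minimal
  trace \<open>Y\<close> has finite index over its normal core \<open>K\<close> in \<open>\<Lambda>\<close>.  Let \<open>P\<close> be the sum of the averages over
  the conjugates of \<open>Y\<close>, as an operator for \<open>\<Lambda>/K\<close>.  The product \<open>aP\<close> lifts to an element of norm at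
  most \<open>C s\<close>, and by Dicman's lemma \<open>P\<close> satisfies a polynomial relation; this relation produces a
  correction \<open>b\<close> of \<open>a\<close> at distance \<open>C s\<close> whose coset sums vanish.  Distances to finitely many ideals
  control the distance to their intersection, and the constant \<open>C\<close> is removed by applying the estimate
  to the powers of \<open>a\<^sup>*a\<close>.
\<close>

section \<open>Approximation by ideals of operators\<close>

text \<open>The support of \<open>a\<close>, hence the subgroup it generates and the constant
  \<open>C\<close>, changes with the required precision, so a bound \<open>C * s\<close> alone gives
  no convergence. The constant can be removed because the quotient norm satisfies a C*-identity: an
  estimate valid for all elements of a selfadjoint algebra improves itself under passage from
  \<open>T\<close> to \<open>T' o\<^sub>L T\<close>.

  The difficulty of the lifting is that absorption into the cosets of \<open>X\<close> yields
  \<open>a\<close> times a weighted average of projections, one for each conjugate of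
  \<open>Y\<close>, with weights dictated by a Reiter function. Summing over the whole finite
  conjugacy class makes the weights disappear; this is the origin of \<open>P\<close>. But
  \<open>P\<close> is merely positive, in general neither a projection nor invertible. A relation
  with lowest term \<open>P^k\<close> only gives a correction \<open>b\<close> with
  \<open>b P^k = 0\<close>, and positivity then forces \<open>b\<close> to annihilate every single
  projection.

  All corrections have to stay finitely supported, so the ideals are not closed and approximate
  units are polynomials instead of limits.\<close>

definition adjoints :: "('h::real_inner \<Rightarrow>\<^sub>L 'k::real_inner) \<Rightarrow> ('k \<Rightarrow>\<^sub>L 'h) \<Rightarrow> bool"
  where "adjoints T T' \<longleftrightarrow> (\<forall>x y. inner (T x) y = inner x (T' y))"

lemma adjoints_norm_le:
  assumes "adjoints T T'"
  shows "norm T' \<le> norm T"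
proof (rule norm_blinfun_bound)
  fix y
  have "(norm (T' y))\<^sup>2 = inner (T (T' y)) y"
    using assms by (simp add: adjoints_def power2_norm_eq_inner)
  also have "\<dots> \<le> norm (T (T' y)) * norm y" by (rule norm_cauchy_schwarz)
  also have "\<dots> \<le> (norm T * norm (T' y)) * norm y"
    by (intro mult_right_mono norm_blinfun) simp
  finally have "norm (T' y) * norm (T' y) \<le> norm (T' y) * (norm T * norm y)"
    by (simp add: power2_eq_square mult_ac)
  then show "norm (T' y) \<le> norm T * norm y"
    by (cases "norm (T' y) = 0") (auto simp: mult_le_cancel_left)
qed simp

lemma adjoints_sym: "adjoints T T' \<Longrightarrow> adjoints T' T"
  by (metis adjoints_def inner_commute)

text \<open>Expanding the square, the cross term contributes minus twice the square of
  \<open>norm (B x)\<close>, and the last term gives back at most one of these since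
  \<open>B'\<close> is a contraction too. So each application of \<open>1 - B' B\<close> pays for
  \<open>norm (B x)\<close>.\<close>

lemma norm_diff_adjoint_sq:
  fixes B :: "'h::real_inner \<Rightarrow>\<^sub>L 'k::real_inner"
  assumes "adjoints B B'" "norm B \<le> 1"
  shows "(norm (x - B' (B x)))\<^sup>2 + (norm (B x))\<^sup>2 \<le> (norm x)\<^sup>2"
proof -
  have "norm (B' (B x)) \<le> norm B' * norm (B x)" by (rule norm_blinfun)
  also have "\<dots> \<le> 1 * norm (B x)"
    using adjoints_norm_le[OF assms(1)] assms(2) by (intro mult_right_mono) auto
  finally have "(norm (B' (B x)))\<^sup>2 \<le> (norm (B x))\<^sup>2" by (intro power_mono) auto
  moreover have "inner x (B' (B x)) = (norm (B x))\<^sup>2"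
    using assms(1) by (simp add: adjoints_def power2_norm_eq_inner)
  ultimately show ?thesis
    unfolding power2_norm_eq_inner by (simp add: inner_diff inner_commute)
qed

text \<open>The recursion says that \<open>1 - approx_unit S n\<close> is the \<open>n\<close>-th
  power of \<open>1 - S\<close>. This is a polynomial in \<open>S\<close> without constant term, so
  it stays in every algebraic ideal containing \<open>S\<close>.\<close>

primrec approx_unit :: "('h::real_normed_vector \<Rightarrow>\<^sub>L 'h) \<Rightarrow> nat \<Rightarrow> 'h \<Rightarrow>\<^sub>L 'h"
  where
    "approx_unit S 0 = 0"
  | "approx_unit S (Suc n) = approx_unit S n + S - (S o\<^sub>L approx_unit S n)"

lemma approx_unit_Suc_apply:
  "x - approx_unit S (Suc n) x = (x - approx_unit S n x) - S (x - approx_unit S n x)"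
  by (simp add: blinfun.bilinear_simps)

text \<open>A telescoping sum in place of functional calculus: the squares of
  \<open>norm (B (r k))\<close> sum to at most the square of \<open>norm x\<close>, and as they
  decrease, the last one is at most their mean.\<close>

lemma approx_unit_bounds:
  fixes B :: "'h::real_inner \<Rightarrow>\<^sub>L 'h"
  assumes adj: "adjoints B B'" and B: "norm B \<le> 1"
  shows "norm (x - approx_unit (B' o\<^sub>L B) n x) \<le> norm x"
    and "real n * (norm (B (x - approx_unit (B' o\<^sub>L B) n x)))\<^sup>2 \<le> (norm x)\<^sup>2"
proof -
  define r where "r n = x - approx_unit (B' o\<^sub>L B) n x" for n
  have step: "r (Suc n) = r n - B' (B (r n))" for n
    unfolding r_def approx_unit_Suc_apply by simp
  \<comment> \<open>\<open>B (r (Suc n))\<close> is \<open>1 - B B'\<close> applied to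
    \<open>B (r n)\<close>, so the basic inequality is used with \<open>B\<close> and
    \<open>B'\<close> exchanged.\<close>
  have dec: "norm (B (r (Suc n))) \<le> norm (B (r n))" for n
  proof -
    have B': "norm B' \<le> 1" using adjoints_norm_le[OF adj] B by simp
    have "(norm (B (r n) - B (B' (B (r n)))))\<^sup>2 \<le> (norm (B (r n)))\<^sup>2"
      using norm_diff_adjoint_sq[OF adjoints_sym[OF adj] B', of "B (r n)"]
      using zero_le_power2[of "norm (B' (B (r n)))"] by linarith
    then show ?thesis
      unfolding step blinfun.diff_right by (rule power2_le_imp_le) simp
  qed
  have sum: "(norm (r n))\<^sup>2 + (\<Sum>k<n. (norm (B (r k)))\<^sup>2) \<le> (norm x)\<^sup>2" for n
  proof (induction n)
    case 0 show ?case by (simp add: r_def)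
  next
    case (Suc n)
    then show ?case
      using norm_diff_adjoint_sq[OF adj B, of "r n"] by (simp add: step)
  qed
  have "0 \<le> (\<Sum>k<n. (norm (B (r k)))\<^sup>2)" by (rule sum_nonneg) simp
  then have "(norm (r n))\<^sup>2 \<le> (norm x)\<^sup>2" using sum[of n] by linarith
  then show "norm (x - approx_unit (B' o\<^sub>L B) n x) \<le> norm x"
    unfolding r_def by (rule power2_le_imp_le) simp
  have "real n * (norm (B (r n)))\<^sup>2 = (\<Sum>k<n. (norm (B (r n)))\<^sup>2)" by simp
  also have "\<dots> \<le> (\<Sum>k<n. (norm (B (r k)))\<^sup>2)"
  proof (rule sum_mono)
    fix k assume "k \<in> {..<n}"
    then have "norm (B (r n)) \<le> norm (B (r k))"
      using lift_Suc_antimono_le[of "\<lambda>k. norm (B (r k))" k n] dec by simp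
    then show "(norm (B (r n)))\<^sup>2 \<le> (norm (B (r k)))\<^sup>2" by (intro power_mono) auto
  qed
  also have "\<dots> \<le> (norm x)\<^sup>2"
    using sum[of n] zero_le_power2[of "norm (r n)"] by linarith
  finally show "real n * (norm (B (x - approx_unit (B' o\<^sub>L B) n x)))\<^sup>2 \<le> (norm x)\<^sup>2"
    unfolding r_def .
qed

text \<open>A purely algebraic notion: \<open>A\<close> and \<open>I\<close> will be images of group
  algebras, and approximants must remain finitely supported.\<close>

definition op_ideal :: "('h::real_inner \<Rightarrow>\<^sub>L 'h) set \<Rightarrow> ('h \<Rightarrow>\<^sub>L 'h) set \<Rightarrow> bool"
  where "op_ideal A I \<longleftrightarrow> I \<subseteq> A \<and> 0 \<in> I \<and>
    (\<forall>S\<in>I. \<forall>T\<in>I. S + T \<in> I) \<and> (\<forall>r. \<forall>S\<in>I. r *\<^sub>R S \<in> I) \<and>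
    (\<forall>S\<in>I. \<forall>T\<in>A. S o\<^sub>L T \<in> I \<and> T o\<^sub>L S \<in> I)"

lemma op_idealD:
  assumes "op_ideal A I"
  shows "S \<in> I \<Longrightarrow> S \<in> A" "0 \<in> I" "S \<in> I \<Longrightarrow> T \<in> I \<Longrightarrow> S + T \<in> I"
    "S \<in> I \<Longrightarrow> T \<in> I \<Longrightarrow> S - T \<in> I"
    "S \<in> I \<Longrightarrow> r *\<^sub>R S \<in> I" "S \<in> I \<Longrightarrow> T \<in> A \<Longrightarrow> S o\<^sub>L T \<in> I" "S \<in> I \<Longrightarrow> T \<in> A \<Longrightarrow> T o\<^sub>L S \<in> I"
proof -
  have "S + (-1) *\<^sub>R T \<in> I" if "S \<in> I" "T \<in> I"
    using assms that unfolding op_ideal_def by blast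
  then show "S \<in> I \<Longrightarrow> T \<in> I \<Longrightarrow> S - T \<in> I" by simp
qed (use assms in \<open>auto simp: op_ideal_def\<close>)

lemma op_ideal_Int: "op_ideal A I \<Longrightarrow> op_ideal A J \<Longrightarrow> op_ideal A (I \<inter> J)"
  unfolding op_ideal_def by blast

lemma approx_unit_in_ideal:
  assumes "op_ideal A I" "S \<in> I"
  shows "approx_unit S n \<in> I"
  using op_idealD[OF assms(1)] assms(2) by (induction n) auto

definition selfadj_set :: "('h::real_inner \<Rightarrow>\<^sub>L 'h) set \<Rightarrow> bool"
  where "selfadj_set A \<longleftrightarrow> (\<forall>T\<in>A. \<exists>T'\<in>A. adjoints T T')"

lemma ideal_approx_unit:
  fixes B :: "'h::real_inner \<Rightarrow>\<^sub>L 'h"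
  assumes "selfadj_set A" "op_ideal A I" "B \<in> I" "\<delta> > 0"
  obtains E where "E \<in> I" "\<And>x. norm (x - E x) \<le> norm x"
    "\<And>x. norm (B (x - E x)) \<le> \<delta> * norm x"
proof -
  note I = op_idealD[OF assms(2)]
  define r where "r = 1 / (norm B + 1)"
  have r: "r > 0" unfolding r_def by (simp add: add_nonneg_pos)
  define B1 where "B1 = r *\<^sub>R B"
  have B1: "B1 \<in> I" unfolding B1_def using I(5) assms(3) by blast
  have n1: "norm B1 \<le> 1" unfolding B1_def r_def by (simp add: divide_simps add_nonneg_pos not_less)
  obtain B' where B': "B' \<in> A" "adjoints B1 B'"
    using assms(1) I(1)[OF B1] unfolding selfadj_set_def by blast
  \<comment> \<open>This size of \<open>n\<close> turns the bound of order \<open>1 / sqrt n\<close>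
    for the rescaled contraction \<open>B1\<close> into the factor \<open>\<delta>\<close> for
    \<open>B\<close>.\<close>
  obtain n :: nat where n: "real n > (1 / (r * \<delta>))\<^sup>2" using reals_Archimedean2 by blast
  have n0: "real n > 0" using n by (smt (verit) zero_le_power2)
  let ?E = "approx_unit (B' o\<^sub>L B1) n"
  show thesis
  proof (rule that[of ?E])
    show "?E \<in> I" by (rule approx_unit_in_ideal[OF assms(2)]) (use I(7) B1 B' in blast)
    fix x
    show "norm (x - ?E x) \<le> norm x" by (rule approx_unit_bounds(1)[OF B'(2) n1])
    have "real n * (norm (B1 (x - ?E x)))\<^sup>2 \<le> (norm x)\<^sup>2"
      by (rule approx_unit_bounds(2)[OF B'(2) n1])
    also have "norm (B1 (x - ?E x)) = r * norm (B (x - ?E x))"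
      using r by (simp add: B1_def blinfun.scaleR_left)
    finally have *: "real n * (r * norm (B (x - ?E x)))\<^sup>2 \<le> (norm x)\<^sup>2" .
    have "(1 / (r * \<delta>))\<^sup>2 * (r * norm (B (x - ?E x)))\<^sup>2 \<le> real n * (r * norm (B (x - ?E x)))\<^sup>2"
      using n by (intro mult_right_mono) auto
    also note *
    also have "(1 / (r * \<delta>))\<^sup>2 * (r * norm (B (x - ?E x)))\<^sup>2 = (norm (B (x - ?E x)) / \<delta>)\<^sup>2"
      using r assms(4) by (simp add: field_simps)
    finally have "norm (B (x - ?E x)) / \<delta> \<le> norm x" by (rule power2_le_imp_le) simp
    then show "norm (B (x - ?E x)) \<le> \<delta> * norm x" using assms(4) by (simp add: field_simps)
  qed
qed

text \<open>If \<open>E\<close> in \<open>I\<close> is an approximate unit for \<open>B\<close>,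
  then \<open>C E\<close> lies in both ideals. The factor is \<open>5 = 1 + 2 + 2\<close>: one error
  from \<open>T - B\<close> at \<open>x\<close>, and one each from \<open>T - C\<close> and
  \<open>T - B\<close> at \<open>E x\<close>, whose norm is at most
  \<open>2 * norm x\<close>.\<close>

lemma ideal_Int_approx:
  fixes T :: "'h::real_inner \<Rightarrow>\<^sub>L 'h"
  assumes A: "selfadj_set A" "op_ideal A I" "op_ideal A J"
    and B: "B \<in> I" "norm (T - B) \<le> d" and C: "C \<in> J" "norm (T - C) \<le> d"
    and "\<delta> > 0"
  shows "\<exists>D\<in>I \<inter> J. norm (T - D) \<le> 5 * d + \<delta>"
proof -
  obtain E where E: "E \<in> I" "\<And>x. norm (x - E x) \<le> norm x"
    "\<And>x. norm (B (x - E x)) \<le> \<delta> * norm x"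
    using ideal_approx_unit[OF A(1,2) B(1) \<open>\<delta> > 0\<close>] by metis
  have d: "0 \<le> d" using B(2) norm_ge_zero order_trans by blast
  have D: "C o\<^sub>L E \<in> I \<inter> J"
    by (intro IntI op_idealD(7)[OF A(2)] op_idealD(6)[OF A(3)] op_idealD(1)[OF A(2)]
        op_idealD(1)[OF A(3)] E(1) C(1))
  have "norm ((T - (C o\<^sub>L E)) x) \<le> (5 * d + \<delta>) * norm x" for x
  proof -
    have Ex: "norm (E x) \<le> 2 * norm x"
      using E(2)[of x] norm_triangle_ineq2[of "E x" x] by (simp add: norm_minus_commute)
    have "(T - (C o\<^sub>L E)) x = (T - B) x + B (x - E x) + (T - C) (E x) - (T - B) (E x)"
      by (simp add: blinfun.bilinear_simps)
    also have "norm \<dots> \<le> norm ((T - B) x) + norm (B (x - E x)) + norm ((T - C) (E x)) + norm ((T - B) (E x))"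
      by (smt (verit) norm_triangle_ineq norm_triangle_ineq4)
    also have "\<dots> \<le> d * norm x + \<delta> * norm x + d * (2 * norm x) + d * (2 * norm x)"
    proof -
      have "norm ((T - B) y) \<le> d * norm y" "norm ((T - C) y) \<le> d * norm y" for y
        using norm_blinfun[of "T - B" y] norm_blinfun[of "T - C" y] B(2) C(2)
        by (meson mult_right_mono norm_ge_zero order_trans)+
      then have "norm ((T - B) x) \<le> d * norm x" "norm ((T - C) (E x)) \<le> d * (2 * norm x)"
        "norm ((T - B) (E x)) \<le> d * (2 * norm x)"
        using Ex d by (meson mult_left_mono order_trans)+
      then show ?thesis using E(3)[of x] by linarith
    qed
    finally show ?thesis by (simp add: algebra_simps)
  qed
  then have "norm (T - (C o\<^sub>L E)) \<le> 5 * d + \<delta>"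
    using d \<open>\<delta> > 0\<close> by (intro norm_blinfun_bound) auto
  then show ?thesis using D by blast
qed

lemma finite_Int_approx:
  fixes T :: "'h::real_inner \<Rightarrow>\<^sub>L 'h"
  assumes A: "selfadj_set A" "finite M" "M \<noteq> {}" "\<And>i. i \<in> M \<Longrightarrow> op_ideal A (I i)"
  shows "\<exists>C\<ge>0. \<forall>T d. (\<forall>i\<in>M. \<exists>B\<in>I i. norm (T - B) \<le> d) \<longrightarrow> 0 < d \<longrightarrow>
    (\<exists>B\<in>(\<Inter>i\<in>M. I i). norm (T - B) \<le> C * d)"
    and "op_ideal A (\<Inter>i\<in>M. I i)"
proof -
  have "(\<exists>C\<ge>0. \<forall>T d. (\<forall>i\<in>M. \<exists>B\<in>I i. norm (T - B) \<le> d) \<longrightarrow> 0 < d \<longrightarrow>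
    (\<exists>B\<in>(\<Inter>i\<in>M. I i). norm (T - B) \<le> C * d)) \<and> op_ideal A (\<Inter>i\<in>M. I i)"
    using A(2,3,4)
  proof (induction M rule: finite_ne_induct)
    case (singleton i)
    then show ?case by (auto intro!: exI[of _ 1])
  next
    case (insert i M)
    then obtain C where C: "C \<ge> 0" "\<And>T d. (\<forall>i\<in>M. \<exists>B\<in>I i. norm (T - B) \<le> d) \<Longrightarrow> 0 < d \<Longrightarrow>
        (\<exists>B\<in>(\<Inter>i\<in>M. I i). norm (T - B) \<le> C * d)"
      and id: "op_ideal A (\<Inter>i\<in>M. I i)" "op_ideal A (I i)"
      by (metis (no_types, lifting) insert_iff)
    \<comment> \<open>\<open>(C + 1) * d\<close> bounds both errors \<open>d\<close> and
      \<open>C * d\<close>, and the slack of \<open>ideal_Int_approx\<close> is taken to be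
      \<open>d\<close>.\<close>
    have "\<exists>D\<in>(\<Inter>i\<in>insert i M. I i). norm (T - D) \<le> (5 * (C + 1) + 1) * d"
      if T: "\<forall>i\<in>insert i M. \<exists>B\<in>I i. norm (T - B) \<le> d" and d: "0 < d" for T d
    proof -
      obtain B where B: "B \<in> I i" "norm (T - B) \<le> d" using T by blast
      obtain B2 where B2: "B2 \<in> (\<Inter>i\<in>M. I i)" "norm (T - B2) \<le> C * d"
        using C(2)[of T d] T d by blast
      have "\<exists>D\<in>I i \<inter> (\<Inter>i\<in>M. I i). norm (T - D) \<le> 5 * ((C + 1) * d) + d"
        by (rule ideal_Int_approx[OF A(1) id(2,1) B(1) _ B2(1)])
          (use B(2) B2(2) C(1) d in \<open>auto simp: algebra_simps intro: order_trans\<close>)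
      then show ?thesis by (simp add: algebra_simps)
    qed
    moreover have "op_ideal A (\<Inter>i\<in>insert i M. I i)" using op_ideal_Int[OF id(2,1)] by simp
    ultimately show ?case using C(1) by (intro conjI exI[of _ "5 * (C + 1) + 1"]) auto
  qed
  then show "\<exists>C\<ge>0. \<forall>T d. (\<forall>i\<in>M. \<exists>B\<in>I i. norm (T - B) \<le> d) \<longrightarrow> 0 < d \<longrightarrow>
    (\<exists>B\<in>(\<Inter>i\<in>M. I i). norm (T - B) \<le> C * d)" "op_ideal A (\<Inter>i\<in>M. I i)" by auto
qed

text \<open>One half of the C*-identity for the quotient norm. With an approximate unit
  \<open>E\<close> for \<open>B\<close>, the square of the norm of \<open>T (x - E x)\<close> is a
  quadratic form of \<open>T' T\<close>, which is \<open>B\<close> up to \<open>d\<close>, and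
  \<open>B\<close> is nearly killed on vectors \<open>x - E x\<close>.\<close>

lemma ideal_dist_square:
  fixes T :: "'h::real_inner \<Rightarrow>\<^sub>L 'h"
  assumes A: "selfadj_set A" "op_ideal A I" and T: "T \<in> A" "adjoints T T'"
    and B: "B \<in> I" "norm ((T' o\<^sub>L T) - B) \<le> d" and \<delta>: "\<delta> > 0"
  shows "\<exists>D\<in>I. (norm (T - D))\<^sup>2 \<le> d + \<delta>"
proof -
  obtain E where E: "E \<in> I" "\<And>x. norm (x - E x) \<le> norm x"
    "\<And>x. norm (B (x - E x)) \<le> \<delta> * norm x"
    using ideal_approx_unit[OF A B(1) \<delta>] by metis
  have d: "0 \<le> d" using B(2) norm_ge_zero order_trans by blast
  have "(norm ((T - (T o\<^sub>L E)) x)) \<le> sqrt (d + \<delta>) * norm x" for x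
  proof -
    let ?y = "x - E x"
    have "(norm ((T - (T o\<^sub>L E)) x))\<^sup>2 = inner (T ?y) (T ?y)"
      by (simp add: blinfun.bilinear_simps power2_norm_eq_inner)
    also have "\<dots> = inner ?y (((T' o\<^sub>L T) - B) ?y) + inner ?y (B ?y)"
    proof -
      have "inner (T ?y) (T ?y) = inner ?y (T' (T ?y))" using T(2) unfolding adjoints_def by blast
      also have "T' (T ?y) = ((T' o\<^sub>L T) - B) ?y + B ?y" by (simp add: blinfun.diff_left)
      finally show ?thesis by (simp only: inner_add_right)
    qed
    also have "\<dots> \<le> norm ?y * norm (((T' o\<^sub>L T) - B) ?y) + norm ?y * norm (B ?y)"
      by (intro add_mono norm_cauchy_schwarz)
    also have "\<dots> \<le> norm x * (d * norm x) + norm x * (\<delta> * norm x)"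
    proof (intro add_mono mult_mono)
      have "norm (((T' o\<^sub>L T) - B) ?y) \<le> norm ((T' o\<^sub>L T) - B) * norm ?y" by (rule norm_blinfun)
      also have "\<dots> \<le> d * norm x" using B(2) E(2) d by (intro mult_mono) auto
      finally show "norm (((T' o\<^sub>L T) - B) ?y) \<le> d * norm x" .
    qed (use E \<delta> d in auto)
    also have "\<dots> = (sqrt (d + \<delta>) * norm x)\<^sup>2"
      using d \<delta> by (simp add: power_mult_distrib power2_eq_square algebra_simps)
    finally show ?thesis by (rule power2_le_imp_le) (use d \<delta> in simp)
  qed
  then have "norm (T - (T o\<^sub>L E)) \<le> sqrt (d + \<delta>)"
    using d \<delta> by (intro norm_blinfun_bound) auto
  then have "(norm (T - (T o\<^sub>L E)))\<^sup>2 \<le> d + \<delta>"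
    using d \<delta> by (metis add_nonneg_nonneg less_imp_le norm_ge_zero power_mono real_sqrt_pow2)
  moreover have "T o\<^sub>L E \<in> I" using op_idealD(7)[OF A(2) E(1) T(1)] .
  ultimately show ?thesis by blast
qed

text \<open>A spectral radius argument, as for uniqueness of C*-norms. \<open>R T r\<close> says
  that a second seminorm bounds \<open>T\<close> by \<open>r\<close>. Replacing \<open>T\<close> by
  \<open>T' o\<^sub>L T\<close> squares both \<open>r\<close> and the distance to \<open>I\<close>
  but leaves \<open>C\<close> unchanged, so after \<open>k\<close> rounds only the
  \<open>2^k\<close>-th root of \<open>C\<close> remains.\<close>

lemma ideal_dist_uniq:
  fixes R :: "('h::real_inner \<Rightarrow>\<^sub>L 'h) \<Rightarrow> real \<Rightarrow> bool"
  assumes A: "selfadj_set A" "op_ideal A I" and C: "C \<ge> 0"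
    and R: "\<And>T r. R T r \<Longrightarrow> T \<in> A \<and> 0 \<le> r"
      "\<And>T r. R T r \<Longrightarrow> \<exists>T'. adjoints T T' \<and> R (T' o\<^sub>L T) (r\<^sup>2)"
    and D: "\<And>T r d. R T r \<Longrightarrow> d > C * r \<Longrightarrow> \<exists>B\<in>I. norm (T - B) \<le> d"
    and T: "R T r" "r < d"
  shows "\<exists>B\<in>I. norm (T - B) \<le> d"
proof -
  have pw: "\<forall>T r d. R T r \<longrightarrow> 0 < d \<longrightarrow> C * r ^ (2 ^ k) < d ^ (2 ^ k) \<longrightarrow> (\<exists>B\<in>I. norm (T - B) \<le> d)" for k
  proof (induction k)
    case 0 then show ?case using D by auto
  next
    case (Suc k)
    show ?case
    proof (intro allI impI)
      fix T r d
      assume *: "R T r" "0 < d" "C * r ^ (2 ^ Suc k) < d ^ (2 ^ Suc k)"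
      \<comment> \<open>The strict inequality leaves room below \<open>d\<^sup>2\<close>; the
        difference \<open>d\<^sup>2 - e\<close> is spent as the slack of
        \<open>ideal_dist_square\<close>.\<close>
      have "\<exists>e. 0 < e \<and> e < d\<^sup>2 \<and> C * r ^ (2 ^ Suc k) < e ^ (2 ^ k)"
      proof -
        have "((\<lambda>e. e ^ (2 ^ k)) \<longlongrightarrow> (d\<^sup>2) ^ (2 ^ k)) (at_left (d\<^sup>2))"
          by (intro tendsto_intros)
        moreover have "C * r ^ (2 ^ Suc k) < (d\<^sup>2) ^ (2 ^ k)"
          using *(3) by (simp add: power_mult[symmetric])
        ultimately have "\<forall>\<^sub>F e in at_left (d\<^sup>2). C * r ^ (2 ^ Suc k) < e ^ (2 ^ k)"
          by (rule order_tendstoD(1))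
        moreover have "\<forall>\<^sub>F e in at_left (d\<^sup>2). e \<in> {0<..<d\<^sup>2}"
          using *(2) by (intro eventually_at_left_real) auto
        ultimately have "\<forall>\<^sub>F e in at_left (d\<^sup>2). 0 < e \<and> e < d\<^sup>2 \<and> C * r ^ (2 ^ Suc k) < e ^ (2 ^ k)"
          by eventually_elim auto
        then show ?thesis by (rule eventually_happens'[rotated]) simp
      qed
      then obtain e where e: "0 < e" "e < d\<^sup>2" "C * r ^ (2 ^ Suc k) < e ^ (2 ^ k)" by blast
      obtain T' where T': "adjoints T T'" "R (T' o\<^sub>L T) (r\<^sup>2)" using R(2)[OF *(1)] by blast
      have "C * (r\<^sup>2) ^ (2 ^ k) < e ^ (2 ^ k)" using e(3) by (simp add: power_mult[symmetric])
      then obtain B where B: "B \<in> I" "norm ((T' o\<^sub>L T) - B) \<le> e" using Suc T'(2) e(1) by blast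
      obtain D where "D \<in> I" "(norm (T - D))\<^sup>2 \<le> e + (d\<^sup>2 - e)"
        using ideal_dist_square[OF A _ T'(1) B, of "d\<^sup>2 - e"] R(1)[OF *(1)] e(2) by auto
      then show "\<exists>B\<in>I. norm (T - B) \<le> d"
        using *(2) by (auto intro!: bexI[of _ D] power2_le_imp_le[of _ d])
    qed
  qed
  have r: "0 \<le> r" using R(1)[OF T(1)] by simp
  have d: "0 < d" using r T(2) by simp
  \<comment> \<open>As \<open>r < d\<close>, high powers of \<open>r / d\<close> beat any
    constant.\<close>
  have "\<exists>k. C * (r / d) ^ (2 ^ k) < 1"
  proof -
    have "(\<lambda>n. C * (r / d) ^ n) \<longlonglongrightarrow> C * 0"
      using r d T(2) by (intro tendsto_mult tendsto_const LIMSEQ_realpow_zero) auto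
    then have "\<forall>\<^sub>F n in sequentially. C * (r / d) ^ n < 1" by (rule order_tendstoD(2)) simp
    then obtain N where N: "\<And>n. n \<ge> N \<Longrightarrow> C * (r / d) ^ n < 1"
      unfolding eventually_sequentially by blast
    have "N \<le> 2 ^ N" by (simp add: less_exp less_imp_le)
    then show ?thesis using N by blast
  qed
  then obtain k where "C * (r / d) ^ (2 ^ k) < 1" by blast
  then have "C * r ^ (2 ^ k) < d ^ (2 ^ k)" using d by (simp add: power_divide field_simps)
  then show ?thesis using pw T(1) d by blast
qed

section \<open>Reiter's condition\<close>

definition sublinear :: "('v::real_vector \<Rightarrow> real) \<Rightarrow> bool"
  where "sublinear p \<longleftrightarrow> (\<forall>x y. p (x + y) \<le> p x + p y) \<and> (\<forall>r\<ge>0. \<forall>x. p (r *\<^sub>R x) = r * p x)"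

lemma sublinearD:
  assumes "sublinear p"
  shows "p (x + y) \<le> p x + p y" "r \<ge> 0 \<Longrightarrow> p (r *\<^sub>R x) = r * p x" "p 0 = 0" "- p (- x) \<le> p x"
proof -
  show 1: "p (x + y) \<le> p x + p y" "r \<ge> 0 \<Longrightarrow> p (r *\<^sub>R x) = r * p x" for x y r
    using assms by (auto simp: sublinear_def)
  show 0: "p 0 = 0" using 1(2)[of 0 0] by simp
  show "- p (- x) \<le> p x" using 1(1)[of x "- x"] 0 by simp
qed

text \<open>The hypotheses let the member of the family change with the arguments. This covers
  infima over chains as well as infima over shifts along rays.\<close>

lemma sublinear_Inf:
  assumes ne: "C \<noteq> {}"
    and C: "\<And>q r x. q \<in> C \<Longrightarrow> r > 0 \<Longrightarrow> \<exists>q'\<in>C. q' (r *\<^sub>R x) \<le> r * (q x :: real)"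
    and bd: "\<And>x. bdd_below ((\<lambda>q. q x) ` C)" and 0: "(INF q\<in>C. q 0) = (0::real)"
    and dir: "\<And>q1 q2 x y. q1 \<in> C \<Longrightarrow> q2 \<in> C \<Longrightarrow> \<exists>q\<in>C. q (x + y) \<le> q1 x + q2 y"
  shows "sublinear (\<lambda>x. INF q\<in>C. q x)"
  unfolding sublinear_def
proof (intro conjI allI impI)
  fix x y
  have *: "(INF q\<in>C. q (x + y)) \<le> q1 x + q2 y" if "q1 \<in> C" "q2 \<in> C" for q1 q2
    using dir[OF that, of x y] bd by (meson cINF_lower2)
  have "(INF q\<in>C. q (x + y)) - q2 y \<le> (INF q\<in>C. q x)" if "q2 \<in> C" for q2
    by (rule cINF_greatest[OF ne]) (use *[OF _ that] in \<open>simp add: algebra_simps\<close>)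
  then have "(INF q\<in>C. q (x + y)) - (INF q\<in>C. q x) \<le> (INF q\<in>C. q y)"
    by (intro cINF_greatest[OF ne]) (simp add: algebra_simps)
  then show "(INF q\<in>C. q (x + y)) \<le> (INF q\<in>C. q x) + (INF q\<in>C. q y)" by simp
next
  fix r :: real and x :: 'a assume r: "0 \<le> r"
  have le: "(INF q\<in>C. q (r *\<^sub>R x)) \<le> r * (INF q\<in>C. q x)" if r: "r > 0" for r x
  proof -
    have "(INF q\<in>C. q (r *\<^sub>R x)) \<le> r * q x" if "q \<in> C" for q
      using C[OF that r, of x] bd by (meson cINF_lower2)
    then have "(INF q\<in>C. q (r *\<^sub>R x)) / r \<le> (INF q\<in>C. q x)"
      using r by (intro cINF_greatest[OF ne]) (simp add: field_simps)
    then show ?thesis using r by (simp add: field_simps)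
  qed
  show "(INF q\<in>C. q (r *\<^sub>R x)) = r * (INF q\<in>C. q x)"
  proof (cases "r = 0")
    case True then show ?thesis using 0 by simp
  next
    case False
    then have r: "r > 0" using r by simp
    have "(INF q\<in>C. q x) \<le> (1 / r) * (INF q\<in>C. q (r *\<^sub>R x))"
      using le[of "1 / r" "r *\<^sub>R x"] r by simp
    then show ?thesis using le[OF r, of x] r by (simp add: field_simps)
  qed
qed

text \<open>By Zorn there is a minimal sublinear functional below \<open>p\<close>, and minimality forces it to be linear.\<close>

lemma sublinear_dominates_linear:
  fixes p :: "'v::real_vector \<Rightarrow> real"
  assumes p: "sublinear p"
  obtains L where "linear L" "\<And>x. L x \<le> p x"
proof -
  define A where "A = {q. sublinear q \<and> q \<le> p}"
  have "\<exists>m\<in>A. \<forall>q\<in>A. q \<le> m \<longrightarrow> q = m"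
  proof (rule predicate_Zorn)
    show "partial_order_on A (relation_of (\<lambda>a b. b \<le> a) A)"
      by (rule partial_order_on_relation_ofI) auto
    fix C assume "C \<in> Chains (relation_of (\<lambda>a b. b \<le> a) A)"
    then have CA: "C \<subseteq> A" and ch: "\<And>a b. a \<in> C \<Longrightarrow> b \<in> C \<Longrightarrow> a \<le> b \<or> b \<le> a"
      unfolding Chains_def relation_of_def by auto
    show "\<exists>u\<in>A. \<forall>a\<in>C. u \<le> a"
    proof (cases "C = {}")
      case True then show ?thesis using p by (auto simp: A_def)
    next
      case ne: False
      have bd: "bdd_below ((\<lambda>q. q x) ` C)" for x
      proof (rule bdd_belowI2)
        fix q assume "q \<in> C"
        then have "sublinear q" "q (- x) \<le> p (- x)" using CA by (auto simp: A_def le_fun_def)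
        then show "- p (- x) \<le> q x" using sublinearD(4)[of q x] by linarith
      qed
      have "sublinear (\<lambda>x. INF q\<in>C. q x)"
      proof (rule sublinear_Inf[OF ne _ bd])
        show "\<exists>q'\<in>C. q' (r *\<^sub>R x) \<le> r * q x" if "q \<in> C" "r > 0" for q r x
          using that CA sublinearD(2)[of q r x] by (intro bexI[of _ q]) (auto simp: A_def)
        have "q 0 = 0" if "q \<in> C" for q using that CA sublinearD(3) by (auto simp: A_def)
        then have "(INF q\<in>C. q 0) = (INF q\<in>C. 0 :: real)" by (rule INF_cong[OF refl])
        then show "(INF q\<in>C. q 0) = 0" using ne by simp
        show "\<exists>q\<in>C. q (x + y) \<le> q1 x + q2 y" if "q1 \<in> C" "q2 \<in> C" for q1 q2 x y
        proof -
          have "sublinear q1" "sublinear q2" using that CA by (auto simp: A_def)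
          then show ?thesis
            using ch[OF that] sublinearD(1)[of q1 x y] sublinearD(1)[of q2 x y] that
            by (smt (verit, best) le_funE)
        qed
      qed
      moreover have "(INF q\<in>C. q x) \<le> q x" if "q \<in> C" for q x
        by (rule cINF_lower[OF bd that])
      moreover obtain q0 where "q0 \<in> C" "q0 \<le> p" using ne CA by (auto simp: A_def)
      ultimately have "(\<lambda>x. INF q\<in>C. q x) \<in> A" "\<forall>q\<in>C. (\<lambda>x. INF q\<in>C. q x) \<le> q"
        unfolding A_def le_fun_def by (blast intro: order_trans)+
      then show ?thesis by blast
    qed
  qed
  then obtain m where m: "sublinear m" "m \<le> p" "\<And>q. sublinear q \<Longrightarrow> q \<le> m \<Longrightarrow> q = m"
    unfolding A_def by (auto intro: order_trans)
  note s = sublinearD[OF m(1)]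
  have add: "m (x + y) = m x + m y" for x y
  proof -
    \<comment> \<open>The infimum of these functionals is sublinear and lies below \<open>m\<close>
      by \<open>t = 0\<close>, hence equals \<open>m\<close> by minimality. The member for
      \<open>t = 1\<close> then gives \<open>m x + m y \<le> m (x + y)\<close>.\<close>
    let ?C = "(\<lambda>t x. m (x + t *\<^sub>R y) - t * m y) ` {0..}"
    have bd: "bdd_below ((\<lambda>q. q x) ` ?C)" for x
    proof (rule bdd_belowI2, clarsimp)
      fix t :: real assume "0 \<le> t"
      then have "t * m y \<le> m (x + t *\<^sub>R y) + m (- x)"
        using s(1)[of "x + t *\<^sub>R y" "- x"] s(2)[of t y] by simp
      then show "- m (- x) \<le> m (x + t *\<^sub>R y) - t * m y" by simp
    qed
    have low: "(INF q\<in>?C. q x) \<le> m (x + t *\<^sub>R y) - t * m y" if "t \<ge> 0" for t x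
      using cINF_lower[OF bd, of "\<lambda>x. m (x + t *\<^sub>R y) - t * m y"] that by auto
    have "sublinear (\<lambda>x. INF q\<in>?C. q x)"
    proof (rule sublinear_Inf[OF _ _ bd])
      show "(INF q\<in>?C. q 0) = 0" using s(2) by (simp add: image_image)
      show "\<exists>q\<in>?C. q (u + v) \<le> q1 u + q2 v" if "q1 \<in> ?C" "q2 \<in> ?C" for q1 q2 u v
      proof -
        obtain t1 t2 where t: "0 \<le> t1" "q1 = (\<lambda>x. m (x + t1 *\<^sub>R y) - t1 * m y)"
          "0 \<le> t2" "q2 = (\<lambda>x. m (x + t2 *\<^sub>R y) - t2 * m y)" using \<open>q1 \<in> ?C\<close> \<open>q2 \<in> ?C\<close> by auto
        have "(u + v) + (t1 + t2) *\<^sub>R y = (u + t1 *\<^sub>R y) + (v + t2 *\<^sub>R y)" by (simp add: algebra_simps)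
        then have "m ((u + v) + (t1 + t2) *\<^sub>R y) - (t1 + t2) * m y \<le> q1 u + q2 v"
          using s(1)[of "u + t1 *\<^sub>R y" "v + t2 *\<^sub>R y"] t by (simp add: algebra_simps)
        then show ?thesis using t
          by (intro bexI[of _ "\<lambda>x. m (x + (t1 + t2) *\<^sub>R y) - (t1 + t2) * m y"]) auto
      qed
    next
      show "\<exists>q'\<in>?C. q' (r *\<^sub>R x) \<le> r * q x" if "q \<in> ?C" "r > 0" for q r x
      proof -
        obtain t where t: "0 \<le> t" "q = (\<lambda>x. m (x + t *\<^sub>R y) - t * m y)" using \<open>q \<in> ?C\<close> by auto
        have "m (r *\<^sub>R x + (r * t) *\<^sub>R y) - (r * t) * m y = r * q x"
          using s(2)[of r "x + t *\<^sub>R y"] \<open>r > 0\<close> t by (simp add: algebra_simps)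
        then show ?thesis using t \<open>r > 0\<close>
          by (intro bexI[of _ "\<lambda>x. m (x + (r * t) *\<^sub>R y) - (r * t) * m y"]) auto
      qed
    qed auto
    moreover have "(\<lambda>x. INF q\<in>?C. q x) \<le> m"
      using low[of 0] by (auto simp: le_fun_def)
    ultimately have "(\<lambda>x. INF q\<in>?C. q x) = m" by (rule m(3))
    then have eq: "(INF q\<in>?C. q x) = m x" by (rule fun_cong)
    have "m x \<le> m (x + y) - m y" using low[of 1 x] unfolding eq by simp
    then show ?thesis using s(1)[of x y] by simp
  qed
  have neg: "m (- x) = - m x" for x using add[of x "- x"] s(3) by simp
  have "linear m"
  proof (rule linearI)
    fix r x
    show "m (r *\<^sub>R x) = r *\<^sub>R m x"
      using s(2)[of r x] s(2)[of "- r" x] neg[of "r *\<^sub>R x"] by (cases "r \<ge> 0") auto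
  qed (rule add)
  then show thesis using that m(2) by (auto simp: le_fun_def)
qed

text \<open>A linear functional below the infimum \<open>p x\<close> of
  \<open>norm (x + t *\<^sub>R c) - t * \<epsilon>\<close> does everything: \<open>t = 0\<close>
  bounds it by the norm, and \<open>t = 1\<close> at \<open>x = - c\<close> bounds it on
  \<open>C\<close> from below.\<close>

lemma separate_from_ball:
  fixes C :: "'v::real_normed_vector set"
  assumes C: "convex C" "C \<noteq> {}" and \<epsilon>: "\<And>c. c \<in> C \<Longrightarrow> \<epsilon> \<le> norm c"
  obtains L where "linear L" "\<And>x. \<bar>L x\<bar> \<le> norm x" "\<And>c. c \<in> C \<Longrightarrow> \<epsilon> \<le> L c"
proof -
  let ?C = "(\<lambda>(t, c) x. norm (x + t *\<^sub>R c) - t * \<epsilon>) ` ({0..} \<times> C)"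
  define p where "p x = (INF q\<in>?C. q x)" for x
  obtain c0 where c0: "c0 \<in> C" using C(2) by blast
  have bd: "bdd_below ((\<lambda>q. q x) ` ?C)" for x
  proof (rule bdd_belowI2, clarsimp)
    fix t :: real and c assume "0 \<le> t" "c \<in> C"
    then have "t * \<epsilon> \<le> norm (t *\<^sub>R c)" using \<epsilon>[of c] by (simp add: mult_left_mono)
    then show "- norm x \<le> norm (x + t *\<^sub>R c) - t * \<epsilon>"
      using norm_triangle_ineq2[of "t *\<^sub>R c" "- x"] by (simp add: add.commute)
  qed
  have low: "p x \<le> norm (x + t *\<^sub>R c) - t * \<epsilon>" if "t \<ge> 0" "c \<in> C" for t c x
    unfolding p_def using cINF_lower[OF bd, of "\<lambda>x. norm (x + t *\<^sub>R c) - t * \<epsilon>"] that by force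
  have "sublinear p"
    unfolding p_def
  proof (rule sublinear_Inf[OF _ _ bd])
    show "?C \<noteq> {}" using C(2) by auto
    have "p 0 \<ge> 0" unfolding p_def
    proof (rule cINF_greatest)
      show "?C \<noteq> {}" using C(2) by auto
      show "0 \<le> q 0" if "q \<in> ?C" for q
        using that \<epsilon> by (auto simp: mult_left_mono)
    qed
    moreover have "p 0 \<le> 0" using low[of 0 c0 0] c0 by simp
    ultimately show "(INF q\<in>?C. q 0) = 0" unfolding p_def by simp
    show "\<exists>q'\<in>?C. q' (r *\<^sub>R x) \<le> r * q x" if "q \<in> ?C" "r > 0" for q r x
    proof -
      obtain t c where t: "0 \<le> t" "c \<in> C" "q = (\<lambda>x. norm (x + t *\<^sub>R c) - t * \<epsilon>)" using \<open>q \<in> ?C\<close> by auto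
      have "r *\<^sub>R x + (r * t) *\<^sub>R c = r *\<^sub>R (x + t *\<^sub>R c)" by (simp add: algebra_simps)
      then have "norm (r *\<^sub>R x + (r * t) *\<^sub>R c) = r * norm (x + t *\<^sub>R c)"
        using \<open>r > 0\<close> by simp
      then have "norm (r *\<^sub>R x + (r * t) *\<^sub>R c) - (r * t) * \<epsilon> = r * q x"
        using t by (simp add: algebra_simps)
      then show ?thesis using t \<open>r > 0\<close>
        by (intro bexI[of _ "\<lambda>x. norm (x + (r * t) *\<^sub>R c) - (r * t) * \<epsilon>"]) (auto intro!: image_eqI[of _ _ "(r * t, c)"])
    qed
    show "\<exists>q\<in>?C. q (u + v) \<le> q1 u + q2 v" if "q1 \<in> ?C" "q2 \<in> ?C" for q1 q2 u v
    proof -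
      obtain t1 c1 t2 c2 where t: "0 \<le> t1" "c1 \<in> C" "q1 = (\<lambda>x. norm (x + t1 *\<^sub>R c1) - t1 * \<epsilon>)"
        "0 \<le> t2" "c2 \<in> C" "q2 = (\<lambda>x. norm (x + t2 *\<^sub>R c2) - t2 * \<epsilon>)"
        using \<open>q1 \<in> ?C\<close> \<open>q2 \<in> ?C\<close> by auto
      \<comment> \<open>Convexity combines two rays into one, which makes \<open>p\<close>
        subadditive.\<close>
      have "\<exists>c\<in>C. (t1 + t2) *\<^sub>R c = t1 *\<^sub>R c1 + t2 *\<^sub>R c2"
      proof (cases "t1 + t2 = 0")
        case True
        then have "t1 = 0" "t2 = 0" using t by auto
        then show ?thesis using t by auto
      next
        case False
        then have "(t1 / (t1 + t2)) *\<^sub>R c1 + (t2 / (t1 + t2)) *\<^sub>R c2 \<in> C"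
          using t by (intro convexD[OF C(1)]) (auto simp: add_divide_distrib[symmetric])
        then show ?thesis using False by (intro bexI) (auto simp: scaleR_add_right)
      qed
      then obtain c where c: "c \<in> C" "(t1 + t2) *\<^sub>R c = t1 *\<^sub>R c1 + t2 *\<^sub>R c2" by blast
      have "norm ((u + v) + (t1 + t2) *\<^sub>R c) \<le> norm (u + t1 *\<^sub>R c1) + norm (v + t2 *\<^sub>R c2)"
        unfolding c(2) using norm_triangle_ineq[of "u + t1 *\<^sub>R c1" "v + t2 *\<^sub>R c2"] by (simp add: algebra_simps)
      then have "norm ((u + v) + (t1 + t2) *\<^sub>R c) - (t1 + t2) * \<epsilon> \<le> q1 u + q2 v"
        using t by (simp add: algebra_simps)
      then show ?thesis using t c
        by (intro bexI[of _ "\<lambda>x. norm (x + (t1 + t2) *\<^sub>R c) - (t1 + t2) * \<epsilon>"])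
          (auto intro!: image_eqI[of _ _ "(t1 + t2, c)"])
    qed
  qed
  then obtain L where L: "linear L" "\<And>x. L x \<le> p x"
    using sublinear_dominates_linear by blast
  show thesis
  proof (rule that[OF L(1)])
    have le: "L x \<le> norm x" for x using L(2)[of x] low[of 0 c0 x] c0 by simp
    show "\<bar>L x\<bar> \<le> norm x" for x
      using le[of x] le[of "- x"] linear_neg[OF L(1), of x] by simp
    show "\<epsilon> \<le> L c" if "c \<in> C" for c
      using L(2)[of "- c"] low[of 1 c "- c"] that linear_neg[OF L(1), of c] by simp
  qed
qed

section \<open>Consequences of an invariant mean\<close>

lemma invariant_meanD:
  assumes "invariant_mean G m"
  shows "bounded (f ` carrier G) \<Longrightarrow> bounded (f' ` carrier G) \<Longrightarrow> m (\<lambda>x. f x + f' x) = m f + m f'"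
    "bounded (f ` carrier G) \<Longrightarrow> m (\<lambda>x. c * f x) = c * m f"
    "bounded (f ` carrier G) \<Longrightarrow> (\<And>x. x \<in> carrier G \<Longrightarrow> 0 \<le> f x) \<Longrightarrow> 0 \<le> m f"
    "m (\<lambda>_. 1) = 1"
    "g \<in> carrier G \<Longrightarrow> bounded (f ` carrier G) \<Longrightarrow> m (\<lambda>x. f (g \<otimes>\<^bsub>G\<^esub> x)) = m f"
  using assms unfolding invariant_mean_def by blast+

lemma bounded_real_imageI: "(\<And>x. x \<in> A \<Longrightarrow> \<bar>f x\<bar> \<le> (B::real)) \<Longrightarrow> bounded (f ` A)"
  by (auto intro!: boundedI)

text \<open>Day's convexity trick. The vector \<open>e x\<close> records, for all \<open>s\<close>
  in \<open>F\<close> at once, the difference of the point masses at \<open>s \<otimes> x\<close>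
  and \<open>x\<close> in an ell1 space. If the convex hull of these vectors stayed away from 0, a
  separating functional would yield bounded functions whose translation differences add up to at
  least \<open>\<epsilon>\<close>, while an invariant mean gives the sum the value 0.\<close>

lemma (in group) Reiter:
  assumes m: "invariant_mean G m" and F: "finite F" "F \<subseteq> carrier G" and \<epsilon>: "\<epsilon> > 0"
  obtains q :: "'a \<Rightarrow> real" where "finite {x. q x \<noteq> 0}" "{x. q x \<noteq> 0} \<subseteq> carrier G" "\<And>x. 0 \<le> q x"
    "(\<Sum>x | q x \<noteq> 0. q x) = 1"
    "\<And>s Z. s \<in> F \<Longrightarrow> finite Z \<Longrightarrow> Z \<subseteq> carrier G \<Longrightarrow> (\<Sum>z\<in>Z. \<bar>q (inv s \<otimes> z) - q z\<bar>) \<le> \<epsilon>"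
proof -
  define e :: "'a \<Rightarrow> ('a \<times> 'a, real) poly_mapping"
    where "e x = (\<Sum>s\<in>F. Poly_Mapping.single (s, s \<otimes> x) 1 - Poly_Mapping.single (s, x) 1)" for x
  let ?C = "convex hull (e ` carrier G)"
  have "\<exists>c\<in>?C. norm c < \<epsilon>"
  proof (rule ccontr)
    assume "\<not> (\<exists>c\<in>?C. norm c < \<epsilon>)"
    then have ge\<epsilon>: "\<And>c. c \<in> ?C \<Longrightarrow> \<epsilon> \<le> norm c" by force
    have ne: "?C \<noteq> {}" using one_closed by auto
    obtain L where L: "linear L" "\<And>x. \<bar>L x\<bar> \<le> norm x" "\<And>c. c \<in> ?C \<Longrightarrow> \<epsilon> \<le> L c"
      using separate_from_ball[OF convex_convex_hull ne ge\<epsilon>] by blast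
    define f where "f s x = L (Poly_Mapping.single (s, x) 1)" for s x
    have fb: "\<bar>f s x\<bar> \<le> 1" for s x
      unfolding f_def using L(2)[of "Poly_Mapping.single (s, x) 1"]
      by (simp add: norm_poly_mapping_def dist_poly_mapping_def)
    have ge: "\<epsilon> \<le> (\<Sum>s\<in>F. f s (s \<otimes> x) - f s x)" if "x \<in> carrier G" for x
      using L(3)[of "e x"] hull_inc[of "e x" "e ` carrier G" convex] that
      by (simp add: e_def f_def linear_sum[OF L(1)] linear_diff[OF L(1)])
    have bs: "bounded ((\<lambda>x. \<Sum>s\<in>F'. f s (s \<otimes> x) - f s x) ` carrier G)" if "finite F'" for F'
    proof (rule bounded_real_imageI)
      fix x
      have "\<bar>\<Sum>s\<in>F'. f s (s \<otimes> x) - f s x\<bar> \<le> (\<Sum>s\<in>F'. \<bar>f s (s \<otimes> x) - f s x\<bar>)" by (rule sum_abs)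
      also have "\<dots> \<le> (\<Sum>s\<in>F'. 2)"
      proof (rule sum_mono)
        fix s show "\<bar>f s (s \<otimes> x) - f s x\<bar> \<le> 2" using fb[of s "s \<otimes> x"] fb[of s x] by linarith
      qed
      finally show "\<bar>\<Sum>s\<in>F'. f s (s \<otimes> x) - f s x\<bar> \<le> (\<Sum>s\<in>F'. 2)" .
    qed
    have m0: "m (\<lambda>x. \<Sum>s\<in>F'. f s (s \<otimes> x) - f s x) = 0" if "finite F'" "F' \<subseteq> F" for F'
      using that
    proof (induction F')
      case empty
      have "bounded ((\<lambda>_. 0::real) ` carrier G)" by (auto intro!: bounded_real_imageI)
      then show ?case using invariant_meanD(2)[OF m, of "\<lambda>_. 0" 0] by simp
    next
      case (insert s F')
      have s: "s \<in> carrier G" using insert F(2) by auto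
      have b: "bounded ((\<lambda>x. f s (s \<otimes> x)) ` carrier G)" "bounded ((\<lambda>x. - 1 * f s x) ` carrier G)"
        "bounded (f s ` carrier G)"
        using fb by (auto intro!: bounded_real_imageI[of _ _ 1])
      have "m (\<lambda>x. f s (s \<otimes> x) + (- 1) * f s x) = 0"
        using invariant_meanD(1)[OF m b(1,2)] invariant_meanD(2)[OF m b(3), of "- 1"]
          invariant_meanD(5)[OF m s b(3)] by simp
      moreover have "bounded ((\<lambda>x. f s (s \<otimes> x) - f s x) ` carrier G)"
        using bs[of "{s}"] by simp
      ultimately show ?case
        using insert invariant_meanD(1)[OF m _ bs[OF insert(1)], of "\<lambda>x. f s (s \<otimes> x) - f s x"]
        by simp
    qed
    have "0 \<le> m (\<lambda>x. (\<Sum>s\<in>F. f s (s \<otimes> x) - f s x) + (- \<epsilon>) * 1)"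
    proof (rule invariant_meanD(3)[OF m])
      have "bounded ((\<lambda>y. y + - \<epsilon>) ` ((\<lambda>x. \<Sum>s\<in>F. f s (s \<otimes> x) - f s x) ` carrier G))"
        using bounded_translation[OF bs[OF F(1)], of "- \<epsilon>"] by (simp add: add.commute)
      then show "bounded ((\<lambda>x. (\<Sum>s\<in>F. f s (s \<otimes> x) - f s x) + (- \<epsilon>) * 1) ` carrier G)"
        by (simp add: image_image)
      show "0 \<le> (\<Sum>s\<in>F. f s (s \<otimes> x) - f s x) + (- \<epsilon>) * 1" if "x \<in> carrier G" for x
        using ge[OF that] by simp
    qed
    also have "\<dots> = 0 + (- \<epsilon>) * 1"
    proof -
      have "bounded ((\<lambda>_. - \<epsilon> * 1) ` carrier G)" "bounded ((\<lambda>_. 1::real) ` carrier G)"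
        by (auto intro!: bounded_real_imageI)
      then show ?thesis
        using invariant_meanD(1)[OF m bs[OF F(1)], of "\<lambda>_. - \<epsilon> * 1"] m0[OF F(1)]
          invariant_meanD(2)[OF m, of "\<lambda>_. 1" "- \<epsilon>"] invariant_meanD(4)[OF m] by simp
    qed
    finally show False using \<epsilon> by simp
  qed
  then obtain c where c: "c \<in> ?C" "norm c < \<epsilon>" by blast
  obtain V u where V: "finite V" "V \<subseteq> e ` carrier G" "\<And>v. v \<in> V \<Longrightarrow> 0 \<le> u v" "sum u V = 1"
    "c = (\<Sum>v\<in>V. u v *\<^sub>R v)"
    using c(1) unfolding convex_hull_explicit by blast
  \<comment> \<open>\<open>e\<close> may fail to be injective, so one preimage is chosen for each
    vector and carries its weight.\<close>
  obtain T where T: "T \<subseteq> carrier G" "inj_on e T" "e ` T = V"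
    using V(2) unfolding subset_image_inj by blast
  have finT: "finite T" using T V(1) finite_image_iff by blast
  define q where "q x = (if x \<in> T then u (e x) else 0)" for x
  have sumT: "(\<Sum>x | q x \<noteq> 0. f x * q x) = (\<Sum>x\<in>T. f x * u (e x))" for f :: "'a \<Rightarrow> real"
  proof -
    have "(\<Sum>x | q x \<noteq> 0. f x * q x) = (\<Sum>x\<in>T. f x * q x)"
      by (rule sum.mono_neutral_left) (auto simp: finT q_def)
    then show ?thesis by (simp add: q_def)
  qed
  have c': "c = (\<Sum>x\<in>T. u (e x) *\<^sub>R e x)"
    unfolding V(5) T(3)[symmetric] by (simp add: sum.reindex[OF T(2)])
  \<comment> \<open>The coefficient of \<open>c\<close> at \<open>(s, z)\<close> is the translation
    defect of \<open>q\<close>, so the ell1 norm of \<open>c\<close> dominates all sums that have to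
    be small.\<close>
  have look: "Poly_Mapping.lookup c (s, z) = q (inv s \<otimes> z) - q z" if s: "s \<in> F" and z: "z \<in> carrier G" for s z
  proof -
    have sc: "s \<in> carrier G" using s F(2) by auto
    have le: "Poly_Mapping.lookup (e x) (s, z) = (if x = inv s \<otimes> z then 1 else 0) - (if x = z then 1 else 0)"
      if "x \<in> carrier G" for x
    proof -
      have "Poly_Mapping.lookup (e x) (s, z) =
        (\<Sum>s'\<in>F. if s' = s then (if s \<otimes> x = z then 1 else 0) - (if x = z then 1 else 0) else 0)"
        unfolding e_def lookup_sum lookup_minus by (rule sum.cong) (auto simp: lookup_single when_def)
      also have "\<dots> = (if s \<otimes> x = z then 1 else 0) - (if x = z then 1 else 0)" using F(1) s by simp
      also have "s \<otimes> x = z \<longleftrightarrow> x = inv s \<otimes> z" using sc z that by (metis inv_closed inv_solve_left)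
      finally show ?thesis .
    qed
    have lsc: "Poly_Mapping.lookup (r *\<^sub>R p) k = r * Poly_Mapping.lookup p k" for r and p :: "('a \<times> 'a, real) poly_mapping" and k
      by (simp add: scaleR_poly_mapping_def)
    have "Poly_Mapping.lookup c (s, z) =
        (\<Sum>x\<in>T. u (e x) * ((if x = inv s \<otimes> z then 1 else 0) - (if x = z then 1 else 0)))"
      unfolding c' lookup_sum lsc using T(1) le by (intro sum.cong) auto
    also have "\<dots> = (\<Sum>x\<in>T. if x = inv s \<otimes> z then u (e x) else 0) - (\<Sum>x\<in>T. if x = z then u (e x) else 0)"
      unfolding sum_subtractf[symmetric] by (rule sum.cong) auto
    also have "\<dots> = q (inv s \<otimes> z) - q z" using finT by (simp add: q_def)
    finally show ?thesis .
  qed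
  have nsum: "(\<Sum>k\<in>K. \<bar>Poly_Mapping.lookup c k\<bar>) \<le> norm c" if "finite K" for K
  proof -
    have "(\<Sum>k\<in>K. \<bar>Poly_Mapping.lookup c k\<bar>) \<le> (\<Sum>k\<in>K \<union> Poly_Mapping.keys c. \<bar>Poly_Mapping.lookup c k\<bar>)"
      by (rule sum_mono2) (use that in auto)
    also have "\<dots> = (\<Sum>k\<in>Poly_Mapping.keys c. \<bar>Poly_Mapping.lookup c k\<bar>)"
      by (rule sum.mono_neutral_right) (use that in \<open>auto simp: in_keys_iff\<close>)
    finally show ?thesis by (simp add: norm_poly_mapping_def dist_poly_mapping_def)
  qed
  show thesis
  proof (rule that[of q])
    show "finite {x. q x \<noteq> 0}" "{x. q x \<noteq> 0} \<subseteq> carrier G"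
      using finT T(1) by (auto simp: q_def intro: finite_subset[of _ T])
    show "0 \<le> q x" for x using V(3) T(3) by (auto simp: q_def)
    show "(\<Sum>x | q x \<noteq> 0. q x) = 1"
      using sumT[of "\<lambda>_. 1"] V(4) sum.reindex[OF T(2), of u] T(3) by simp
    show "(\<Sum>z\<in>Z. \<bar>q (inv s \<otimes> z) - q z\<bar>) \<le> \<epsilon>" if "s \<in> F" "finite Z" "Z \<subseteq> carrier G" for s Z
    proof -
      have "(\<Sum>z\<in>Z. \<bar>q (inv s \<otimes> z) - q z\<bar>) = (\<Sum>z\<in>Z. \<bar>Poly_Mapping.lookup c (s, z)\<bar>)"
        using look that by (intro sum.cong) auto
      also have "\<dots> = (\<Sum>k\<in>Pair s ` Z. \<bar>Poly_Mapping.lookup c k\<bar>)"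
        by (simp add: sum.reindex inj_on_def)
      also have "\<dots> \<le> norm c" using that by (intro nsum) auto
      finally show ?thesis using c(2) by simp
    qed
  qed
qed

text \<open>Functions on \<open>H\<close> are pulled back along \<open>\<theta>\<close>, where
  \<open>x = \<theta> x \<otimes> r\<close> with \<open>r\<close> the chosen representative of the
  right coset of \<open>x\<close>. This map commutes with left translation by
  \<open>H\<close>.\<close>

lemma (in group) amenable_subgroup:
  assumes m: "invariant_mean G m" and H: "subgroup H G"
  obtains m' where "invariant_mean (G\<lparr>carrier := H\<rparr>) m'"
proof -
  have HG: "H \<subseteq> carrier G" by (rule subgroup.subset[OF H])
  define rep where "rep C = (SOME x. x \<in> C)" for C :: "'a set"
  have rep: "rep (H #> x) \<in> H #> x" if "x \<in> carrier G" for x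
    unfolding rep_def using rcos_self[OF that H] by (rule someI)
  define \<theta> where "\<theta> x = x \<otimes> inv (rep (H #> x))" for x
  have repc: "rep (H #> x) \<in> carrier G" if "x \<in> carrier G" for x
    using rep[OF that] r_coset_subset_G[OF HG that] by blast
  have \<theta>: "\<theta> x \<in> H" if x: "x \<in> carrier G" for x
  proof -
    obtain h where h: "h \<in> H" "rep (H #> x) = h \<otimes> x" using rep[OF x] unfolding r_coset_def by blast
    have hc: "h \<in> carrier G" using h HG by auto
    have "\<theta> x = inv h" unfolding \<theta>_def h(2) using hc x by (simp add: inv_mult_group m_assoc[symmetric])
    then show ?thesis using subgroup.m_inv_closed[OF H h(1)] by simp
  qed
  have eq: "\<theta> (y \<otimes> x) = y \<otimes> \<theta> x" if "y \<in> H" "x \<in> carrier G" for x y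
  proof -
    have "y \<in> carrier G" using that HG by auto
    moreover have "H #> (y \<otimes> x) = H #> x"
      using that coset_mult_assoc[OF HG, of y x] subgroup.rcos_const[OF H is_group that(1)] HG by auto
    ultimately show ?thesis unfolding \<theta>_def using that repc[OF that(2)] by (simp add: m_assoc)
  qed
  have bd: "bounded ((\<lambda>x. f (\<theta> x)) ` carrier G)" if "bounded (f ` H)" for f :: "'a \<Rightarrow> real"
    by (rule bounded_subset[OF that]) (use \<theta> in auto)
  have inv: "m (\<lambda>x. f (g \<otimes> \<theta> x)) = m (\<lambda>x. f (\<theta> x))" if "g \<in> H" "bounded (f ` H)" for f g
  proof -
    have "m (\<lambda>x. f (\<theta> (g \<otimes> x))) = m (\<lambda>x. f (\<theta> x))"
      using invariant_meanD(5)[OF m, of g "\<lambda>x. f (\<theta> x)"] that bd HG by auto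
    \<comment> \<open>The two functions agree on the carrier only; positivity applied to their
      difference and its negative makes the means equal.\<close>
    moreover have "m (\<lambda>x. f (\<theta> (g \<otimes> x))) = m (\<lambda>x. f (g \<otimes> \<theta> x))"
    proof -
      have b1: "bounded ((\<lambda>x. f (\<theta> (g \<otimes> x))) ` carrier G)" "bounded ((\<lambda>x. f (g \<otimes> \<theta> x)) ` carrier G)"
        using that \<theta> HG
        by (auto intro!: bounded_subset[OF that(2)] subgroup.m_closed[OF H])
      have "m (\<lambda>x. f (\<theta> (g \<otimes> x)) + - 1 * f (g \<otimes> \<theta> x)) = m (\<lambda>x. f (\<theta> (g \<otimes> x))) + - 1 * m (\<lambda>x. f (g \<otimes> \<theta> x))"
      proof -
        have "bounded ((\<lambda>x. - 1 * f (g \<otimes> \<theta> x)) ` carrier G)"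
          using bounded_scaling[OF b1(2), of "- 1"] by (simp add: image_image)
        then show ?thesis
          by (simp only: invariant_meanD(1)[OF m b1(1)] invariant_meanD(2)[OF m b1(2)])
      qed
      moreover have "m (\<lambda>x. f (\<theta> (g \<otimes> x)) + - 1 * f (g \<otimes> \<theta> x)) = 0"
      proof -
        define d where "d x = f (\<theta> (g \<otimes> x)) + - 1 * f (g \<otimes> \<theta> x)" for x
        have d0: "d x = 0" if "x \<in> carrier G" for x unfolding d_def using eq[OF \<open>g \<in> H\<close> that] by simp
        then have bdd: "bounded (d ` carrier G)" by (auto intro!: bounded_real_imageI[of _ _ 0])
        have bdd': "bounded ((\<lambda>x. - 1 * d x) ` carrier G)" using d0 by (auto intro!: bounded_real_imageI[of _ _ 0])
        have "0 \<le> m d" "0 \<le> m (\<lambda>x. - 1 * d x)"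
          using invariant_meanD(3)[OF m bdd] invariant_meanD(3)[OF m bdd'] d0 by auto
        then have "m d = 0" using invariant_meanD(2)[OF m bdd, of "- 1"] by simp
        then show ?thesis unfolding d_def .
      qed
      ultimately show ?thesis by simp
    qed
    ultimately show ?thesis by simp
  qed
  have "invariant_mean (G\<lparr>carrier := H\<rparr>) (\<lambda>f. m (\<lambda>x. f (\<theta> x)))"
    unfolding invariant_mean_def
    using invariant_meanD[OF m] bd \<theta> inv by auto
  then show thesis by (rule that)
qed

section \<open>Permutation representations\<close>

lemma ell2_eqI: "(\<And>s. ell2_apply \<xi> s = ell2_apply \<eta> s) \<Longrightarrow> \<xi> = \<eta>"
  by (rule ell2_apply_inject[THEN iffD1], rule ext)

lemma ell2_apply_simps [simp]:
  "ell2_apply 0 s = 0" "ell2_apply (\<xi> + \<eta>) s = ell2_apply \<xi> s + ell2_apply \<eta> s"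
  "ell2_apply (- \<xi>) s = - ell2_apply \<xi> s" "ell2_apply (\<xi> - \<eta>) s = ell2_apply \<xi> s - ell2_apply \<eta> s"
  "ell2_apply (r *\<^sub>R \<xi>) s = of_real r * ell2_apply \<xi> s"
  "ell2_apply (ell2_cmult c \<xi>) s = c * ell2_apply \<xi> s"
  "ell2_apply (delta u) s = (if s = u then 1 else 0)"
  by (simp_all only: minus_ell2_def zero_ell2.rep_eq plus_ell2.rep_eq uminus_ell2.rep_eq
      scaleR_ell2.rep_eq ell2_cmult.rep_eq delta.rep_eq diff_conv_add_uminus)

lemma ell2_apply_sum [simp]: "ell2_apply (\<Sum>i\<in>I. f i) s = (\<Sum>i\<in>I. ell2_apply (f i) s)"
  by (induction I rule: infinite_finite_induct) auto

lemma ell2_summable: "(\<lambda>x. (norm (ell2_apply \<xi> x))\<^sup>2) summable_on UNIV"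
  using ell2_apply[of \<xi>] by simp

lemma norm_ell2_sq: "(norm \<xi>)\<^sup>2 = (\<Sum>\<^sub>\<infinity>x. (norm (ell2_apply \<xi> x))\<^sup>2)"
  by (simp add: norm_ell2_eq infsum_nonneg)

lemma ell2_finite_sum_le: "finite F \<Longrightarrow> (\<Sum>x\<in>F. (norm (ell2_apply \<xi> x))\<^sup>2) \<le> (norm \<xi>)\<^sup>2"
  unfolding norm_ell2_sq by (rule finite_sum_le_infsum[OF ell2_summable]) auto

lemma norm_ell2_apply_le: "norm (ell2_apply \<xi> s) \<le> norm \<xi>"
  by (rule power2_le_imp_le) (use ell2_finite_sum_le[of "{s}" \<xi>] in simp_all)

text \<open>Completeness passes to the operator spaces, and this is what allows a quasi-regular
  representation to be extended continuously to the closure of the group algebra. Limits are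
  coordinatewise; square summability comes from finite partial sums.\<close>

instance ell2 :: (type) banach
proof
  fix X :: "nat \<Rightarrow> 'a ell2" assume X: "Cauchy X"
  have "Cauchy (\<lambda>n. ell2_apply (X n) s)" for s
  proof (rule CauchyI)
    fix e :: real assume "0 < e"
    then obtain M where "\<forall>m\<ge>M. \<forall>n\<ge>M. norm (X m - X n) < e" using X CauchyD by blast
    moreover have "norm (ell2_apply (X m) s - ell2_apply (X n) s) \<le> norm (X m - X n)" for m n
      using norm_ell2_apply_le[of "X m - X n" s] by simp
    ultimately show "\<exists>M. \<forall>m\<ge>M. \<forall>n\<ge>M. norm (ell2_apply (X m) s - ell2_apply (X n) s) < e"
      by (meson le_less_trans)
  qed
  then have "\<forall>s. \<exists>l. (\<lambda>n. ell2_apply (X n) s) \<longlonglongrightarrow> l"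
    by (simp add: Cauchy_convergent_iff convergent_def)
  then obtain f where f: "\<And>s. (\<lambda>n. ell2_apply (X n) s) \<longlonglongrightarrow> f s" by metis
  have bound: "\<exists>N. \<forall>n\<ge>N. \<forall>F. finite F \<longrightarrow> (\<Sum>s\<in>F. (norm (ell2_apply (X n) s - f s))\<^sup>2) \<le> e\<^sup>2"
    if e: "0 < e" for e
  proof -
    obtain N where N: "\<And>m n. m \<ge> N \<Longrightarrow> n \<ge> N \<Longrightarrow> norm (X m - X n) < e"
      using X CauchyD[OF X e] by blast
    have "(\<Sum>s\<in>F. (norm (ell2_apply (X n) s - f s))\<^sup>2) \<le> e\<^sup>2" if n: "n \<ge> N" and F: "finite F" for n F
    proof (rule tendsto_le[of sequentially])
      show "(\<lambda>m. \<Sum>s\<in>F. (norm (ell2_apply (X n) s - ell2_apply (X m) s))\<^sup>2) \<longlonglongrightarrow>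
          (\<Sum>s\<in>F. (norm (ell2_apply (X n) s - f s))\<^sup>2)"
        by (intro tendsto_intros f)
      show "\<forall>\<^sub>F m in sequentially. (\<Sum>s\<in>F. (norm (ell2_apply (X n) s - ell2_apply (X m) s))\<^sup>2) \<le> e\<^sup>2"
        unfolding eventually_sequentially
      proof (intro exI[of _ N] allI impI)
        fix m assume "m \<ge> N"
        then have "(norm (X n - X m))\<^sup>2 \<le> e\<^sup>2" using N[OF n] by (intro power_mono) (auto intro: less_imp_le)
        then show "(\<Sum>s\<in>F. (norm (ell2_apply (X n) s - ell2_apply (X m) s))\<^sup>2) \<le> e\<^sup>2"
          using ell2_finite_sum_le[OF F, of "X n - X m"] by simp
      qed
    qed auto
    then show ?thesis by blast
  qed
  have summ: "(\<lambda>s. (norm (ell2_apply (X n) s - f s))\<^sup>2) summable_on UNIV"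
    if "\<forall>F. finite F \<longrightarrow> (\<Sum>s\<in>F. (norm (ell2_apply (X n) s - f s))\<^sup>2) \<le> c" for n c
    by (rule nonneg_bdd_above_summable_on) (use that in \<open>auto intro!: bdd_aboveI\<close>)
  obtain N where N: "\<forall>n\<ge>N. \<forall>F. finite F \<longrightarrow> (\<Sum>s\<in>F. (norm (ell2_apply (X n) s - f s))\<^sup>2) \<le> 1\<^sup>2"
    using bound[of 1] by auto
  have "(\<lambda>s. (norm (- (ell2_apply (X N) s - f s) + ell2_apply (X N) s))\<^sup>2) summable_on UNIV"
  proof (rule square_summable_add[OF _ ell2_summable])
    have "(\<lambda>s. (norm (ell2_apply (X N) s - f s))\<^sup>2) summable_on UNIV"
      by (rule summ[of N "1\<^sup>2"]) (use N in blast)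
    then show "(\<lambda>s. (norm (- (ell2_apply (X N) s - f s)))\<^sup>2) summable_on UNIV"
      by (simp only: norm_minus_cancel)
  qed
  then have "f \<in> {f. (\<lambda>x. (norm (f x))\<^sup>2) summable_on UNIV}" by simp
  then have L: "ell2_apply (Abs_ell2 f) = f" by (rule Abs_ell2_inverse)
  have "X \<longlonglongrightarrow> Abs_ell2 f"
  proof (rule metric_LIMSEQ_I)
    fix r :: real assume r: "0 < r"
    obtain M where M: "\<forall>n\<ge>M. \<forall>F. finite F \<longrightarrow> (\<Sum>s\<in>F. (norm (ell2_apply (X n) s - f s))\<^sup>2) \<le> (r / 2)\<^sup>2"
      using bound[of "r / 2"] r by auto
    have "dist (X n) (Abs_ell2 f) < r" if "n \<ge> M" for n
    proof -
      have "(norm (X n - Abs_ell2 f))\<^sup>2 \<le> (r / 2)\<^sup>2"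
        unfolding norm_ell2_sq
        by (rule infsum_le_finite_sums[OF ell2_summable]) (use M that in \<open>simp add: L\<close>)
      then have "norm (X n - Abs_ell2 f) \<le> r / 2" by (rule power2_le_imp_le) (use r in simp)
      then show ?thesis unfolding dist_norm using r by linarith
    qed
    then show "\<exists>no. \<forall>n\<ge>no. dist (X n) (Abs_ell2 f) < r" by blast
  qed
  then show "convergent X" unfolding convergent_def by blast
qed

lemma has_sum_finite_sum:
  fixes f :: "'i \<Rightarrow> 'x \<Rightarrow> 'b::topological_comm_monoid_add"
  assumes "\<And>i. i \<in> I \<Longrightarrow> (f i has_sum s i) A"
  shows "((\<lambda>x. \<Sum>i\<in>I. f i x) has_sum (\<Sum>i\<in>I. s i)) A"
  using assms by (induction I rule: infinite_finite_induct) (auto intro!: has_sum_add)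

lemma inner_ell2_has_sum:
  "((\<lambda>x. inner (ell2_apply \<xi> x) (ell2_apply \<eta> x)) has_sum inner \<xi> \<eta>) UNIV"
  unfolding inner_ell2.rep_eq
  by (intro has_sum_infsum square_summable_inner ell2_summable)

lemma norm_ell2_sq_has_sum:
  "((\<lambda>x. (norm (ell2_apply \<xi> x))\<^sup>2) has_sum (norm \<xi>)\<^sup>2) UNIV"
  unfolding norm_ell2_sq by (intro has_sum_infsum ell2_summable)

lemma inner_cmult_left: "inner (ell2_cmult c \<xi>) \<eta> = inner \<xi> (ell2_cmult (cnj c) \<eta>)"
  unfolding inner_ell2.rep_eq by (rule infsum_cong) (simp add: inner_complex_def algebra_simps)

lemma inner_delta: "inner (ell2_cmult c (delta u)) \<eta> = inner c (ell2_apply \<eta> u)"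
proof -
  have "inner (ell2_cmult c (delta u)) \<eta> = (\<Sum>\<^sub>\<infinity>x\<in>{u}. inner c (ell2_apply \<eta> x))"
    unfolding inner_ell2.rep_eq by (rule infsum_cong_neutral) auto
  then show ?thesis by simp
qed

lemma ell2_cmult_algebra:
  "ell2_cmult c (ell2_cmult d \<xi>) = ell2_cmult (c * d) \<xi>" "ell2_cmult 1 \<xi> = \<xi>" "ell2_cmult 0 \<xi> = 0"
  "ell2_cmult c (\<xi> + \<eta>) = ell2_cmult c \<xi> + ell2_cmult c \<eta>"
  "ell2_cmult (c + d) \<xi> = ell2_cmult c \<xi> + ell2_cmult d \<xi>"
  "ell2_cmult (of_real r) \<xi> = r *\<^sub>R \<xi>" "ell2_cmult c 0 = 0"
  by (rule ell2_eqI, simp add: algebra_simps)+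

lemma ell2_cmult_sum: "ell2_cmult c (\<Sum>i\<in>I. f i) = (\<Sum>i\<in>I. ell2_cmult c (f i))"
  by (rule ell2_eqI) (simp add: sum_distrib_left)

lemma norm_ell2_cmult: "norm (ell2_cmult c \<xi>) = norm c * norm \<xi>"
  by (simp add: norm_ell2_eq norm_mult power_mult_distrib infsum_cmult_right' real_sqrt_mult)

lemma inner_sum_delta:
  assumes "finite T"
  shows "inner (\<Sum>t\<in>T. ell2_cmult (f t) (delta t)) \<eta> = (\<Sum>t\<in>T. inner (f t) (ell2_apply \<eta> t))"
  by (simp add: inner_sum_left inner_delta)

lemma norm_sum_delta:
  assumes "finite T"
  shows "(norm (\<Sum>t\<in>T. ell2_cmult (f t) (delta t)))\<^sup>2 = (\<Sum>t\<in>T. (norm (f t))\<^sup>2)"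
proof -
  have "inner (\<Sum>t\<in>T. ell2_cmult (f t) (delta t)) (\<Sum>t\<in>T. ell2_cmult (f t) (delta t))
      = (\<Sum>t\<in>T. inner (f t) (f t))"
    unfolding inner_sum_delta[OF assms] using assms by (intro sum.cong) (auto simp: if_distrib cong: if_cong)
  then show ?thesis by (simp add: power2_norm_eq_inner)
qed

text \<open>Testing against the multiple of \<open>T x\<close> that has norm \<open>norm x\<close>
  turns the mean of squares into a product. The form with squares is the one that adds up over
  tuples of vectors.\<close>

lemma norm_blinfun_le_inner:
  fixes T :: "'h::real_inner \<Rightarrow>\<^sub>L 'k::real_inner"
  assumes "M \<ge> 0" "\<And>x y. inner (T x) y \<le> M * (((norm x)\<^sup>2 + (norm y)\<^sup>2) / 2)"
  shows "norm T \<le> M"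
proof (rule norm_blinfun_bound[OF assms(1)])
  fix x
  show "norm (T x) \<le> M * norm x"
  proof (cases "norm (T x) = 0 \<or> norm x = 0")
    case True then show ?thesis using assms(1) by (auto simp: blinfun.zero_right)
  next
    case False
    define y where "y = (norm x / norm (T x)) *\<^sub>R T x"
    have "norm y = norm x" unfolding y_def using False by simp
    then have "inner (T x) y \<le> M * (norm x)\<^sup>2" using assms(2)[of x y] by simp
    moreover have "inner (T x) y = norm x * norm (T x)"
      unfolding y_def using False by (simp add: power2_norm_eq_inner[symmetric] power2_eq_square)
    ultimately show ?thesis using False by (simp add: power2_eq_square)
  qed
qed

text \<open>One construction for all representations in play: the regular one, the quasi-regular
  ones, and their restrictions to subgroups.\<close>

definition perm_lin :: "'s set \<Rightarrow> ('g \<Rightarrow> 's \<Rightarrow> 's) \<Rightarrow> ('g \<Rightarrow> complex) \<Rightarrow> 's ell2 \<Rightarrow>\<^sub>L 's ell2"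
  where "perm_lin S act a = lin_ext (\<lambda>g. perm_op S (act g)) a"

definition indc :: "'g set \<Rightarrow> 'g \<Rightarrow> complex" where "indc A x = (if x \<in> A then 1 else 0)"

definition conv :: "('g, 'b) monoid_scheme \<Rightarrow> ('g \<Rightarrow> complex) \<Rightarrow> ('g \<Rightarrow> complex) \<Rightarrow> 'g \<Rightarrow> complex"
  where "conv H a b x = (\<Sum>g | a g \<noteq> 0. \<Sum>h | b h \<noteq> 0. if g \<otimes>\<^bsub>H\<^esub> h = x then a g * b h else 0)"

definition star :: "('g, 'b) monoid_scheme \<Rightarrow> ('g \<Rightarrow> complex) \<Rightarrow> 'g \<Rightarrow> complex"
  where "star H a x = (if x \<in> carrier H then cnj (a (inv\<^bsub>H\<^esub> x)) else 0)"

lemma group_algebraI: "finite A \<Longrightarrow> A \<subseteq> carrier G \<Longrightarrow> (\<And>x. x \<notin> A \<Longrightarrow> a x = 0) \<Longrightarrow> a \<in> group_algebra G"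
  unfolding group_algebra_def by (auto intro: finite_subset[of _ A])

lemma group_algebraD:
  assumes "a \<in> group_algebra G"
  shows "finite {g. a g \<noteq> 0}" "{g. a g \<noteq> 0} \<subseteq> carrier G"
  using assms by (auto simp: group_algebra_def)

lemma ga_zero: "(\<lambda>_. 0) \<in> group_algebra G"
  by (rule group_algebraI[of "{}"]) auto

lemma ga_scale: "a \<in> group_algebra G \<Longrightarrow> (\<lambda>x. c * a x) \<in> group_algebra G"
  by (rule group_algebraI[OF group_algebraD]) auto

lemma ga_add: "a \<in> group_algebra G \<Longrightarrow> b \<in> group_algebra G \<Longrightarrow> (\<lambda>x. a x + b x) \<in> group_algebra G"
  by (rule group_algebraI[of "{g. a g \<noteq> 0} \<union> {g. b g \<noteq> 0}"]) (auto dest: group_algebraD)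

lemma ga_diff: "a \<in> group_algebra G \<Longrightarrow> b \<in> group_algebra G \<Longrightarrow> (\<lambda>x. a x - b x) \<in> group_algebra G"
  by (rule group_algebraI[of "{g. a g \<noteq> 0} \<union> {g. b g \<noteq> 0}"]) (auto dest: group_algebraD)

lemma ga_sum: "(\<And>i. i \<in> I \<Longrightarrow> f i \<in> group_algebra G) \<Longrightarrow> (\<lambda>x. \<Sum>i\<in>I. f i x) \<in> group_algebra G"
  by (induction I rule: infinite_finite_induct) (auto intro: ga_zero ga_add)

lemma ga_indc: "finite A \<Longrightarrow> A \<subseteq> carrier G \<Longrightarrow> indc A \<in> group_algebra G"
  by (rule group_algebraI[of A]) (auto simp: indc_def)

lemma (in group) ga_star:
  assumes "a \<in> group_algebra G"
  shows "star G a \<in> group_algebra G"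
proof (rule group_algebraI)
  show "finite (m_inv G ` {g. a g \<noteq> 0})" "m_inv G ` {g. a g \<noteq> 0} \<subseteq> carrier G"
    using group_algebraD[OF assms] by auto
  show "star G a x = 0" if x: "x \<notin> m_inv G ` {g. a g \<noteq> 0}" for x
  proof (rule ccontr)
    assume "star G a x \<noteq> 0"
    then have "x \<in> carrier G" "a (inv x) \<noteq> 0" unfolding star_def by (auto split: if_splits)
    then have "x = inv (inv x)" "inv x \<in> {g. a g \<noteq> 0}" by auto
    then show False using x by blast
  qed
qed

lemma (in group) conv_eq_0:
  assumes "x \<notin> (\<lambda>(g, h). g \<otimes> h) ` ({g. a g \<noteq> 0} \<times> {h. b h \<noteq> 0})"
  shows "conv G a b x = 0"
  unfolding conv_def using assms by (intro sum.neutral ballI) force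

lemma (in group) ga_conv:
  assumes a: "a \<in> group_algebra G" and b: "b \<in> group_algebra G"
  shows "conv G a b \<in> group_algebra G"
proof (rule group_algebraI)
  show "finite ((\<lambda>(g, h). g \<otimes> h) ` ({g. a g \<noteq> 0} \<times> {h. b h \<noteq> 0}))"
    using group_algebraD[OF a] group_algebraD[OF b] by auto
  show "(\<lambda>(g, h). g \<otimes> h) ` ({g. a g \<noteq> 0} \<times> {h. b h \<noteq> 0}) \<subseteq> carrier G"
    using group_algebraD[OF a] group_algebraD[OF b] by auto
qed (rule conv_eq_0)

text \<open>The operators of an action on \<open>S\<close> vanish on functions supported outside
  \<open>S\<close>, so \<open>\<one>\<close> acts as a projection of \<open>'s ell2\<close> and not
  as its identity.\<close>

locale group_perm = group H for H (structure) +
  fixes S :: "'s set" and act :: "'a \<Rightarrow> 's \<Rightarrow> 's"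
  assumes act_closed: "g \<in> carrier H \<Longrightarrow> s \<in> S \<Longrightarrow> act g s \<in> S"
    and act_mult: "g \<in> carrier H \<Longrightarrow> h \<in> carrier H \<Longrightarrow> s \<in> S \<Longrightarrow> act (g \<otimes> h) s = act g (act h s)"
    and act_one: "s \<in> S \<Longrightarrow> act \<one> s = s"
begin

lemma act_inv: "g \<in> carrier H \<Longrightarrow> s \<in> S \<Longrightarrow> act (inv g) (act g s) = s"
  "g \<in> carrier H \<Longrightarrow> s \<in> S \<Longrightarrow> act g (act (inv g) s) = s"
  using act_mult[of "inv g" g s] act_mult[of g "inv g" s] act_one[of s] by auto

lemma bij_act: "g \<in> carrier H \<Longrightarrow> bij_betw (act g) S S"
  by (rule bij_betw_byWitness[where f' = "act (inv g)"]) (auto simp: act_inv act_closed)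

lemma perm_apply:
  assumes "g \<in> carrier H"
  shows "ell2_apply (perm_op S (act g) \<xi>) s = (if s \<in> S then ell2_apply \<xi> (act (inv g) s) else 0)"
proof -
  have "inv_into S (act g) s = act (inv g) s" if "s \<in> S"
  proof (rule inv_into_f_eq)
    show "inj_on (act g) S" using bij_act[OF assms] by (rule bij_betw_imp_inj_on)
    show "act (inv g) s \<in> S" using that assms by (simp add: act_closed)
    show "act g (act (inv g) s) = s" using that assms by (simp add: act_inv)
  qed
  then show ?thesis using bij_act[OF assms] by (simp add: perm_op.rep_eq perm_ell2.rep_eq)
qed

lemma perm_delta: "g \<in> carrier H \<Longrightarrow> s \<in> S \<Longrightarrow> perm_op S (act g) (delta s) = delta (act g s)"
  by (rule perm_op_delta[OF bij_act])

lemma perm_mult: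
  "g \<in> carrier H \<Longrightarrow> h \<in> carrier H \<Longrightarrow> perm_op S (act (g \<otimes> h)) \<xi> = perm_op S (act g) (perm_op S (act h) \<xi>)"
  by (rule ell2_eqI) (simp add: perm_apply act_closed inv_mult_group act_mult)

lemma perm_cmult: "g \<in> carrier H \<Longrightarrow> perm_op S (act g) (ell2_cmult c \<xi>) = ell2_cmult c (perm_op S (act g) \<xi>)"
  by (rule ell2_eqI) (simp add: perm_apply)

lemma perm_adj:
  assumes g: "g \<in> carrier H"
  shows "inner (perm_op S (act g) \<xi>) \<eta> = inner \<xi> (perm_op S (act (inv g)) \<eta>)"
proof -
  have "inner (perm_op S (act g) \<xi>) \<eta> = (\<Sum>\<^sub>\<infinity>x\<in>S. inner (ell2_apply \<xi> (act (inv g) x)) (ell2_apply \<eta> x))"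
    unfolding inner_ell2.rep_eq by (rule infsum_cong_neutral) (auto simp: perm_apply g)
  also have "\<dots> = (\<Sum>\<^sub>\<infinity>x\<in>S. inner (ell2_apply \<xi> (act (inv g) (act g x))) (ell2_apply \<eta> (act g x)))"
    by (rule infsum_reindex_bij_betw[OF bij_act[OF g], symmetric])
  also have "\<dots> = (\<Sum>\<^sub>\<infinity>x\<in>S. inner (ell2_apply \<xi> x) (ell2_apply \<eta> (act g x)))"
    by (rule infsum_cong) (simp add: act_inv g)
  also have "\<dots> = inner \<xi> (perm_op S (act (inv g)) \<eta>)"
    unfolding inner_ell2.rep_eq by (rule infsum_cong_neutral) (auto simp: perm_apply g)
  finally show ?thesis .
qed

text \<open>The degenerate case is the zero operator, the default value of \<open>perm_ell2\<close>.
  Estimates indexed by arbitrary elements of the type can therefore cite this bound.\<close>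

lemma norm_perm_le: "norm (perm_op S (act g) \<xi>) \<le> norm \<xi>"
proof (cases "bij_betw (act g) S S")
  case True
  have "norm (perm_op S (act g) \<xi>) = norm (perm_ell2 S (act g) \<xi>)" by (simp add: perm_op.rep_eq)
  have s: "(\<lambda>x. (norm (ell2_apply \<xi> x))\<^sup>2) summable_on UNIV" by (rule ell2_summable)
  have "(\<Sum>\<^sub>\<infinity>x. (norm (ell2_apply (perm_ell2 S (act g) \<xi>) x))\<^sup>2)
      = (\<Sum>\<^sub>\<infinity>x\<in>S. (norm (ell2_apply \<xi> (inv_into S (act g) x)))\<^sup>2)"
    by (rule infsum_cong_neutral) (auto simp: perm_ell2.rep_eq True)
  also have "\<dots> = (\<Sum>\<^sub>\<infinity>x\<in>S. (norm (ell2_apply \<xi> x))\<^sup>2)"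
    by (rule perm_summable(2)[OF s True])
  also have "\<dots> \<le> (\<Sum>\<^sub>\<infinity>x. (norm (ell2_apply \<xi> x))\<^sup>2)"
    using s by (intro infsum_mono2 summable_on_subset_banach[OF s]) auto
  finally show ?thesis by (simp add: norm_ell2_eq perm_op.rep_eq)
next
  case False
  then have "perm_op S (act g) \<xi> = 0"
    by (intro ell2_eqI) (simp add: perm_op.rep_eq perm_ell2.rep_eq)
  then show ?thesis by simp
qed

abbreviation "rp \<equiv> perm_lin S act"

lemma rp_sum_form:
  assumes "finite A" "{g. a g \<noteq> 0} \<subseteq> A"
  shows "rp a \<xi> = (\<Sum>g\<in>A. ell2_cmult (a g) (perm_op S (act g) \<xi>))"
proof -
  have "rp a \<xi> = (\<Sum>g | a g \<noteq> 0. ell2_cmult (a g) (perm_op S (act g) \<xi>))"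
    unfolding perm_lin_def lin_ext_def by (simp add: blinfun.sum_left cmult_op.rep_eq)
  also have "\<dots> = (\<Sum>g\<in>A. ell2_cmult (a g) (perm_op S (act g) \<xi>))"
    by (rule sum.mono_neutral_left) (use assms in \<open>auto simp: ell2_cmult_algebra\<close>)
  finally show ?thesis .
qed

lemma rp_apply:
  assumes "finite A" "{g. a g \<noteq> 0} \<subseteq> A" "A \<subseteq> carrier H"
  shows "ell2_apply (rp a \<xi>) s = (if s \<in> S then \<Sum>g\<in>A. a g * ell2_apply \<xi> (act (inv g) s) else 0)"
  unfolding rp_sum_form[OF assms(1,2)] using assms(3)
  by (auto intro!: sum.cong sum.neutral simp: perm_apply)

lemma rp_scale: "a \<in> group_algebra H \<Longrightarrow> rp (\<lambda>x. c * a x) = cmult_op c o\<^sub>L rp a"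
proof (rule blinfun_eqI)
  fix \<xi> assume a: "a \<in> group_algebra H"
  show "rp (\<lambda>x. c * a x) \<xi> = (cmult_op c o\<^sub>L rp a) \<xi>"
    using rp_sum_form[OF group_algebraD(1)[OF a], of "\<lambda>x. c * a x" \<xi>] rp_sum_form[OF group_algebraD(1)[OF a] order_refl, of \<xi>]
    by (auto simp: cmult_op.rep_eq ell2_cmult_sum ell2_cmult_algebra)
qed

lemma rp_scaleR: "a \<in> group_algebra H \<Longrightarrow> rp (\<lambda>x. of_real r * a x) = r *\<^sub>R rp a"
  by (rule blinfun_eqI) (simp add: rp_scale cmult_op.rep_eq ell2_cmult_algebra blinfun.scaleR_left)

lemma rp_add:
  assumes a: "a \<in> group_algebra H" and b: "b \<in> group_algebra H"
  shows "rp (\<lambda>x. a x + b x) = rp a + rp b"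
proof (rule blinfun_eqI)
  fix \<xi>
  have fin: "finite ({g. a g \<noteq> 0} \<union> {g. b g \<noteq> 0})"
    using group_algebraD[OF a] group_algebraD[OF b] by auto
  show "rp (\<lambda>x. a x + b x) \<xi> = (rp a + rp b) \<xi>"
    unfolding blinfun.add_left
    by (subst (1 2 3) rp_sum_form[OF fin]) (auto simp: ell2_cmult_algebra sum.distrib)
qed

lemma rp_zero: "rp (\<lambda>_. 0) = 0"
  by (simp add: perm_lin_def lin_ext_def)

lemma rp_diff:
  assumes "a \<in> group_algebra H" "b \<in> group_algebra H"
  shows "rp (\<lambda>x. a x - b x) = rp a - rp b"
  using rp_add[OF assms(1) ga_scale[OF assms(2), of "-1"]] rp_scaleR[OF assms(2), of "-1"] by simp

lemma rp_sum: "(\<And>i. i \<in> I \<Longrightarrow> f i \<in> group_algebra H) \<Longrightarrow> rp (\<lambda>x. \<Sum>i\<in>I. f i x) = (\<Sum>i\<in>I. rp (f i))"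
  by (induction I rule: infinite_finite_induct) (auto simp: rp_zero rp_add ga_sum)

lemma rp_indc:
  assumes "finite A"
  shows "rp (indc A) = (\<Sum>g\<in>A. perm_op S (act g))"
  by (rule blinfun_eqI)
    (subst rp_sum_form[OF assms], auto simp: indc_def blinfun.sum_left ell2_cmult_algebra)

lemma rp_single: "rp (indc {g}) = perm_op S (act g)"
  by (simp add: rp_indc)

lemma rp_conv:
  assumes a: "a \<in> group_algebra H" and b: "b \<in> group_algebra H"
  shows "rp (conv H a b) = rp a o\<^sub>L rp b"
proof (rule blinfun_eqI, rule ell2_eqI)
  fix \<xi> s
  let ?A = "{g. a g \<noteq> 0}" and ?B = "{g. b g \<noteq> 0}"
  note A = group_algebraD[OF a] and B = group_algebraD[OF b]
  let ?C = "(\<lambda>(g, h). g \<otimes> h) ` (?A \<times> ?B)"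
  have C: "finite ?C" "{g. conv H a b g \<noteq> 0} \<subseteq> ?C" "?C \<subseteq> carrier H"
    using A B conv_eq_0[of _ a b] by auto
  show "ell2_apply (rp (conv H a b) \<xi>) s = ell2_apply ((rp a o\<^sub>L rp b) \<xi>) s"
  proof (cases "s \<in> S")
    case False
    then show ?thesis using rp_apply[OF C] rp_apply[OF A(1) order_refl A(2)] by simp
  next
    case True
    define F where "F x = ell2_apply \<xi> (act (inv x) s)" for x
    have "ell2_apply (rp (conv H a b) \<xi>) s = (\<Sum>x\<in>?C. conv H a b x * F x)"
      using rp_apply[OF C] True by (simp add: F_def)
    also have "\<dots> = (\<Sum>x\<in>?C. \<Sum>g\<in>?A. \<Sum>h\<in>?B. if g \<otimes> h = x then a g * b h * F x else 0)"
      unfolding conv_def sum_distrib_right by (intro sum.cong refl) simp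
    also have "\<dots> = (\<Sum>g\<in>?A. \<Sum>h\<in>?B. \<Sum>x\<in>?C. if g \<otimes> h = x then a g * b h * F x else 0)"
      by (subst sum.swap, intro sum.cong refl sum.swap)
    also have "\<dots> = (\<Sum>g\<in>?A. \<Sum>h\<in>?B. a g * b h * F (g \<otimes> h))"
      using C(1) by (intro sum.cong refl) (auto simp: image_iff)
    also have "\<dots> = (\<Sum>g\<in>?A. a g * (\<Sum>h\<in>?B. b h * ell2_apply \<xi> (act (inv h) (act (inv g) s))))"
      unfolding sum_distrib_left F_def
    proof (intro sum.cong refl)
      fix g h assume "g \<in> ?A" "h \<in> ?B"
      then have "g \<in> carrier H" "h \<in> carrier H" using A B by auto
      then show "a g * b h * ell2_apply \<xi> (act (inv (g \<otimes> h)) s) =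
          a g * (b h * ell2_apply \<xi> (act (inv h) (act (inv g) s)))"
        using True by (simp add: inv_mult_group act_mult)
    qed
    also have "\<dots> = (\<Sum>g\<in>?A. a g * ell2_apply (rp b \<xi>) (act (inv g) s))"
    proof (intro sum.cong refl)
      fix g assume "g \<in> ?A"
      then have "g \<in> carrier H" using A by auto
      then have "act (inv g) s \<in> S" using True by (simp add: act_closed)
      then show "a g * (\<Sum>h\<in>?B. b h * ell2_apply \<xi> (act (inv h) (act (inv g) s))) =
          a g * ell2_apply (rp b \<xi>) (act (inv g) s)"
        using rp_apply[OF B(1) order_refl B(2)] by simp
    qed
    also have "\<dots> = ell2_apply ((rp a o\<^sub>L rp b) \<xi>) s"
      using rp_apply[OF A(1) order_refl A(2), of "rp b \<xi>" s] True by simp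
    finally show ?thesis .
  qed
qed

lemma rp_adj:
  assumes a: "a \<in> group_algebra H"
  shows "adjoints (rp a) (rp (star H a))"
  unfolding adjoints_def
proof (intro allI)
  fix \<xi> \<eta>
  let ?A = "{g. a g \<noteq> 0}"
  note A = group_algebraD[OF a]
  have inj: "inj_on (m_inv H) ?A" using A(2) by (meson inj_on_def inv_inj inj_on_subset)
  have sub: "{g. star H a g \<noteq> 0} \<subseteq> m_inv H ` ?A"
  proof
    fix x assume "x \<in> {g. star H a g \<noteq> 0}"
    then have "x \<in> carrier H" "a (inv x) \<noteq> 0" unfolding star_def by (auto split: if_splits)
    then have "x = inv (inv x)" "inv x \<in> ?A" by auto
    then show "x \<in> m_inv H ` ?A" by blast
  qed
  have "inner \<xi> (rp (star H a) \<eta>) = (\<Sum>x\<in>m_inv H ` ?A. inner \<xi> (ell2_cmult (star H a x) (perm_op S (act x) \<eta>)))"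
    using A(1) by (subst rp_sum_form[OF _ sub]) (auto simp: inner_sum_right)
  also have "\<dots> = (\<Sum>g\<in>?A. inner \<xi> (ell2_cmult (star H a (inv g)) (perm_op S (act (inv g)) \<eta>)))"
    by (simp add: sum.reindex[OF inj])
  also have "\<dots> = (\<Sum>g\<in>?A. inner (ell2_cmult (a g) (perm_op S (act g) \<xi>)) \<eta>)"
  proof (intro sum.cong refl)
    fix g assume "g \<in> ?A"
    then have g: "g \<in> carrier H" using A by auto
    have "inner (ell2_cmult (a g) (perm_op S (act g) \<xi>)) \<eta> = inner (perm_op S (act g) (ell2_cmult (a g) \<xi>)) \<eta>"
      by (simp add: perm_cmult g)
    also have "\<dots> = inner \<xi> (ell2_cmult (cnj (a g)) (perm_op S (act (inv g)) \<eta>))"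
      by (simp add: perm_adj g inner_cmult_left)
    finally show "inner \<xi> (ell2_cmult (star H a (inv g)) (perm_op S (act (inv g)) \<eta>)) =
      inner (ell2_cmult (a g) (perm_op S (act g) \<xi>)) \<eta>"
      using g by (simp add: star_def)
  qed
  also have "\<dots> = inner (rp a \<xi>) \<eta>"
    by (subst rp_sum_form[OF A(1) order_refl]) (simp add: inner_sum_left)
  finally show "inner (rp a \<xi>) \<eta> = inner \<xi> (rp (star H a) \<eta>)" by simp
qed

text \<open>The matrix of \<open>rp a\<close> also acts on \<open>S\<close>-tuples of vectors of an arbitrary Hilbert space, with the
  same norm.\<close>

lemma tensor_bound:
  fixes \<xi> \<eta> :: "'s \<Rightarrow> 't ell2"
  assumes a: "a \<in> group_algebra H" and T: "finite T" "T \<subseteq> S"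
  shows "(\<Sum>h | a h \<noteq> 0. \<Sum>t | t \<in> T \<and> act h t \<in> T. inner (ell2_cmult (a h) (\<xi> t)) (\<eta> (act h t)))
    \<le> norm (rp a) * (((\<Sum>t\<in>T. (norm (\<xi> t))\<^sup>2) + (\<Sum>t\<in>T. (norm (\<eta> t))\<^sup>2)) / 2)"
proof (rule has_sum_mono)
  let ?M = "norm (rp a)"
  \<comment> \<open>The \<open>j\<close>-th coordinates of the tuple form one vector of the Hilbert
    space over \<open>S\<close>. The claim is the sum over \<open>j\<close> of the inequalities for
    \<open>rp a\<close> on these vectors.\<close>
  define v where "v \<xi> j = (\<Sum>t\<in>T. ell2_cmult (ell2_apply (\<xi> t) j) (delta t))" for \<xi> :: "'s \<Rightarrow> 't ell2" and j
  let ?f = "\<lambda>j. \<Sum>h | a h \<noteq> 0. \<Sum>t | t \<in> T \<and> act h t \<in> T.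
      inner (ell2_apply (ell2_cmult (a h) (\<xi> t)) j) (ell2_apply (\<eta> (act h t)) j)"
  show "(?f has_sum (\<Sum>h | a h \<noteq> 0. \<Sum>t | t \<in> T \<and> act h t \<in> T.
      inner (ell2_cmult (a h) (\<xi> t)) (\<eta> (act h t)))) UNIV"
    by (intro has_sum_finite_sum inner_ell2_has_sum)
  let ?g = "\<lambda>j. ?M * (((\<Sum>t\<in>T. (norm (ell2_apply (\<xi> t) j))\<^sup>2) + (\<Sum>t\<in>T. (norm (ell2_apply (\<eta> t) j))\<^sup>2)) * (1 / 2))"
  have "(?g has_sum ?M * (((\<Sum>t\<in>T. (norm (\<xi> t))\<^sup>2) + (\<Sum>t\<in>T. (norm (\<eta> t))\<^sup>2)) * (1 / 2))) UNIV"
    by (intro has_sum_cmult_right has_sum_cmult_left has_sum_add has_sum_finite_sum norm_ell2_sq_has_sum)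
  then show "(?g has_sum ?M * (((\<Sum>t\<in>T. (norm (\<xi> t))\<^sup>2) + (\<Sum>t\<in>T. (norm (\<eta> t))\<^sup>2)) / 2)) UNIV"
    by simp
  fix j
  have "?f j = inner (rp a (v \<xi> j)) (v \<eta> j)"
  proof -
    have "rp a (v \<xi> j) = (\<Sum>h | a h \<noteq> 0. \<Sum>t\<in>T. ell2_cmult (a h * ell2_apply (\<xi> t) j) (delta (act h t)))"
    proof -
      have "perm_op S (act h) (v \<xi> j) = (\<Sum>t\<in>T. ell2_cmult (ell2_apply (\<xi> t) j) (delta (act h t)))"
        if "a h \<noteq> 0" for h
      proof -
        have h: "h \<in> carrier H" using that group_algebraD[OF a] by auto
        show ?thesis unfolding v_def blinfun.sum_right
          using T(2) by (intro sum.cong refl) (auto simp: perm_cmult h perm_delta)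
      qed
      then show ?thesis
        unfolding rp_sum_form[OF group_algebraD(1)[OF a] order_refl]
        by (intro sum.cong refl) (simp add: ell2_cmult_sum ell2_cmult_algebra)
    qed
    moreover have "ell2_apply (v \<eta> j) u = (if u \<in> T then ell2_apply (\<eta> u) j else 0)" for u
      unfolding v_def using T(1) by (simp add: if_distrib cong: if_cong)
    ultimately have "inner (rp a (v \<xi> j)) (v \<eta> j) = (\<Sum>h | a h \<noteq> 0. \<Sum>t\<in>T.
        if act h t \<in> T then inner (a h * ell2_apply (\<xi> t) j) (ell2_apply (\<eta> (act h t)) j) else 0)"
      by (auto simp: inner_sum_left inner_delta intro!: sum.cong)
    also have "\<dots> = ?f j"
      using T(1) by (simp add: sum.inter_filter)
    finally show ?thesis by simp
  qed
  also have "\<dots> \<le> norm (rp a (v \<xi> j)) * norm (v \<eta> j)" by (rule norm_cauchy_schwarz)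
  also have "\<dots> \<le> (?M * norm (v \<xi> j)) * norm (v \<eta> j)"
    by (intro mult_right_mono norm_blinfun) simp
  also have "\<dots> \<le> ?M * (((norm (v \<xi> j))\<^sup>2 + (norm (v \<eta> j))\<^sup>2) * (1 / 2))"
    using sum_squares_bound[of "norm (v \<xi> j)" "norm (v \<eta> j)"]
    by (simp add: mult.assoc mult_left_mono)
  also have "\<dots> = ?g j" unfolding v_def norm_sum_delta[OF T(1)] ..
  finally show "?f j \<le> ?g j" .
qed

end

section \<open>Finitely generated finite-by-nilpotent groups\<close>

context group
begin

lemma cancel_inv:
  "x \<in> carrier G \<Longrightarrow> y \<in> carrier G \<Longrightarrow> inv x \<otimes> (x \<otimes> y) = y"
  "x \<in> carrier G \<Longrightarrow> y \<in> carrier G \<Longrightarrow> x \<otimes> (inv x \<otimes> y) = y"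
  by (simp_all add: m_assoc[symmetric])

lemmas word_simps = m_assoc inv_mult_group cancel_inv

text \<open>Moving \<open>c\<close> to the front past a letter replaces that letter by a conjugate,
  which is again in \<open>D\<close>. So occurrences of \<open>c\<close> can be collected without
  increasing the number of letters.\<close>

lemma word_product_collect:
  assumes D: "D \<subseteq> carrier G" "\<And>c d. c \<in> D \<Longrightarrow> d \<in> D \<Longrightarrow> inv c \<otimes> d \<otimes> c \<in> D" and c: "c \<in> D"
  shows "set xs \<subseteq> D \<Longrightarrow> j \<le> count_list xs c \<Longrightarrow>
    \<exists>ys. set ys \<subseteq> D \<and> length ys + j = length xs \<and> foldr (\<otimes>) xs \<one> = c [^] j \<otimes> foldr (\<otimes>) ys \<one>"
proof (induction xs arbitrary: j)
  case Nil then show ?case by simp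
next
  case (Cons x xs)
  have cG: "c \<in> carrier G" "x \<in> carrier G" using D(1) c Cons.prems(1) by auto
  have prod: "foldr (\<otimes>) ys \<one> \<in> carrier G" if "set ys \<subseteq> D" for ys
    using that D(1) by (induction ys) auto
  show ?case
  proof (cases j)
    case 0
    then show ?thesis using Cons.prems prod[OF Cons.prems(1)] by (intro exI[of _ "x # xs"]) simp
  next
    case (Suc i)
    show ?thesis
    proof (cases "x = c")
      case True
      then obtain ys where "set ys \<subseteq> D" "length ys + i = length xs"
        "foldr (\<otimes>) xs \<one> = c [^] i \<otimes> foldr (\<otimes>) ys \<one>"
        using Cons.IH[of i] Cons.prems Suc by auto
      then show ?thesis using True Suc cG prod[of ys]
        by (intro exI[of _ ys]) (simp add: m_assoc[symmetric] nat_pow_Suc2[symmetric])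
    next
      case False
      then obtain ys where ys: "set ys \<subseteq> D" "length ys + j = length xs"
        "foldr (\<otimes>) xs \<one> = c [^] j \<otimes> foldr (\<otimes>) ys \<one>"
        using Cons.IH[of j] Cons.prems by auto
      have "inv (c [^] k) \<otimes> x \<otimes> c [^] k \<in> D" for k :: nat
      proof (induction k)
        case 0 then show ?case using cG Cons.prems by simp
      next
        case (Suc k)
        have "inv (c [^] Suc k) \<otimes> x \<otimes> c [^] Suc k = inv c \<otimes> (inv (c [^] k) \<otimes> x \<otimes> c [^] k) \<otimes> c"
          using cG by (simp add: word_simps)
        then show ?case using D(2)[OF c Suc] by simp
      qed
      moreover have "foldr (\<otimes>) (x # xs) \<one> = c [^] j \<otimes> (inv (c [^] j) \<otimes> x \<otimes> c [^] j) \<otimes> foldr (\<otimes>) ys \<one>"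
        using ys(3) cG prod[OF ys(1)] by (simp add: word_simps)
      ultimately show ?thesis
        using ys cG prod[OF ys(1)]
        by (intro exI[of _ "(inv (c [^] j) \<otimes> x \<otimes> c [^] j) # ys"]) (simp add: m_assoc)
    qed
  qed
qed

text \<open>Dicman's lemma.\<close>

lemma finite_generated_of_torsion_classes:
  assumes D: "finite D" "D \<subseteq> carrier G" "\<And>c d. c \<in> D \<Longrightarrow> d \<in> D \<Longrightarrow> inv c \<otimes> d \<otimes> c \<in> D"
    and tors: "\<And>d. d \<in> D \<Longrightarrow> \<exists>n>0. d [^] (n::nat) = \<one>"
  obtains E where "finite E" "E \<subseteq> carrier G" "\<one> \<in> E" "\<And>d x. d \<in> D \<Longrightarrow> x \<in> E \<Longrightarrow> d \<otimes> x \<in> E"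
proof -
  obtain n :: "'a \<Rightarrow> nat" where n: "\<And>d. d \<in> D \<Longrightarrow> n d > 0 \<and> d [^] n d = \<one>" using tors by metis
  define k where "k = (\<Prod>d\<in>D. n d)"
  have k: "k > 0" unfolding k_def using n by (intro prod_pos) auto
  have pow: "d [^] k = \<one>" if "d \<in> D" for d
  proof -
    have "n d dvd k" unfolding k_def using D(1) that by (rule dvd_prodI)
    then obtain m where "k = n d * m" by blast
    moreover have "d [^] (n d * m) = (d [^] n d) [^] m"
      using that D(2) by (subst nat_pow_pow) auto
    ultimately show ?thesis using n[OF that] by simp
  qed
  have prod: "foldr (\<otimes>) ys \<one> \<in> carrier G" if "set ys \<subseteq> D" for ys
    using that D(2) by (induction ys) auto
  \<comment> \<open>\<open>k\<close> is a common exponent of the elements of \<open>D\<close>. A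
    word longer than \<open>?M\<close> contains some letter at least \<open>k\<close> times, and
    collecting \<open>k\<close> copies removes them; words of length at most \<open>?M\<close>
    therefore give all products.\<close>
  let ?M = "card D * k"
  let ?W = "{ys. set ys \<subseteq> D \<and> length ys \<le> ?M}"
  let ?E = "(\<lambda>ys. foldr (\<otimes>) ys \<one>) ` ?W"
  show thesis
  proof (rule that[of ?E])
    show "finite ?E" using finite_lists_length_le[OF D(1)] by simp
    show "?E \<subseteq> carrier G" using prod by auto
    show "\<one> \<in> ?E" by (rule image_eqI[of _ _ "[]"]) auto
    fix d x assume d: "d \<in> D" and "x \<in> ?E"
    then obtain ys where ys: "set ys \<subseteq> D" "length ys \<le> ?M" "x = foldr (\<otimes>) ys \<one>" by auto
    show "d \<otimes> x \<in> ?E"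
    proof (cases "length (d # ys) \<le> ?M")
      case True
      then show ?thesis using d ys by (intro image_eqI[of _ _ "d # ys"]) auto
    next
      case False
      have sub: "set (d # ys) \<subseteq> D" using d ys by auto
      have "\<exists>c\<in>D. k \<le> count_list (d # ys) c"
      proof (rule ccontr)
        assume "\<not> ?thesis"
        then have "(\<Sum>c\<in>D. count_list (d # ys) c) \<le> (\<Sum>c\<in>D. k)" by (intro sum_mono) auto
        moreover have "(\<Sum>c\<in>D. count_list (d # ys) c) = length (d # ys)"
          by (rule sum_count_set[OF sub D(1)])
        ultimately show False using False by simp
      qed
      then obtain c where c: "c \<in> D" "k \<le> count_list (d # ys) c" by blast
      obtain zs where zs: "set zs \<subseteq> D" "length zs + k = length (d # ys)"
        "foldr (\<otimes>) (d # ys) \<one> = c [^] k \<otimes> foldr (\<otimes>) zs \<one>"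
        using word_product_collect[OF D(2,3) c(1) sub c(2)] by blast
      have "d \<otimes> x = foldr (\<otimes>) zs \<one>" using zs(3) ys(3) pow[OF c(1)] prod[OF zs(1)] by simp
      then show ?thesis using zs ys(2) k by (intro image_eqI[of _ _ zs]) auto
    qed
  qed
qed

section \<open>Properties inherited by extensions with cyclic quotient\<close>

definition slender :: "'a set \<Rightarrow> bool"
  where "slender A \<longleftrightarrow> (\<forall>W. subgroup W G \<longrightarrow> W \<subseteq> A \<longrightarrow> (\<exists>E. finite E \<and> E \<subseteq> W \<and> W \<subseteq> generate G E))"

definition finite_index_in :: "'a set \<Rightarrow> 'a set \<Rightarrow> bool"
  where "finite_index_in Y K \<longleftrightarrow> (\<exists>R. finite R \<and> R \<subseteq> Y \<and> (\<forall>y\<in>Y. \<exists>r\<in>R. inv r \<otimes> y \<in> K))"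

text \<open>The implication from bounded exponent modulo \<open>K\<close> to finite index of
  \<open>K\<close>, for all pairs of subgroups inside \<open>A\<close>, a form that can be carried
  through extensions. It later converts exponent bounds into finite index of normal cores.\<close>

definition torsion_finite :: "'a set \<Rightarrow> bool"
  where "torsion_finite A \<longleftrightarrow> (\<forall>K Y. subgroup K G \<longrightarrow> subgroup Y G \<longrightarrow> K \<subseteq> Y \<longrightarrow> Y \<subseteq> A \<longrightarrow>
    (\<exists>n>0. \<forall>y\<in>Y. y [^] (n::nat) \<in> K) \<longrightarrow> finite_index_in Y K)"

lemma subgroup_nat_pow: "subgroup W G \<Longrightarrow> x \<in> W \<Longrightarrow> x [^] (n::nat) \<in> W"
  by (induction n) (auto intro: subgroup.one_closed subgroup.m_closed)

lemma subgroup_int_pow: "subgroup W G \<Longrightarrow> x \<in> W \<Longrightarrow> x [^] (n::int) \<in> W"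
  unfolding int_pow_def2 by (metis subgroup_nat_pow subgroup.m_inv_closed)

text \<open>For normal \<open>A\<close> this is the product of \<open>A\<close> with the cyclic
  group of \<open>t\<close>. The integer \<open>k\<close> is minus the exponent of \<open>t\<close>
  in \<open>x\<close>, and such exponents add under multiplication.\<close>

definition cyclic_ext :: "'a set \<Rightarrow> 'a \<Rightarrow> 'a set"
  where "cyclic_ext A t = {x \<in> carrier G. \<exists>k::int. x \<otimes> t [^] k \<in> A}"

lemma cyclic_ext_rules:
  assumes A: "A \<lhd> G" and t: "t \<in> carrier G"
  shows "x \<in> carrier G \<Longrightarrow> y \<in> carrier G \<Longrightarrow> x \<otimes> t [^] (k::int) \<in> A \<Longrightarrow> y \<otimes> t [^] (l::int) \<in> A \<Longrightarrow>
      (x \<otimes> y) \<otimes> t [^] (k + l) \<in> A"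
    and "x \<in> carrier G \<Longrightarrow> x \<otimes> t [^] (k::int) \<in> A \<Longrightarrow> inv x \<otimes> t [^] (- k) \<in> A"
proof -
  note s = normal_imp_subgroup[OF A]
  have conj: "g \<otimes> a \<otimes> inv g \<in> A" if "g \<in> carrier G" "a \<in> A" for g a
    using A that by (simp add: normal_inv_iff)
  {
    assume xy: "x \<in> carrier G" "y \<in> carrier G" "x \<otimes> t [^] (k::int) \<in> A" "y \<otimes> t [^] (l::int) \<in> A"
    have "(x \<otimes> t [^] k) \<otimes> (inv (t [^] k) \<otimes> (y \<otimes> t [^] l) \<otimes> inv (inv (t [^] k))) \<in> A"
      by (rule subgroup.m_closed[OF s xy(3) conj[OF _ xy(4)]]) (use t in simp)
    also have "(x \<otimes> t [^] k) \<otimes> (inv (t [^] k) \<otimes> (y \<otimes> t [^] l) \<otimes> inv (inv (t [^] k))) =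
        (x \<otimes> y) \<otimes> t [^] (l + k)"
      using xy t by (simp add: word_simps int_pow_mult)
    finally show "(x \<otimes> y) \<otimes> t [^] (k + l) \<in> A" by (simp add: add.commute)
  }
  {
    assume x: "x \<in> carrier G" "x \<otimes> t [^] (k::int) \<in> A"
    have "t [^] k \<otimes> inv (x \<otimes> t [^] k) \<otimes> inv (t [^] k) \<in> A"
      by (rule conj[OF _ subgroup.m_inv_closed[OF s x(2)]]) (use t in simp)
    also have "t [^] k \<otimes> inv (x \<otimes> t [^] k) \<otimes> inv (t [^] k) = inv x \<otimes> t [^] (- k)"
      using x t by (simp add: word_simps int_pow_neg)
    finally show "inv x \<otimes> t [^] (- k) \<in> A" .
  }
qed

lemma cyclic_ext_int_pow:
  assumes A: "A \<lhd> G" and t: "t \<in> carrier G" and x: "x \<in> carrier G" "x \<otimes> t [^] (k::int) \<in> A"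
  shows "x [^] (m::int) \<otimes> t [^] (m * k) \<in> A"
proof -
  have nat: "x [^] n \<otimes> t [^] (int n * k) \<in> A" for n :: nat
  proof (induction n)
    case 0 then show ?case using subgroup.one_closed[OF normal_imp_subgroup[OF A]] by simp
  next
    case (Suc n)
    have "x [^] n \<otimes> x \<otimes> t [^] (int n * k + k) \<in> A"
      by (rule cyclic_ext_rules(1)[OF A t _ x(1) Suc x(2)]) (use x in simp)
    moreover have "int n * k + k = int (Suc n) * k" by (simp add: algebra_simps)
    ultimately show ?case by (simp only: nat_pow_Suc)
  qed
  show ?thesis
  proof (cases m rule: int_cases2)
    case (nonneg n)
    then show ?thesis using nat[of n] by (simp only: int_pow_int)
  next
    case (nonpos n)
    have "inv (x [^] n) \<otimes> t [^] (- (int n * k)) \<in> A"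
      by (rule cyclic_ext_rules(2)[OF A t _ nat]) (use x in simp)
    then show ?thesis unfolding nonpos int_pow_neg_int[OF x(1)] by simp
  qed
qed

lemma cyclic_ext_subgroup:
  assumes A: "A \<lhd> G" and t: "t \<in> carrier G"
  shows "subgroup (cyclic_ext A t) G"
proof (rule subgroupI)
  have "\<one> \<otimes> t [^] (0::int) \<in> A" using subgroup.one_closed[OF normal_imp_subgroup[OF A]] by simp
  then show "cyclic_ext A t \<noteq> {}" unfolding cyclic_ext_def by blast
  show "cyclic_ext A t \<subseteq> carrier G" unfolding cyclic_ext_def by blast
  show "inv a \<in> cyclic_ext A t" if "a \<in> cyclic_ext A t" for a
    using that cyclic_ext_rules(2)[OF A t, of a] unfolding cyclic_ext_def by blast
  show "a \<otimes> b \<in> cyclic_ext A t" if "a \<in> cyclic_ext A t" "b \<in> cyclic_ext A t" for a b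
    using that cyclic_ext_rules(1)[OF A t, of a b] unfolding cyclic_ext_def by blast
qed

lemma cyclic_ext_incl:
  assumes A: "A \<lhd> G" and t: "t \<in> carrier G"
  shows "A \<subseteq> cyclic_ext A t" "t \<in> cyclic_ext A t"
proof -
  note s = normal_imp_subgroup[OF A]
  show "A \<subseteq> cyclic_ext A t" unfolding cyclic_ext_def
    using subgroup.subset[OF s] by (auto intro!: exI[of _ 0])
  have "t \<otimes> t [^] (- 1 :: int) \<in> A"
    using t subgroup.one_closed[OF s] by (simp add: int_pow_neg)
  then show "t \<in> cyclic_ext A t" unfolding cyclic_ext_def using t by blast
qed

text \<open>By hypothesis \<open>t\<close> is central modulo \<open>A\<close>, so conjugation
  preserves the exponent of an element.\<close>

lemma cyclic_ext_normal:
  assumes A: "A \<lhd> G" and t: "t \<in> carrier G"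
    and c: "\<And>g. g \<in> carrier G \<Longrightarrow> g \<otimes> t \<otimes> inv g \<otimes> inv t \<in> A"
  shows "cyclic_ext A t \<lhd> G"
proof (rule normal_invI[OF cyclic_ext_subgroup[OF A t]])
  fix g x assume g: "g \<in> carrier G" and "x \<in> cyclic_ext A t"
  then obtain k :: int where x: "x \<in> carrier G" "x \<otimes> t [^] k \<in> A" unfolding cyclic_ext_def by blast
  note s = normal_imp_subgroup[OF A]
  have conj: "g \<otimes> a \<otimes> inv g \<in> A" if "a \<in> A" for a
    using A that g by (simp add: normal_inv_iff)
  have "(g \<otimes> t \<otimes> inv g) \<otimes> t [^] (- 1 :: int) \<in> A" using c[OF g] g t by (simp add: int_pow_neg)
  then have *: "(g \<otimes> t \<otimes> inv g) [^] (- k) \<otimes> t [^] (- k * - 1) \<in> A"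
    using cyclic_ext_int_pow[OF A t, of "g \<otimes> t \<otimes> inv g" "- 1" "- k"] g t by simp
  have hom: "(g \<otimes> t \<otimes> inv g) [^] m = g \<otimes> t [^] m \<otimes> inv g" for m :: int
  proof -
    have nat: "(g \<otimes> t \<otimes> inv g) [^] n = g \<otimes> t [^] n \<otimes> inv g" for n :: nat
      using g t by (induction n) (simp_all add: word_simps)
    show ?thesis
    proof (cases m rule: int_cases2)
      case (nonneg n)
      then show ?thesis using nat by (simp only: int_pow_int)
    next
      case (nonpos n)
      have c: "g \<otimes> t \<otimes> inv g \<in> carrier G" using g t by simp
      have "inv (g \<otimes> t [^] n \<otimes> inv g) = g \<otimes> inv (t [^] n) \<otimes> inv g" using g t by (simp add: word_simps)
      then show ?thesis unfolding nonpos int_pow_neg_int[OF c] int_pow_neg_int[OF t] nat .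
    qed
  qed
  have "(g \<otimes> (x \<otimes> t [^] k) \<otimes> inv g) \<otimes> ((g \<otimes> t \<otimes> inv g) [^] (- k) \<otimes> t [^] (- k * - 1)) \<in> A"
    by (rule subgroup.m_closed[OF s conj[OF x(2)] *])
  also have "(g \<otimes> (x \<otimes> t [^] k) \<otimes> inv g) \<otimes> ((g \<otimes> t \<otimes> inv g) [^] (- k) \<otimes> t [^] (- k * - 1)) =
      (g \<otimes> x \<otimes> inv g) \<otimes> t [^] k"
    unfolding hom using g t x by (simp add: word_simps int_pow_neg)
  finally show "g \<otimes> x \<otimes> inv g \<in> cyclic_ext A t" unfolding cyclic_ext_def using g x by auto
qed

text \<open>The exponents occurring in \<open>W\<close> form a subgroup of the integers. Either it
  is trivial, so that \<open>W\<close> lies in \<open>A\<close> and \<open>\<one>\<close> works, or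
  \<open>w\<close> realises its least positive element.\<close>

lemma cyclic_ext_generator:
  assumes A: "A \<lhd> G" and t: "t \<in> carrier G" and W: "subgroup W G" "W \<subseteq> cyclic_ext A t"
  obtains w where "w \<in> W" "\<And>x. x \<in> W \<Longrightarrow> \<exists>m::int. w [^] m \<otimes> x \<in> A"
proof -
  note s = normal_imp_subgroup[OF A]
  define P where "P k \<longleftrightarrow> (\<exists>x\<in>W. x \<otimes> t [^] (k::int) \<in> A)" for k
  have WG: "x \<in> carrier G" if "x \<in> W" for x using that subgroup.subset[OF W(1)] by auto
  have inW: "\<exists>k::int. x \<otimes> t [^] k \<in> A" if "x \<in> W" for x using that W(2) unfolding cyclic_ext_def by blast
  show thesis
  proof (cases "\<exists>k. P k \<and> k \<noteq> 0")
    case False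
    show ?thesis
    proof (rule that[of \<one>])
      show "\<one> \<in> W" by (rule subgroup.one_closed[OF W(1)])
      fix x assume x: "x \<in> W"
      then obtain k :: int where k: "x \<otimes> t [^] k \<in> A" using inW by blast
      then have "k = 0" using False x P_def by blast
      then have "\<one> [^] (0::int) \<otimes> x \<in> A" using k WG[OF x] by simp
      then show "\<exists>m::int. \<one> [^] m \<otimes> x \<in> A" by blast
    qed
  next
    case True
    have neg: "P (- k)" if "P k" for k
      using that cyclic_ext_rules(2)[OF A t] WG subgroup.m_inv_closed[OF W(1)] unfolding P_def by blast
    obtain k0 where "P k0" "k0 \<noteq> 0" using True by blast
    then have "\<exists>n. n > 0 \<and> P (int n)"
      using neg[of k0] by (intro exI[of _ "nat \<bar>k0\<bar>"]) (auto simp: abs_if)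
    then obtain d where d: "d > 0" "P (int d)" and dmin: "\<And>n. n < d \<Longrightarrow> \<not> (n > 0 \<and> P (int n))"
      using exists_least_iff[of "\<lambda>n. n > 0 \<and> P (int n)"] by blast
    obtain w where w: "w \<in> W" "w \<otimes> t [^] int d \<in> A" using d(2) P_def by blast
    show ?thesis
    proof (rule that[OF w(1)])
      fix x assume x: "x \<in> W"
      then obtain k :: int where k: "x \<otimes> t [^] k \<in> A" using inW by blast
      \<comment> \<open>Division with remainder: multiplying by \<open>w [^] m\<close> reduces the
        exponent of \<open>x\<close> to \<open>k mod int d\<close>, which must be 0 by minimality of
        \<open>d\<close>.\<close>
      define m where "m = - (k div int d)"
      have m: "m * int d + k = k mod int d" unfolding m_def by (simp add: minus_div_mult_eq_mod)
      have wx: "(w [^] m \<otimes> x) \<otimes> t [^] (m * int d + k) \<in> A"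
        by (rule cyclic_ext_rules(1)[OF A t _ _ cyclic_ext_int_pow[OF A t _ w(2)] k]) (use WG w x in auto)
      have "w [^] m \<otimes> x \<in> W" by (intro subgroup.m_closed[OF W(1)] subgroup_int_pow[OF W(1)] w x)
      then have "P (int (nat (k mod int d)))" unfolding P_def using wx m d(1) by auto
      then have "nat (k mod int d) = 0" using dmin[of "nat (k mod int d)"] d(1)
        by (metis gr0I nat_less_iff pos_mod_bound pos_mod_sign of_nat_0_less_iff)
      then have "k mod int d = 0" using d(1) by (metis nat_0_iff pos_mod_sign of_nat_0_less_iff order_antisym)
      then show "\<exists>m::int. w [^] m \<otimes> x \<in> A" using wx m WG w x by (intro exI[of _ m]) simp
    qed
  qed
qed

lemma slender_cyclic_ext:
  assumes A: "A \<lhd> G" "slender A" and t: "t \<in> carrier G"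
  shows "slender (cyclic_ext A t)"
  unfolding slender_def
proof (intro allI impI)
  fix W assume W: "subgroup W G" "W \<subseteq> cyclic_ext A t"
  obtain w where w: "w \<in> W" "\<And>x. x \<in> W \<Longrightarrow> \<exists>m::int. w [^] m \<otimes> x \<in> A"
    using cyclic_ext_generator[OF A(1) t W] by blast
  have WG: "x \<in> carrier G" if "x \<in> W" for x using that subgroup.subset[OF W(1)] by auto
  have "subgroup (W \<inter> A) G" by (rule subgroups_Inter_pair[OF W(1) normal_imp_subgroup[OF A(1)]])
  from A(2)[unfolded slender_def, rule_format, OF this Int_lower2]
  obtain E where E: "finite E" "E \<subseteq> W \<inter> A" "W \<inter> A \<subseteq> generate G E" by blast
  have EG: "insert w E \<subseteq> carrier G" using E(2) w(1) WG by blast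
  have sg: "subgroup (generate G (insert w E)) G" by (rule generate_is_subgroup[OF EG])
  have mono: "generate G E \<subseteq> generate G (insert w E)" by (rule mono_generate) blast
  have "x \<in> generate G (insert w E)" if x: "x \<in> W" for x
  proof -
    obtain m :: int where m: "w [^] m \<otimes> x \<in> A" using w(2)[OF x] by blast
    have "w [^] m \<otimes> x \<in> W" by (intro subgroup.m_closed[OF W(1)] subgroup_int_pow[OF W(1)] w x)
    then have 1: "w [^] m \<otimes> x \<in> generate G (insert w E)" using m E(3) mono by blast
    have 2: "inv (w [^] m) \<in> generate G (insert w E)"
      by (intro subgroup.m_inv_closed[OF sg] subgroup_int_pow[OF sg] generate.incl) simp
    have "inv (w [^] m) \<otimes> (w [^] m \<otimes> x) \<in> generate G (insert w E)" by (rule subgroup.m_closed[OF sg 2 1])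
    then show ?thesis using WG w(1) x by (simp add: cancel_inv)
  qed
  then show "\<exists>E. finite E \<and> E \<subseteq> W \<and> W \<subseteq> generate G E"
    using E w(1) by (intro exI[of _ "insert w E"]) auto
qed

text \<open>Modulo \<open>A\<close> the group \<open>Y\<close> is generated by \<open>w\<close>, and
  \<open>w [^] n\<close> lies in \<open>K\<close>. Hence the products of \<open>w [^] i\<close> with
  \<open>i < n\<close> and representatives for \<open>Y \<inter> A\<close> meet every coset of
  \<open>K\<close> in \<open>Y\<close>.\<close>

lemma torsion_finite_cyclic_ext:
  assumes A: "A \<lhd> G" "torsion_finite A" and t: "t \<in> carrier G"
  shows "torsion_finite (cyclic_ext A t)"
  unfolding torsion_finite_def
proof (intro allI impI)
  fix K Y assume K: "subgroup K G" and Y: "subgroup Y G" and KY: "K \<subseteq> Y" "Y \<subseteq> cyclic_ext A t"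
    and "\<exists>n>0. \<forall>y\<in>Y. y [^] (n::nat) \<in> K"
  then obtain n :: nat where n: "n > 0" "\<And>y. y \<in> Y \<Longrightarrow> y [^] n \<in> K" by blast
  obtain w where w: "w \<in> Y" "\<And>x. x \<in> Y \<Longrightarrow> \<exists>m::int. w [^] m \<otimes> x \<in> A"
    using cyclic_ext_generator[OF A(1) t Y KY(2)] by blast
  have YG: "x \<in> carrier G" if "x \<in> Y" for x using that subgroup.subset[OF Y] by auto
  note sA = normal_imp_subgroup[OF A(1)]
  have conj: "g \<otimes> a \<otimes> inv g \<in> A" if "g \<in> carrier G" "a \<in> A" for g a
    using A that by (simp add: normal_inv_iff)
  have "\<exists>n>0. \<forall>y\<in>Y \<inter> A. y [^] (n::nat) \<in> K \<inter> A"
    using n subgroup_nat_pow[OF sA] by (intro exI[of _ n]) simp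
  from A(2)[unfolded torsion_finite_def, rule_format, OF subgroups_Inter_pair[OF K sA]
      subgroups_Inter_pair[OF Y sA] Int_mono[OF KY(1) order_refl] Int_lower2 this]
  have "finite_index_in (Y \<inter> A) (K \<inter> A)" .
  then obtain R where R: "finite R" "R \<subseteq> Y \<inter> A" "\<And>y. y \<in> Y \<inter> A \<Longrightarrow> \<exists>r\<in>R. inv r \<otimes> y \<in> K \<inter> A"
    unfolding finite_index_in_def by blast
  let ?R = "(\<lambda>(i, r). w [^] (i::nat) \<otimes> r) ` ({..<n} \<times> R)"
  show "finite_index_in Y K"
    unfolding finite_index_in_def
  proof (intro exI[of _ ?R] conjI ballI)
    show "finite ?R" using R(1) by simp
    show "?R \<subseteq> Y" using R(2) w(1) by (auto intro!: subgroup.m_closed[OF Y] subgroup_nat_pow[OF Y])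
    fix y assume y: "y \<in> Y"
    then obtain m :: int where m: "w [^] m \<otimes> y \<in> A" using w(2) by blast
    define q i where "q = (- m) div int n" and "i = nat ((- m) mod int n)"
    have i: "i < n" "- m = int i + int n * q"
      using n(1) by (auto simp: q_def i_def nat_less_iff)
    define z where "z = w [^] (int n * q)"
    define u where "u = w [^] m \<otimes> y"
    have wG: "w \<in> carrier G" using w YG by auto
    have z: "z \<in> K" "z \<in> carrier G"
    proof -
      have "z = (w [^] n) [^] q" unfolding z_def using wG by (simp add: int_pow_int[symmetric] int_pow_pow)
      then show "z \<in> K" using n(2)[OF w(1)] subgroup_int_pow[OF K] by simp
      then show "z \<in> carrier G" using YG KY(1) by blast
    qed
    have u: "u \<in> Y \<inter> A" "u \<in> carrier G"
      using m w(1) y YG unfolding u_def by (auto intro!: subgroup.m_closed[OF Y] subgroup_int_pow[OF Y])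
    have "z \<otimes> u \<otimes> inv z \<in> Y \<inter> A"
      using u z KY(1) conj by (auto intro!: subgroup.m_closed[OF Y] subgroup.m_inv_closed[OF Y])
    then obtain r where r: "r \<in> R" "inv r \<otimes> (z \<otimes> u \<otimes> inv z) \<in> K \<inter> A" using R(3) by blast
    have rG: "r \<in> carrier G" using r(1) R(2) YG by auto
    \<comment> \<open>The factor \<open>z\<close> from \<open>K\<close> has to stand on the right,
      and moving it there conjugates \<open>u\<close>. This is why the representative
      \<open>r\<close> was chosen for the conjugate of \<open>u\<close>.\<close>
    have yy: "y = w [^] i \<otimes> (z \<otimes> u \<otimes> inv z) \<otimes> z"
    proof -
      have "w [^] i \<otimes> z = w [^] (- m)"
        unfolding z_def i(2) using wG by (simp add: int_pow_mult int_pow_int)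
      moreover have "w [^] (- m) \<otimes> u = y" unfolding u_def using wG y YG by (simp add: int_pow_neg cancel_inv)
      moreover have "w [^] i \<otimes> (z \<otimes> u \<otimes> inv z) \<otimes> z = w [^] i \<otimes> z \<otimes> u"
        using wG z(2) u(2) by (simp add: m_assoc)
      ultimately show ?thesis by simp
    qed
    have "inv (w [^] i \<otimes> r) \<otimes> y = (inv r \<otimes> (z \<otimes> u \<otimes> inv z)) \<otimes> z"
      unfolding yy using wG z(2) u(2) rG by (simp add: word_simps)
    also have "\<dots> \<in> K" using r(2) z(1) by (auto intro: subgroup.m_closed[OF K])
    finally show "\<exists>r\<in>?R. inv r \<otimes> y \<in> K" using r(1) i(1) by force
  qed
qed

lemma finite_slender: "finite A \<Longrightarrow> slender A"
  unfolding slender_def by (meson finite_subset generate.incl subsetI order_refl)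

lemma finite_torsion_finite: "finite A \<Longrightarrow> torsion_finite A"
  unfolding torsion_finite_def finite_index_in_def
  by (metis finite_subset l_inv order_refl subgroup.mem_carrier subgroup.one_closed)

section \<open>Central chains\<close>

definition commut :: "'a \<Rightarrow> 'a \<Rightarrow> 'a" where "commut x y = x \<otimes> y \<otimes> inv x \<otimes> inv y"

lemma commut_closed [simp]: "x \<in> carrier G \<Longrightarrow> y \<in> carrier G \<Longrightarrow> commut x y \<in> carrier G"
  by (simp add: commut_def)

text \<open>A witness of finite-by-nilpotency whose terms are mere sets; it passes to subgroups by
  intersection and to quotients by images.\<close>

definition central_chain :: "(nat \<Rightarrow> 'a set) \<Rightarrow> nat \<Rightarrow> 'a set \<Rightarrow> bool"
  where "central_chain L c N \<longleftrightarrow> N \<lhd> G \<and> finite N \<and> L 0 = carrier G \<and> (\<forall>n. L n \<subseteq> carrier G) \<and>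
    (\<forall>n. \<forall>g\<in>carrier G. \<forall>y\<in>L n. commut g y \<in> L (Suc n)) \<and> L c \<subseteq> N"

definition good :: "'a set \<Rightarrow> bool"
  where "good A \<longleftrightarrow> A \<lhd> G \<and> slender A \<and> torsion_finite A"

text \<open>By \<open>[h1 h2, t] = (h1 [h2, t] inv h1) [h1, t]\<close> and normality of
  \<open>A\<close>, commutators with the generators decide.\<close>

lemma commut_generate:
  assumes A: "A \<lhd> G" and t: "t \<in> carrier G" and F: "F \<subseteq> carrier G" "\<And>f. f \<in> F \<Longrightarrow> inv f \<in> F"
    and c: "\<And>f. f \<in> F \<Longrightarrow> commut f t \<in> A" and g: "g \<in> generate G F"
  shows "commut g t \<in> A"
proof -
  note s = normal_imp_subgroup[OF A]
  have conj: "g \<otimes> a \<otimes> inv g \<in> A" if "g \<in> carrier G" "a \<in> A" for g a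
    using A that by (simp add: normal_inv_iff)
  show ?thesis using g
  proof (induction rule: generate.induct)
    case one
    show ?case using t subgroup.one_closed[OF s] by (simp add: commut_def)
  next
    case (incl h) then show ?case by (rule c)
  next
    case (inv h) then show ?case by (rule c[OF F(2)])
  next
    case (eng h1 h2)
    have h: "h1 \<in> carrier G" "h2 \<in> carrier G" using eng(1,2) generate_in_carrier[OF F(1)] by auto
    have "(h1 \<otimes> commut h2 t \<otimes> inv h1) \<otimes> commut h1 t \<in> A"
      by (rule subgroup.m_closed[OF s conj[OF h(1) eng(4)] eng(3)])
    also have "(h1 \<otimes> commut h2 t \<otimes> inv h1) \<otimes> commut h1 t = commut (h1 \<otimes> h2) t"
      using h t by (simp add: commut_def word_simps)
    finally show ?case .
  qed
qed

text \<open>The elements of \<open>T\<close> are adjoined one at a time. Each is central modulo the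
  group reached so far, since its commutators with the generators already lie in
  \<open>A\<close>.\<close>

lemma good_add_finite:
  assumes F: "F \<subseteq> carrier G" "\<And>f. f \<in> F \<Longrightarrow> inv f \<in> F" "generate G F = carrier G"
    and "finite T" "T \<subseteq> carrier G" "good A" "\<And>t f. t \<in> T \<Longrightarrow> f \<in> F \<Longrightarrow> commut f t \<in> A"
  shows "\<exists>B. good B \<and> A \<subseteq> B \<and> T \<subseteq> B"
  using assms(4,5,7)
proof (induction T rule: finite_induct)
  case empty then show ?case using assms(6) by blast
next
  case (insert t T)
  have "\<exists>B. good B \<and> A \<subseteq> B \<and> T \<subseteq> B" by (rule insert.IH) (use insert.prems in auto)
  then obtain B where B: "good B" "A \<subseteq> B" "T \<subseteq> B" by blast
  have t: "t \<in> carrier G" using insert.prems(1) by simp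
  have Bn: "B \<lhd> G" "slender B" "torsion_finite B" using B(1) unfolding good_def by auto
  have c: "commut g t \<in> B" if "g \<in> carrier G" for g
  proof (rule commut_generate[OF Bn(1) t F(1,2)])
    show "commut f t \<in> B" if "f \<in> F" for f using insert.prems(2)[of t f] that B(2) by auto
    show "g \<in> generate G F" using that F(3) by simp
  qed
  have "cyclic_ext B t \<lhd> G"
    by (rule cyclic_ext_normal[OF Bn(1) t]) (use c in \<open>simp add: commut_def\<close>)
  then have "good (cyclic_ext B t)"
    unfolding good_def using slender_cyclic_ext[OF Bn(1,2) t] torsion_finite_cyclic_ext[OF Bn(1,3) t] by blast
  moreover have "A \<subseteq> cyclic_ext B t" "insert t T \<subseteq> cyclic_ext B t"
    using cyclic_ext_incl[OF Bn(1) t] B(2,3) by auto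
  ultimately show ?case by blast
qed

text \<open>Iterated commutators \<open>S j\<close> of the generators lie in the \<open>j\<close>-th term of the central chain; adjoining
  them for decreasing \<open>j\<close> exhibits the group as an iterated extension by cyclic groups.\<close>

lemma good_carrier_of_central_chain:
  assumes L: "central_chain L c N" and F: "finite F" "F \<subseteq> carrier G" "generate G F = carrier G"
  shows "slender (carrier G)" "torsion_finite (carrier G)"
proof -
  define F' where "F' = F \<union> m_inv G ` F"
  have F': "finite F'" "F' \<subseteq> carrier G" "\<And>f. f \<in> F' \<Longrightarrow> inv f \<in> F'"
    using F(1,2) unfolding F'_def by auto
  have gen: "generate G F' = carrier G"
  proof
    show "generate G F' \<subseteq> carrier G" using generate_in_carrier[OF F'(2)] by blast
    show "carrier G \<subseteq> generate G F'" using mono_generate[of F F'] F(3) F'_def by blast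
  qed
  define S where "S = rec_nat F' (\<lambda>_ T. (\<lambda>(f, s). commut f s) ` (F' \<times> T))"
  have S: "S 0 = F'" "S (Suc j) = (\<lambda>(f, s). commut f s) ` (F' \<times> S j)" for j
    unfolding S_def by simp_all
  have Lc: "L 0 = carrier G" "\<And>n. L n \<subseteq> carrier G" "L c \<subseteq> N" "N \<lhd> G" "finite N"
    and Lcomm: "\<And>n g y. g \<in> carrier G \<Longrightarrow> y \<in> L n \<Longrightarrow> commut g y \<in> L (Suc n)"
    using L unfolding central_chain_def by blast+
  have SL: "finite (S j) \<and> S j \<subseteq> L j" for j
  proof (induction j)
    case 0 then show ?case using F' S(1) Lc(1) by auto
  next
    case (Suc j)
    show ?case
    proof
      show "finite (S (Suc j))" unfolding S(2) using Suc F'(1) by simp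
      show "S (Suc j) \<subseteq> L (Suc j)"
      proof
        fix x assume "x \<in> S (Suc j)"
        then obtain f s where "f \<in> F'" "s \<in> S j" "x = commut f s" unfolding S(2) by auto
        then show "x \<in> L (Suc j)" using Lcomm[of f s j] F'(2) Suc by auto
      qed
    qed
  qed
  have "i \<le> c \<Longrightarrow> \<exists>A. good A \<and> S (c - i) \<subseteq> A" for i
  proof (induction i)
    case 0
    have "good N" unfolding good_def using Lc(4,5) finite_slender finite_torsion_finite by blast
    then show ?case using SL[of c] Lc(3) by auto
  next
    case (Suc i)
    then obtain A where A: "good A" "S (c - i) \<subseteq> A" by auto
    have *: "S (c - i) = (\<lambda>(f, s). commut f s) ` (F' \<times> S (c - Suc i))"
      using S(2)[of "c - Suc i"] Suc.prems by (simp add: Suc_diff_Suc)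
    have "\<exists>B. good B \<and> A \<subseteq> B \<and> S (c - Suc i) \<subseteq> B"
    proof (rule good_add_finite[OF F'(2,3) gen])
      show "finite (S (c - Suc i))" "S (c - Suc i) \<subseteq> carrier G"
        using SL[of "c - Suc i"] Lc(2) by auto
      show "commut f t \<in> A" if "t \<in> S (c - Suc i)" "f \<in> F'" for t f
        using A(2) * that by auto
    qed (use A(1) in auto)
    then show ?case by blast
  qed
  from this[of c] obtain A where A: "good A" "F' \<subseteq> A" using S(1) by auto
  have "carrier G \<subseteq> A"
    using generate_subgroup_incl[OF A(2) normal_imp_subgroup] A(1) gen unfolding good_def by blast
  moreover have "A \<subseteq> carrier G"
    using A(1) subgroup.subset[OF normal_imp_subgroup] unfolding good_def by blast
  ultimately show "slender (carrier G)" "torsion_finite (carrier G)"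
    using A(1) unfolding good_def by auto
qed

section \<open>Almost normal subgroups have bounded exponent modulo their core\<close>

primrec upper_series :: "'a set \<Rightarrow> nat \<Rightarrow> 'a set"
  where
    "upper_series N 0 = N"
  | "upper_series N (Suc i) = {y \<in> carrier G. \<forall>g\<in>carrier G. commut g y \<in> upper_series N i}"

text \<open>Commutators with an inverse, a product or a conjugate in the second argument are
  products of conjugates of the given commutators and their inverses, hence stay in the previous
  term. For normal \<open>N\<close> the terms are the preimages of the upper central series of the
  quotient by \<open>N\<close>.\<close>

lemma upper_series_normal:
  assumes "N \<lhd> G"
  shows "upper_series N i \<lhd> G"
proof (induction i)
  case 0 then show ?case using assms by simp
next
  case (Suc i)
  let ?U = "upper_series N i"
  note s = normal_imp_subgroup[OF Suc]
  have conj: "g \<otimes> a \<otimes> inv g \<in> ?U" if "g \<in> carrier G" "a \<in> ?U" for g a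
    using Suc that by (simp add: normal_inv_iff)
  show ?case
  proof (rule normal_invI)
    show "subgroup (upper_series N (Suc i)) G"
    proof (rule subgroupI)
      have "commut g \<one> \<in> ?U" if "g \<in> carrier G" for g
        using that subgroup.one_closed[OF s] by (simp add: commut_def)
      then show "upper_series N (Suc i) \<noteq> {}" by auto
      show "upper_series N (Suc i) \<subseteq> carrier G" by auto
      show "inv a \<in> upper_series N (Suc i)" if a: "a \<in> upper_series N (Suc i)" for a
      proof -
        have aG: "a \<in> carrier G" using a by simp
        have "commut g (inv a) \<in> ?U" if g: "g \<in> carrier G" for g
        proof -
          have "inv a \<otimes> inv (commut g a) \<otimes> inv (inv a) \<in> ?U"
            by (rule conj[OF _ subgroup.m_inv_closed[OF s]]) (use a g in auto)
          also have "inv a \<otimes> inv (commut g a) \<otimes> inv (inv a) = commut g (inv a)"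
            using aG g by (simp add: commut_def word_simps)
          finally show ?thesis .
        qed
        then show ?thesis using aG by simp
      qed
      show "a \<otimes> b \<in> upper_series N (Suc i)"
        if a: "a \<in> upper_series N (Suc i)" and b: "b \<in> upper_series N (Suc i)" for a b
      proof -
        have aG: "a \<in> carrier G" "b \<in> carrier G" using a b by simp_all
        have "commut g (a \<otimes> b) \<in> ?U" if g: "g \<in> carrier G" for g
        proof -
          have "commut g a \<otimes> (a \<otimes> commut g b \<otimes> inv a) \<in> ?U"
            by (rule subgroup.m_closed[OF s _ conj]) (use a b g in auto)
          also have "commut g a \<otimes> (a \<otimes> commut g b \<otimes> inv a) = commut g (a \<otimes> b)"
            using aG g by (simp add: commut_def word_simps)
          finally show ?thesis .
        qed
        then show ?thesis using aG by simp
      qed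
    qed
    fix x a assume x: "x \<in> carrier G" and a: "a \<in> upper_series N (Suc i)"
    have aG: "a \<in> carrier G" using a by simp
    have "commut g (x \<otimes> a \<otimes> inv x) \<in> ?U" if g: "g \<in> carrier G" for g
    proof -
      have "x \<otimes> commut (inv x \<otimes> g \<otimes> x) a \<otimes> inv x \<in> ?U"
        by (rule conj[OF x]) (use a g x in auto)
      also have "x \<otimes> commut (inv x \<otimes> g \<otimes> x) a \<otimes> inv x = commut g (x \<otimes> a \<otimes> inv x)"
        using aG g x by (simp add: commut_def word_simps)
      finally show ?thesis .
    qed
    then show "x \<otimes> a \<otimes> inv x \<in> upper_series N (Suc i)" using aG x by simp
  qed
qed

text \<open>Counting down from \<open>L c\<close>, the set \<open>L (c - i)\<close> lies in
  \<open>upper_series N i\<close>. The conclusion is shifted to \<open>Suc c\<close> because the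
  torsion induction that uses it starts at \<open>Suc 0\<close>.\<close>

lemma central_chain_upper_series:
  assumes "central_chain L c N"
  shows "carrier G \<subseteq> upper_series N (Suc c)"
proof -
  have L: "L 0 = carrier G" "\<And>n. L n \<subseteq> carrier G" "L c \<subseteq> N" "N \<lhd> G"
    and Lcomm: "\<And>n g y. g \<in> carrier G \<Longrightarrow> y \<in> L n \<Longrightarrow> commut g y \<in> L (Suc n)"
    using assms unfolding central_chain_def by blast+
  have "i \<le> c \<Longrightarrow> L (c - i) \<subseteq> upper_series N i" for i
  proof (induction i)
    case 0 then show ?case using L(3) by simp
  next
    case (Suc i)
    then have IH: "L (c - i) \<subseteq> upper_series N i" by simp
    have e: "Suc (c - Suc i) = c - i" using Suc.prems by simp
    show ?case
    proof
      fix y assume y: "y \<in> L (c - Suc i)"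
      have "commut g y \<in> upper_series N i" if "g \<in> carrier G" for g
        using Lcomm[OF that y] IH unfolding e by blast
      then show "y \<in> upper_series N (Suc i)" using y L(2) by auto
    qed
  qed
  from this[of c] have U: "carrier G \<subseteq> upper_series N c" using L(1) by simp
  then show ?thesis by auto
qed

text \<open>With \<open>u = [g, y]\<close> one has \<open>g y = u y g\<close>, and \<open>u\<close>
  commutes with both. Moving powers past each other collects powers of \<open>u\<close>.\<close>

lemma commut_pow:
  assumes "g \<in> carrier G" "y \<in> carrier G" and "g \<otimes> commut g y = commut g y \<otimes> g" "y \<otimes> commut g y = commut g y \<otimes> y"
  shows "commut g (y [^] (n::nat)) = commut g y [^] n" "commut (g [^] n) y = commut g y [^] n"
proof -
  let ?u = "commut g y"
  have u: "?u \<in> carrier G" using assms by simp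
  have gy: "g \<otimes> y = ?u \<otimes> y \<otimes> g" using assms(1,2) by (simp add: commut_def word_simps)
  have uy: "y \<otimes> ?u [^] n = ?u [^] n \<otimes> y" for n :: nat
  proof (induction n)
    case (Suc n)
    have "y \<otimes> ?u [^] Suc n = y \<otimes> ?u [^] n \<otimes> ?u" using u assms(2) by (simp add: m_assoc)
    also have "\<dots> = ?u [^] n \<otimes> (y \<otimes> ?u)" unfolding Suc using u assms(2) by (simp add: m_assoc)
    also have "\<dots> = ?u [^] Suc n \<otimes> y" unfolding assms(4) using u assms(2) by (simp add: m_assoc)
    finally show ?case .
  qed (use assms in simp)
  have ug: "g \<otimes> ?u [^] n = ?u [^] n \<otimes> g" for n :: nat
  proof (induction n)
    case (Suc n)
    have "g \<otimes> ?u [^] Suc n = g \<otimes> ?u [^] n \<otimes> ?u" using u assms(1) by (simp add: m_assoc)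
    also have "\<dots> = ?u [^] n \<otimes> (g \<otimes> ?u)" unfolding Suc using u assms(1) by (simp add: m_assoc)
    also have "\<dots> = ?u [^] Suc n \<otimes> g" unfolding assms(3) using u assms(1) by (simp add: m_assoc)
    finally show ?case .
  qed (use assms in simp)
  have 1: "g \<otimes> y [^] n = ?u [^] n \<otimes> y [^] n \<otimes> g" for n :: nat
  proof (induction n)
    case (Suc n)
    have "g \<otimes> y [^] Suc n = (g \<otimes> y [^] n) \<otimes> y" using assms by (simp add: m_assoc)
    also have "\<dots> = ?u [^] n \<otimes> y [^] n \<otimes> (g \<otimes> y)" unfolding Suc using u assms(1,2) by (simp add: m_assoc)
    also have "\<dots> = ?u [^] n \<otimes> (y [^] n \<otimes> ?u) \<otimes> y \<otimes> g" unfolding gy using u assms(1,2) by (simp add: m_assoc)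
    also have "y [^] n \<otimes> ?u = ?u \<otimes> y [^] n"
    proof (induction n)
      case (Suc n)
      have "y [^] Suc n \<otimes> ?u = y [^] n \<otimes> (y \<otimes> ?u)" using u assms(2) by (simp add: m_assoc)
      also have "\<dots> = (y [^] n \<otimes> ?u) \<otimes> y" unfolding assms(4) using u assms(2) by (simp add: m_assoc)
      also have "\<dots> = ?u \<otimes> y [^] Suc n" unfolding Suc using u assms(2) by (simp add: m_assoc)
      finally show ?case .
    qed (use u in simp)
    also have "?u [^] n \<otimes> (?u \<otimes> y [^] n) \<otimes> y \<otimes> g = ?u [^] Suc n \<otimes> y [^] Suc n \<otimes> g"
      using u assms(1,2) by (simp add: m_assoc)
    finally show ?case .
  qed (use assms in simp)
  show "commut g (y [^] n) = ?u [^] n"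
    unfolding commut_def[of g "y [^] n"] 1 using u assms(1,2) by (simp add: m_assoc)
  have 2: "g [^] n \<otimes> y = ?u [^] n \<otimes> y \<otimes> g [^] n" for n :: nat
  proof (induction n)
    case (Suc n)
    have "g [^] Suc n \<otimes> y = g [^] n \<otimes> (g \<otimes> y)" using assms(1,2) by (simp add: m_assoc)
    also have "\<dots> = (g [^] n \<otimes> ?u) \<otimes> y \<otimes> g" unfolding gy using u assms(1,2) by (simp add: m_assoc)
    also have "g [^] n \<otimes> ?u = ?u \<otimes> g [^] n"
    proof (induction n)
      case (Suc n)
      have "g [^] Suc n \<otimes> ?u = g [^] n \<otimes> (g \<otimes> ?u)" using u assms(1) by (simp add: m_assoc)
      also have "\<dots> = (g [^] n \<otimes> ?u) \<otimes> g" unfolding assms(3) using u assms(1) by (simp add: m_assoc)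
      also have "\<dots> = ?u \<otimes> g [^] Suc n" unfolding Suc using u assms(1) by (simp add: m_assoc)
      finally show ?case .
    qed (use u in simp)
    also have "(?u \<otimes> g [^] n) \<otimes> y \<otimes> g = ?u \<otimes> (g [^] n \<otimes> y) \<otimes> g" using u assms(1,2) by (simp add: m_assoc)
    also have "\<dots> = ?u \<otimes> ?u [^] n \<otimes> y \<otimes> (g [^] n \<otimes> g)" unfolding Suc using u assms(1,2) by (simp add: m_assoc)
    also have "?u \<otimes> ?u [^] n = ?u [^] Suc n" using u by (simp add: nat_pow_Suc2[symmetric])
    finally show ?case by simp
  qed (use assms in simp)
  show "commut (g [^] n) y = ?u [^] n"
    unfolding commut_def[of "g [^] n" y] 2 using u assms(1,2) by (simp add: m_assoc)
qed

end

lemma (in group_hom) hom_commut: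
  assumes "x \<in> carrier G" "y \<in> carrier G"
  shows "h (G.commut x y) = H.commut (h x) (h y)"
  using assms by (simp add: G.commut_def H.commut_def)

context group
begin

lemma normal_quotient_hom:
  assumes "M \<lhd> G"
  shows "group_hom G (G Mod M) (\<lambda>a. M #> a)"
  using assms normal.factorgroup_is_group normal.r_coset_hom_Mod is_group
  by (auto intro!: group_hom.intro group_hom_axioms.intro)

lemma quotient_eq_one_iff:
  assumes "M \<lhd> G" "x \<in> carrier G"
  shows "M #> x = \<one>\<^bsub>G Mod M\<^esub> \<longleftrightarrow> x \<in> M"
  using assms coset_join1[OF _ assms(2)] coset_join2[OF assms(2)] normal_imp_subgroup[OF assms(1)]
    subgroup.subset by (auto simp: one_FactGroup)

text \<open>The power trick behind both exponent bounds: modulo \<open>M\<close> the commutator \<open>[g, y]\<close> is central, so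
  \<open>[g, y\<^sup>k] = [g\<^sup>k, y]\<close>.\<close>

lemma commut_pow_mod:
  assumes M: "M \<lhd> G" and g: "g \<in> carrier G" and y: "y \<in> carrier G"
    and c: "\<And>h. h \<in> carrier G \<Longrightarrow> commut h (commut g y) \<in> M"
    and v: "commut (g [^] (e::nat)) y [^] (E::nat) \<in> M"
  shows "commut g (y [^] (e * E)) \<in> M"
proof -
  interpret q: group_hom G "G Mod M" "\<lambda>a. M #> a" by (rule normal_quotient_hom[OF M])
  let ?\<phi> = "\<lambda>a. M #> a"
  have central: "?\<phi> h \<otimes>\<^bsub>G Mod M\<^esub> ?\<phi> (commut g y) = ?\<phi> (commut g y) \<otimes>\<^bsub>G Mod M\<^esub> ?\<phi> h" if h: "h \<in> carrier G" for h
  proof -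
    have "commut h (commut g y) \<otimes> commut g y \<otimes> h = h \<otimes> commut g y"
      using h commut_closed[OF g y] by (simp add: commut_def[of h] word_simps)
    then have "?\<phi> (h \<otimes> commut g y) = ?\<phi> (commut h (commut g y) \<otimes> commut g y \<otimes> h)" by simp
    also have "\<dots> = ?\<phi> (commut h (commut g y)) \<otimes>\<^bsub>G Mod M\<^esub> ?\<phi> (commut g y) \<otimes>\<^bsub>G Mod M\<^esub> ?\<phi> h"
      using h g y by (simp only: q.hom_mult commut_closed m_closed)
    also have "?\<phi> (commut h (commut g y)) = \<one>\<^bsub>G Mod M\<^esub>"
      using quotient_eq_one_iff[OF M] c[OF h] h g y by simp
    also have "\<one>\<^bsub>G Mod M\<^esub> \<otimes>\<^bsub>G Mod M\<^esub> ?\<phi> (commut g y) = ?\<phi> (commut g y)"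
      by (rule q.H.l_one[OF q.hom_closed[OF commut_closed[OF g y]]])
    finally show ?thesis using q.hom_mult[OF h commut_closed[OF g y]] by (simp only:)
  qed
  have cc: "?\<phi> (commut g y) = q.H.commut (?\<phi> g) (?\<phi> y)" by (rule q.hom_commut[OF g y])
  note pows = q.H.commut_pow[OF q.hom_closed[OF g] q.hom_closed[OF y], folded cc, OF central[OF g] central[OF y]]
  have np: "?\<phi> (x [^] (n::nat)) = ?\<phi> x [^]\<^bsub>G Mod M\<^esub> n" if "x \<in> carrier G" for x n
    by (rule q.hom_nat_pow[OF that])
  have "?\<phi> (commut g (y [^] (e * E))) = ?\<phi> (commut g y) [^]\<^bsub>G Mod M\<^esub> (e * E)"
    using g y pows(1)[of "e * E"] by (simp add: q.hom_commut np del: cc)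
  also have "\<dots> = (?\<phi> (commut g y) [^]\<^bsub>G Mod M\<^esub> e) [^]\<^bsub>G Mod M\<^esub> E"
    using g y by (simp add: q.H.nat_pow_pow)
  also have "?\<phi> (commut g y) [^]\<^bsub>G Mod M\<^esub> e = ?\<phi> (commut (g [^] e) y)"
    using g y pows(2)[of e] by (simp add: q.hom_commut np)
  also have "?\<phi> (commut (g [^] e) y) [^]\<^bsub>G Mod M\<^esub> E = ?\<phi> (commut (g [^] e) y [^] E)"
    using g y by (simp add: np)
  also have "\<dots> = \<one>\<^bsub>G Mod M\<^esub>" using quotient_eq_one_iff[OF M] v g y by simp
  finally show ?thesis using quotient_eq_one_iff[OF M] g y by simp
qed

text \<open>Induction along the upper series. For \<open>y\<close> in \<open>Y\<close> and in the
  next term, \<open>[g [^] e, y]\<close> lies in \<open>Y\<close> because \<open>g [^] e\<close>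
  normalises \<open>Y\<close>, and it lies one term lower, where the exponent \<open>E\<close> is
  known. The power trick moves \<open>y [^] (e * E)\<close> one term down, where \<open>E\<close>
  applies once more.\<close>

lemma almost_normal_torsion:
  assumes L: "central_chain L c N" and Y: "subgroup Y G" and e: "e > 0"
    and norm: "\<And>g y. g \<in> carrier G \<Longrightarrow> y \<in> Y \<Longrightarrow> g [^] (e::nat) \<otimes> y \<otimes> inv (g [^] e) \<in> Y"
    and core: "\<And>y. y \<in> Y \<Longrightarrow> (\<And>g. g \<in> carrier G \<Longrightarrow> g \<otimes> y \<otimes> inv g \<in> Y) \<Longrightarrow> y = \<one>"
  shows "\<exists>n>0. \<forall>y\<in>Y. y [^] (n::nat) = \<one>"
proof -
  have N: "N \<lhd> G" "finite N" using L unfolding central_chain_def by auto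
  have YG: "y \<in> carrier G" if "y \<in> Y" for y using that subgroup.subset[OF Y] by blast
  let ?U = "upper_series N"
  have "\<exists>n>0. \<forall>y\<in>Y \<inter> ?U (Suc i). y [^] (n::nat) = \<one>" for i
  proof (induction i)
    case 0
    have "y [^] (fact (card N) :: nat) = \<one>" if y: "y \<in> Y \<inter> ?U (Suc 0)" for y
    proof (rule core)
      show "y [^] (fact (card N) :: nat) \<in> Y" using y subgroup_nat_pow[OF Y] by blast
      fix g assume g: "g \<in> carrier G"
      have yG: "y \<in> carrier G" using y YG by blast
      note sU = normal_imp_subgroup[OF upper_series_normal[OF N(1), of "Suc 0"]]
      \<comment> \<open>Pigeonhole in the finite \<open>N\<close>: two exponents with equal
        commutators differ by some \<open>d \<le> card N\<close> for which \<open>y [^] d\<close>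
        commutes with \<open>g\<close>. The factorial is a multiple of \<open>d\<close> for every
        \<open>g\<close>, so this power of \<open>y\<close> is central and the trivial core kills
        it.\<close>
      let ?f = "\<lambda>j::nat. commut g (y [^] j)"
      have "?f j \<in> N" for j
      proof -
        have "y [^] j \<in> ?U (Suc 0)" using subgroup_nat_pow[OF sU] y by blast
        then show ?thesis using g by simp
      qed
      then have "\<not> inj_on ?f {0..card N}"
        using card_inj_on_le[of ?f "{0..card N}" N] N(2) by auto
      then obtain i j where ij: "i \<le> card N" "j \<le> card N" "i \<noteq> j" "?f i = ?f j"
        unfolding inj_on_def by auto
      then obtain i j where ij: "i < j" "j \<le> card N" "?f i = ?f j"
        by (metis linorder_neqE_nat)
      define d where "d = j - i"
      have d: "0 < d" "d \<le> card N" "j = i + d" using ij unfolding d_def by auto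
      have "g \<otimes> y [^] i \<otimes> inv g \<otimes> inv (y [^] i) = g \<otimes> y [^] (i + d) \<otimes> inv g \<otimes> inv (y [^] (i + d))"
        using ij(3) unfolding commut_def d(3) .
      also have "y [^] (i + d) = y [^] i \<otimes> y [^] d" using yG by (simp add: nat_pow_mult)
      finally have "inv g \<otimes> inv (y [^] i) = y [^] d \<otimes> inv g \<otimes> (inv (y [^] d) \<otimes> inv (y [^] i))"
        using g yG by (simp add: word_simps)
      then have "inv g = y [^] d \<otimes> inv g \<otimes> inv (y [^] d)"
        using g yG by (simp add: m_assoc[symmetric])
      then have comm: "y [^] d \<otimes> inv g = inv g \<otimes> y [^] d"
        using g yG by (metis inv_closed inv_solve_right m_closed nat_pow_closed)
      have "d dvd fact (card N)" using d(1,2) by (intro dvd_fact) auto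
      then obtain m :: nat where m: "fact (card N) = d * m" by blast
      have "y [^] (d * m) \<otimes> inv g = inv g \<otimes> y [^] (d * m)" for m
      proof (induction m)
        case 0 then show ?case using g by simp
      next
        case (Suc m)
        have s: "y [^] (d * Suc m) = y [^] d \<otimes> y [^] (d * m)" using yG by (simp add: nat_pow_mult)
        have "y [^] (d * Suc m) \<otimes> inv g = y [^] d \<otimes> (y [^] (d * m) \<otimes> inv g)" unfolding s using g yG by (simp add: m_assoc)
        also have "\<dots> = (y [^] d \<otimes> inv g) \<otimes> y [^] (d * m)" unfolding Suc using g yG by (simp add: m_assoc)
        also have "\<dots> = inv g \<otimes> y [^] (d * Suc m)" unfolding comm s using g yG by (simp add: m_assoc)
        finally show ?case .
      qed
      then have "g \<otimes> y [^] (fact (card N) :: nat) \<otimes> inv g = y [^] (fact (card N) :: nat)"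
        unfolding m using g yG by (simp add: m_assoc cancel_inv)
      then show "g \<otimes> y [^] (fact (card N) :: nat) \<otimes> inv g \<in> Y"
        using y subgroup_nat_pow[OF Y] by simp
    qed
    then show ?case by (intro exI[of _ "fact (card N)"]) auto
  next
    case (Suc i)
    then obtain E :: nat where E: "E > 0" "\<And>y. y \<in> Y \<Longrightarrow> y \<in> ?U (Suc i) \<Longrightarrow> y [^] E = \<one>" by blast
    have "y [^] (e * E * E) = \<one>" if y: "y \<in> Y" "y \<in> ?U (Suc (Suc i))" for y
    proof -
      have yG: "y \<in> carrier G" using y YG by blast
      have "commut g (y [^] (e * E)) \<in> ?U i" if g: "g \<in> carrier G" for g
      proof (rule commut_pow_mod[OF upper_series_normal[OF N(1)] g yG])
        have cU: "commut h y \<in> ?U (Suc i)" if "h \<in> carrier G" for h using y(2) that by simp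
        show "commut h (commut g y) \<in> ?U i" if "h \<in> carrier G" for h using cU[OF g] that by simp
        have "commut (g [^] e) y \<in> Y"
          unfolding commut_def by (rule subgroup.m_closed[OF Y norm[OF g y(1)] subgroup.m_inv_closed[OF Y y(1)]])
        then have "commut (g [^] e) y [^] E = \<one>" using E(2) cU g by simp
        then show "commut (g [^] e) y [^] E \<in> ?U i"
          using subgroup.one_closed[OF normal_imp_subgroup[OF upper_series_normal[OF N(1)]]] by simp
      qed
      then have "y [^] (e * E) \<in> ?U (Suc i)" using yG by simp
      then have "(y [^] (e * E)) [^] E = \<one>" using E(2) subgroup_nat_pow[OF Y y(1)] by blast
      then show ?thesis using yG by (simp add: nat_pow_pow)
    qed
    then show ?case using e E(1) by (intro exI[of _ "e * E * E"]) auto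
  qed
  from this[of c] show ?thesis using central_chain_upper_series[OF L] YG by blast
qed

section \<open>Normal cores, conjugates and finite generation\<close>

definition normal_core :: "'a set \<Rightarrow> 'a set"
  where "normal_core Y = {y \<in> Y. \<forall>g\<in>carrier G. g \<otimes> y \<otimes> inv g \<in> Y}"

lemma normal_core_subset: "normal_core Y \<subseteq> Y"
  by (auto simp: normal_core_def)

lemma normal_core_normal:
  assumes Y: "subgroup Y G"
  shows "normal_core Y \<lhd> G"
proof (rule normal_invI)
  have YG: "y \<in> carrier G" if "y \<in> Y" for y using that subgroup.subset[OF Y] by blast
  show "subgroup (normal_core Y) G"
  proof (rule subgroupI)
    show "normal_core Y \<subseteq> carrier G" using YG normal_core_subset by blast
    show "normal_core Y \<noteq> {}"
      using subgroup.one_closed[OF Y] by (auto simp: normal_core_def intro!: exI[of _ \<one>])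
    show "inv a \<in> normal_core Y" if a: "a \<in> normal_core Y" for a
    proof -
      have aY: "a \<in> Y" "a \<in> carrier G" using a YG normal_core_subset by blast+
      have "g \<otimes> inv a \<otimes> inv g \<in> Y" if g: "g \<in> carrier G" for g
      proof -
        have "inv (g \<otimes> a \<otimes> inv g) \<in> Y"
          using a g unfolding normal_core_def by (intro subgroup.m_inv_closed[OF Y]) simp
        then show ?thesis using g aY by (simp add: word_simps)
      qed
      then show ?thesis using subgroup.m_inv_closed[OF Y aY(1)] unfolding normal_core_def by simp
    qed
    show "a \<otimes> b \<in> normal_core Y" if a: "a \<in> normal_core Y" and b: "b \<in> normal_core Y" for a b
    proof -
      have aY: "a \<in> Y" "a \<in> carrier G" "b \<in> Y" "b \<in> carrier G" using a b YG normal_core_subset by blast+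
      have "g \<otimes> (a \<otimes> b) \<otimes> inv g \<in> Y" if g: "g \<in> carrier G" for g
      proof -
        have "(g \<otimes> a \<otimes> inv g) \<otimes> (g \<otimes> b \<otimes> inv g) \<in> Y"
          by (rule subgroup.m_closed[OF Y]) (use a b g in \<open>simp_all add: normal_core_def\<close>)
        then show ?thesis using g aY by (simp add: word_simps)
      qed
      then show ?thesis using subgroup.m_closed[OF Y aY(1,3)] unfolding normal_core_def by simp
    qed
  qed
  fix x a assume x: "x \<in> carrier G" and a: "a \<in> normal_core Y"
  have aY: "a \<in> Y" "a \<in> carrier G" using a YG normal_core_subset by blast+
  have "g \<otimes> (x \<otimes> a \<otimes> inv x) \<otimes> inv g \<in> Y" if g: "g \<in> carrier G" for g
  proof -
    have "(g \<otimes> x) \<otimes> a \<otimes> inv (g \<otimes> x) \<in> Y" using a g x unfolding normal_core_def by simp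
    then show ?thesis using g x aY by (simp add: word_simps)
  qed
  then show "x \<otimes> a \<otimes> inv x \<in> normal_core Y" using a x unfolding normal_core_def by simp
qed

text \<open>Dividing by the core reduces to a subgroup with trivial core. The central chain and the
  almost normality are inherited by the images in the quotient.\<close>

lemma almost_normal_exponent:
  assumes L: "central_chain L c N" and Y: "subgroup Y G" and e: "e > 0"
    and norm: "\<And>g y. g \<in> carrier G \<Longrightarrow> y \<in> Y \<Longrightarrow> g [^] (e::nat) \<otimes> y \<otimes> inv (g [^] e) \<in> Y"
  shows "\<exists>n>0. \<forall>y\<in>Y. y [^] (n::nat) \<in> normal_core Y"
proof -
  let ?K = "normal_core Y"
  have K: "?K \<lhd> G" by (rule normal_core_normal[OF Y])
  let ?Q = "G Mod ?K" and ?\<phi> = "\<lambda>a. ?K #> a"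
  interpret q: group_hom G ?Q ?\<phi> by (rule normal_quotient_hom[OF K])
  have YG: "y \<in> carrier G" if "y \<in> Y" for y using that subgroup.subset[OF Y] by blast
  have car: "carrier ?Q = ?\<phi> ` carrier G" by (rule carrier_FactGroup)
  have Lc: "L 0 = carrier G" "\<And>n. L n \<subseteq> carrier G" "L c \<subseteq> N" "N \<lhd> G" "finite N"
    and Lcomm: "\<And>n g y. g \<in> carrier G \<Longrightarrow> y \<in> L n \<Longrightarrow> commut g y \<in> L (Suc n)"
    using L unfolding central_chain_def by blast+
  note sN = normal_imp_subgroup[OF Lc(4)]
  have N': "?\<phi> ` N \<lhd> ?Q"
  proof (rule q.H.normal_invI)
    show "subgroup (?\<phi> ` N) ?Q" by (rule q.subgroup_img_is_subgroup[OF sN])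
    fix x a assume "x \<in> carrier ?Q" "a \<in> ?\<phi> ` N"
    then obtain g n where gn: "g \<in> carrier G" "x = ?\<phi> g" "n \<in> N" "a = ?\<phi> n" using car by auto
    have nG: "n \<in> carrier G" using gn(3) subgroup.subset[OF sN] by blast
    have "x \<otimes>\<^bsub>?Q\<^esub> a \<otimes>\<^bsub>?Q\<^esub> inv\<^bsub>?Q\<^esub> x = ?\<phi> (g \<otimes> n \<otimes> inv g)"
      unfolding gn(2,4) using gn(1) nG by (simp only: q.hom_mult q.hom_inv m_closed inv_closed)
    moreover have "g \<otimes> n \<otimes> inv g \<in> N" using Lc(4) gn(1,3) by (simp add: normal_inv_iff)
    ultimately show "x \<otimes>\<^bsub>?Q\<^esub> a \<otimes>\<^bsub>?Q\<^esub> inv\<^bsub>?Q\<^esub> x \<in> ?\<phi> ` N" by blast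
  qed
  have chain: "q.H.central_chain (\<lambda>n. ?\<phi> ` L n) c (?\<phi> ` N)"
    unfolding q.H.central_chain_def
  proof (intro conjI allI ballI)
    show "?\<phi> ` L 0 = carrier ?Q" using car Lc(1) by simp
    show "?\<phi> ` L n \<subseteq> carrier ?Q" for n unfolding car using Lc(2) by blast
    fix n x y assume xy: "x \<in> carrier ?Q" "y \<in> ?\<phi> ` L n"
    show "q.H.commut x y \<in> ?\<phi> ` L (Suc n)"
    proof -
      obtain g l where gl: "g \<in> carrier G" "x = ?\<phi> g" "l \<in> L n" "y = ?\<phi> l" using xy car by auto
      then have "q.H.commut x y = ?\<phi> (commut g l)" using q.hom_commut[of g l] Lc(2) by auto
      then show ?thesis using Lcomm[OF gl(1,3)] by blast
    qed
  qed (use N' Lc(3,5) in auto)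
  have Y': "subgroup (?\<phi> ` Y) ?Q" by (rule q.subgroup_img_is_subgroup[OF Y])
  have "\<exists>n>0. \<forall>y\<in>?\<phi> ` Y. y [^]\<^bsub>?Q\<^esub> (n::nat) = \<one>\<^bsub>?Q\<^esub>"
  proof (rule q.H.almost_normal_torsion[OF chain Y' e])
    fix x z assume "x \<in> carrier ?Q" "z \<in> ?\<phi> ` Y"
    then obtain g y where gy: "g \<in> carrier G" "x = ?\<phi> g" "y \<in> Y" "z = ?\<phi> y" using car by auto
    have yG: "y \<in> carrier G" using gy YG by blast
    have "x [^]\<^bsub>?Q\<^esub> e \<otimes>\<^bsub>?Q\<^esub> z \<otimes>\<^bsub>?Q\<^esub> inv\<^bsub>?Q\<^esub> (x [^]\<^bsub>?Q\<^esub> e) = ?\<phi> (g [^] e \<otimes> y \<otimes> inv (g [^] e))"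
      unfolding gy(2,4) q.hom_nat_pow[OF gy(1), symmetric]
      using gy(1) yG by (simp only: q.hom_mult q.hom_inv m_closed inv_closed nat_pow_closed)
    then show "x [^]\<^bsub>?Q\<^esub> e \<otimes>\<^bsub>?Q\<^esub> z \<otimes>\<^bsub>?Q\<^esub> inv\<^bsub>?Q\<^esub> (x [^]\<^bsub>?Q\<^esub> e) \<in> ?\<phi> ` Y"
      using norm[OF gy(1,3)] by blast
  next
    fix z assume "z \<in> ?\<phi> ` Y" and all: "\<And>x. x \<in> carrier ?Q \<Longrightarrow> x \<otimes>\<^bsub>?Q\<^esub> z \<otimes>\<^bsub>?Q\<^esub> inv\<^bsub>?Q\<^esub> x \<in> ?\<phi> ` Y"
    then obtain y where y: "y \<in> Y" "z = ?\<phi> y" by blast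
    have yG: "y \<in> carrier G" using y YG by blast
    \<comment> \<open>The core is contained in \<open>Y\<close>, so an element whose image lies in
      the image of \<open>Y\<close> lies in \<open>Y\<close> itself.\<close>
    have "g \<otimes> y \<otimes> inv g \<in> Y" if g: "g \<in> carrier G" for g
    proof -
      have "?\<phi> (g \<otimes> y \<otimes> inv g) = ?\<phi> g \<otimes>\<^bsub>?Q\<^esub> z \<otimes>\<^bsub>?Q\<^esub> inv\<^bsub>?Q\<^esub> (?\<phi> g)"
        unfolding y(2) using g yG by (simp only: q.hom_mult q.hom_inv m_closed inv_closed)
      then have "?\<phi> (g \<otimes> y \<otimes> inv g) \<in> ?\<phi> ` Y" using all[of "?\<phi> g"] g car by auto
      then obtain y2 where y2: "y2 \<in> Y" "?\<phi> (g \<otimes> y \<otimes> inv g) = ?\<phi> y2" by blast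
      have "g \<otimes> y \<otimes> inv g \<in> ?\<phi> (g \<otimes> y \<otimes> inv g)"
        by (rule rcos_self[OF _ normal_imp_subgroup[OF K]]) (use g yG in simp)
      then have "g \<otimes> y \<otimes> inv g \<in> ?\<phi> y2" by (simp only: y2(2))
      then obtain k where k: "k \<in> ?K" "g \<otimes> y \<otimes> inv g = k \<otimes> y2" unfolding r_coset_def by blast
      show ?thesis unfolding k(2)
        by (rule subgroup.m_closed[OF Y subsetD[OF normal_core_subset k(1)] y2(1)])
    qed
    then have "y \<in> ?K" using y(1) unfolding normal_core_def by blast
    then show "z = \<one>\<^bsub>?Q\<^esub>" using quotient_eq_one_iff[OF K yG] y(2) by blast
  qed
  then obtain n :: nat where n: "n > 0" "\<And>y. y \<in> Y \<Longrightarrow> ?\<phi> y [^]\<^bsub>?Q\<^esub> n = \<one>\<^bsub>?Q\<^esub>" by blast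
  have "y [^] n \<in> ?K" if "y \<in> Y" for y
    using n(2)[OF that] quotient_eq_one_iff[OF K nat_pow_closed[OF YG[OF that]]] q.hom_nat_pow[OF YG[OF that], of n]
    by simp
  then show ?thesis using n(1) by blast
qed

definition conjugate :: "'a \<Rightarrow> 'a set \<Rightarrow> 'a set" where "conjugate g Y = (\<lambda>y. g \<otimes> y \<otimes> inv g) ` Y"

lemma conjugate_mult:
  "g \<in> carrier G \<Longrightarrow> h \<in> carrier G \<Longrightarrow> Y \<subseteq> carrier G \<Longrightarrow> conjugate (g \<otimes> h) Y = conjugate g (conjugate h Y)"
  unfolding conjugate_def image_image by (rule image_cong) (auto simp: word_simps subsetD)

lemma conjugate_one: "Y \<subseteq> carrier G \<Longrightarrow> conjugate \<one> Y = Y"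
  unfolding conjugate_def by (force simp: subsetD)

lemma conjugate_subset: "g \<in> carrier G \<Longrightarrow> Y \<subseteq> carrier G \<Longrightarrow> conjugate g Y \<subseteq> carrier G"
  unfolding conjugate_def by auto

lemma conjugate_eq_cosets:
  "g \<in> carrier G \<Longrightarrow> Y \<subseteq> carrier G \<Longrightarrow> (g <# Y) #> inv g = conjugate g Y"
  unfolding conjugate_def l_coset_def r_coset_def by auto

text \<open>Conjugation by powers of \<open>g\<close> moves \<open>Y\<close> within the finite
  \<open>M\<close>, so some \<open>g [^] d\<close> with \<open>0 < d \<le> card M\<close> normalises
  \<open>Y\<close>. The factorial of \<open>card M\<close> is a multiple of all such
  \<open>d\<close> and works for every \<open>g\<close>.\<close>

lemma finite_conjugates_exponent:
  assumes M: "finite M" "\<And>Y g. Y \<in> M \<Longrightarrow> g \<in> carrier G \<Longrightarrow> conjugate g Y \<in> M" and Y: "Y \<in> M" "Y \<subseteq> carrier G"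
  shows "\<exists>e>0. \<forall>g\<in>carrier G. \<forall>y\<in>Y. g [^] (e::nat) \<otimes> y \<otimes> inv (g [^] e) \<in> Y"
proof -
  let ?e = "fact (card M) :: nat"
  have "conjugate (g [^] ?e) Y = Y" if g: "g \<in> carrier G" for g
  proof -
    let ?f = "\<lambda>j::nat. conjugate (g [^] j) Y"
    have "?f j \<in> M" for j by (rule M(2)[OF Y(1)]) (use g in simp)
    then have "\<not> inj_on ?f {0..card M}"
      using card_inj_on_le[of ?f "{0..card M}" M] M(1) by auto
    then obtain i j where "i \<le> card M" "j \<le> card M" "i \<noteq> j" "?f i = ?f j"
      unfolding inj_on_def by auto
    then obtain i j where ij: "i < j" "j \<le> card M" "?f i = ?f j"
      by (metis linorder_neqE_nat)
    define d where "d = j - i"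
    have d: "0 < d" "d \<le> card M" "j = i + d" using ij unfolding d_def by auto
    have gi: "g [^] i \<in> carrier G" "g [^] d \<in> carrier G" using g by auto
    have "conjugate (g [^] i) Y = conjugate (g [^] i) (conjugate (g [^] d) Y)"
      using ij(3) conjugate_mult[OF gi Y(2)] g unfolding d(3) by (simp add: nat_pow_mult)
    then have "conjugate (inv (g [^] i)) (conjugate (g [^] i) Y) =
        conjugate (inv (g [^] i)) (conjugate (g [^] i) (conjugate (g [^] d) Y))" by simp
    moreover have "conjugate (inv (g [^] i)) (conjugate (g [^] i) W) = W" if "W \<subseteq> carrier G" for W
      using conjugate_mult[OF inv_closed[OF gi(1)] gi(1) that] l_inv[OF gi(1)] conjugate_one[OF that] by simp
    ultimately have fix_d: "conjugate (g [^] d) Y = Y"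
      using Y(2) conjugate_subset[OF gi(2) Y(2)] by metis
    have "conjugate (g [^] (d * m)) Y = Y" for m
    proof (induction m)
      case 0 then show ?case using conjugate_one[OF Y(2)] by simp
    next
      case (Suc m)
      have "g [^] (d * Suc m) = g [^] (d * m) \<otimes> g [^] d" using g by (simp add: nat_pow_mult add.commute)
      then show ?case using conjugate_mult[of "g [^] (d * m)" "g [^] d" Y] g Y(2) fix_d Suc by simp
    qed
    moreover have "d dvd fact (card M)" using d(1,2) by (intro dvd_fact) auto
    ultimately show ?thesis by (metis dvdE)
  qed
  then have "g [^] ?e \<otimes> y \<otimes> inv (g [^] ?e) \<in> Y" if "g \<in> carrier G" "y \<in> Y" for g y
    using that unfolding conjugate_def by blast
  then show ?thesis by (intro exI[of _ ?e]) simp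
qed

text \<open>The chain consists of the preimages of the lower central series of the quotient by
  \<open>N\<close>.\<close>

lemma finite_by_nilpotent_central_chain:
  assumes "finite_by_nilpotent G"
  obtains L c N where "central_chain L c N"
proof -
  obtain N where N: "N \<lhd> G" "finite N" "nilpotent_group (G Mod N)"
    using assms unfolding finite_by_nilpotent_def by blast
  obtain c where c: "lower_central_series (G Mod N) c = {\<one>\<^bsub>G Mod N\<^esub>}"
    using N(3) unfolding nilpotent_group_def by blast
  interpret q: group_hom G "G Mod N" "\<lambda>a. N #> a" by (rule normal_quotient_hom[OF N(1)])
  define L where "L n = {g \<in> carrier G. N #> g \<in> lower_central_series (G Mod N) n}" for n
  have "central_chain L c N"
    unfolding central_chain_def
  proof (intro conjI allI ballI)
    show "L 0 = carrier G" unfolding L_def by (auto simp: carrier_FactGroup)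
    show "L n \<subseteq> carrier G" for n unfolding L_def by blast
    show "commut g y \<in> L (Suc n)" if g: "g \<in> carrier G" and y: "y \<in> L n" for n g y
    proof -
      have yG: "y \<in> carrier G" "N #> y \<in> lower_central_series (G Mod N) n" using y unfolding L_def by auto
      have "N #> commut g y \<in> lower_central_series (G Mod N) (Suc n)"
        unfolding q.hom_commut[OF g yG(1)] lower_central_series.simps q.H.commut_def
        by (rule generate.incl) (use g yG q.hom_closed in blast)
      then show ?thesis using g yG unfolding L_def by simp
    qed
    show "L c \<subseteq> N"
    proof
      fix x assume "x \<in> L c"
      then have "x \<in> carrier G" "N #> x = \<one>\<^bsub>G Mod N\<^esub>" unfolding L_def c by auto
      then show "x \<in> N" using quotient_eq_one_iff[OF N(1)] by blast
    qed
  qed (use N in auto)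
  then show thesis by (rule that)
qed

lemma central_chain_subgroup:
  assumes L: "central_chain L c N" and H: "subgroup H G"
  shows "group.central_chain (G\<lparr>carrier := H\<rparr>) (\<lambda>n. L n \<inter> H) c (N \<inter> H)"
proof -
  interpret h: group "G\<lparr>carrier := H\<rparr>" by (rule subgroup_imp_group[OF H])
  have HG: "H \<subseteq> carrier G" by (rule subgroup.subset[OF H])
  have Lc: "L 0 = carrier G" "\<And>n. L n \<subseteq> carrier G" "L c \<subseteq> N" "N \<lhd> G" "finite N"
    and Lcomm: "\<And>n g y. g \<in> carrier G \<Longrightarrow> y \<in> L n \<Longrightarrow> commut g y \<in> L (Suc n)"
    using L unfolding central_chain_def by blast+
  have comm: "h.commut x y = commut x y" "commut x y \<in> H" if "x \<in> H" "y \<in> H" for x y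
    using that m_inv_consistent[OF H] subgroup.m_closed[OF H] subgroup.m_inv_closed[OF H]
    by (auto simp: h.commut_def commut_def)
  have "N \<inter> H \<lhd> G\<lparr>carrier := H\<rparr>"
  proof (rule h.normal_invI)
    show "subgroup (N \<inter> H) (G\<lparr>carrier := H\<rparr>)"
      by (rule subgroup_incl[OF subgroups_Inter_pair[OF normal_imp_subgroup[OF Lc(4)] H] H]) simp
    fix x a assume xa: "x \<in> carrier (G\<lparr>carrier := H\<rparr>)" "a \<in> N \<inter> H"
    then have "x \<otimes> a \<otimes> inv x \<in> N" using Lc(4) HG by (auto simp: normal_inv_iff)
    moreover have "x \<otimes> a \<otimes> inv x \<in> H"
      using xa subgroup.m_closed[OF H] subgroup.m_inv_closed[OF H] by simp
    ultimately show "x \<otimes>\<^bsub>G\<lparr>carrier := H\<rparr>\<^esub> a \<otimes>\<^bsub>G\<lparr>carrier := H\<rparr>\<^esub> inv\<^bsub>G\<lparr>carrier := H\<rparr>\<^esub> x \<in> N \<inter> H"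
      using xa m_inv_consistent[OF H] by simp
  qed
  then show ?thesis
    unfolding h.central_chain_def using Lc HG Lcomm comm by (auto simp: subsetD)
qed

text \<open>Two elements of \<open>Y\<close> that permute the finitely many cosets of
  \<open>Y\<close> in the same way differ by an element fixing every coset, that is, by an element
  of the core.\<close>

lemma finite_index_core:
  assumes Y: "subgroup Y G" and fin: "finite (lcosets Y)"
  shows "finite_index_in Y (normal_core Y)"
proof -
  have YG: "Y \<subseteq> carrier G" by (rule subgroup.subset[OF Y])
  define f where "f y = restrict (\<lambda>C. y <# C) (lcosets Y)" for y
  have "f ` Y \<subseteq> lcosets Y \<rightarrow>\<^sub>E lcosets Y"
    unfolding f_def using YG bij_betw_apply[OF bij_betw_lcosets[OF _ Y]] by auto
  then have "finite (f ` Y)" by (rule finite_subset) (intro finite_PiE fin)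
  then obtain R where R: "R \<subseteq> Y" "finite R" "f ` R = f ` Y"
    by (metis finite_subset_image order_refl)
  have "\<exists>r\<in>R. inv r \<otimes> y \<in> normal_core Y" if y: "y \<in> Y" for y
  proof -
    obtain r where r: "r \<in> R" "f r = f y" using R(3) y by (metis imageE imageI)
    have G: "r \<in> carrier G" "y \<in> carrier G" "r \<in> Y" using r(1) R(1) y YG by auto
    have "g \<otimes> (inv r \<otimes> y) \<otimes> inv g \<in> Y" if g: "g \<in> carrier G" for g
    proof -
      let ?h = "inv g"
      have h: "?h \<in> carrier G" using g by simp
      have C: "?h <# Y \<in> lcosets Y" using h unfolding LCOSETS_def by blast
      have "r <# (?h <# Y) = y <# (?h <# Y)" using fun_cong[OF r(2), of "?h <# Y"] C unfolding f_def by simp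
      then have "(r \<otimes> ?h) <# Y = (y \<otimes> ?h) <# Y" using G h by (simp add: lcos_m_assoc[OF YG])
      moreover have "y \<otimes> ?h \<in> (y \<otimes> ?h) <# Y" using G h by (intro lcos_self[OF _ Y]) simp
      ultimately obtain z where z: "z \<in> Y" "y \<otimes> ?h = r \<otimes> ?h \<otimes> z" unfolding l_coset_def by blast
      have zG: "z \<in> carrier G" using z(1) YG by blast
      have "g \<otimes> (inv r \<otimes> y) \<otimes> inv g = g \<otimes> (inv r \<otimes> (y \<otimes> ?h))" using G g by (simp add: m_assoc)
      also have "\<dots> = z" unfolding z(2) using G g zG by (simp add: word_simps)
      finally show ?thesis using z(1) by simp
    qed
    moreover have "inv r \<otimes> y \<in> Y" by (intro subgroup.m_closed[OF Y] subgroup.m_inv_closed[OF Y] G y)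
    ultimately show ?thesis using r(1) unfolding normal_core_def by blast
  qed
  then show ?thesis unfolding finite_index_in_def using R(1,2) by blast
qed

text \<open>Finite generation of \<open>Y\<close> in terms of the subgroups above it: in this form a
  neighbourhood in the Chabauty space forces an inclusion of traces.\<close>

definition locally_finitely_determined :: "'a set \<Rightarrow> bool"
  where "locally_finitely_determined Y \<longleftrightarrow>
    (\<exists>E. finite E \<and> E \<subseteq> Y \<and> (\<forall>Z. subgroup Z G \<longrightarrow> E \<subseteq> Z \<longrightarrow> Y \<subseteq> Z))"

text \<open>The finite set witnessing this consists of the Schreier generators.\<close>

lemma finite_index_finitely_determined:
  assumes F: "finite F" "F \<subseteq> carrier G" "generate G F = carrier G"
    and Y: "subgroup Y G" "finite (lcosets Y)"
  shows "locally_finitely_determined Y"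
proof -
  have YG: "Y \<subseteq> carrier G" by (rule subgroup.subset[OF Y(1)])
  define rep where "rep C = (SOME x. x \<in> C)" for C :: "'a set"
  define R where "R = insert \<one> (rep ` (lcosets Y))"
  have cos: "C \<noteq> {} \<and> C \<subseteq> carrier G" if "C \<in> lcosets Y" for C
    using that lcos_self[OF _ Y(1)] l_coset_subset_G[OF YG] unfolding LCOSETS_def by blast
  then have rep: "rep C \<in> C" if "C \<in> lcosets Y" for C unfolding rep_def using that some_in_eq by auto
  have R: "finite R" "R \<subseteq> carrier G" "\<one> \<in> R" unfolding R_def using Y(2) rep cos by auto
  have Rex: "\<exists>r\<in>R. inv r \<otimes> x \<in> Y" if x: "x \<in> carrier G" for x
  proof -
    have C: "x <# Y \<in> lcosets Y" using x unfolding LCOSETS_def by blast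
    then obtain y where y: "y \<in> Y" "rep (x <# Y) = x \<otimes> y" using rep[OF C] unfolding l_coset_def by blast
    have yG: "y \<in> carrier G" using y YG by blast
    have "inv (x \<otimes> y) \<otimes> x = inv y" using x yG by (simp add: word_simps)
    then have "inv (rep (x <# Y)) \<otimes> x \<in> Y" using subgroup.m_inv_closed[OF Y(1) y(1)] y(2) by simp
    then show ?thesis using C unfolding R_def by blast
  qed
  define F' where "F' = F \<union> m_inv G ` F"
  have F': "finite F'" "F' \<subseteq> carrier G" using F unfolding F'_def by auto
  \<comment> \<open>Besides the Schreier generators, \<open>E\<close> contains the representatives
    lying in \<open>Y\<close>: the last step writes an element of \<open>Y\<close> as such a
    representative, possibly different from \<open>\<one>\<close>, times an element of
    \<open>Z\<close>.\<close>
  define E where "E = ((\<lambda>(r', f, r). inv r' \<otimes> f \<otimes> r) ` (R \<times> F' \<times> R) \<union> R) \<inter> Y"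
  have "Y \<subseteq> Z" if Z: "subgroup Z G" "E \<subseteq> Z" for Z
  proof -
    \<comment> \<open>This set contains \<open>\<one>\<close> and, by the Schreier generators in
      \<open>E\<close>, is stable under left multiplication by the generators of the group; so it is
      everything.\<close>
    define P where "P = {x \<in> carrier G. \<exists>r\<in>R. inv r \<otimes> x \<in> Z \<inter> Y}"
    have step: "f \<otimes> x \<in> P" if f: "f \<in> F'" and x: "x \<in> P" for f x
    proof -
      obtain r where r: "r \<in> R" "inv r \<otimes> x \<in> Z" "inv r \<otimes> x \<in> Y" "x \<in> carrier G" using x unfolding P_def by blast
      have G: "r \<in> carrier G" "f \<in> carrier G" using r(1) R(2) f F'(2) by auto
      obtain r' where r': "r' \<in> R" "inv r' \<otimes> (f \<otimes> r) \<in> Y" using Rex[of "f \<otimes> r"] G by auto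
      have r'G: "r' \<in> carrier G" using r'(1) R(2) by blast
      have ee: "inv r' \<otimes> f \<otimes> r = inv r' \<otimes> (f \<otimes> r)" using G r'G by (simp add: m_assoc)
      have "inv r' \<otimes> f \<otimes> r \<in> E"
        unfolding E_def using r(1) r' f ee by (auto intro!: image_eqI[of _ _ "(r', f, r)"])
      then have "inv r' \<otimes> f \<otimes> r \<in> Z \<inter> Y" using Z(2) unfolding E_def by blast
      then have "(inv r' \<otimes> f \<otimes> r) \<otimes> (inv r \<otimes> x) \<in> Z \<inter> Y"
        using r subgroup.m_closed[OF Z(1)] subgroup.m_closed[OF Y(1)] by blast
      also have "(inv r' \<otimes> f \<otimes> r) \<otimes> (inv r \<otimes> x) = inv r' \<otimes> (f \<otimes> x)"
        using G r'G r(4) by (simp add: word_simps)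
      finally show ?thesis using r'(1) G r(4) unfolding P_def by auto
    qed
    have closed: "\<forall>x\<in>P. h \<otimes> x \<in> P" if "h \<in> generate G F" for h
      using that
    proof (induction rule: generate.induct)
      case one then show ?case unfolding P_def by auto
    next
      case (incl h) then show ?case using step unfolding F'_def by blast
    next
      case (inv h) then show ?case using step unfolding F'_def by blast
    next
      case (eng h1 h2)
      have G: "h1 \<in> carrier G" "h2 \<in> carrier G" using eng(1,2) F(3) by auto
      show ?case
      proof
        fix x assume x: "x \<in> P"
        then have "x \<in> carrier G" unfolding P_def by blast
        then have "h1 \<otimes> h2 \<otimes> x = h1 \<otimes> (h2 \<otimes> x)" using G by (simp add: m_assoc)
        then show "h1 \<otimes> h2 \<otimes> x \<in> P" using eng(3,4) x by simp
      qed
    qed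
    have "\<one> \<in> P" unfolding P_def
      using R(3) subgroup.one_closed[OF Z(1)] subgroup.one_closed[OF Y(1)] by (auto intro!: bexI[of _ \<one>])
    show "Y \<subseteq> Z"
    proof
      fix y assume y: "y \<in> Y"
      then have yG: "y \<in> carrier G" using YG by blast
      have "y \<otimes> \<one> \<in> P" using closed[of y] \<open>\<one> \<in> P\<close> yG F(3) by blast
      then obtain r where r: "r \<in> R" "inv r \<otimes> y \<in> Z" "inv r \<otimes> y \<in> Y" using yG unfolding P_def by auto
      have rG: "r \<in> carrier G" using r(1) R(2) by blast
      have "r = y \<otimes> inv (inv r \<otimes> y)" using rG yG by (simp add: word_simps)
      then have "r \<in> Y" using subgroup.m_closed[OF Y(1) y subgroup.m_inv_closed[OF Y(1) r(3)]] by simp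
      then have "r \<in> Z" using r(1) Z(2) unfolding E_def by blast
      then have "r \<otimes> (inv r \<otimes> y) \<in> Z" by (rule subgroup.m_closed[OF Z(1) _ r(2)])
      then show "y \<in> Z" using rG yG by (simp add: cancel_inv)
    qed
  qed
  moreover have "finite E" unfolding E_def using R(1) F'(1) by auto
  ultimately show ?thesis unfolding locally_finitely_determined_def E_def by (metis Int_lower2)
qed

lemma slender_finitely_determined:
  assumes "slender (carrier G)" "subgroup Y G"
  shows "locally_finitely_determined Y"
proof -
  obtain E where "finite E" "E \<subseteq> Y" "Y \<subseteq> generate G E"
    using assms(1)[unfolded slender_def, rule_format, OF assms(2) subgroup.subset[OF assms(2)]] by blast
  then show ?thesis unfolding locally_finitely_determined_def
    using generate_subgroup_incl by (meson order_trans)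
qed

lemma finite_lcosets_Int:
  assumes X: "subgroup X G" "finite (lcosets X)" and H: "subgroup H G"
  shows "finite (lcosets\<^bsub>G\<lparr>carrier := H\<rparr>\<^esub> (X \<inter> H))"
proof (rule finite_subset)
  show "finite ((\<lambda>D. D \<inter> H) ` (lcosets X))" using X(2) by simp
  have HG: "H \<subseteq> carrier G" by (rule subgroup.subset[OF H])
  show "lcosets\<^bsub>G\<lparr>carrier := H\<rparr>\<^esub> (X \<inter> H) \<subseteq> (\<lambda>D. D \<inter> H) ` (lcosets X)"
  proof
    fix C assume "C \<in> lcosets\<^bsub>G\<lparr>carrier := H\<rparr>\<^esub> (X \<inter> H)"
    then obtain t where t: "t \<in> H" "C = t <# (X \<inter> H)" unfolding LCOSETS_def by auto
    have tG: "t \<in> carrier G" using t(1) HG by blast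
    have "t <# (X \<inter> H) = (t <# X) \<inter> H"
    proof
      show "t <# (X \<inter> H) \<subseteq> (t <# X) \<inter> H"
        unfolding l_coset_def using t(1) subgroup.m_closed[OF H] by auto
      show "(t <# X) \<inter> H \<subseteq> t <# (X \<inter> H)"
      proof
        fix z assume "z \<in> (t <# X) \<inter> H"
        then obtain x where x: "x \<in> X" "z = t \<otimes> x" "z \<in> H" unfolding l_coset_def by auto
        have xG: "x \<in> carrier G" using x(1) subgroup.subset[OF X(1)] by blast
        have "inv t \<otimes> z \<in> H" using x(3) t(1) subgroup.m_closed[OF H] subgroup.m_inv_closed[OF H] by blast
        then have "x \<in> H" unfolding x(2) using tG xG by (simp add: cancel_inv)
        then show "z \<in> t <# (X \<inter> H)" using x unfolding l_coset_def by auto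
      qed
    qed
    then show "C \<in> (\<lambda>D. D \<inter> H) ` (lcosets X)" using t(2) tG unfolding LCOSETS_def by blast
  qed
qed

text \<open>The sets of subgroups containing a fixed finite set are open, and the Chabauty space is compact.\<close>

lemma chabauty_finite_subcover:
  assumes cl: "closedin (chabauty G) \<X>" and E: "\<And>X. X \<in> \<X> \<Longrightarrow> finite (E X) \<and> E X \<subseteq> X"
  obtains \<X>0 where "finite \<X>0" "\<X>0 \<subseteq> \<X>" "\<And>X'. X' \<in> \<X> \<Longrightarrow> \<exists>X\<in>\<X>0. E X \<subseteq> X'"
proof -
  define T where "T = product_topology (\<lambda>_::'a. discrete_topology {0, 1 :: nat}) (carrier G)"
  define \<phi> where "\<phi> X = (\<lambda>g\<in>carrier G. indicator X g :: nat)" for X :: "'a set"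
  have sub: "subgroup X G" if "X \<in> \<X>" for X
    using closedin_subset[OF cl] that unfolding topspace_chabauty by blast
  have "openin (chabauty G) ({X. subgroup X G} - \<X>)"
    using cl unfolding closedin_def topspace_chabauty by blast
  then obtain U where U: "openin T U" "{X. subgroup X G} - \<X> = \<phi> -` U \<inter> {X. subgroup X G}"
    unfolding chabauty_def openin_pullback_topology T_def \<phi>_def by blast
  have topT: "topspace T = (\<Pi>\<^sub>E g\<in>carrier G. {0, 1})" unfolding T_def by simp
  have \<phi>T: "\<phi> X \<in> topspace T" for X unfolding topT \<phi>_def by (auto simp: indicator_def)
  have "compact_space (discrete_topology {0, 1 :: nat})" by (simp add: compact_space_discrete_topology)
  then have comp: "compact_space T" unfolding T_def by (simp add: compact_space_product_topology)
  have proj: "continuous_map T (discrete_topology {0, 1}) (\<lambda>f. f g)" if "g \<in> carrier G" for g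
    unfolding T_def by (rule continuous_map_product_projection[OF that])
  have clg: "closedin T {f \<in> topspace T. f g \<in> B}" if "g \<in> carrier G" "B \<subseteq> {0, 1}" for g B
    by (rule closedin_continuous_map_preimage[OF proj[OF that(1)]]) (use that(2) in simp)
  have opg: "openin T {f \<in> topspace T. f g \<in> B}" if "g \<in> carrier G" "B \<subseteq> {0, 1}" for g B
    by (rule openin_continuous_map_preimage[OF proj[OF that(1)]]) (use that(2) in simp)
  let ?m = "\<lambda>x y. {f \<in> topspace T. f x \<in> {0}} \<union> {f \<in> topspace T. f y \<in> {0}} \<union> {f \<in> topspace T. f (x \<otimes> y) \<in> {1}}"
  let ?i = "\<lambda>x. {f \<in> topspace T. f x \<in> {0}} \<union> {f \<in> topspace T. f (inv x) \<in> {1}}"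
  \<comment> \<open>The subgroup axioms are closed conditions on indicator functions. Together with
    avoiding \<open>U\<close> they describe exactly the image of \<open>\<X>\<close>, which is
    therefore compact.\<close>
  define Z where "Z = (topspace T - U) \<inter> {f \<in> topspace T. f \<one> \<in> {1}} \<inter>
      (\<Inter>p\<in>carrier G \<times> carrier G. ?m (fst p) (snd p)) \<inter> (\<Inter>x\<in>carrier G. ?i x)"
  have "closedin T (\<Inter>p\<in>carrier G \<times> carrier G. ?m (fst p) (snd p))"
  proof (rule closedin_Inter)
    fix S assume "S \<in> (\<lambda>p. ?m (fst p) (snd p)) ` (carrier G \<times> carrier G)"
    then obtain p where p: "p \<in> carrier G \<times> carrier G" "S = ?m (fst p) (snd p)" by blast
    show "closedin T S" unfolding p(2) by (intro closedin_Un clg) (use p(1) in auto)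
  qed (use one_closed in blast)
  moreover have "closedin T (\<Inter>x\<in>carrier G. ?i x)"
  proof (rule closedin_Inter)
    fix S assume "S \<in> ?i ` carrier G"
    then obtain x where x: "x \<in> carrier G" "S = ?i x" by blast
    show "closedin T S" unfolding x(2) by (intro closedin_Un clg) (use x(1) in auto)
  qed (use one_closed in blast)
  moreover have "closedin T {f \<in> topspace T. f \<one> \<in> {1}}" by (rule clg) auto
  ultimately have "closedin T Z" unfolding Z_def using U(1) by (intro closedin_Int closedin_diff) auto
  then have cZ: "compactin T Z" by (rule closedin_compact_space[OF comp])
  have ZX: "\<exists>X\<in>\<X>. f = \<phi> X" if f: "f \<in> Z" for f
  proof -
    define X where "X = {g \<in> carrier G. f g = 1}"
    have fT: "f \<in> topspace T" using f unfolding Z_def by blast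
    have f01: "f g = 0 \<or> f g = 1" if "g \<in> carrier G" for g using fT that unfolding topT by auto
    have "f = \<phi> X"
      by (rule PiE_ext[OF fT[unfolded topT] \<phi>T[unfolded topT]]) (use f01 in \<open>auto simp: \<phi>_def X_def indicator_def\<close>)
    moreover have "subgroup X G"
    proof (rule subgroupI)
      show "X \<subseteq> carrier G" unfolding X_def by blast
      have "f \<one> = 1" using f unfolding Z_def by blast
      then show "X \<noteq> {}" unfolding X_def using one_closed by blast
      fix a assume a: "a \<in> X"
      then have aG: "a \<in> carrier G" "f a = 1" unfolding X_def by auto
      have "f \<in> (\<Inter>x\<in>carrier G. ?i x)" using f unfolding Z_def by (elim IntE)
      then have "f \<in> ?i a" by (rule INT_D) (rule aG(1))
      then show "inv a \<in> X" using aG unfolding X_def by auto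
      fix b assume b: "b \<in> X"
      then have bG: "b \<in> carrier G" "f b = 1" unfolding X_def by auto
      have "f \<in> (\<Inter>p\<in>carrier G \<times> carrier G. ?m (fst p) (snd p))"
        using f unfolding Z_def by (elim IntE)
      then have "f \<in> ?m (fst (a, b)) (snd (a, b))" by (rule INT_D) (use aG(1) bG(1) in simp)
      then show "a \<otimes> b \<in> X" using aG bG unfolding X_def by auto
    qed
    moreover have "f \<notin> U" using f unfolding Z_def by blast
    ultimately show ?thesis using U(2) by blast
  qed
  have XZ: "\<phi> X \<in> Z" if X: "X \<in> \<X>" for X
  proof -
    note s = sub[OF X]
    have "\<phi> X \<notin> U" using U(2) X s by blast
    then show ?thesis unfolding Z_def
      using \<phi>T subgroup.one_closed[OF s] subgroup.m_closed[OF s] subgroup.m_inv_closed[OF s]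
      by (auto simp: \<phi>_def indicator_def)
  qed
  define V where "V X = topspace T \<inter> (\<Inter>g\<in>E X. {f \<in> topspace T. f g \<in> {1}})" for X
  have EG: "E X \<subseteq> carrier G" if "X \<in> \<X>" for X using E[OF that] subgroup.subset[OF sub[OF that]] by blast
  have V: "openin T (V X)" if "X \<in> \<X>" for X
  proof (cases "E X = {}")
    case True then show ?thesis unfolding V_def by simp
  next
    case False
    then have "openin T (\<Inter>g\<in>E X. {f \<in> topspace T. f g \<in> {1}})"
    proof (intro openin_Inter)
      show "openin T S" if S: "S \<in> (\<lambda>g. {f \<in> topspace T. f g \<in> {1}}) ` E X" for S
      proof -
        obtain g where "g \<in> E X" "S = {f \<in> topspace T. f g \<in> {1}}" using S by blast
        then show ?thesis using opg[of g "{1}"] EG[OF \<open>X \<in> \<X>\<close>] by blast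
      qed
    qed (use E[OF that] in auto)
    then show ?thesis unfolding V_def by (intro openin_Int) auto
  qed
  have \<phi>V: "\<phi> X' \<in> V X \<longleftrightarrow> E X \<subseteq> X'" if "X \<in> \<X>" for X X'
    using EG[OF that] \<phi>T unfolding V_def by (auto simp: \<phi>_def indicator_def subset_iff)
  have "Z \<subseteq> \<Union> (V ` \<X>)" using ZX \<phi>V E by blast
  then obtain \<F> where F: "finite \<F>" "\<F> \<subseteq> V ` \<X>" "Z \<subseteq> \<Union> \<F>"
    using compactinD[OF cZ, of "V ` \<X>"] V by blast
  then obtain \<X>0 where X0: "\<X>0 \<subseteq> \<X>" "finite \<X>0" "\<F> = V ` \<X>0"
    using finite_subset_image by metis
  show thesis
  proof (rule that[OF X0(2,1)])
    fix X' assume "X' \<in> \<X>"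
    then have "\<phi> X' \<in> \<Union> (V ` \<X>0)" using XZ F(3) X0(3) by blast
    then show "\<exists>X\<in>\<X>0. E X \<subseteq> X'" using \<phi>V X0(1) by blast
  qed
qed

end

section \<open>Almost invariant vectors\<close>

lemma Cauchy_Schwarz_sum_sqrt:
  fixes f g :: "'i \<Rightarrow> real"
  assumes "(\<Sum>i\<in>I. (f i)\<^sup>2) \<le> 1" "(\<Sum>i\<in>I. (g i)\<^sup>2) \<le> \<epsilon>"
  shows "(\<Sum>i\<in>I. f i * g i) \<le> sqrt \<epsilon>"
proof -
  have "(\<Sum>i\<in>I. f i * g i)\<^sup>2 \<le> (\<Sum>i\<in>I. (f i)\<^sup>2) * (\<Sum>i\<in>I. (g i)\<^sup>2)"
    by (rule Cauchy_Schwarz_ineq_sum)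
  also have "\<dots> \<le> 1 * \<epsilon>" using assms by (intro mult_mono) (auto intro: sum_nonneg)
  finally show ?thesis by (simp add: real_le_rsqrt)
qed

lemma sq_diff_le: "0 \<le> x \<Longrightarrow> 0 \<le> y \<Longrightarrow> (x - y)\<^sup>2 \<le> \<bar>x\<^sup>2 - y\<^sup>2\<bar>" for x y :: real
proof -
  assume xy: "0 \<le> x" "0 \<le> y"
  have "(x - y)\<^sup>2 = \<bar>x - y\<bar> * \<bar>x - y\<bar>" by (simp add: power2_eq_square)
  also have "\<dots> \<le> \<bar>x - y\<bar> * \<bar>x + y\<bar>" using xy by (intro mult_left_mono) auto
  also have "\<dots> = \<bar>x\<^sup>2 - y\<^sup>2\<bar>" by (simp add: abs_mult[symmetric] power2_eq_square algebra_simps)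
  finally show ?thesis .
qed

text \<open>The ell1 bound on translation defects is expressed by finite sets \<open>Z\<close>, so
  that only finite sums occur.\<close>

definition Reiter_function :: "('g, 'b) monoid_scheme \<Rightarrow> ('g \<Rightarrow> real) \<Rightarrow> 'g set \<Rightarrow> real \<Rightarrow> bool"
  where "Reiter_function H q F \<epsilon> \<longleftrightarrow> finite {x. q x \<noteq> 0} \<and> {x. q x \<noteq> 0} \<subseteq> carrier H \<and> (\<forall>x. 0 \<le> q x) \<and>
    (\<Sum>x | q x \<noteq> 0. q x) = 1 \<and>
    (\<forall>s\<in>F. \<forall>Z. finite Z \<longrightarrow> Z \<subseteq> carrier H \<longrightarrow> (\<Sum>z\<in>Z. \<bar>q (inv\<^bsub>H\<^esub> s \<otimes>\<^bsub>H\<^esub> z) - q z\<bar>) \<le> \<epsilon>)"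

lemma (in group) Reiter_function_exists:
  assumes "invariant_mean G m" "finite F" "F \<subseteq> carrier G" "\<epsilon> > 0"
  obtains q where "Reiter_function G q F \<epsilon>"
proof -
  obtain q :: "'a \<Rightarrow> real" where "finite {x. q x \<noteq> 0}" "{x. q x \<noteq> 0} \<subseteq> carrier G" "\<And>x. 0 \<le> q x"
    "(\<Sum>x | q x \<noteq> 0. q x) = 1"
    "\<And>s Z. s \<in> F \<Longrightarrow> finite Z \<Longrightarrow> Z \<subseteq> carrier G \<Longrightarrow> (\<Sum>z\<in>Z. \<bar>q (inv s \<otimes> z) - q z\<bar>) \<le> \<epsilon>"
    using Reiter[OF assms] by blast
  then have "Reiter_function G q F \<epsilon>" unfolding Reiter_function_def by blast
  then show thesis by (rule that)
qed

context group_perm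
begin

text \<open>The push-forward of \<open>q\<close> along the orbit map of \<open>o'\<close>. The
  square root makes it a unit vector of the Hilbert space and turns almost invariance in ell1 into
  almost invariance in ell2.\<close>

definition push_sqrt :: "('a \<Rightarrow> real) \<Rightarrow> 's \<Rightarrow> 's \<Rightarrow> real"
  where "push_sqrt q o' t = sqrt (\<Sum>g | q g \<noteq> 0 \<and> act g o' = t. q g)"

text \<open>For the last claim, \<open>sq_diff_le\<close> bounds the ell2 distance by an ell1
  distance, push-forward does not increase the latter, and Cauchy-Schwarz produces the square
  root.\<close>

lemma push_sqrt:
  assumes q: "Reiter_function H q F \<epsilon>" and o': "o' \<in> S"
  defines "T \<equiv> (\<lambda>g. act g o') ` {g. q g \<noteq> 0}"
  shows "finite T" "T \<subseteq> S" "0 \<le> push_sqrt q o' t" "t \<notin> T \<Longrightarrow> push_sqrt q o' t = 0"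
    "(push_sqrt q o' t)\<^sup>2 = (\<Sum>g | q g \<noteq> 0 \<and> act g o' = t. q g)"
    "(\<Sum>t\<in>T. (push_sqrt q o' t)\<^sup>2) = 1"
    "inv h \<in> F \<Longrightarrow> h \<in> carrier H \<Longrightarrow>
      (\<Sum>t\<in>T. push_sqrt q o' t * \<bar>push_sqrt q o' t - push_sqrt q o' (act h t)\<bar>) \<le> sqrt \<epsilon>"
proof -
  let ?A = "{g. q g \<noteq> 0}" and ?p = "push_sqrt q o'"
  have A: "finite ?A" "?A \<subseteq> carrier H" "\<And>x. 0 \<le> q x" "sum q ?A = 1"
    using q unfolding Reiter_function_def by auto
  show T: "finite T" "T \<subseteq> S" unfolding T_def using A(1,2) o' act_closed by auto
  show p0: "0 \<le> ?p t" for t unfolding push_sqrt_def using A(3) by (simp add: sum_nonneg)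
  show sq: "(?p t)\<^sup>2 = (\<Sum>g | q g \<noteq> 0 \<and> act g o' = t. q g)" for t
    unfolding push_sqrt_def using A(3) by (simp add: sum_nonneg)
  show "?p t = 0" if "t \<notin> T" for t
  proof -
    have e: "{g. q g \<noteq> 0 \<and> act g o' = t} = {}" using that unfolding T_def by auto
    show ?thesis unfolding push_sqrt_def e by simp
  qed
  have "(\<Sum>t\<in>T. (?p t)\<^sup>2) = (\<Sum>t\<in>T. \<Sum>g\<in>{g \<in> ?A. act g o' = t}. q g)" unfolding sq by simp
  also have "\<dots> = sum q ?A" by (rule sum.group[OF A(1) T(1)]) (simp add: T_def)
  finally show sum1: "(\<Sum>t\<in>T. (?p t)\<^sup>2) = 1" using A(4) by simp
  assume h: "inv h \<in> F" "h \<in> carrier H"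
  \<comment> \<open>Large enough to contain every \<open>z\<close> for which \<open>q z\<close> or
    \<open>q (h \<otimes> z)\<close> is nonzero.\<close>
  define Z where "Z = ?A \<union> (\<lambda>g. inv h \<otimes> g) ` ?A"
  have Z: "finite Z" "Z \<subseteq> carrier H" unfolding Z_def using A(1,2) h(2) by auto
  have Zsum: "(\<Sum>z\<in>Z. \<bar>q (h \<otimes> z) - q z\<bar>) \<le> \<epsilon>"
    using q h Z unfolding Reiter_function_def by (metis inv_inv)
  have P1: "(?p t)\<^sup>2 = (\<Sum>z | z \<in> Z \<and> act z o' = t. q z)" for t
    unfolding sq
  proof (rule sum.mono_neutral_left)
    show "finite {z. z \<in> Z \<and> act z o' = t}" using Z(1) by simp
  qed (auto simp: Z_def)
  have P2: "(?p (act h t))\<^sup>2 = (\<Sum>z | z \<in> Z \<and> act z o' = t. q (h \<otimes> z))" if t: "t \<in> S" for t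
  proof -
    let ?B = "(\<lambda>g. inv h \<otimes> g) ` {g. q g \<noteq> 0 \<and> act g o' = act h t}"
    have "(\<Sum>z\<in>?B. q (h \<otimes> z)) = (\<Sum>z | z \<in> Z \<and> act z o' = t. q (h \<otimes> z))"
    proof (rule sum.mono_neutral_left)
      show "finite {z. z \<in> Z \<and> act z o' = t}" using Z(1) by simp
      show "?B \<subseteq> {z. z \<in> Z \<and> act z o' = t}"
      proof
        fix z assume "z \<in> ?B"
        then obtain g where g: "q g \<noteq> 0" "act g o' = act h t" "z = inv h \<otimes> g" by blast
        have gc: "g \<in> carrier H" using g(1) A(2) by blast
        have "act z o' = act (inv h) (act g o')" unfolding g(3) using gc h(2) o' by (simp add: act_mult)
        then have "act z o' = t" unfolding g(2) using act_inv(1)[OF h(2) t] by simp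
        then show "z \<in> {z. z \<in> Z \<and> act z o' = t}" unfolding Z_def using g by auto
      qed
      show "\<forall>z\<in>{z. z \<in> Z \<and> act z o' = t} - ?B. q (h \<otimes> z) = 0"
      proof (rule ballI, rule ccontr)
        fix z assume z: "z \<in> {z. z \<in> Z \<and> act z o' = t} - ?B" "q (h \<otimes> z) \<noteq> 0"
        have zc: "z \<in> carrier H" using z(1) Z(2) by auto
        have "act (h \<otimes> z) o' = act h t" using z(1) zc h(2) o' by (auto simp: act_mult)
        moreover have "z = inv h \<otimes> (h \<otimes> z)" using zc h(2) by (simp add: cancel_inv)
        ultimately have "z \<in> ?B" using z(2) by blast
        then show False using z(1) by blast
      qed
    qed
    moreover have "(\<Sum>z\<in>?B. q (h \<otimes> z)) = (\<Sum>g | q g \<noteq> 0 \<and> act g o' = act h t. q g)"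
    proof -
      have inj: "inj_on (\<lambda>g. inv h \<otimes> g) {g. q g \<noteq> 0 \<and> act g o' = act h t}"
        using A(2) h(2) by (auto intro!: inj_onI simp: subset_iff)
      show ?thesis unfolding sum.reindex[OF inj]
        using A(2) h(2) by (intro sum.cong) (auto simp: subset_iff cancel_inv)
    qed
    ultimately show ?thesis unfolding sq by simp
  qed
  have "(\<Sum>t\<in>T. (\<bar>?p t - ?p (act h t)\<bar>)\<^sup>2) \<le> (\<Sum>t\<in>T. \<Sum>z | z \<in> Z \<and> act z o' = t. \<bar>q (h \<otimes> z) - q z\<bar>)"
  proof (rule sum_mono)
    fix t assume "t \<in> T"
    then have t: "t \<in> S" using T(2) by blast
    have "(\<bar>?p t - ?p (act h t)\<bar>)\<^sup>2 \<le> \<bar>(?p t)\<^sup>2 - (?p (act h t))\<^sup>2\<bar>"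
      using sq_diff_le[OF p0 p0] by simp
    also have "\<dots> = \<bar>\<Sum>z | z \<in> Z \<and> act z o' = t. q z - q (h \<otimes> z)\<bar>"
      unfolding P1[of t] P2[OF t] by (simp add: sum_subtractf)
    also have "\<dots> \<le> (\<Sum>z | z \<in> Z \<and> act z o' = t. \<bar>q z - q (h \<otimes> z)\<bar>)" by (rule sum_abs)
    finally show "(\<bar>?p t - ?p (act h t)\<bar>)\<^sup>2 \<le> (\<Sum>z | z \<in> Z \<and> act z o' = t. \<bar>q (h \<otimes> z) - q z\<bar>)"
      by (simp add: abs_minus_commute)
  qed
  also have "\<dots> \<le> (\<Sum>t\<in>(\<lambda>z. act z o') ` Z. \<Sum>z\<in>{z \<in> Z. act z o' = t}. \<bar>q (h \<otimes> z) - q z\<bar>)"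
  proof (rule sum_mono2)
    show "finite ((\<lambda>z. act z o') ` Z)" using Z(1) by simp
    show "T \<subseteq> (\<lambda>z. act z o') ` Z" unfolding T_def Z_def by blast
  qed (simp add: sum_nonneg)
  also have "\<dots> = (\<Sum>z\<in>Z. \<bar>q (h \<otimes> z) - q z\<bar>)"
    by (rule sum.group[OF Z(1) finite_imageI[OF Z(1)] order_refl])
  also note Zsum
  finally show "(\<Sum>t\<in>T. ?p t * \<bar>?p t - ?p (act h t)\<bar>) \<le> sqrt \<epsilon>"
    using sum1 by (intro Cauchy_Schwarz_sum_sqrt) auto
qed

text \<open>Fell's absorption principle, compressed to a finitely supported unit vector \<open>p\<close>.\<close>

lemma absorption_bound:
  fixes U :: "'t set" and actU :: "'a \<Rightarrow> 't \<Rightarrow> 't" and B :: "'s \<Rightarrow> 't ell2 \<Rightarrow>\<^sub>L 't ell2"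
  assumes U: "group_perm H U actU" and a: "a \<in> group_algebra H" and T: "finite T" "T \<subseteq> S"
    and p: "(\<Sum>t\<in>T. (p t)\<^sup>2) \<le> 1" and B: "\<And>t \<xi>. norm (B t \<xi>) \<le> norm \<xi>"
    and g: "\<And>t. t \<in> T \<Longrightarrow> g t \<in> carrier H"
  shows "norm (\<Sum>h | a h \<noteq> 0. \<Sum>t | t \<in> T \<and> act h t \<in> T.
    (p t * p (act h t)) *\<^sub>R (cmult_op (a h) o\<^sub>L (perm_op U (actU (g (act h t))) o\<^sub>L B t))) \<le> norm (rp a)"
proof (rule norm_blinfun_le_inner)
  interpret u: group_perm H U actU by (rule U)
  fix \<xi> \<eta> :: "'t ell2"
  \<comment> \<open>The unitary attached to the target point \<open>act h t\<close> is moved to the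
    other side of the inner product. What remains has the shape of \<open>tensor_bound\<close>, and
    the weights \<open>p\<close> keep the two tuples within the norms of \<open>\<xi>\<close> and
    \<open>\<eta>\<close>.\<close>
  define \<xi>' where "\<xi>' t = p t *\<^sub>R B t \<xi>" for t
  define \<eta>' where "\<eta>' t = p t *\<^sub>R perm_op U (actU (inv (g t))) \<eta>" for t
  let ?T = "\<Sum>h | a h \<noteq> 0. \<Sum>t | t \<in> T \<and> act h t \<in> T.
    (p t * p (act h t)) *\<^sub>R (cmult_op (a h) o\<^sub>L (perm_op U (actU (g (act h t))) o\<^sub>L B t))"
  have "inner (?T \<xi>) \<eta> = (\<Sum>h | a h \<noteq> 0. \<Sum>t | t \<in> T \<and> act h t \<in> T.
      (p t * p (act h t)) * inner (ell2_cmult (a h) (perm_op U (actU (g (act h t))) (B t \<xi>))) \<eta>)"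
    by (simp add: blinfun.sum_left blinfun.scaleR_left inner_sum_left cmult_op.rep_eq)
  also have "\<dots> = (\<Sum>h | a h \<noteq> 0. \<Sum>t | t \<in> T \<and> act h t \<in> T. inner (ell2_cmult (a h) (\<xi>' t)) (\<eta>' (act h t)))"
  proof (intro sum.cong refl)
    fix h t assume "t \<in> {t. t \<in> T \<and> act h t \<in> T}"
    then have gc: "g (act h t) \<in> carrier H" using g by blast
    have "inner (ell2_cmult (a h) (perm_op U (actU (g (act h t))) (B t \<xi>))) \<eta> =
        inner (perm_op U (actU (g (act h t))) (ell2_cmult (a h) (B t \<xi>))) \<eta>"
      by (simp add: u.perm_cmult[OF gc])
    also have "\<dots> = inner (ell2_cmult (a h) (B t \<xi>)) (perm_op U (actU (inv (g (act h t)))) \<eta>)"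
      by (rule u.perm_adj[OF gc])
    finally have 1: "inner (ell2_cmult (a h) (perm_op U (actU (g (act h t))) (B t \<xi>))) \<eta> =
      inner (ell2_cmult (a h) (B t \<xi>)) (perm_op U (actU (inv (g (act h t)))) \<eta>)" .
    have 2: "ell2_cmult (a h) (p t *\<^sub>R B t \<xi>) = p t *\<^sub>R ell2_cmult (a h) (B t \<xi>)"
      by (rule ell2_eqI) simp
    show "(p t * p (act h t)) * inner (ell2_cmult (a h) (perm_op U (actU (g (act h t))) (B t \<xi>))) \<eta> =
        inner (ell2_cmult (a h) (\<xi>' t)) (\<eta>' (act h t))"
      unfolding \<xi>'_def \<eta>'_def 1 2 by simp
  qed
  also have "\<dots> \<le> norm (rp a) * (((\<Sum>t\<in>T. (norm (\<xi>' t))\<^sup>2) + (\<Sum>t\<in>T. (norm (\<eta>' t))\<^sup>2)) / 2)"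
    by (rule tensor_bound[OF a T])
  also have "\<dots> \<le> norm (rp a) * (((norm \<xi>)\<^sup>2 + (norm \<eta>)\<^sup>2) / 2)"
  proof -
    have le: "(\<Sum>t\<in>T. (norm (p t *\<^sub>R f t))\<^sup>2) \<le> (norm \<zeta>)\<^sup>2" if "\<And>t. norm (f t) \<le> norm \<zeta>" for f and \<zeta> :: "'t ell2"
    proof -
      have "(\<Sum>t\<in>T. (norm (p t *\<^sub>R f t))\<^sup>2) = (\<Sum>t\<in>T. (p t)\<^sup>2 * (norm (f t))\<^sup>2)"
        by (simp add: power_mult_distrib)
      also have "\<dots> \<le> (\<Sum>t\<in>T. (p t)\<^sup>2 * (norm \<zeta>)\<^sup>2)"
        by (intro sum_mono mult_left_mono power_mono that) auto
      also have "\<dots> = (\<Sum>t\<in>T. (p t)\<^sup>2) * (norm \<zeta>)\<^sup>2" by (simp add: sum_distrib_right)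
      also have "\<dots> \<le> 1 * (norm \<zeta>)\<^sup>2" by (intro mult_right_mono p) simp
      finally show ?thesis by simp
    qed
    show ?thesis
      unfolding \<xi>'_def \<eta>'_def
      by (intro mult_left_mono divide_right_mono add_mono le B u.norm_perm_le) auto
  qed
  finally show "inner (?T \<xi>) \<eta> \<le> norm (rp a) * (((norm \<xi>)\<^sup>2 + (norm \<eta>)\<^sup>2) / 2)" .
qed simp

end

section \<open>Weak containment in the regular representation\<close>

lemma norm_sum_weighted_le:
  fixes T :: "'i \<Rightarrow> 'v::real_normed_vector"
  assumes "\<And>i. i \<in> I \<Longrightarrow> norm (T i) \<le> f i"
  shows "norm (\<Sum>i\<in>I. T i) \<le> (\<Sum>i\<in>I. f i)"
  by (rule order_trans[OF norm_sum sum_mono[OF assms]])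

lemma norm_cmult_op_comp_le:
  fixes A :: "'s ell2 \<Rightarrow>\<^sub>L 't ell2"
  assumes "\<And>\<xi>. norm (A \<xi>) \<le> norm \<xi>"
  shows "norm (cmult_op c o\<^sub>L A) \<le> norm c"
  by (rule norm_blinfun_bound) (simp_all add: cmult_op.rep_eq norm_ell2_cmult mult_left_mono assms)

lemma (in group) regular_group_perm: "group_perm G (carrier G) (\<lambda>g h. g \<otimes> h)"
  by unfold_locales (auto simp: m_assoc)

text \<open>With an almost invariant unit vector \<open>?p\<close> of the regular representation,
  absorption bounds an operator \<open>X\<close> in which the group elements recombine as
  \<open>(h \<otimes> t) \<otimes> inv t = h\<close>. So \<open>X\<close> differs from the given
  operator only by the scalars \<open>1 - (\<Sum>t\<in>?T. ?p t * ?p (h \<otimes> t))\<close>, which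
  are small.\<close>

lemma (in group) norm_perm_lin_le_regular:
  assumes m: "invariant_mean G m" and U: "group_perm G U actU" and a: "a \<in> group_algebra G"
  shows "norm (perm_lin U actU a) \<le> norm (perm_lin (carrier G) (\<lambda>g h. g \<otimes> h) a)"
proof (rule field_le_epsilon)
  fix \<delta> :: real assume \<delta>: "\<delta> > 0"
  interpret r: group_perm G "carrier G" "\<lambda>g h. g \<otimes> h" by (rule regular_group_perm)
  interpret u: group_perm G U actU by (rule U)
  let ?A = "{g. a g \<noteq> 0}"
  note A = group_algebraD[OF a]
  define M where "M = 1 + (\<Sum>h\<in>?A. norm (a h))"
  have M: "M > 0" unfolding M_def by (simp add: add_pos_nonneg sum_nonneg)
  \<comment> \<open>Chosen so that \<open>sqrt \<epsilon> * M = \<delta>\<close>, the total error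
    over the support of \<open>a\<close>.\<close>
  define \<epsilon> where "\<epsilon> = (\<delta> / M)\<^sup>2"
  have \<epsilon>: "\<epsilon> > 0" unfolding \<epsilon>_def using \<delta> M by simp
  obtain q where q: "Reiter_function G q (m_inv G ` ?A) \<epsilon>"
    using Reiter_function_exists[OF m _ _ \<epsilon>, of "m_inv G ` ?A"] A by auto
  let ?T = "(\<lambda>g. g \<otimes> \<one>) ` {g. q g \<noteq> 0}" and ?p = "r.push_sqrt q \<one>"
  note P = r.push_sqrt[OF q one_closed]
  define X where "X = (\<Sum>h\<in>?A. \<Sum>t | t \<in> ?T \<and> h \<otimes> t \<in> ?T. (?p t * ?p (h \<otimes> t)) *\<^sub>R
      (cmult_op (a h) o\<^sub>L (perm_op U (actU (h \<otimes> t)) o\<^sub>L perm_op U (actU (inv t)))))"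
  have X: "norm X \<le> norm (r.rp a)"
    unfolding X_def
    by (rule r.absorption_bound[OF U a P(1,2)]) (use P(2,6) u.norm_perm_le in auto)
  have "norm (u.rp a - X) \<le> (\<Sum>h\<in>?A. sqrt \<epsilon> * norm (a h))"
  proof -
    have "u.rp a - X = (\<Sum>h\<in>?A. (1 - (\<Sum>t\<in>?T. ?p t * ?p (h \<otimes> t))) *\<^sub>R (cmult_op (a h) o\<^sub>L perm_op U (actU h)))"
    proof -
      have "X = (\<Sum>h\<in>?A. (\<Sum>t\<in>?T. ?p t * ?p (h \<otimes> t)) *\<^sub>R (cmult_op (a h) o\<^sub>L perm_op U (actU h)))"
        unfolding X_def
      proof (intro sum.cong refl)
        fix h assume "h \<in> ?A"
        then have hc: "h \<in> carrier G" using A by blast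
        have "perm_op U (actU (h \<otimes> t)) o\<^sub>L perm_op U (actU (inv t)) = perm_op U (actU h)" if t: "t \<in> ?T" for t
        proof (rule blinfun_eqI)
          fix \<xi>
          have tc: "t \<in> carrier G" using t P(2) by blast
          have "perm_op U (actU (h \<otimes> t \<otimes> inv t)) \<xi> = perm_op U (actU (h \<otimes> t)) (perm_op U (actU (inv t)) \<xi>)"
            by (rule u.perm_mult) (use hc tc in auto)
          moreover have "h \<otimes> t \<otimes> inv t = h" using hc tc by (simp add: m_assoc)
          ultimately show "(perm_op U (actU (h \<otimes> t)) o\<^sub>L perm_op U (actU (inv t))) \<xi> = perm_op U (actU h) \<xi>" by simp
        qed
        then have "(\<Sum>t | t \<in> ?T \<and> h \<otimes> t \<in> ?T. (?p t * ?p (h \<otimes> t)) *\<^sub>R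
            (cmult_op (a h) o\<^sub>L (perm_op U (actU (h \<otimes> t)) o\<^sub>L perm_op U (actU (inv t))))) =
            (\<Sum>t | t \<in> ?T \<and> h \<otimes> t \<in> ?T. ?p t * ?p (h \<otimes> t)) *\<^sub>R (cmult_op (a h) o\<^sub>L perm_op U (actU h))"
          unfolding scaleR_sum_left by (intro sum.cong refl) simp
        also have "(\<Sum>t | t \<in> ?T \<and> h \<otimes> t \<in> ?T. ?p t * ?p (h \<otimes> t)) = (\<Sum>t\<in>?T. ?p t * ?p (h \<otimes> t))"
          by (rule sum.mono_neutral_left) (use P(1) P(4) in auto)
        finally show "(\<Sum>t | t \<in> ?T \<and> h \<otimes> t \<in> ?T. (?p t * ?p (h \<otimes> t)) *\<^sub>R
            (cmult_op (a h) o\<^sub>L (perm_op U (actU (h \<otimes> t)) o\<^sub>L perm_op U (actU (inv t))))) =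
            (\<Sum>t\<in>?T. ?p t * ?p (h \<otimes> t)) *\<^sub>R (cmult_op (a h) o\<^sub>L perm_op U (actU h))" .
      qed
      moreover have "u.rp a = (\<Sum>h\<in>?A. cmult_op (a h) o\<^sub>L perm_op U (actU h))"
        by (simp add: perm_lin_def lin_ext_def)
      ultimately show ?thesis by (simp add: sum_subtractf scaleR_diff_left)
    qed
    also have "norm \<dots> \<le> (\<Sum>h\<in>?A. sqrt \<epsilon> * norm (a h))"
    proof (rule norm_sum_weighted_le)
      fix h assume h: "h \<in> ?A"
      have eq: "1 - (\<Sum>t\<in>?T. ?p t * ?p (h \<otimes> t)) = (\<Sum>t\<in>?T. ?p t * (?p t - ?p (h \<otimes> t)))"
        using P(6) by (simp add: right_diff_distrib sum_subtractf power2_eq_square)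
      have "\<bar>1 - (\<Sum>t\<in>?T. ?p t * ?p (h \<otimes> t))\<bar> \<le> (\<Sum>t\<in>?T. \<bar>?p t * (?p t - ?p (h \<otimes> t))\<bar>)"
        unfolding eq by (rule sum_abs)
      also have "\<dots> = (\<Sum>t\<in>?T. ?p t * \<bar>?p t - ?p (h \<otimes> t)\<bar>)" using P(3) by (simp add: abs_mult)
      also have "\<dots> \<le> sqrt \<epsilon>" by (rule P(7)) (use h A in auto)
      finally have "\<bar>1 - (\<Sum>t\<in>?T. ?p t * ?p (h \<otimes> t))\<bar> \<le> sqrt \<epsilon>" .
      moreover have "norm (cmult_op (a h) o\<^sub>L perm_op U (actU h)) \<le> norm (a h)"
        by (rule norm_cmult_op_comp_le[OF u.norm_perm_le])
      ultimately show "norm ((1 - (\<Sum>t\<in>?T. ?p t * ?p (h \<otimes> t))) *\<^sub>R (cmult_op (a h) o\<^sub>L perm_op U (actU h)))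
          \<le> sqrt \<epsilon> * norm (a h)"
        unfolding norm_scaleR using \<epsilon> by (intro mult_mono) auto
    qed
    finally show ?thesis .
  qed
  also have "\<dots> = sqrt \<epsilon> * (\<Sum>h\<in>?A. norm (a h))" by (simp add: sum_distrib_left)
  also have "\<dots> \<le> sqrt \<epsilon> * M" unfolding M_def by (intro mult_left_mono) (use \<epsilon> in auto)
  also have "\<dots> = \<delta>" unfolding \<epsilon>_def using \<delta> M by simp
  finally have "norm (u.rp a - X) \<le> \<delta>" .
  then show "norm (u.rp a) \<le> norm (r.rp a) + \<delta>"
    using X norm_triangle_sub[of "u.rp a" X] by linarith
qed

text \<open>A repetition in the sequence is a relation that the linear dependence of the set of
  values does not see, hence the case distinction.\<close>

lemma sequence_in_finite_span_dependent:
  fixes v :: "nat \<Rightarrow> 'v::real_vector"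
  assumes B: "finite B" "\<And>k. v k \<in> span B"
  obtains n \<alpha> k where "k \<le> n" "\<alpha> k \<noteq> 0" "(\<Sum>k\<le>n. \<alpha> k *\<^sub>R v k) = 0"
proof -
  let ?n = "card B"
  show thesis
  proof (cases "inj_on v {..?n}")
    case False
    then obtain i j where ij: "i \<le> ?n" "j \<le> ?n" "i \<noteq> j" "v i = v j" unfolding inj_on_def by auto
    define \<alpha> where "\<alpha> k = (if k = i then 1 else if k = j then - 1 else 0 :: real)" for k
    have "(\<Sum>k\<le>?n. \<alpha> k *\<^sub>R v k) = (\<Sum>k\<in>{i, j}. \<alpha> k *\<^sub>R v k)"
      by (rule sum.mono_neutral_right) (use ij in \<open>auto simp: \<alpha>_def\<close>)
    also have "\<dots> = 0" using ij by (simp add: \<alpha>_def)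
    finally show ?thesis using that[of i ?n \<alpha>] ij(1) by (simp add: \<alpha>_def)
  next
    case True
    let ?S = "v ` {..?n}"
    have "card ?S = Suc ?n" using card_image[OF True] by simp
    then have "\<not> independent ?S"
      using independent_span_bound[OF B(1), of ?S] B(2) by auto
    then obtain u where u: "\<exists>w\<in>?S. u w \<noteq> 0" "(\<Sum>w\<in>?S. u w *\<^sub>R w) = 0"
      using dependent_finite[of ?S] by auto
    then obtain k where "k \<le> ?n" "u (v k) \<noteq> 0" by auto
    moreover have "(\<Sum>k\<le>?n. u (v k) *\<^sub>R v k) = 0" using u(2) by (simp add: sum.reindex[OF True])
    ultimately show ?thesis using that[of k ?n "u \<circ> v"] by simp
  qed
qed

section \<open>Coset sums\<close>

lemma (in group) lcosets_group_perm:
  assumes "subgroup Y G"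
  shows "group_perm G (lcosets Y) (l_coset G)"
proof unfold_locales
  have Y: "Y \<subseteq> carrier G" by (rule subgroup.subset[OF assms])
  show "g <# C \<in> lcosets Y" if "g \<in> carrier G" "C \<in> lcosets Y" for g C
    using bij_betw_apply[OF bij_betw_lcosets[OF that(1) assms] that(2)] .
  show "(g \<otimes> h) <# C = g <# (h <# C)" if gh: "g \<in> carrier G" "h \<in> carrier G" and C: "C \<in> lcosets Y" for g h C
  proof -
    obtain t where "t \<in> carrier G" "C = t <# Y" using C unfolding LCOSETS_def by blast
    then show ?thesis using gh Y by (simp add: lcos_m_assoc m_assoc)
  qed
  show "\<one> <# C = C" if C: "C \<in> lcosets Y" for C
  proof -
    obtain t where "t \<in> carrier G" "C = t <# Y" using C unfolding LCOSETS_def by blast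
    then show ?thesis using Y by (simp add: lcos_m_assoc)
  qed
qed

lemma (in group) lcoset_eq_iff:
  assumes "subgroup Y G" "x \<in> carrier G" "y \<in> carrier G"
  shows "x <# Y = y <# Y \<longleftrightarrow> inv x \<otimes> y \<in> Y"
proof
  have Y: "Y \<subseteq> carrier G" by (rule subgroup.subset[OF assms(1)])
  assume "x <# Y = y <# Y"
  then have "y \<in> x <# Y" using lcos_self[OF assms(3,1)] by simp
  then obtain z where "z \<in> Y" "y = x \<otimes> z" unfolding l_coset_def by blast
  then show "inv x \<otimes> y \<in> Y" using assms(2) Y by (auto simp: cancel_inv)
next
  have Y: "Y \<subseteq> carrier G" by (rule subgroup.subset[OF assms(1)])
  assume z: "inv x \<otimes> y \<in> Y"
  have "(x \<otimes> (inv x \<otimes> y)) <# Y = x <# ((inv x \<otimes> y) <# Y)"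
    using z Y assms(2,3) by (subst lcos_m_assoc) auto
  also have "(inv x \<otimes> y) <# Y = Y"
    using coset_join3[OF _ assms(1) z] z Y by blast
  finally show "x <# Y = y <# Y" using assms(2,3) by (simp add: cancel_inv)
qed

lemma (in group) mem_lcoset_iff:
  assumes "Y \<subseteq> carrier G" "x \<in> carrier G" "t \<in> carrier G"
  shows "x \<in> t <# Y \<longleftrightarrow> inv t \<otimes> x \<in> Y"
proof
  assume "x \<in> t <# Y"
  then obtain y where "y \<in> Y" "x = t \<otimes> y" unfolding l_coset_def by blast
  then show "inv t \<otimes> x \<in> Y" using assms by (auto simp: cancel_inv)
next
  assume "inv t \<otimes> x \<in> Y"
  moreover have "x = t \<otimes> (inv t \<otimes> x)" using assms by (simp add: cancel_inv)
  ultimately show "x \<in> t <# Y" unfolding l_coset_def by blast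
qed

text \<open>These sums are the matrix coefficients of the quasi-regular representations, so
  membership in a kernel becomes a combinatorial condition.\<close>

definition coset_sum :: "('g, 'b) monoid_scheme \<Rightarrow> ('g \<Rightarrow> complex) \<Rightarrow> 'g \<Rightarrow> 'g set \<Rightarrow> complex"
  where "coset_sum G f t Y = (\<Sum>g | f g \<noteq> 0 \<and> g \<in> t <#\<^bsub>G\<^esub> Y. f g)"

abbreviation coset_rep :: "('g, 'b) monoid_scheme \<Rightarrow> 'g set \<Rightarrow> ('g \<Rightarrow> complex) \<Rightarrow> 'g set ell2 \<Rightarrow>\<^sub>L 'g set ell2"
  where "coset_rep G Y \<equiv> perm_lin (lcosets\<^bsub>G\<^esub> Y) (\<lambda>g C. g <#\<^bsub>G\<^esub> C)"

lemma (in group) coset_rep_delta: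
  assumes Y: "subgroup Y G" and f: "f \<in> group_algebra G" and t: "t \<in> carrier G"
  shows "ell2_apply (coset_rep G Y f (delta Y)) (t <# Y) = coset_sum G f t Y"
proof -
  interpret k: group_perm G "lcosets Y" "l_coset G" by (rule lcosets_group_perm[OF Y])
  note A = group_algebraD[OF f]
  have YG: "Y \<subseteq> carrier G" by (rule subgroup.subset[OF Y])
  have tc: "t <# Y \<in> lcosets Y" using t unfolding LCOSETS_def by blast
  have "ell2_apply (coset_rep G Y f (delta Y)) (t <# Y) =
      (\<Sum>g | f g \<noteq> 0. f g * (if inv g <# (t <# Y) = Y then 1 else 0))"
    using k.rp_apply[OF A(1) order_refl A(2)] tc by simp
  also have "\<dots> = (\<Sum>g | f g \<noteq> 0. if g \<in> t <# Y then f g else 0)"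
  proof (intro sum.cong refl)
    fix g assume "g \<in> {g. f g \<noteq> 0}"
    then have g: "g \<in> carrier G" using A by blast
    have "inv g <# (t <# Y) = Y \<longleftrightarrow> \<one> <# Y = (inv g \<otimes> t) <# Y"
      using g t YG by (auto simp: lcos_m_assoc lcos_mult_one)
    also have "\<dots> \<longleftrightarrow> inv g \<otimes> t \<in> Y" using g t by (subst lcoset_eq_iff[OF Y]) auto
    also have "\<dots> \<longleftrightarrow> inv (inv g \<otimes> t) \<in> Y"
      using subgroup.m_inv_closed[OF Y, of "inv g \<otimes> t"] subgroup.m_inv_closed[OF Y, of "inv (inv g \<otimes> t)"] g t by auto
    also have "inv (inv g \<otimes> t) = inv t \<otimes> g" using g t by (simp add: inv_mult_group)
    also have "inv t \<otimes> g \<in> Y \<longleftrightarrow> g \<in> t <# Y" using mem_lcoset_iff[OF YG g t] by simp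
    finally show "f g * (if inv g <# (t <# Y) = Y then 1 else 0) = (if g \<in> t <# Y then f g else 0)" by simp
  qed
  also have "\<dots> = coset_sum G f t Y"
    unfolding coset_sum_def using sum.inter_filter[OF A(1), of f "\<lambda>g. g \<in> t <# Y"] by simp
  finally show ?thesis .
qed

text \<open>The matrix entry from \<open>s <# Y\<close> to \<open>t <# Y\<close> sums
  \<open>f\<close> over all \<open>g\<close> with \<open>g <# (s <# Y) = t <# Y\<close>. These form
  the left coset of \<open>conjugate s Y\<close> represented by
  \<open>t \<otimes> inv s\<close>.\<close>

lemma (in group) coset_rep_eq_0:
  assumes Y: "subgroup Y G" and f: "f \<in> group_algebra G"
    and 0: "\<And>s t. s \<in> carrier G \<Longrightarrow> t \<in> carrier G \<Longrightarrow> coset_sum G f t (conjugate s Y) = 0"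
  shows "coset_rep G Y f = 0"
proof (rule blinfun_eqI, rule ell2_eqI)
  interpret k: group_perm G "lcosets Y" "l_coset G" by (rule lcosets_group_perm[OF Y])
  note A = group_algebraD[OF f]
  have YG: "Y \<subseteq> carrier G" by (rule subgroup.subset[OF Y])
  fix \<xi> C
  show "ell2_apply (coset_rep G Y f \<xi>) C = ell2_apply ((0 :: 'a set ell2 \<Rightarrow>\<^sub>L 'a set ell2) \<xi>) C"
  proof (cases "C \<in> lcosets Y")
    case False
    then show ?thesis using k.rp_apply[OF A(1) order_refl A(2)] by simp
  next
    case True
    then obtain t where t: "t \<in> carrier G" "C = t <# Y" unfolding LCOSETS_def by blast
    let ?A = "{g. f g \<noteq> 0}" and ?\<phi> = "\<lambda>g. inv g <# C"
    have "ell2_apply (coset_rep G Y f \<xi>) C = (\<Sum>g\<in>?A. f g * ell2_apply \<xi> (?\<phi> g))"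
      using k.rp_apply[OF A(1) order_refl A(2)] True by simp
    also have "\<dots> = (\<Sum>D\<in>?\<phi> ` ?A. \<Sum>g\<in>{g \<in> ?A. ?\<phi> g = D}. f g * ell2_apply \<xi> (?\<phi> g))"
      by (rule sum.group[symmetric, OF A(1) finite_imageI[OF A(1)] order_refl])
    also have "\<dots> = (\<Sum>D\<in>?\<phi> ` ?A. 0)"
    proof (intro sum.cong refl)
      fix D assume "D \<in> ?\<phi> ` ?A"
      then obtain g0 where g0: "g0 \<in> ?A" "D = inv g0 <# C" by blast
      have g0c: "g0 \<in> carrier G" using g0(1) A(2) by blast
      define s where "s = inv g0 \<otimes> t"
      have s: "s \<in> carrier G" "D = s <# Y"
        unfolding s_def g0(2) t(2) using g0c t(1) YG by (auto simp: lcos_m_assoc)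
      have "?\<phi> g = D \<longleftrightarrow> g \<in> (t \<otimes> inv s) <# conjugate s Y" if g: "g \<in> ?A" for g
      proof -
        have gc: "g \<in> carrier G" using g A(2) by blast
        have "?\<phi> g = D \<longleftrightarrow> (inv g \<otimes> t) <# Y = s <# Y"
          unfolding s(2) t(2) using gc t(1) YG by (simp add: lcos_m_assoc)
        also have "\<dots> \<longleftrightarrow> inv (inv g \<otimes> t) \<otimes> s \<in> Y" using gc t(1) s(1) by (subst lcoset_eq_iff[OF Y]) auto
        also have "\<dots> \<longleftrightarrow> (\<exists>y\<in>Y. g = t \<otimes> inv s \<otimes> (s \<otimes> y \<otimes> inv s))"
        proof
          assume y: "inv (inv g \<otimes> t) \<otimes> s \<in> Y"
          have "g = t \<otimes> inv s \<otimes> (s \<otimes> (inv (inv g \<otimes> t) \<otimes> s) \<otimes> inv s)"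
            using gc t(1) s(1) by (simp add: word_simps)
          then show "\<exists>y\<in>Y. g = t \<otimes> inv s \<otimes> (s \<otimes> y \<otimes> inv s)" using y by blast
        next
          assume "\<exists>y\<in>Y. g = t \<otimes> inv s \<otimes> (s \<otimes> y \<otimes> inv s)"
          then obtain y where y: "y \<in> Y" "g = t \<otimes> inv s \<otimes> (s \<otimes> y \<otimes> inv s)" by blast
          have yc: "y \<in> carrier G" using y(1) YG by blast
          have "inv (inv g \<otimes> t) \<otimes> s = y" unfolding y(2) using t(1) s(1) yc by (simp add: word_simps)
          then show "inv (inv g \<otimes> t) \<otimes> s \<in> Y" using y(1) by simp
        qed
        also have "\<dots> \<longleftrightarrow> g \<in> (t \<otimes> inv s) <# conjugate s Y" unfolding l_coset_def conjugate_def by auto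
        finally show ?thesis .
      qed
      then have e: "{g \<in> ?A. ?\<phi> g = D} = {g. f g \<noteq> 0 \<and> g \<in> (t \<otimes> inv s) <# conjugate s Y}" by blast
      have "(\<Sum>g\<in>{g \<in> ?A. ?\<phi> g = D}. f g * ell2_apply \<xi> (?\<phi> g)) = (\<Sum>g\<in>{g \<in> ?A. ?\<phi> g = D}. f g * ell2_apply \<xi> D)"
        by (intro sum.cong) auto
      also have "\<dots> = coset_sum G f (t \<otimes> inv s) (conjugate s Y) * ell2_apply \<xi> D"
        unfolding e coset_sum_def sum_distrib_right ..
      also have "\<dots> = 0" using 0[OF s(1), of "t \<otimes> inv s"] t(1) s(1) by simp
      finally show "(\<Sum>g\<in>{g \<in> ?A. ?\<phi> g = D}. f g * ell2_apply \<xi> (?\<phi> g)) = 0" .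
    qed
    finally show ?thesis by simp
  qed
qed

lemma (in group) conjugate_normal:
  assumes K: "K \<lhd> G" and g: "g \<in> carrier G"
  shows "conjugate g K = K"
proof
  have sub: "conjugate h K \<subseteq> K" if "h \<in> carrier G" for h
    using K that unfolding conjugate_def by (auto simp: normal_inv_iff)
  show "conjugate g K \<subseteq> K" by (rule sub[OF g])
  have KG: "K \<subseteq> carrier G" by (rule subgroup.subset[OF normal_imp_subgroup[OF K]])
  have "K = conjugate g (conjugate (inv g) K)"
    using conjugate_mult[OF g inv_closed[OF g] KG] conjugate_one[OF KG] g by simp
  also have "\<dots> \<subseteq> conjugate g K" using sub[OF inv_closed[OF g]] unfolding conjugate_def by blast
  finally show "K \<subseteq> conjugate g K" .
qed

text \<open>All conjugates of \<open>K\<close> coincide with \<open>K\<close>, so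
  \<open>delta K\<close> is a separating vector: it alone decides whether an operator of the group
  algebra vanishes.\<close>

lemma (in group) coset_rep_normal_eq_0:
  assumes K: "K \<lhd> G" and f: "f \<in> group_algebra G" and 0: "coset_rep G K f (delta K) = 0"
  shows "coset_rep G K f = 0"
proof (rule coset_rep_eq_0[OF normal_imp_subgroup[OF K] f])
  fix s t assume "s \<in> carrier G" "t \<in> carrier G"
  then show "coset_sum G f t (conjugate s K) = 0"
    using coset_rep_delta[OF normal_imp_subgroup[OF K] f, of t] 0 by (simp add: conjugate_normal[OF K])
qed

section \<open>A conjugation-invariant family with cores of finite index\<close>

lemmas compose_bilinear =
  bounded_bilinear.sum_left[OF bounded_bilinear_blinfun_compose]
  bounded_bilinear.sum_right[OF bounded_bilinear_blinfun_compose]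
  bounded_bilinear.scaleR_left[OF bounded_bilinear_blinfun_compose]
  bounded_bilinear.scaleR_right[OF bounded_bilinear_blinfun_compose]
  bounded_bilinear.zero_left[OF bounded_bilinear_blinfun_compose]
  bounded_bilinear.zero_right[OF bounded_bilinear_blinfun_compose]
  bounded_bilinear.diff_left[OF bounded_bilinear_blinfun_compose]
  bounded_bilinear.diff_right[OF bounded_bilinear_blinfun_compose]

lemma blinfun_compose_assoc3: "(A o\<^sub>L B) o\<^sub>L C = A o\<^sub>L (B o\<^sub>L C)"
  by (rule blinfun_eqI) simp

lemma (in group_perm) perm_comp:
  "g \<in> carrier H \<Longrightarrow> h \<in> carrier H \<Longrightarrow> perm_op S (act g) o\<^sub>L perm_op S (act h) = perm_op S (act (g \<otimes> h))"
  by (rule blinfun_eqI) (simp add: perm_mult)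

text \<open>The abstract situation of one conjugacy class \<open>\<C>\<close> of minimal traces with
  common core \<open>K\<close>. Three representations interact: the action on \<open>S\<close>
  measures the distances, those on \<open>Q Y\<close> carry the smallness hypothesis, and the one on
  the cosets of \<open>K\<close> carries the algebra. The stabiliser of \<open>base Y\<close> is
  contained in \<open>Y\<close>.\<close>

locale finite_core_class = group H for H (structure) +
  fixes m :: "('a \<Rightarrow> real) \<Rightarrow> real" and K :: "'a set" and \<C> :: "'a set set"
    and S :: "'s set" and actS :: "'a \<Rightarrow> 's \<Rightarrow> 's"
    and Q :: "'a set \<Rightarrow> 'q set" and act :: "'a \<Rightarrow> 'q \<Rightarrow> 'q" and base :: "'a set \<Rightarrow> 'q"
  assumes mean: "invariant_mean H m" and K: "K \<lhd> H" and fin: "finite \<C>"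
    and subY: "Y \<in> \<C> \<Longrightarrow> subgroup Y H" and KY: "Y \<in> \<C> \<Longrightarrow> K \<subseteq> Y"
    and indexY: "Y \<in> \<C> \<Longrightarrow> finite_index_in Y K"
    and conjY: "Y \<in> \<C> \<Longrightarrow> g \<in> carrier H \<Longrightarrow> conjugate g Y \<in> \<C>"
    and rho: "group_perm H S actS" and permQ: "Y \<in> \<C> \<Longrightarrow> group_perm H (Q Y) act"
    and base: "Y \<in> \<C> \<Longrightarrow> base Y \<in> Q Y"
    and stab: "Y \<in> \<C> \<Longrightarrow> g \<in> carrier H \<Longrightarrow> h \<in> carrier H \<Longrightarrow> act g (base Y) = act h (base Y) \<Longrightarrow>
      inv g \<otimes> h \<in> Y"

sublocale finite_core_class \<subseteq> r: group_perm H S actS by (rule rho)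

sublocale finite_core_class \<subseteq> k: group_perm H "lcosets K" "l_coset H"
  by (rule lcosets_group_perm[OF normal_imp_subgroup[OF K]])

context finite_core_class
begin

abbreviation \<kappa>p :: "'a \<Rightarrow> 'a set ell2 \<Rightarrow>\<^sub>L 'a set ell2" where "\<kappa>p g \<equiv> perm_op (lcosets K) (l_coset H g)"

lemma conjK: "g \<in> carrier H \<Longrightarrow> x \<in> K \<Longrightarrow> g \<otimes> x \<otimes> inv g \<in> K"
  using K by (simp add: normal_inv_iff)

lemma conjK': "g \<in> carrier H \<Longrightarrow> x \<in> K \<Longrightarrow> inv g \<otimes> x \<otimes> g \<in> K"
  using conjK[of "inv g" x] by simp

lemma KG: "K \<subseteq> carrier H" and YG: "Y \<in> \<C> \<Longrightarrow> Y \<subseteq> carrier H"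
  using subgroup.subset[OF normal_imp_subgroup[OF K]] subgroup.subset[OF subY] by auto

lemma \<kappa>p_eq:
  assumes "x \<in> carrier H" "y \<in> carrier H" "inv x \<otimes> y \<in> K"
  shows "\<kappa>p x = \<kappa>p y"
proof (rule blinfun_eqI, rule ell2_eqI)
  fix \<xi> C
  show "ell2_apply (\<kappa>p x \<xi>) C = ell2_apply (\<kappa>p y \<xi>) C"
  proof (cases "C \<in> lcosets K")
    case True
    then obtain c where c: "c \<in> carrier H" "C = c <# K" unfolding LCOSETS_def by blast
    have "inv (inv x \<otimes> c) \<otimes> (inv y \<otimes> c) = inv c \<otimes> (x \<otimes> inv (inv x \<otimes> y) \<otimes> inv x) \<otimes> c"
      using assms c by (simp add: word_simps)
    also have "\<dots> \<in> K"
      by (intro conjK' conjK subgroup.m_inv_closed[OF normal_imp_subgroup[OF K]] assms c)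
    finally have "(inv x \<otimes> c) <# K = (inv y \<otimes> c) <# K"
      using assms c by (subst lcoset_eq_iff[OF normal_imp_subgroup[OF K]]) auto
    then have "inv x <# C = inv y <# C" unfolding c(2) using assms c KG by (simp add: lcos_m_assoc)
    then show ?thesis using k.perm_apply[OF assms(1)] k.perm_apply[OF assms(2)] by simp
  next
    case False
    then show ?thesis using k.perm_apply[OF assms(1)] k.perm_apply[OF assms(2)] by simp
  qed
qed

definition transversal :: "'a set \<Rightarrow> 'a set \<Rightarrow> bool"
  where "transversal Y R \<longleftrightarrow> finite R \<and> R \<subseteq> Y \<and> (\<forall>x\<in>R. \<forall>y\<in>R. inv x \<otimes> y \<in> K \<longrightarrow> x = y) \<and>
    (\<forall>y\<in>Y. \<exists>x\<in>R. inv x \<otimes> y \<in> K)"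

lemma transversal_image:
  assumes Y: "Y \<in> \<C>" and R: "transversal Y R"
  shows "inj_on (\<lambda>x. x <# K) R" "(\<lambda>x. x <# K) ` R = (\<lambda>x. x <# K) ` Y"
proof -
  note s = normal_imp_subgroup[OF K]
  have R': "R \<subseteq> Y" "\<And>x y. x \<in> R \<Longrightarrow> y \<in> R \<Longrightarrow> inv x \<otimes> y \<in> K \<Longrightarrow> x = y"
    "\<And>y. y \<in> Y \<Longrightarrow> \<exists>x\<in>R. inv x \<otimes> y \<in> K"
    using R unfolding transversal_def by auto
  have c: "x \<in> carrier H" if "x \<in> Y" for x using that YG[OF Y] by blast
  show "inj_on (\<lambda>x. x <# K) R"
  proof (rule inj_onI)
    fix x y assume xy: "x \<in> R" "y \<in> R" "x <# K = y <# K"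
    have "x \<in> carrier H" "y \<in> carrier H" using xy(1,2) R'(1) c by auto
    then have "inv x \<otimes> y \<in> K" using lcoset_eq_iff[OF s] xy(3) by blast
    then show "x = y" by (rule R'(2)[OF xy(1,2)])
  qed
  show "(\<lambda>x. x <# K) ` R = (\<lambda>x. x <# K) ` Y"
  proof
    show "(\<lambda>x. x <# K) ` R \<subseteq> (\<lambda>x. x <# K) ` Y" using R'(1) by blast
    show "(\<lambda>x. x <# K) ` Y \<subseteq> (\<lambda>x. x <# K) ` R"
    proof
      fix C assume "C \<in> (\<lambda>x. x <# K) ` Y"
      then obtain y where y: "y \<in> Y" "C = y <# K" by blast
      obtain x where x: "x \<in> R" "inv x \<otimes> y \<in> K" using R'(3)[OF y(1)] by blast
      have "x \<in> carrier H" "y \<in> carrier H" using x(1) y(1) R'(1) c by auto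
      then have "x <# K = y <# K" using lcoset_eq_iff[OF s] x(2) by blast
      then show "C \<in> (\<lambda>x. x <# K) ` R" using x(1) y(2) by blast
    qed
  qed
qed

lemma transversal_exists:
  assumes Y: "Y \<in> \<C>"
  shows "\<exists>R. transversal Y R"
proof -
  note s = normal_imp_subgroup[OF K]
  have c: "x \<in> carrier H" if "x \<in> Y" for x using that YG[OF Y] by blast
  obtain R0 where R0: "finite R0" "R0 \<subseteq> Y" "\<And>y. y \<in> Y \<Longrightarrow> \<exists>r\<in>R0. inv r \<otimes> y \<in> K"
    using indexY[OF Y] unfolding finite_index_in_def by blast
  from iffD1[OF subset_image_inj, OF order_refl[of "(\<lambda>x. x <# K) ` R0"]]
  obtain R where R: "R \<subseteq> R0" "inj_on (\<lambda>x. x <# K) R" "(\<lambda>x. x <# K) ` R0 = (\<lambda>x. x <# K) ` R"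
    by (elim exE conjE)
  have "transversal Y R"
    unfolding transversal_def
  proof (intro conjI ballI impI)
    show "finite R" "R \<subseteq> Y" using R(1) R0(1,2) finite_subset by auto
    fix x y assume xy: "x \<in> R" "y \<in> R" "inv x \<otimes> y \<in> K"
    have "x \<in> carrier H" "y \<in> carrier H" using xy(1,2) R(1) R0(2) c by auto
    then have "x <# K = y <# K" using lcoset_eq_iff[OF s] xy(3) by blast
    then show "x = y" using inj_onD[OF R(2) _ xy(1,2)] by blast
  next
    fix y assume y: "y \<in> Y"
    obtain r where r: "r \<in> R0" "inv r \<otimes> y \<in> K" using R0(3)[OF y] by blast
    have rc: "r \<in> carrier H" "y \<in> carrier H" using r(1) y R0(2) c by auto
    then have 1: "r <# K = y <# K" using lcoset_eq_iff[OF s] r(2) by blast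
    have "r <# K \<in> (\<lambda>x. x <# K) ` R" using R(3) r(1) by blast
    then obtain x where x: "x \<in> R" "r <# K = x <# K" by blast
    have "x \<in> carrier H" using x(1) R(1) R0(2) c by auto
    then have "inv x \<otimes> y \<in> K" using lcoset_eq_iff[OF s _ rc(2)] 1 x(2) by simp
    then show "\<exists>x\<in>R. inv x \<otimes> y \<in> K" using x(1) by blast
  qed
  then show ?thesis by blast
qed

definition reps :: "'a set \<Rightarrow> 'a set" where "reps Y = (SOME R. transversal Y R)"

lemma reps: "Y \<in> \<C> \<Longrightarrow> transversal Y (reps Y)"
  unfolding reps_def by (rule someI_ex[OF transversal_exists])

lemma reps_simps:
  assumes "Y \<in> \<C>"
  shows "finite (reps Y)" "reps Y \<subseteq> Y" "reps Y \<subseteq> carrier H" "card (reps Y) > 0"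
proof -
  have R: "transversal Y (reps Y)" by (rule reps[OF assms])
  then show *: "finite (reps Y)" "reps Y \<subseteq> Y" "reps Y \<subseteq> carrier H"
    using YG[OF assms] unfolding transversal_def by auto
  have "reps Y \<noteq> {}" using R subgroup.one_closed[OF subY[OF assms]] unfolding transversal_def by blast
  then show "card (reps Y) > 0" using *(1) by (simp add: card_gt_0_iff)
qed

text \<open>A lift to the group algebra of the projection onto \<open>Y\<close>-invariant vectors.
  The lift depends on the representatives, its image \<open>E Y\<close> does not.\<close>

definition avg :: "'a set \<Rightarrow> 'a \<Rightarrow> complex"
  where "avg Y x = of_real (1 / real (card (reps Y))) * indc (reps Y) x"

lemma ga_avg: "Y \<in> \<C> \<Longrightarrow> avg Y \<in> group_algebra H"
  unfolding avg_def by (intro ga_scale ga_indc reps_simps)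

lemma rp_avg:
  assumes "group_perm H U actU" "Y \<in> \<C>"
  shows "perm_lin U actU (avg Y) = (1 / real (card (reps Y))) *\<^sub>R (\<Sum>g\<in>reps Y. perm_op U (actU g))"
proof -
  interpret u: group_perm H U actU by (rule assms(1))
  show ?thesis unfolding avg_def
    using u.rp_scaleR[OF ga_indc[OF reps_simps(1,3)[OF assms(2)]], of "1 / real (card (reps Y))"]
      u.rp_indc[OF reps_simps(1)[OF assms(2)]] by simp
qed

lemma norm_avg_le:
  assumes U: "group_perm H U actU" and Y: "Y \<in> \<C>"
  shows "norm (perm_lin U actU (avg Y) \<xi>) \<le> norm \<xi>"
proof -
  interpret u: group_perm H U actU by (rule U)
  have "norm (\<Sum>g\<in>reps Y. perm_op U (actU g) \<xi>) \<le> (\<Sum>g\<in>reps Y. norm \<xi>)"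
    by (rule norm_sum_weighted_le[OF u.norm_perm_le])
  then show ?thesis
    using reps_simps(4)[OF Y] by (simp add: rp_avg[OF U Y] blinfun.scaleR_left blinfun.sum_left field_simps)
qed

abbreviation E :: "'a set \<Rightarrow> 'a set ell2 \<Rightarrow>\<^sub>L 'a set ell2" where "E Y \<equiv> k.rp (avg Y)"

text \<open>As \<open>\<kappa>p\<close> is constant on cosets of \<open>K\<close>, the sum over a
  transversal is a sum over cosets. The following lemmas apply this to translated, conjugated and
  inverted transversals.\<close>

lemma E_transversal:
  assumes Y: "Y \<in> \<C>" and R: "transversal Y R"
  shows "E Y = (1 / real (card R)) *\<^sub>R (\<Sum>g\<in>R. \<kappa>p g)"
proof -
  define pc where "pc D = \<kappa>p (SOME x. x \<in> carrier H \<and> x <# K = D)" for D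
  have pc: "pc (x <# K) = \<kappa>p x" if x: "x \<in> carrier H" for x
  proof -
    let ?z = "SOME z. z \<in> carrier H \<and> z <# K = x <# K"
    have "?z \<in> carrier H \<and> ?z <# K = x <# K" by (rule someI[of _ x]) (use x in simp)
    then show ?thesis
      unfolding pc_def using \<kappa>p_eq[of ?z x] x lcoset_eq_iff[OF normal_imp_subgroup[OF K], of ?z x] by blast
  qed
  have sum: "(\<Sum>g\<in>R. \<kappa>p g) = (\<Sum>D\<in>(\<lambda>x. x <# K) ` Y. pc D)" and card: "card R = card ((\<lambda>x. x <# K) ` Y)"
    if R: "transversal Y R" for R
  proof -
    have RG: "R \<subseteq> carrier H" using R YG[OF Y] unfolding transversal_def by blast
    have "(\<Sum>g\<in>R. \<kappa>p g) = (\<Sum>g\<in>R. pc (g <# K))" using RG pc by (intro sum.cong) auto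
    also have "\<dots> = (\<Sum>D\<in>(\<lambda>x. x <# K) ` R. pc D)"
      by (simp add: sum.reindex[OF transversal_image(1)[OF Y R]])
    finally show "(\<Sum>g\<in>R. \<kappa>p g) = (\<Sum>D\<in>(\<lambda>x. x <# K) ` Y. pc D)" unfolding transversal_image(2)[OF Y R] .
    show "card R = card ((\<lambda>x. x <# K) ` Y)"
      using card_image[OF transversal_image(1)[OF Y R]] transversal_image(2)[OF Y R] by simp
  qed
  show ?thesis
    unfolding rp_avg[OF k.group_perm_axioms Y] sum[OF R] card[OF R] sum[OF reps[OF Y]] card[OF reps[OF Y]] ..
qed

lemma E_absorb:
  assumes Y: "Y \<in> \<C>" and y: "y \<in> Y"
  shows "\<kappa>p y o\<^sub>L E Y = E Y"
proof -
  let ?R = "(\<lambda>x. y \<otimes> x) ` reps Y"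
  note s = subY[OF Y]
  have c: "x \<in> carrier H" if "x \<in> Y" for x using that YG[OF Y] by blast
  have R: "finite (reps Y)" "reps Y \<subseteq> Y" "\<And>x y. x \<in> reps Y \<Longrightarrow> y \<in> reps Y \<Longrightarrow> inv x \<otimes> y \<in> K \<Longrightarrow> x = y"
    "\<And>y. y \<in> Y \<Longrightarrow> \<exists>x\<in>reps Y. inv x \<otimes> y \<in> K"
    using reps[OF Y] unfolding transversal_def by auto
  have inj: "inj_on (\<lambda>x. y \<otimes> x) (reps Y)" using c R(2) y by (auto intro!: inj_onI simp: subset_iff)
  have T: "transversal Y ?R"
    unfolding transversal_def
  proof (intro conjI ballI impI)
    show "finite ?R" using R(1) by simp
    show "?R \<subseteq> Y" using R(2) y subgroup.m_closed[OF s] by blast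
    fix x z assume "x \<in> ?R" "z \<in> ?R" and i: "inv x \<otimes> z \<in> K"
    then obtain x' z' where xz: "x' \<in> reps Y" "x = y \<otimes> x'" "z' \<in> reps Y" "z = y \<otimes> z'" by blast
    have "x' \<in> carrier H" "z' \<in> carrier H" "y \<in> carrier H" using xz R(2) c y by auto
    then have eq: "inv x' \<otimes> z' = inv x \<otimes> z" unfolding xz by (simp add: word_simps)
    have "x' = z'" by (rule R(3)[OF xz(1,3)]) (unfold eq, rule i)
    then show "x = z" using xz(2,4) by simp
  next
    fix z assume z: "z \<in> Y"
    have "inv y \<otimes> z \<in> Y" by (intro subgroup.m_closed[OF s] subgroup.m_inv_closed[OF s] y z)
    then obtain x where x: "x \<in> reps Y" "inv x \<otimes> (inv y \<otimes> z) \<in> K" using R(4) by blast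
    have "x \<in> carrier H" "z \<in> carrier H" "y \<in> carrier H" using x R(2) c y z by auto
    then have eq: "inv (y \<otimes> x) \<otimes> z = inv x \<otimes> (inv y \<otimes> z)" by (simp add: word_simps)
    have "inv (y \<otimes> x) \<otimes> z \<in> K" unfolding eq by (rule x(2))
    then show "\<exists>x\<in>?R. inv x \<otimes> z \<in> K" using x(1) by blast
  qed
  have "\<kappa>p y o\<^sub>L E Y = (1 / real (card (reps Y))) *\<^sub>R (\<Sum>g\<in>reps Y. \<kappa>p y o\<^sub>L \<kappa>p g)"
    unfolding rp_avg[OF k.group_perm_axioms Y] by (simp add: compose_bilinear)
  also have "\<dots> = (1 / real (card ?R)) *\<^sub>R (\<Sum>g\<in>?R. \<kappa>p g)"
    unfolding card_image[OF inj] sum.reindex[OF inj]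
    using R(2) c y by (intro arg_cong2[where f = scaleR] refl sum.cong) (auto simp: k.perm_comp subset_iff)
  also have "\<dots> = E Y" using E_transversal[OF Y T] by simp
  finally show ?thesis .
qed

lemma E_conj:
  assumes Y: "Y \<in> \<C>" and g: "g \<in> carrier H"
  shows "\<kappa>p g o\<^sub>L (E Y o\<^sub>L \<kappa>p (inv g)) = E (conjugate g Y)"
proof -
  let ?R = "(\<lambda>x. g \<otimes> x \<otimes> inv g) ` reps Y"
  have c: "x \<in> carrier H" if "x \<in> Y" for x using that YG[OF Y] by blast
  have R: "finite (reps Y)" "reps Y \<subseteq> Y" "\<And>x y. x \<in> reps Y \<Longrightarrow> y \<in> reps Y \<Longrightarrow> inv x \<otimes> y \<in> K \<Longrightarrow> x = y"
    "\<And>y. y \<in> Y \<Longrightarrow> \<exists>x\<in>reps Y. inv x \<otimes> y \<in> K"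
    using reps[OF Y] unfolding transversal_def by auto
  have inj: "inj_on (\<lambda>x. g \<otimes> x \<otimes> inv g) (reps Y)"
    using c R(2) g by (auto intro!: inj_onI simp: subset_iff m_assoc)
  have T: "transversal (conjugate g Y) ?R"
    unfolding transversal_def
  proof (intro conjI ballI impI)
    show "finite ?R" using R(1) by simp
    show "?R \<subseteq> conjugate g Y" unfolding conjugate_def using R(2) by blast
    fix x z assume "x \<in> ?R" "z \<in> ?R" and i: "inv x \<otimes> z \<in> K"
    then obtain x' z' where xz: "x' \<in> reps Y" "x = g \<otimes> x' \<otimes> inv g" "z' \<in> reps Y" "z = g \<otimes> z' \<otimes> inv g" by blast
    have "x' \<in> carrier H" "z' \<in> carrier H" using xz R(2) c by auto
    then have "inv x' \<otimes> z' = inv g \<otimes> (inv x \<otimes> z) \<otimes> g" unfolding xz using g by (simp add: word_simps)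
    then have "inv x' \<otimes> z' \<in> K" using conjK'[OF g i] by simp
    then have "x' = z'" by (rule R(3)[OF xz(1,3)])
    then show "x = z" using xz(2,4) by simp
  next
    fix z assume "z \<in> conjugate g Y"
    then obtain y where y: "y \<in> Y" "z = g \<otimes> y \<otimes> inv g" unfolding conjugate_def by blast
    then obtain x where x: "x \<in> reps Y" "inv x \<otimes> y \<in> K" using R(4) by blast
    have "x \<in> carrier H" "y \<in> carrier H" using x R(2) c y by auto
    then have "inv (g \<otimes> x \<otimes> inv g) \<otimes> z = g \<otimes> (inv x \<otimes> y) \<otimes> inv g" unfolding y(2) using g by (simp add: word_simps)
    then have "inv (g \<otimes> x \<otimes> inv g) \<otimes> z \<in> K" using conjK[OF g x(2)] by simp
    then show "\<exists>x\<in>?R. inv x \<otimes> z \<in> K" using x(1) by blast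
  qed
  have "\<kappa>p g o\<^sub>L (E Y o\<^sub>L \<kappa>p (inv g)) = (1 / real (card (reps Y))) *\<^sub>R (\<Sum>x\<in>reps Y. \<kappa>p g o\<^sub>L (\<kappa>p x o\<^sub>L \<kappa>p (inv g)))"
    unfolding rp_avg[OF k.group_perm_axioms Y] by (simp add: compose_bilinear)
  also have "\<dots> = (1 / real (card ?R)) *\<^sub>R (\<Sum>x\<in>?R. \<kappa>p x)"
    unfolding card_image[OF inj] sum.reindex[OF inj]
    using R(2) c g by (intro arg_cong2[where f = scaleR] refl sum.cong) (auto simp: k.perm_comp subset_iff m_assoc)
  also have "\<dots> = E (conjugate g Y)" using E_transversal[OF conjY[OF Y g] T] by simp
  finally show ?thesis .
qed

lemma E_idem: "Y \<in> \<C> \<Longrightarrow> E Y o\<^sub>L E Y = E Y"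
proof -
  assume Y: "Y \<in> \<C>"
  have "E Y o\<^sub>L E Y = (1 / real (card (reps Y))) *\<^sub>R (\<Sum>x\<in>reps Y. \<kappa>p x o\<^sub>L E Y)"
    by (subst (1) rp_avg[OF k.group_perm_axioms Y]) (simp add: compose_bilinear)
  also have "(\<Sum>x\<in>reps Y. \<kappa>p x o\<^sub>L E Y) = (\<Sum>x\<in>reps Y. E Y)"
    using E_absorb[OF Y] reps_simps(2)[OF Y] by (intro sum.cong) auto
  also have "(1 / real (card (reps Y))) *\<^sub>R (\<Sum>x\<in>reps Y. E Y) = E Y"
    using reps_simps(4)[OF Y] by (simp only: sum_constant_scaleR) simp
  finally show ?thesis .
qed

lemma E_selfadj:
  assumes Y: "Y \<in> \<C>"
  shows "adjoints (E Y) (E Y)"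
proof -
  let ?R = "m_inv H ` reps Y"
  note s = subY[OF Y] and sK = normal_imp_subgroup[OF K]
  have c: "x \<in> carrier H" if "x \<in> Y" for x using that YG[OF Y] by blast
  have R: "finite (reps Y)" "reps Y \<subseteq> Y" "\<And>x y. x \<in> reps Y \<Longrightarrow> y \<in> reps Y \<Longrightarrow> inv x \<otimes> y \<in> K \<Longrightarrow> x = y"
    "\<And>y. y \<in> Y \<Longrightarrow> \<exists>x\<in>reps Y. inv x \<otimes> y \<in> K"
    using reps[OF Y] unfolding transversal_def by auto
  have inj: "inj_on (m_inv H) (reps Y)"
    by (rule inj_on_subset[OF inv_inj]) (use c R(2) in auto)
  have T: "transversal Y ?R"
    unfolding transversal_def
  proof (intro conjI ballI impI)
    show "finite ?R" using R(1) by simp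
    show "?R \<subseteq> Y" using R(2) subgroup.m_inv_closed[OF s] by blast
    fix x z assume "x \<in> ?R" "z \<in> ?R" and i: "inv x \<otimes> z \<in> K"
    then obtain x' z' where xz: "x' \<in> reps Y" "x = inv x'" "z' \<in> reps Y" "z = inv z'" by blast
    have G: "x' \<in> carrier H" "z' \<in> carrier H" using xz R(2) c by auto
    then have "inv x' \<otimes> z' = inv x' \<otimes> inv (inv x \<otimes> z) \<otimes> x'"
      unfolding xz by (simp add: word_simps)
    also have "\<dots> \<in> K" by (rule conjK'[OF G(1) subgroup.m_inv_closed[OF sK i]])
    finally have "x' = z'" by (rule R(3)[OF xz(1,3)])
    then show "x = z" using xz(2,4) by simp
  next
    fix z assume z: "z \<in> Y"
    have "inv z \<in> Y" by (rule subgroup.m_inv_closed[OF s z])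
    then obtain x where x: "x \<in> reps Y" "inv x \<otimes> inv z \<in> K" using R(4) by blast
    have G: "x \<in> carrier H" "z \<in> carrier H" using x R(2) c z by auto
    have "inv (inv x) \<otimes> z = x \<otimes> inv (inv x \<otimes> inv z) \<otimes> inv x" using G by (simp add: word_simps)
    also have "\<dots> \<in> K" by (rule conjK[OF G(1) subgroup.m_inv_closed[OF sK x(2)]])
    finally show "\<exists>x\<in>?R. inv x \<otimes> z \<in> K" using x(1) by blast
  qed
  have E1: "E Y = (1 / real (card (reps Y))) *\<^sub>R (\<Sum>x\<in>reps Y. \<kappa>p (inv x))"
    using E_transversal[OF Y T] unfolding card_image[OF inj] sum.reindex[OF inj] by simp
  show ?thesis
    unfolding adjoints_def
  proof (intro allI)
    fix \<xi> \<eta>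
    have "inner (E Y \<xi>) \<eta> = (1 / real (card (reps Y))) * (\<Sum>x\<in>reps Y. inner (\<kappa>p x \<xi>) \<eta>)"
      by (subst rp_avg[OF k.group_perm_axioms Y]) (simp add: blinfun.scaleR_left blinfun.sum_left inner_sum_left)
    also have "(\<Sum>x\<in>reps Y. inner (\<kappa>p x \<xi>) \<eta>) = (\<Sum>x\<in>reps Y. inner \<xi> (\<kappa>p (inv x) \<eta>))"
      using R(2) c by (intro sum.cong refl k.perm_adj) auto
    also have "(1 / real (card (reps Y))) * (\<Sum>x\<in>reps Y. inner \<xi> (\<kappa>p (inv x) \<eta>)) = inner \<xi> (E Y \<eta>)"
      by (subst E1) (simp add: blinfun.scaleR_left blinfun.sum_left inner_sum_right)
    finally show "inner (E Y \<xi>) \<eta> = inner \<xi> (E Y \<eta>)" .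
  qed
qed

definition mono :: "'a \<Rightarrow> 'a set \<Rightarrow> 'a \<Rightarrow> 'a \<Rightarrow> complex"
  where "mono x Y y = conv H (indc {x}) (conv H (avg Y) (indc {y}))"

lemma ga_mono:
  assumes "Y \<in> \<C>" "x \<in> carrier H" "y \<in> carrier H"
  shows "mono x Y y \<in> group_algebra H"
  unfolding mono_def using assms by (intro ga_conv ga_avg ga_indc) auto

lemma rp_mono:
  assumes U: "group_perm H U actU" and Y: "Y \<in> \<C>" and x: "x \<in> carrier H" "y \<in> carrier H"
  shows "perm_lin U actU (mono x Y y) =
    perm_op U (actU x) o\<^sub>L (perm_lin U actU (avg Y) o\<^sub>L perm_op U (actU y))"
proof -
  interpret u: group_perm H U actU by (rule U)
  have i: "indc {z} \<in> group_algebra H" if "z \<in> carrier H" for z using that by (intro ga_indc) auto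
  show ?thesis
    unfolding mono_def u.rp_conv[OF i[OF x(1)] ga_conv[OF ga_avg[OF Y] i[OF x(2)]]]
      u.rp_conv[OF ga_avg[OF Y] i[OF x(2)]] u.rp_single ..
qed

text \<open>Its image under \<open>k.rp\<close> is a sum of orthogonal projections that conjugation
  permutes.\<close>

definition P :: "'a \<Rightarrow> complex" where "P x = (\<Sum>Y\<in>\<C>. avg Y x)"

lemma ga_P: "P \<in> group_algebra H"
proof -
  have "(\<lambda>x. \<Sum>Y\<in>\<C>. avg Y x) \<in> group_algebra H" by (rule ga_sum[OF ga_avg])
  then show ?thesis by (simp add: P_def[abs_def])
qed

lemma kP: "k.rp P = (\<Sum>Y\<in>\<C>. E Y)"
proof -
  have "k.rp (\<lambda>x. \<Sum>Y\<in>\<C>. avg Y x) = (\<Sum>Y\<in>\<C>. E Y)" by (rule k.rp_sum[OF ga_avg])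
  then show ?thesis by (simp add: P_def[abs_def])
qed

lemma sum_E_conj:
  assumes g: "g \<in> carrier H"
  shows "(\<Sum>Y\<in>\<C>. E (conjugate g Y)) = (\<Sum>Y\<in>\<C>. E Y)"
proof (rule sum.reindex_bij_witness[where i = "conjugate (inv g)" and j = "conjugate g"])
  fix Y assume Y: "Y \<in> \<C>"
  note YG' = YG[OF Y]
  show "conjugate (inv g) (conjugate g Y) = Y" "conjugate g (conjugate (inv g) Y) = Y"
    using conjugate_mult[OF inv_closed[OF g] g YG'] conjugate_mult[OF g inv_closed[OF g] YG']
      conjugate_one[OF YG'] g by simp_all
  show "conjugate g Y \<in> \<C>" "conjugate (inv g) Y \<in> \<C>" using conjY[OF Y] g by auto
qed simp

text \<open>Absorption gives an element \<open>c1\<close> whose norm over \<open>S\<close> is at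
  most that of \<open>a\<close> over \<open>Q Y\<close>, but its image over the cosets of
  \<open>K\<close> carries the weights \<open>?p t * ?p (act h t)\<close>. The correction
  \<open>c2\<close> replaces them by the squares of \<open>?p t\<close>, so that the identity for
  \<open>k.rp\<close> is exact; almost invariance of \<open>?p\<close> makes \<open>c2\<close>
  small.\<close>

lemma approx_right_mult:
  assumes a: "a \<in> group_algebra H" and Y: "Y \<in> \<C>" and \<delta>: "\<delta> > 0"
    and q: "Reiter_function H q (m_inv H ` {g. a g \<noteq> 0}) \<epsilon>" and \<epsilon>: "\<epsilon> \<ge> 0"
    and small: "sqrt \<epsilon> * (\<Sum>h | a h \<noteq> 0. norm (a h)) \<le> \<delta>"
  shows "\<exists>c\<in>group_algebra H. norm (r.rp c) \<le> norm (perm_lin (Q Y) act a) + \<delta> \<and>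
    k.rp c = k.rp a o\<^sub>L (\<Sum>g | q g \<noteq> 0. q g *\<^sub>R E (conjugate g Y))"
proof -
  interpret u: group_perm H "Q Y" act by (rule permQ[OF Y])
  let ?A = "{g. a g \<noteq> 0}" and ?B = "{g. q g \<noteq> 0}"
  note A = group_algebraD[OF a]
  have B: "finite ?B" "?B \<subseteq> carrier H" using q unfolding Reiter_function_def by auto
  let ?o = "base Y"
  let ?T = "(\<lambda>g. act g ?o) ` ?B" and ?p = "u.push_sqrt q ?o"
  note Pp = u.push_sqrt[OF q base[OF Y]]
  \<comment> \<open>A group element of the support of \<open>q\<close> carrying the base point to
    \<open>t\<close>.\<close>
  define g where "g t = (SOME g. q g \<noteq> 0 \<and> act g ?o = t)" for t
  have g: "q (g t) \<noteq> 0 \<and> act (g t) ?o = t" if "t \<in> ?T" for t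
    unfolding g_def by (rule someI_ex) (use that in auto)
  have gc: "g t \<in> carrier H" if "t \<in> ?T" for t using g[OF that] B(2) by auto
  have mon: "mono (h \<otimes> g t) Y (inv (g t)) \<in> group_algebra H" if "h \<in> ?A" "t \<in> ?T" for h t
    using that A gc by (intro ga_mono[OF Y]) auto
  have mon': "mono (g (act h t)) Y (inv (g t)) \<in> group_algebra H" if "t \<in> ?T" "act h t \<in> ?T" for h t
    using that gc by (intro ga_mono[OF Y]) auto
  define c1 where "c1 x = (\<Sum>h\<in>?A. \<Sum>t | t \<in> ?T \<and> act h t \<in> ?T.
      of_real (?p t * ?p (act h t)) * (a h * mono (g (act h t)) Y (inv (g t)) x))" for x
  define c2 where "c2 x = (\<Sum>h\<in>?A. \<Sum>t\<in>?T.
      of_real (?p t * (?p t - ?p (act h t))) * (a h * mono (h \<otimes> g t) Y (inv (g t)) x))" for x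
  have ga1: "c1 \<in> group_algebra H"
    unfolding c1_def[abs_def] by (intro ga_sum ga_scale) (use mon' in auto)
  have ga2: "c2 \<in> group_algebra H"
    unfolding c2_def[abs_def] by (intro ga_sum ga_scale) (use mon in auto)
  have rp1: "perm_lin U actU c1 = (\<Sum>h\<in>?A. \<Sum>t | t \<in> ?T \<and> act h t \<in> ?T. (?p t * ?p (act h t)) *\<^sub>R
      (cmult_op (a h) o\<^sub>L (perm_op U (actU (g (act h t))) o\<^sub>L (perm_lin U actU (avg Y) o\<^sub>L perm_op U (actU (inv (g t)))))))"
    if U: "group_perm H U actU" for U :: "'u set" and actU
  proof -
    interpret v: group_perm H U actU by (rule U)
    have "v.rp c1 = (\<Sum>h\<in>?A. \<Sum>t | t \<in> ?T \<and> act h t \<in> ?T.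
        v.rp (\<lambda>x. of_real (?p t * ?p (act h t)) * (a h * mono (g (act h t)) Y (inv (g t)) x)))"
      unfolding c1_def[abs_def]
      by (subst v.rp_sum, intro ga_sum ga_scale, use mon' in simp, intro sum.cong refl v.rp_sum ga_scale)
        (use mon' in auto)
    also have "\<dots> = (\<Sum>h\<in>?A. \<Sum>t | t \<in> ?T \<and> act h t \<in> ?T. (?p t * ?p (act h t)) *\<^sub>R
      (cmult_op (a h) o\<^sub>L (perm_op U (actU (g (act h t))) o\<^sub>L (perm_lin U actU (avg Y) o\<^sub>L perm_op U (actU (inv (g t)))))))"
    proof (intro sum.cong refl)
      fix h t assume "t \<in> {t. t \<in> ?T \<and> act h t \<in> ?T}"
      then have t: "t \<in> ?T" "act h t \<in> ?T" by auto
      show "v.rp (\<lambda>x. of_real (?p t * ?p (act h t)) * (a h * mono (g (act h t)) Y (inv (g t)) x)) =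
        (?p t * ?p (act h t)) *\<^sub>R (cmult_op (a h) o\<^sub>L (perm_op U (actU (g (act h t))) o\<^sub>L
          (perm_lin U actU (avg Y) o\<^sub>L perm_op U (actU (inv (g t))))))"
        unfolding v.rp_scaleR[OF ga_scale[OF mon'[OF t]]] v.rp_scale[OF mon'[OF t]]
          rp_mono[OF U Y gc[OF t(2)] inv_closed[OF gc[OF t(1)]]] ..
    qed
    finally show ?thesis .
  qed
  have rp2: "perm_lin U actU c2 = (\<Sum>h\<in>?A. \<Sum>t\<in>?T. (?p t * (?p t - ?p (act h t))) *\<^sub>R
      (cmult_op (a h) o\<^sub>L (perm_op U (actU (h \<otimes> g t)) o\<^sub>L (perm_lin U actU (avg Y) o\<^sub>L perm_op U (actU (inv (g t)))))))"
    if U: "group_perm H U actU" for U :: "'u set" and actU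
  proof -
    interpret v: group_perm H U actU by (rule U)
    have "v.rp c2 = (\<Sum>h\<in>?A. \<Sum>t\<in>?T.
        v.rp (\<lambda>x. of_real (?p t * (?p t - ?p (act h t))) * (a h * mono (h \<otimes> g t) Y (inv (g t)) x)))"
      unfolding c2_def[abs_def]
      by (subst v.rp_sum, intro ga_sum ga_scale mon, assumption, assumption, intro sum.cong refl v.rp_sum ga_scale mon)
    also have "\<dots> = (\<Sum>h\<in>?A. \<Sum>t\<in>?T. (?p t * (?p t - ?p (act h t))) *\<^sub>R
      (cmult_op (a h) o\<^sub>L (perm_op U (actU (h \<otimes> g t)) o\<^sub>L (perm_lin U actU (avg Y) o\<^sub>L perm_op U (actU (inv (g t)))))))"
    proof (intro sum.cong refl)
      fix h t assume h: "h \<in> ?A" and t: "t \<in> ?T"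
      have hg: "h \<otimes> g t \<in> carrier H" using h A gc[OF t] by auto
      show "v.rp (\<lambda>x. of_real (?p t * (?p t - ?p (act h t))) * (a h * mono (h \<otimes> g t) Y (inv (g t)) x)) =
        (?p t * (?p t - ?p (act h t))) *\<^sub>R (cmult_op (a h) o\<^sub>L (perm_op U (actU (h \<otimes> g t)) o\<^sub>L
          (perm_lin U actU (avg Y) o\<^sub>L perm_op U (actU (inv (g t))))))"
        unfolding v.rp_scaleR[OF ga_scale[OF mon[OF h t]]] v.rp_scale[OF mon[OF h t]]
          rp_mono[OF U Y hg inv_closed[OF gc[OF t]]] ..
    qed
    finally show ?thesis .
  qed
  have n1: "norm (r.rp c1) \<le> norm (u.rp a)"
    unfolding rp1[OF rho]
  \<comment> \<open>Absorption with the orbit in \<open>Q Y\<close> as index set and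
    \<open>S\<close> as the coefficient space; the averages are absorbed into the contractions
    indexed by \<open>t\<close>.\<close>
  proof (rule u.absorption_bound[OF rho a Pp(1,2)])
    show "(\<Sum>t\<in>?T. (?p t)\<^sup>2) \<le> 1" using Pp(6) by simp
    show "norm ((r.rp (avg Y) o\<^sub>L perm_op S (actS (inv (g t)))) \<xi>) \<le> norm \<xi>" for t \<xi>
      using norm_avg_le[OF rho Y, of "perm_op S (actS (inv (g t))) \<xi>"] r.norm_perm_le[of "inv (g t)" \<xi>] by simp
  qed (rule gc)
  have n2: "norm (r.rp c2) \<le> \<delta>"
  proof -
    have "norm (r.rp c2) \<le> (\<Sum>h\<in>?A. \<Sum>t\<in>?T. ?p t * \<bar>?p t - ?p (act h t)\<bar> * norm (a h))"
      unfolding rp2[OF rho]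
    proof (intro norm_sum_weighted_le)
      fix h t assume "h \<in> ?A" and t: "t \<in> ?T"
      have "norm ((perm_op S (actS (h \<otimes> g t)) o\<^sub>L (r.rp (avg Y) o\<^sub>L perm_op S (actS (inv (g t))))) \<xi>) \<le> norm \<xi>" for \<xi>
        using norm_avg_le[OF rho Y, of "perm_op S (actS (inv (g t))) \<xi>"] r.norm_perm_le[of "inv (g t)" \<xi>]
          r.norm_perm_le[of "h \<otimes> g t" "r.rp (avg Y) (perm_op S (actS (inv (g t))) \<xi>)"] by simp
      from norm_cmult_op_comp_le[OF this]
      show "norm ((?p t * (?p t - ?p (act h t))) *\<^sub>R (cmult_op (a h) o\<^sub>L (perm_op S (actS (h \<otimes> g t)) o\<^sub>L
          (r.rp (avg Y) o\<^sub>L perm_op S (actS (inv (g t))))))) \<le> ?p t * \<bar>?p t - ?p (act h t)\<bar> * norm (a h)"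
        unfolding norm_scaleR using Pp(3)[of t] by (intro mult_mono) (auto simp: abs_mult)
    qed
    also have "\<dots> = (\<Sum>h\<in>?A. (\<Sum>t\<in>?T. ?p t * \<bar>?p t - ?p (act h t)\<bar>) * norm (a h))"
      by (simp add: sum_distrib_right)
    also have "\<dots> \<le> (\<Sum>h\<in>?A. sqrt \<epsilon> * norm (a h))"
    proof (intro sum_mono mult_right_mono)
      fix h assume "h \<in> ?A"
      then show "(\<Sum>t\<in>?T. ?p t * \<bar>?p t - ?p (act h t)\<bar>) \<le> sqrt \<epsilon>" using A by (intro Pp(7)) auto
    qed simp
    also have "\<dots> = sqrt \<epsilon> * (\<Sum>h\<in>?A. norm (a h))" by (simp add: sum_distrib_left)
    finally show ?thesis using small by linarith
  qed
  let ?X = "\<lambda>h t. cmult_op (a h) o\<^sub>L (\<kappa>p (h \<otimes> g t) o\<^sub>L (E Y o\<^sub>L \<kappa>p (inv (g t))))"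
  have X: "?X h t = (cmult_op (a h) o\<^sub>L \<kappa>p h) o\<^sub>L E (conjugate (g t) Y)" if "h \<in> ?A" "t \<in> ?T" for h t
  proof -
    have hc: "h \<in> carrier H" using that(1) A by blast
    show ?thesis
      unfolding E_conj[OF Y gc[OF that(2)], symmetric] k.perm_comp[OF hc gc[OF that(2)], symmetric]
      by (simp only: blinfun_compose_assoc3)
  qed
  have k1: "k.rp c1 = (\<Sum>h\<in>?A. \<Sum>t\<in>?T. (?p t * ?p (act h t)) *\<^sub>R ?X h t)"
    unfolding rp1[OF k.group_perm_axioms]
  proof (rule sum.cong[OF refl])
    fix h assume h: "h \<in> ?A"
    then have hc: "h \<in> carrier H" using A by blast
    have "(\<Sum>t | t \<in> ?T \<and> act h t \<in> ?T. (?p t * ?p (act h t)) *\<^sub>R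
        (cmult_op (a h) o\<^sub>L (\<kappa>p (g (act h t)) o\<^sub>L (E Y o\<^sub>L \<kappa>p (inv (g t)))))) =
        (\<Sum>t | t \<in> ?T \<and> act h t \<in> ?T. (?p t * ?p (act h t)) *\<^sub>R ?X h t)"
    proof (rule sum.cong[OF refl])
      fix t assume "t \<in> {t. t \<in> ?T \<and> act h t \<in> ?T}"
      then have t: "t \<in> ?T" "act h t \<in> ?T" by auto
      \<comment> \<open>Both \<open>g (act h t)\<close> and \<open>h \<otimes> g t\<close> carry the
        base point to the same place, so they differ by an element of \<open>Y\<close>, and
        \<open>E Y\<close> absorbs this element.\<close>
      have "act (g (act h t)) ?o = act (h \<otimes> g t) ?o"
        using g[OF t(2)] g[OF t(1)] u.act_mult[OF hc gc[OF t(1)] base[OF Y]] by simp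
      then have y: "inv (g (act h t)) \<otimes> (h \<otimes> g t) \<in> Y"
        by (rule stab[OF Y gc[OF t(2)] m_closed[OF hc gc[OF t(1)]]])
      let ?y = "inv (g (act h t)) \<otimes> (h \<otimes> g t)"
      have yc: "?y \<in> carrier H" using gc[OF t(1)] gc[OF t(2)] hc by simp
      have "h \<otimes> g t = g (act h t) \<otimes> ?y" using gc[OF t(1)] gc[OF t(2)] hc by (simp add: cancel_inv)
      then have "\<kappa>p (h \<otimes> g t) = \<kappa>p (g (act h t)) o\<^sub>L \<kappa>p ?y"
        by (simp only: k.perm_comp[OF gc[OF t(2)] yc])
      then have "\<kappa>p (h \<otimes> g t) o\<^sub>L (E Y o\<^sub>L \<kappa>p (inv (g t))) = \<kappa>p (g (act h t)) o\<^sub>L ((\<kappa>p ?y o\<^sub>L E Y) o\<^sub>L \<kappa>p (inv (g t)))"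
        by (simp only: blinfun_compose_assoc3)
      then show "(?p t * ?p (act h t)) *\<^sub>R (cmult_op (a h) o\<^sub>L (\<kappa>p (g (act h t)) o\<^sub>L (E Y o\<^sub>L \<kappa>p (inv (g t))))) =
          (?p t * ?p (act h t)) *\<^sub>R ?X h t"
        by (simp only: E_absorb[OF Y y])
    qed
    also have "\<dots> = (\<Sum>t\<in>?T. (?p t * ?p (act h t)) *\<^sub>R ?X h t)"
    proof (rule sum.mono_neutral_left[OF Pp(1)])
      show "\<forall>t\<in>?T - {t. t \<in> ?T \<and> act h t \<in> ?T}. (?p t * ?p (act h t)) *\<^sub>R ?X h t = 0"
      proof
        fix t assume "t \<in> ?T - {t. t \<in> ?T \<and> act h t \<in> ?T}"
        then have "?p (act h t) = 0" by (intro Pp(4)) auto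
        then show "(?p t * ?p (act h t)) *\<^sub>R ?X h t = 0" by simp
      qed
    qed auto
    finally show "(\<Sum>t | t \<in> ?T \<and> act h t \<in> ?T. (?p t * ?p (act h t)) *\<^sub>R
        (cmult_op (a h) o\<^sub>L (\<kappa>p (g (act h t)) o\<^sub>L (E Y o\<^sub>L \<kappa>p (inv (g t)))))) =
        (\<Sum>t\<in>?T. (?p t * ?p (act h t)) *\<^sub>R ?X h t)" .
  qed
  have "k.rp (\<lambda>x. c1 x + c2 x) = (\<Sum>h\<in>?A. \<Sum>t\<in>?T. ((?p t)\<^sup>2) *\<^sub>R ?X h t)"
    unfolding k.rp_add[OF ga1 ga2] k1 rp2[OF k.group_perm_axioms] sum.distrib[symmetric] scaleR_add_left[symmetric]
    by (intro sum.cong refl) (simp add: power2_eq_square algebra_simps)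
  also have "\<dots> = (\<Sum>h\<in>?A. (cmult_op (a h) o\<^sub>L \<kappa>p h) o\<^sub>L (\<Sum>t\<in>?T. ((?p t)\<^sup>2) *\<^sub>R E (conjugate (g t) Y)))"
    unfolding compose_bilinear using X by (intro sum.cong refl) simp
  also have "\<dots> = k.rp a o\<^sub>L (\<Sum>t\<in>?T. ((?p t)\<^sup>2) *\<^sub>R E (conjugate (g t) Y))"
    by (simp add: compose_bilinear(1)[symmetric] perm_lin_def lin_ext_def)
  \<comment> \<open>All \<open>x\<close> carrying the base point to \<open>t\<close> agree with
    \<open>g t\<close> up to right multiplication by \<open>Y\<close> and give the same conjugate of
    \<open>Y\<close>. So the choice of \<open>g\<close> drops out.\<close>
  also have "(\<Sum>t\<in>?T. ((?p t)\<^sup>2) *\<^sub>R E (conjugate (g t) Y)) = (\<Sum>t\<in>?T. \<Sum>x\<in>{x \<in> ?B. act x ?o = t}. q x *\<^sub>R E (conjugate x Y))"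
  proof (rule sum.cong[OF refl])
    fix t assume t: "t \<in> ?T"
    have "((?p t)\<^sup>2) *\<^sub>R E (conjugate (g t) Y) = (\<Sum>x\<in>{x \<in> ?B. act x ?o = t}. q x *\<^sub>R E (conjugate (g t) Y))"
      unfolding Pp(5) scaleR_sum_left by simp
    also have "\<dots> = (\<Sum>x\<in>{x \<in> ?B. act x ?o = t}. q x *\<^sub>R E (conjugate x Y))"
    proof (rule sum.cong[OF refl])
      fix x assume "x \<in> {x \<in> ?B. act x ?o = t}"
      then have x: "x \<in> carrier H" "act x ?o = t" using B by auto
      then have y: "inv (g t) \<otimes> x \<in> Y"
        using stab[OF Y gc[OF t] x(1)] g[OF t] by simp
      have sub: "conjugate z Y \<subseteq> Y" if "z \<in> Y" for z
        unfolding conjugate_def using that subgroup.m_closed[OF subY[OF Y]] subgroup.m_inv_closed[OF subY[OF Y]] by auto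
      have "conjugate (inv (g t) \<otimes> x) Y = Y"
      proof
        show "conjugate (inv (g t) \<otimes> x) Y \<subseteq> Y" by (rule sub[OF y])
        have yc: "inv (g t) \<otimes> x \<in> carrier H" using x(1) gc[OF t] by simp
        have "Y = conjugate (inv (g t) \<otimes> x) (conjugate (inv (inv (g t) \<otimes> x)) Y)"
          using conjugate_mult[OF yc inv_closed[OF yc] YG[OF Y]] r_inv[OF yc] conjugate_one[OF YG[OF Y]] by simp
        also have "\<dots> \<subseteq> conjugate (inv (g t) \<otimes> x) Y"
          using sub[OF subgroup.m_inv_closed[OF subY[OF Y] y]] unfolding conjugate_def by blast
        finally show "Y \<subseteq> conjugate (inv (g t) \<otimes> x) Y" .
      qed
      then have "conjugate (g t) Y = conjugate (g t) (conjugate (inv (g t) \<otimes> x) Y)" by simp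
      also have "\<dots> = conjugate x Y"
        using conjugate_mult[OF gc[OF t] _ YG[OF Y], of "inv (g t) \<otimes> x"] gc[OF t] x(1) by (simp add: cancel_inv)
      finally show "q x *\<^sub>R E (conjugate (g t) Y) = q x *\<^sub>R E (conjugate x Y)" by simp
    qed
    finally show "((?p t)\<^sup>2) *\<^sub>R E (conjugate (g t) Y) = (\<Sum>x\<in>{x \<in> ?B. act x ?o = t}. q x *\<^sub>R E (conjugate x Y))" .
  qed
  also have "\<dots> = (\<Sum>x\<in>?B. q x *\<^sub>R E (conjugate x Y))"
    by (rule sum.group[OF B(1) Pp(1) order_refl])
  finally have kc: "k.rp (\<lambda>x. c1 x + c2 x) = k.rp a o\<^sub>L (\<Sum>x\<in>?B. q x *\<^sub>R E (conjugate x Y))" .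
  have "norm (r.rp (\<lambda>x. c1 x + c2 x)) \<le> norm (u.rp a) + \<delta>"
    unfolding r.rp_add[OF ga1 ga2] using n1 n2 norm_triangle_ineq[of "r.rp c1" "r.rp c2"] by linarith
  then show ?thesis using kc ga_add[OF ga1 ga2] by blast
qed

text \<open>Conjugation permutes the family, so summing over it turns every average of conjugates into the
  fixed element \<open>P\<close>.\<close>

lemma approx_right_mult_P:
  assumes a: "a \<in> group_algebra H" and \<delta>: "\<delta> > 0"
  shows "\<exists>c\<in>group_algebra H. norm (r.rp c) \<le> (\<Sum>Y\<in>\<C>. norm (perm_lin (Q Y) act a)) + \<delta> \<and>
    k.rp c = k.rp a o\<^sub>L k.rp P"
proof -
  let ?A = "{g. a g \<noteq> 0}"
  note A = group_algebraD[OF a]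
  \<comment> \<open>A single Reiter function has to serve the whole class, each member getting the
    share \<open>\<delta>'\<close> of the error; the added ones keep the denominators
    positive.\<close>
  define M where "M = (1 + card \<C>) * (1 + (\<Sum>h\<in>?A. norm (a h)))"
  have S0: "0 \<le> (\<Sum>h\<in>?A. norm (a h))" by (simp add: sum_nonneg)
  then have M: "M > 0" unfolding M_def by (intro mult_pos_pos) auto
  define \<delta>' where "\<delta>' = \<delta> / (1 + card \<C>)"
  define \<epsilon> where "\<epsilon> = (\<delta> / M)\<^sup>2"
  have \<epsilon>: "\<epsilon> > 0" unfolding \<epsilon>_def using \<delta> M by simp
  have \<delta>': "\<delta>' > 0" unfolding \<delta>'_def using \<delta> by simp
  obtain q where q: "Reiter_function H q (m_inv H ` ?A) \<epsilon>"
    using Reiter_function_exists[OF mean _ _ \<epsilon>, of "m_inv H ` ?A"] A by auto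
  let ?B = "{g. q g \<noteq> 0}"
  have B: "finite ?B" "?B \<subseteq> carrier H" "sum q ?B = 1" using q unfolding Reiter_function_def by auto
  have small: "sqrt \<epsilon> * (\<Sum>h\<in>?A. norm (a h)) \<le> \<delta>'"
  proof -
    have "sqrt \<epsilon> = \<delta> / M" unfolding \<epsilon>_def using \<delta> M by simp
    then have "sqrt \<epsilon> * (\<Sum>h\<in>?A. norm (a h)) \<le> (\<delta> / M) * (1 + (\<Sum>h\<in>?A. norm (a h)))"
      using \<delta> M S0 by (intro mult_mono) auto
    also have "\<dots> = \<delta>'" unfolding M_def \<delta>'_def using S0 by simp
    finally show ?thesis .
  qed
  have "\<forall>Y\<in>\<C>. \<exists>c. c \<in> group_algebra H \<and> norm (r.rp c) \<le> norm (perm_lin (Q Y) act a) + \<delta>' \<and>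
      k.rp c = k.rp a o\<^sub>L (\<Sum>g\<in>?B. q g *\<^sub>R E (conjugate g Y))"
    by (rule ballI, rule approx_right_mult[OF a _ \<delta>' q less_imp_le[OF \<epsilon>] small, unfolded Bex_def])
  from bchoice[OF this] obtain c where c': "\<forall>Y\<in>\<C>. c Y \<in> group_algebra H \<and>
      norm (r.rp (c Y)) \<le> norm (perm_lin (Q Y) act a) + \<delta>' \<and>
      k.rp (c Y) = k.rp a o\<^sub>L (\<Sum>g\<in>?B. q g *\<^sub>R E (conjugate g Y))" by (elim exE)
  have c: "Y \<in> \<C> \<Longrightarrow> c Y \<in> group_algebra H"
    "Y \<in> \<C> \<Longrightarrow> norm (r.rp (c Y)) \<le> norm (perm_lin (Q Y) act a) + \<delta>'"
    "Y \<in> \<C> \<Longrightarrow> k.rp (c Y) = k.rp a o\<^sub>L (\<Sum>g\<in>?B. q g *\<^sub>R E (conjugate g Y))" for Y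
    using c' by simp_all
  let ?c = "\<lambda>x. \<Sum>Y\<in>\<C>. c Y x"
  have ga: "?c \<in> group_algebra H" by (rule ga_sum) (rule c(1))
  have rsum: "r.rp ?c = (\<Sum>Y\<in>\<C>. r.rp (c Y))" by (rule r.rp_sum) (rule c(1))
  have ksum: "k.rp ?c = (\<Sum>Y\<in>\<C>. k.rp (c Y))" by (rule k.rp_sum) (rule c(1))
  have "norm (r.rp ?c) \<le> (\<Sum>Y\<in>\<C>. norm (perm_lin (Q Y) act a) + \<delta>')"
    unfolding rsum by (rule norm_sum_weighted_le) (rule c(2))
  also have "\<dots> = (\<Sum>Y\<in>\<C>. norm (perm_lin (Q Y) act a)) + card \<C> * \<delta>'" by (simp add: sum.distrib)
  also have "card \<C> * \<delta>' \<le> \<delta>" unfolding \<delta>'_def using \<delta> by (simp add: field_simps)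
  finally have n: "norm (r.rp ?c) \<le> (\<Sum>Y\<in>\<C>. norm (perm_lin (Q Y) act a)) + \<delta>" by simp
  have "k.rp ?c = (\<Sum>Y\<in>\<C>. k.rp a o\<^sub>L (\<Sum>g\<in>?B. q g *\<^sub>R E (conjugate g Y)))"
    unfolding ksum by (rule sum.cong[OF refl]) (rule c(3))
  also have "\<dots> = k.rp a o\<^sub>L (\<Sum>Y\<in>\<C>. \<Sum>g\<in>?B. q g *\<^sub>R E (conjugate g Y))"
    by (rule compose_bilinear(2)[symmetric])
  also have "(\<Sum>Y\<in>\<C>. \<Sum>g\<in>?B. q g *\<^sub>R E (conjugate g Y)) = (\<Sum>g\<in>?B. \<Sum>Y\<in>\<C>. q g *\<^sub>R E (conjugate g Y))"
    by (rule sum.swap)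
  also have "\<dots> = (\<Sum>g\<in>?B. q g *\<^sub>R k.rp P)"
    unfolding scaleR_sum_right[symmetric] using sum_E_conj B(2) by (intro sum.cong refl) (auto simp: kP)
  also have "\<dots> = k.rp P" unfolding scaleR_sum_left[symmetric] B(3) by simp
  finally show ?thesis using n ga by blast
qed

end

text \<open>\<open>\<one>\<close> acts as the projection onto the functions on \<open>S\<close>,
  through which every \<open>rp a\<close> factors on both sides.\<close>

lemma (in group_perm) rp_one:
  assumes a: "a \<in> group_algebra H"
  shows "perm_op S (act \<one>) o\<^sub>L rp a = rp a" "rp a o\<^sub>L perm_op S (act \<one>) = rp a"
proof -
  note A = group_algebraD[OF a]
  have one: "ell2_apply (perm_op S (act \<one>) \<xi>) s = (if s \<in> S then ell2_apply \<xi> s else 0)" for \<xi> s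
    using perm_apply[OF one_closed] act_one by simp
  show "perm_op S (act \<one>) o\<^sub>L rp a = rp a"
    by (rule blinfun_eqI, rule ell2_eqI) (simp add: one rp_apply[OF A(1) order_refl A(2)])
  show "rp a o\<^sub>L perm_op S (act \<one>) = rp a"
  proof (rule blinfun_eqI, rule ell2_eqI)
    fix \<xi> s
    have "act (inv g) s \<in> S" if "s \<in> S" "a g \<noteq> 0" for g
      using that A(2) by (intro act_closed inv_closed) auto
    then show "ell2_apply ((rp a o\<^sub>L perm_op S (act \<one>)) \<xi>) s = ell2_apply (rp a \<xi>) s"
      by (simp add: one rp_apply[OF A(1) order_refl A(2)])
  qed
qed

lemma adjoints_compose: "adjoints S S' \<Longrightarrow> adjoints T T' \<Longrightarrow> adjoints (S o\<^sub>L T) (T' o\<^sub>L S')"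
  by (simp add: adjoints_def)

lemma adjoints_zero_iff:
  assumes "adjoints T T'"
  shows "T = 0 \<longleftrightarrow> T' = 0"
proof -
  have "norm T = norm T'"
    using adjoints_norm_le[OF assms] adjoints_norm_le[OF adjoints_sym[OF assms]] by simp
  then show ?thesis by (metis norm_eq_zero)
qed

lemma adjoints_sum: "(\<And>i. i \<in> I \<Longrightarrow> adjoints (f i) (g i)) \<Longrightarrow> adjoints (\<Sum>i\<in>I. f i) (\<Sum>i\<in>I. g i)"
  by (simp add: adjoints_def blinfun.sum_left inner_sum_left inner_sum_right)

section \<open>The polynomial relation and the correction\<close>

context finite_core_class
begin

text \<open>Dicman's lemma in the quotient by \<open>K\<close>, applied to the image of
  \<open>\<Union>\<C>\<close>. This image is finite because each member has finite index over
  \<open>K\<close>, and it is closed under conjugation.\<close>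

lemma finite_invariant_cosets:
  obtains X where "finite X" "X \<subseteq> lcosets K" "K \<in> X" "\<And>Y y C. Y \<in> \<C> \<Longrightarrow> y \<in> Y \<Longrightarrow> C \<in> X \<Longrightarrow> y <# C \<in> X"
proof -
  let ?Q = "H Mod K"
  interpret q: group_hom H ?Q "\<lambda>a. K #> a" by (rule normal_quotient_hom[OF K])
  have lr: "K #> x = x <# K" if "x \<in> carrier H" for x
    using normal.coset_eq[OF K] that by blast
  let ?D = "(\<lambda>y. K #> y) ` (\<Union>\<C>)"
  have c: "y \<in> carrier H" if "y \<in> \<Union>\<C>" for y using that YG by blast
  have "?D = (\<Union>Y\<in>\<C>. (\<lambda>y. y <# K) ` reps Y)"
  proof -
    have "?D = (\<Union>Y\<in>\<C>. (\<lambda>y. y <# K) ` Y)" using lr c by auto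
    then show ?thesis using transversal_image(2)[OF _ reps] by simp
  qed
  then have D: "finite ?D" using fin reps_simps(1) by simp
  have Dc: "?D \<subseteq> carrier ?Q" using c q.hom_closed by blast
  have Dconj: "inv\<^bsub>?Q\<^esub> x \<otimes>\<^bsub>?Q\<^esub> d \<otimes>\<^bsub>?Q\<^esub> x \<in> ?D" if xd: "x \<in> ?D" "d \<in> ?D" for x d
  proof -
    obtain y z Y where yz: "y \<in> \<Union>\<C>" "x = K #> y" "Y \<in> \<C>" "z \<in> Y" "d = K #> z" using xd by blast
    have yc: "y \<in> carrier H" "z \<in> carrier H" using yz c by auto
    have "inv\<^bsub>?Q\<^esub> x \<otimes>\<^bsub>?Q\<^esub> d \<otimes>\<^bsub>?Q\<^esub> x = K #> (inv y \<otimes> z \<otimes> y)"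
      unfolding yz(2,5) using yc by (simp only: q.hom_mult q.hom_inv m_closed inv_closed)
    moreover have "inv y \<otimes> z \<otimes> y \<in> conjugate (inv y) Y" unfolding conjugate_def using yz(4) yc by force
    ultimately show ?thesis using conjY[OF yz(3) inv_closed[OF yc(1)]] by blast
  qed
  \<comment> \<open>The powers of \<open>y\<close> stay in the subgroup \<open>Y\<close>, so their
    cosets stay in the finite \<open>?D\<close> and must repeat.\<close>
  have Dtors: "\<exists>n>0. d [^]\<^bsub>?Q\<^esub> (n::nat) = \<one>\<^bsub>?Q\<^esub>" if d: "d \<in> ?D" for d
  proof -
    obtain y Y where y: "Y \<in> \<C>" "y \<in> Y" "d = K #> y" using d by blast
    have yc: "y \<in> carrier H" using y c by blast
    have "range (\<lambda>k::nat. K #> (y [^] k)) \<subseteq> ?D" using y subgroup_nat_pow[OF subY[OF y(1)] y(2)] by blast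
    then have "finite (range (\<lambda>k::nat. K #> (y [^] k)))" using D finite_subset by blast
    then have "\<not> inj (\<lambda>k::nat. K #> (y [^] k))" using finite_imageD infinite_UNIV_nat by blast
    then obtain i j :: nat where "i \<noteq> j" "K #> (y [^] i) = K #> (y [^] j)" unfolding inj_on_def by blast
    then obtain i j :: nat where ij: "i < j" "K #> (y [^] i) = K #> (y [^] j)"
      by (cases "i < j") (auto dest: sym simp: not_less le_less)
    define n where "n = j - i"
    have n: "n > 0" "j = i + n" using ij(1) unfolding n_def by auto
    have dc: "d \<in> carrier ?Q" unfolding y(3) by (rule q.hom_closed[OF yc])
    have pw: "d [^]\<^bsub>?Q\<^esub> (k::nat) = K #> (y [^] k)" for k
      unfolding y(3) by (rule q.hom_nat_pow[OF yc, symmetric])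
    have pc: "d [^]\<^bsub>?Q\<^esub> (k::nat) \<in> carrier ?Q" for k by (rule q.H.nat_pow_closed[OF dc])
    have "d [^]\<^bsub>?Q\<^esub> i \<otimes>\<^bsub>?Q\<^esub> d [^]\<^bsub>?Q\<^esub> n = d [^]\<^bsub>?Q\<^esub> (i + n)"
      by (rule q.H.nat_pow_mult[OF dc])
    also have "\<dots> = d [^]\<^bsub>?Q\<^esub> i" unfolding pw using ij(2) n(2) by simp
    finally have "d [^]\<^bsub>?Q\<^esub> n = \<one>\<^bsub>?Q\<^esub>"
      using q.H.l_cancel_one[OF pc pc] by blast
    then show ?thesis using n(1) by blast
  qed
  obtain X where X: "finite X" "X \<subseteq> carrier ?Q" "\<one>\<^bsub>?Q\<^esub> \<in> X" "\<And>d x. d \<in> ?D \<Longrightarrow> x \<in> X \<Longrightarrow> d \<otimes>\<^bsub>?Q\<^esub> x \<in> X"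
    using q.H.finite_generated_of_torsion_classes[OF D Dc Dconj Dtors] by blast
  show thesis
  proof (rule that[OF X(1)])
    show "X \<subseteq> lcosets K"
      using X(2) lr unfolding carrier_FactGroup LCOSETS_def by auto
    show "K \<in> X" using X(3) by simp
    fix Y y C assume y: "Y \<in> \<C>" "y \<in> Y" and C: "C \<in> X"
    obtain z where z: "z \<in> carrier H" "C = K #> z" using C X(2) unfolding carrier_FactGroup by blast
    have yc: "y \<in> carrier H" using y c by blast
    have "(K #> y) \<otimes>\<^bsub>?Q\<^esub> C \<in> X" by (rule X(4)) (use y C in auto)
    also have "(K #> y) \<otimes>\<^bsub>?Q\<^esub> C = K #> (y \<otimes> z)" unfolding z(2) using q.hom_mult[OF yc z(1)] by simp
    also have "\<dots> = y <# C" using lr[of "y \<otimes> z"] lr[OF z(1)] yc z KG by (simp add: lcos_m_assoc)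
    finally show "y <# C \<in> X" .
  qed
qed

text \<open>The powers are formed in the group algebra, since the relation between them holds over
  the cosets of \<open>K\<close> while norms are measured over \<open>S\<close>.\<close>

primrec cpow :: "nat \<Rightarrow> 'a \<Rightarrow> complex"
  where "cpow 0 = indc {\<one>}" | "cpow (Suc n) = conv H P (cpow n)"

lemma ga_cpow: "cpow n \<in> group_algebra H"
  by (induction n) (auto intro: ga_indc ga_conv ga_P)

definition W :: "nat \<Rightarrow> 'a set ell2 \<Rightarrow>\<^sub>L 'a set ell2" where "W n = k.rp (cpow n)"

lemma W_0: "W 0 = \<kappa>p \<one>" and W_Suc: "W (Suc n) = k.rp P o\<^sub>L W n"
  unfolding W_def by (simp_all add: k.rp_single k.rp_conv[OF ga_P ga_cpow])

lemma W_add: "W i o\<^sub>L W j = W (i + j)"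
proof (induction i)
  case 0 then show ?case unfolding W_0 by (simp add: W_def k.rp_one(1)[OF ga_cpow])
next
  case (Suc i) then show ?case unfolding W_Suc by (simp add: blinfun_compose_assoc3 W_Suc)
qed

lemma W_1: "W (Suc 0) = k.rp P"
  unfolding W_Suc W_0 by (rule k.rp_one(2)[OF ga_P])

lemma W_selfadj: "adjoints (W n) (W n)"
proof (induction n)
  case 0
  have "adjoints (\<kappa>p \<one>) (\<kappa>p \<one>)" unfolding adjoints_def using k.perm_adj[OF one_closed] by simp
  then show ?case unfolding W_0 .
next
  case (Suc n)
  have "adjoints (k.rp P) (k.rp P)" unfolding kP by (rule adjoints_sum) (rule E_selfadj)
  then have "adjoints (k.rp P o\<^sub>L W n) (W n o\<^sub>L k.rp P)" by (rule adjoints_compose[OF _ Suc])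
  moreover have "W n o\<^sub>L k.rp P = W (Suc n)" unfolding W_1[symmetric] W_add by simp
  ultimately show ?case unfolding W_Suc by (simp add: W_Suc)
qed

lemma K_coset: "K \<in> lcosets K"
  using lcos_mult_one[OF KG] one_closed unfolding LCOSETS_def by (metis (no_types, lifting) UN_iff insertI1)

text \<open>All vectors \<open>W j (delta K)\<close> lie in the span of a finite set of cosets that
  is invariant under the members of \<open>\<C>\<close>, so they are linearly dependent. As
  \<open>delta K\<close> is separating, the relation holds for the operators too.\<close>

lemma W_relation:
  obtains n \<alpha> k where "k \<le> n" "\<alpha> k \<noteq> (0::real)" "\<forall>j<k. \<alpha> j = 0" "(\<Sum>j\<le>n. \<alpha> j *\<^sub>R W j) = 0"
proof -
  obtain X where X: "finite X" "X \<subseteq> lcosets K" "K \<in> X" "\<And>Y y C. Y \<in> \<C> \<Longrightarrow> y \<in> Y \<Longrightarrow> C \<in> X \<Longrightarrow> y <# C \<in> X"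
    using finite_invariant_cosets by blast
  let ?B = "delta ` X"
  have pinv: "\<kappa>p y x \<in> span ?B" if x: "x \<in> span ?B" and y: "Y \<in> \<C>" "y \<in> Y" for x y Y
  proof -
    have yc: "y \<in> carrier H" using y YG by blast
    have "subspace {x. \<kappa>p y x \<in> span ?B}"
      unfolding subspace_def
      by (auto simp: blinfun.zero_right blinfun.add_right blinfun.scaleR_right span_zero span_add span_scale)
    moreover have "?B \<subseteq> {x. \<kappa>p y x \<in> span ?B}"
      using X(2,4) y k.perm_delta[OF yc] by (auto intro!: span_base)
    ultimately have "span ?B \<subseteq> {x. \<kappa>p y x \<in> span ?B}" by (rule span_minimal[rotated])
    then show ?thesis using x by blast
  qed
  have "W j (delta K) \<in> span ?B" for j
  proof (induction j)
    case 0
    have "W 0 (delta K) = delta K"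
      unfolding W_0 using k.perm_delta[OF one_closed K_coset] k.act_one[OF K_coset] by simp
    then show ?case using X(3) by (simp add: span_base)
  next
    case (Suc j)
    have "E Y (W j (delta K)) \<in> span ?B" if Y: "Y \<in> \<C>" for Y
      unfolding rp_avg[OF k.group_perm_axioms Y] blinfun.scaleR_left blinfun.sum_left
      by (intro span_scale span_sum pinv[OF Suc Y]) (use reps_simps(2)[OF Y] in auto)
    then show ?case unfolding W_Suc kP by (simp add: blinfun.sum_left span_sum)
  qed
  from sequence_in_finite_span_dependent[OF finite_imageI[OF X(1)] this]
  obtain n \<alpha> k0 where rel: "k0 \<le> n" "\<alpha> k0 \<noteq> (0::real)" "(\<Sum>j\<le>n. \<alpha> j *\<^sub>R W j (delta K)) = 0" .
  \<comment> \<open>The relation is read from its lowest nonzero coefficient, which later allows the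
    corresponding power to be solved for.\<close>
  define k1 where "k1 = (LEAST k. \<alpha> k \<noteq> 0)"
  have k1: "\<alpha> k1 \<noteq> 0" "k1 \<le> k0" "\<And>j. j < k1 \<Longrightarrow> \<alpha> j = 0"
    unfolding k1_def using LeastI[of "\<lambda>k. \<alpha> k \<noteq> 0", OF rel(2)] Least_le[of "\<lambda>k. \<alpha> k \<noteq> 0", OF rel(2)]
      not_less_Least[of _ "\<lambda>k. \<alpha> k \<noteq> 0"] by blast+
  let ?f = "\<lambda>x. \<Sum>j\<le>n. of_real (\<alpha> j) * cpow j x"
  have gf: "?f \<in> group_algebra H" by (intro ga_sum ga_scale ga_cpow)
  have kf: "k.rp ?f = (\<Sum>j\<le>n. \<alpha> j *\<^sub>R W j)"
  proof -
    have "k.rp ?f = (\<Sum>j\<le>n. k.rp (\<lambda>x. of_real (\<alpha> j) * cpow j x))" by (rule k.rp_sum) (intro ga_scale ga_cpow)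
    also have "\<dots> = (\<Sum>j\<le>n. \<alpha> j *\<^sub>R W j)" unfolding W_def by (intro sum.cong refl k.rp_scaleR ga_cpow)
    finally show ?thesis .
  qed
  have "k.rp ?f (delta K) = 0" unfolding kf using rel(3) by (simp add: blinfun.sum_left blinfun.scaleR_left)
  then have "k.rp ?f = 0" by (rule coset_rep_normal_eq_0[OF K gf])
  then show thesis using that[of k1 n \<alpha>] k1 rel(1) kf by simp
qed

text \<open>Positivity at work: after taking adjoints, powers of the selfadjoint
  \<open>k.rp P\<close> can be stripped down to the first one. A sum of projections annihilates only
  what each summand annihilates, so \<open>k.rp b o\<^sub>L E Y = 0\<close>, and the entries of this
  product at \<open>delta K\<close> are multiples of coset sums.\<close>

lemma coset_sum_eq_0:
  assumes b: "b \<in> group_algebra H" and W0: "k.rp b o\<^sub>L W j = 0" and Y: "Y \<in> \<C>" and t: "t \<in> carrier H"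
  shows "coset_sum H b t Y = 0"
proof -
  let ?U = "k.rp b" and ?U' = "k.rp (star H b)"
  have adj: "adjoints ?U ?U'" by (rule k.rp_adj[OF b])
  have aW: "?U o\<^sub>L W i = 0 \<longleftrightarrow> W i o\<^sub>L ?U' = 0" for i
    by (rule adjoints_zero_iff[OF adjoints_compose[OF adj W_selfadj]])
  have down: "W (Suc i) o\<^sub>L ?U' = 0" if "W (Suc (Suc i)) o\<^sub>L ?U' = 0" for i
  proof (rule blinfun_eqI)
    fix \<xi>
    have "inner (W (Suc i) (?U' \<xi>)) (W (Suc i) (?U' \<xi>)) = inner (?U' \<xi>) ((W (Suc i) o\<^sub>L W (Suc i)) (?U' \<xi>))"
      using W_selfadj[of "Suc i"] by (simp add: adjoints_def)
    also have "W (Suc i) o\<^sub>L W (Suc i) = W i o\<^sub>L W (Suc (Suc i))" by (simp add: W_add)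
    also have "(W i o\<^sub>L W (Suc (Suc i))) (?U' \<xi>) = W i ((W (Suc (Suc i)) o\<^sub>L ?U') \<xi>)" by simp
    also have "\<dots> = 0" unfolding that by (simp add: blinfun.zero_right)
    finally show "(W (Suc i) o\<^sub>L ?U') \<xi> = (0 :: 'a set ell2 \<Rightarrow>\<^sub>L 'a set ell2) \<xi>" by simp
  qed
  have "W (Suc i) o\<^sub>L ?U' = 0 \<Longrightarrow> W (Suc 0) o\<^sub>L ?U' = 0" for i
    by (induction i) (use down in auto)
  \<comment> \<open>The descent starts at a positive power, so one more factor is multiplied on;
    this also covers \<open>j = 0\<close>.\<close>
  moreover have "W (Suc j) o\<^sub>L ?U' = 0"
  proof -
    have "W (Suc j) o\<^sub>L ?U' = k.rp P o\<^sub>L (W j o\<^sub>L ?U')" unfolding W_Suc blinfun_compose_assoc3 ..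
    then show ?thesis using W0 aW[of j] by (simp add: compose_bilinear)
  qed
  ultimately have V0: "k.rp P o\<^sub>L ?U' = 0" unfolding W_1 by blast
  have EU: "E Y o\<^sub>L ?U' = 0"
  proof (rule blinfun_eqI)
    fix \<xi>
    let ?\<eta> = "?U' \<xi>"
    have sq: "inner (E Y' ?\<eta>) ?\<eta> = (norm (E Y' ?\<eta>))\<^sup>2" if Y': "Y' \<in> \<C>" for Y'
    proof -
      have "inner (E Y' ?\<eta>) ?\<eta> = inner ((E Y' o\<^sub>L E Y') ?\<eta>) ?\<eta>" by (simp only: E_idem[OF Y'])
      also have "\<dots> = inner (E Y' ?\<eta>) (E Y' ?\<eta>)" using E_selfadj[OF Y'] by (simp add: adjoints_def)
      finally show ?thesis by (simp add: power2_norm_eq_inner)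
    qed
    \<comment> \<open>The quadratic form of \<open>k.rp P\<close> is the sum of the squared norms of
      the projections.\<close>
    have "(\<Sum>Y'\<in>\<C>. (norm (E Y' ?\<eta>))\<^sup>2) = inner ((k.rp P o\<^sub>L ?U') \<xi>) ?\<eta>"
      using sq by (simp add: kP blinfun.sum_left inner_sum_left)
    also have "\<dots> = 0" unfolding V0 by simp
    finally have "(norm (E Y ?\<eta>))\<^sup>2 = 0" using sum_nonneg_eq_0_iff[OF fin, of "\<lambda>Y'. (norm (E Y' ?\<eta>))\<^sup>2"] Y by auto
    then show "(E Y o\<^sub>L ?U') \<xi> = (0 :: 'a set ell2 \<Rightarrow>\<^sub>L 'a set ell2) \<xi>" by simp
  qed
  have UE: "?U o\<^sub>L E Y = 0"
    using adjoints_zero_iff[OF adjoints_compose[OF adj E_selfadj[OF Y]]] EU by blast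
  note A = group_algebraD[OF b]
  let ?R = "reps Y"
  have tc: "t <# K \<in> lcosets K" using t unfolding LCOSETS_def by blast
  have RY: "r \<in> Y" "r \<in> carrier H" if "r \<in> ?R" for r using that reps_simps(2,3)[OF Y] by auto
  have Ed: "E Y (delta K) = (1 / real (card ?R)) *\<^sub>R (\<Sum>r\<in>?R. delta (r <# K))"
    unfolding rp_avg[OF k.group_perm_axioms Y] using k.perm_delta[OF RY(2) K_coset]
    by (simp add: blinfun.scaleR_left blinfun.sum_left)
  have "(?U o\<^sub>L E Y) (delta K) = (1 / real (card ?R)) *\<^sub>R (\<Sum>r\<in>?R. ?U (delta (r <# K)))"
    using Ed by (simp add: blinfun.scaleR_right blinfun.sum_right)
  then have "(\<Sum>r\<in>?R. ?U (delta (r <# K))) = 0" using UE reps_simps(4)[OF Y] by simp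
  then have "0 = ell2_apply (\<Sum>r\<in>?R. ?U (delta (r <# K))) (t <# K)" by simp
  also have "\<dots> = (\<Sum>r\<in>?R. \<Sum>g | b g \<noteq> 0. b g * (if inv g <# (t <# K) = r <# K then 1 else 0))"
    using k.rp_apply[OF A(1) order_refl A(2)] tc by simp
  also have "\<dots> = (\<Sum>g | b g \<noteq> 0. b g * (\<Sum>r\<in>?R. if inv g <# (t <# K) = r <# K then 1 else 0))"
    unfolding sum_distrib_left by (rule sum.swap)
  also have "\<dots> = (\<Sum>g | b g \<noteq> 0. if g \<in> t <# Y then b g else 0)"
  proof (rule sum.cong[OF refl])
    fix g assume "g \<in> {g. b g \<noteq> 0}"
    then have g: "g \<in> carrier H" using A by blast
    define z where "z = inv g \<otimes> t"
    have z: "z \<in> carrier H" unfolding z_def using g t by simp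
    have zc: "inv g <# (t <# K) = z <# K" unfolding z_def using g t KG by (simp add: lcos_m_assoc)
    have zY: "z \<in> Y \<longleftrightarrow> g \<in> t <# Y"
    proof -
      have "inv z = inv t \<otimes> g" unfolding z_def using g t by (simp add: inv_mult_group)
      moreover have "z \<in> Y \<longleftrightarrow> inv z \<in> Y"
        using subgroup.m_inv_closed[OF subY[OF Y], of z] subgroup.m_inv_closed[OF subY[OF Y], of "inv z"] inv_inv[OF z] by metis
      ultimately have "z \<in> Y \<longleftrightarrow> inv t \<otimes> g \<in> Y" by simp
      then show ?thesis using mem_lcoset_iff[OF YG[OF Y] g t] by simp
    qed
    have "(\<Sum>r\<in>?R. if z <# K = r <# K then 1 else 0 :: complex) = (if z \<in> Y then 1 else 0)"
    proof (cases "z \<in> Y")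
      case True
      have "z <# K \<in> (\<lambda>x. x <# K) ` ?R" unfolding transversal_image(2)[OF Y reps[OF Y]] using True by blast
      then obtain r0 where r0: "r0 \<in> ?R" "z <# K = r0 <# K" by blast
      have "z <# K = r <# K \<longleftrightarrow> r = r0" if "r \<in> ?R" for r
        using inj_onD[OF transversal_image(1)[OF Y reps[OF Y]] _ that r0(1)] r0(2) by auto
      then have "(\<Sum>r\<in>?R. if z <# K = r <# K then 1 else 0 :: complex) = (\<Sum>r\<in>?R. if r = r0 then 1 else 0)"
        by (intro sum.cong) auto
      also have "\<dots> = 1" using r0(1) reps_simps(1)[OF Y] by simp
      finally show ?thesis using True by simp
    next
      case False
      have "z <# K \<noteq> r <# K" if "r \<in> ?R" for r
      proof
        assume "z <# K = r <# K"
        then have "r <# K = z <# K" by simp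
        then have "inv r \<otimes> z \<in> K" using lcoset_eq_iff[OF normal_imp_subgroup[OF K] RY(2)[OF that] z] by blast
        then have "r \<otimes> (inv r \<otimes> z) \<in> Y" using KY[OF Y] subgroup.m_closed[OF subY[OF Y] RY(1)[OF that]] by blast
        then show False using False z RY(2)[OF that] by (simp add: cancel_inv)
      qed
      then show ?thesis using False by (simp add: sum.neutral)
    qed
    then show "b g * (\<Sum>r\<in>?R. if inv g <# (t <# K) = r <# K then 1 else 0) = (if g \<in> t <# Y then b g else 0)"
      unfolding zc zY[symmetric] by simp
  qed
  also have "\<dots> = coset_sum H b t Y"
    unfolding coset_sum_def using sum.inter_filter[OF A(1), of b "\<lambda>g. g \<in> t <# Y"] by simp
  finally show ?thesis by simp
qed

text \<open>Normalising the relation, the power \<open>k0\<close> is minus a combination of higher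
  powers. Each term of \<open>a\<close> times this combination contains a factor \<open>a P\<close>,
  whose lift \<open>c\<close> is small over \<open>S\<close>; replacing that factor by
  \<open>c\<close> gives a small \<open>d\<close> such that \<open>a + d\<close> annihilates
  \<open>W k0\<close>. The constant depends on the class but not on \<open>a\<close>.\<close>

lemma vanishing_approx:
  "\<exists>C\<ge>0. \<forall>a\<in>group_algebra H. \<forall>s. (\<forall>Y\<in>\<C>. norm (perm_lin (Q Y) act a) \<le> s) \<longrightarrow> (\<forall>\<delta>>0.
    \<exists>b\<in>group_algebra H. (\<forall>Y\<in>\<C>. \<forall>t\<in>carrier H. coset_sum H b t Y = 0) \<and> norm (r.rp a - r.rp b) \<le> C * s + \<delta>)"
proof -
  obtain n \<alpha> k0 where rel: "k0 \<le> n" "\<alpha> k0 \<noteq> (0::real)" "\<forall>j<k0. \<alpha> j = 0" "(\<Sum>j\<le>n. \<alpha> j *\<^sub>R W j) = 0"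
    by (rule W_relation) (rule that)
  define \<beta> where "\<beta> j = \<alpha> j / \<alpha> k0" for j
  \<comment> \<open>The factor by which the correction \<open>d\<close> may exceed the norm of
    \<open>c\<close>.\<close>
  define M where "M = (\<Sum>j\<in>{k0<..n}. \<bar>\<beta> j\<bar> * norm (r.rp (cpow (j - k0 - 1))))"
  have M: "M \<ge> 0" unfolding M_def by (intro sum_nonneg) auto
  have main: "\<exists>b\<in>group_algebra H. (\<forall>Y\<in>\<C>. \<forall>t\<in>carrier H. coset_sum H b t Y = 0) \<and>
      norm (r.rp a - r.rp b) \<le> (card \<C> * M) * s + \<delta>"
    if a: "a \<in> group_algebra H" and s: "\<forall>Y\<in>\<C>. norm (perm_lin (Q Y) act a) \<le> s" and \<delta>: "\<delta> > 0" for a s \<delta>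
  proof -
    define \<delta>' where "\<delta>' = \<delta> / (M + 1)"
    have \<delta>': "\<delta>' > 0" unfolding \<delta>'_def using \<delta> M by simp
    obtain c where c: "c \<in> group_algebra H" "norm (r.rp c) \<le> (\<Sum>Y\<in>\<C>. norm (perm_lin (Q Y) act a)) + \<delta>'"
      "k.rp c = k.rp a o\<^sub>L k.rp P"
      using approx_right_mult_P[OF a \<delta>'] by blast
    \<comment> \<open>\<open>k.rp c\<close> already contains one factor \<open>P\<close>; with
      \<open>j - k0 - 1\<close> further ones and the \<open>W k0\<close> multiplied on the right,
      the total is \<open>W j\<close>.\<close>
    define d where "d x = (\<Sum>j\<in>{k0<..n}. of_real (\<beta> j) * conv H c (cpow (j - k0 - 1)) x)" for x
    have gd: "d \<in> group_algebra H" unfolding d_def[abs_def] by (intro ga_sum ga_scale ga_conv c(1) ga_cpow)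
    have rpd: "perm_lin U actU d = (\<Sum>j\<in>{k0<..n}. \<beta> j *\<^sub>R (perm_lin U actU c o\<^sub>L perm_lin U actU (cpow (j - k0 - 1))))"
      if U: "group_perm H U actU" for U :: "'u set" and actU
    proof -
      interpret v: group_perm H U actU by (rule U)
      have "v.rp d = (\<Sum>j\<in>{k0<..n}. v.rp (\<lambda>x. of_real (\<beta> j) * conv H c (cpow (j - k0 - 1)) x))"
        unfolding d_def[abs_def] by (rule v.rp_sum) (intro ga_scale ga_conv c(1) ga_cpow)
      also have "\<dots> = (\<Sum>j\<in>{k0<..n}. \<beta> j *\<^sub>R (v.rp c o\<^sub>L v.rp (cpow (j - k0 - 1))))"
        by (intro sum.cong refl) (simp only: v.rp_scaleR[OF ga_conv[OF c(1) ga_cpow]] v.rp_conv[OF c(1) ga_cpow])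
      finally show ?thesis .
    qed
    let ?b = "\<lambda>x. a x + d x"
    have gb: "?b \<in> group_algebra H" by (rule ga_add[OF a gd])
    have "k.rp ?b o\<^sub>L W k0 = (1 / \<alpha> k0) *\<^sub>R (k.rp a o\<^sub>L (\<Sum>j\<le>n. \<alpha> j *\<^sub>R W j))"
    proof -
      have "k.rp d o\<^sub>L W k0 = (\<Sum>j\<in>{k0<..n}. \<beta> j *\<^sub>R (k.rp a o\<^sub>L W j))"
        unfolding rpd[OF k.group_perm_axioms] compose_bilinear
      proof (rule sum.cong[OF refl])
        fix j assume "j \<in> {k0<..n}"
        then have j: "Suc (j - k0 - 1) + k0 = j" by auto
        have "(k.rp c o\<^sub>L k.rp (cpow (j - k0 - 1))) o\<^sub>L W k0 = k.rp a o\<^sub>L (W (Suc (j - k0 - 1)) o\<^sub>L W k0)"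
          unfolding c(3) W_Suc by (simp only: W_def blinfun_compose_assoc3)
        also have "\<dots> = k.rp a o\<^sub>L W j" unfolding W_add j ..
        finally show "\<beta> j *\<^sub>R ((k.rp c o\<^sub>L k.rp (cpow (j - k0 - 1))) o\<^sub>L W k0) = \<beta> j *\<^sub>R (k.rp a o\<^sub>L W j)" by simp
      qed
      then have "k.rp ?b o\<^sub>L W k0 = (k.rp a o\<^sub>L W k0) + (\<Sum>j\<in>{k0<..n}. \<beta> j *\<^sub>R (k.rp a o\<^sub>L W j))"
        unfolding k.rp_add[OF a gd] by (simp add: bounded_bilinear.add_left[OF bounded_bilinear_blinfun_compose])
      also have "\<dots> = (\<Sum>j\<in>{k0..n}. \<beta> j *\<^sub>R (k.rp a o\<^sub>L W j))"
      proof -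
        have "{k0..n} = insert k0 {k0<..n}" using rel(1) by auto
        then show ?thesis using rel(2) by (simp add: \<beta>_def)
      qed
      also have "\<dots> = (\<Sum>j\<le>n. \<beta> j *\<^sub>R (k.rp a o\<^sub>L W j))"
        by (rule sum.mono_neutral_left) (use rel(3) in \<open>auto simp: \<beta>_def not_le\<close>)
      also have "\<dots> = (1 / \<alpha> k0) *\<^sub>R (k.rp a o\<^sub>L (\<Sum>j\<le>n. \<alpha> j *\<^sub>R W j))"
        unfolding compose_bilinear scaleR_sum_right by (simp add: \<beta>_def)
      finally show ?thesis .
    qed
    also have "\<dots> = 0" unfolding rel(4) by (simp add: compose_bilinear)
    finally have "k.rp ?b o\<^sub>L W k0 = 0" .
    then have "\<forall>Y\<in>\<C>. \<forall>t\<in>carrier H. coset_sum H ?b t Y = 0" by (intro ballI coset_sum_eq_0[OF gb])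
    moreover have "norm (r.rp a - r.rp ?b) \<le> (card \<C> * M) * s + \<delta>"
    proof -
      have "norm (r.rp a - r.rp ?b) = norm (r.rp d)" unfolding r.rp_add[OF a gd] by simp
      also have "\<dots> \<le> (\<Sum>j\<in>{k0<..n}. \<bar>\<beta> j\<bar> * norm (r.rp (cpow (j - k0 - 1))) * norm (r.rp c))"
        unfolding rpd[OF rho]
      proof (rule norm_sum_weighted_le)
        fix j
        have "norm (r.rp c o\<^sub>L r.rp (cpow (j - k0 - 1))) \<le> norm (r.rp c) * norm (r.rp (cpow (j - k0 - 1)))"
          by (rule norm_blinfun_compose)
        then show "norm (\<beta> j *\<^sub>R (r.rp c o\<^sub>L r.rp (cpow (j - k0 - 1)))) \<le> \<bar>\<beta> j\<bar> * norm (r.rp (cpow (j - k0 - 1))) * norm (r.rp c)"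
          by (simp add: mult_left_mono mult_ac)
      qed
      also have "\<dots> = M * norm (r.rp c)" unfolding M_def sum_distrib_right ..
      also have "\<dots> \<le> M * ((\<Sum>Y\<in>\<C>. s) + \<delta>')"
      proof (rule mult_left_mono[OF _ M])
        have "(\<Sum>Y\<in>\<C>. norm (perm_lin (Q Y) act a)) \<le> (\<Sum>Y\<in>\<C>. s)" using s by (intro sum_mono) auto
        then show "norm (r.rp c) \<le> (\<Sum>Y\<in>\<C>. s) + \<delta>'" using c(2) by linarith
      qed
      also have "\<dots> = (card \<C> * M) * s + M * \<delta>'" by (simp add: algebra_simps)
      also have "M * \<delta>' \<le> \<delta>" unfolding \<delta>'_def using M \<delta> by (simp add: field_simps)
      finally show ?thesis by simp
    qed
    ultimately show ?thesis using gb by blast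
  qed
  show ?thesis
  proof (intro exI[of _ "card \<C> * M"] conjI ballI allI impI)
    show "0 \<le> card \<C> * M" using M by simp
  qed (rule main)
qed

end

section \<open>Kernels of permutation representations\<close>

lemma selfadj_set_perm_lin:
  assumes "group_perm H S act"
  shows "selfadj_set (perm_lin S act ` group_algebra H)"
proof -
  interpret group_perm H S act by (rule assms)
  show ?thesis unfolding selfadj_set_def using rp_adj ga_star by blast
qed

text \<open>The kernel is taken in one representation, while the ideal lives in the other one, whose
  norm measures distances.\<close>

lemma op_ideal_perm_lin_kernel:
  assumes S: "group_perm H S actS" and U: "group_perm H U actU"
  shows "op_ideal (perm_lin S actS ` group_algebra H)
    (perm_lin S actS ` {b \<in> group_algebra H. perm_lin U actU b = 0})"
proof -
  interpret s: group_perm H S actS by (rule S)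
  interpret u: group_perm H U actU by (rule U)
  let ?I = "{b \<in> group_algebra H. u.rp b = 0}"
  show ?thesis unfolding op_ideal_def
  proof (intro conjI ballI allI)
    show "s.rp ` ?I \<subseteq> s.rp ` group_algebra H" by blast
    show "0 \<in> s.rp ` ?I"
      by (rule image_eqI[of _ _ "\<lambda>_. 0"]) (simp_all add: s.rp_zero u.rp_zero ga_zero)
  next
    fix T T' assume "T \<in> s.rp ` ?I" "T' \<in> s.rp ` ?I"
    then obtain b b' where b: "b \<in> group_algebra H" "u.rp b = 0" "T = s.rp b"
      "b' \<in> group_algebra H" "u.rp b' = 0" "T' = s.rp b'" by blast
    show "T + T' \<in> s.rp ` ?I"
      by (rule image_eqI[of _ _ "\<lambda>x. b x + b' x"]) (use b in \<open>simp_all add: s.rp_add u.rp_add ga_add\<close>)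
  next
    fix r :: real and T assume "T \<in> s.rp ` ?I"
    then obtain b where b: "b \<in> group_algebra H" "u.rp b = 0" "T = s.rp b" by blast
    show "r *\<^sub>R T \<in> s.rp ` ?I"
      by (rule image_eqI[of _ _ "\<lambda>x. of_real r * b x"]) (use b in \<open>simp_all add: s.rp_scaleR u.rp_scaleR ga_scale\<close>)
  next
    fix T A assume "T \<in> s.rp ` ?I" "A \<in> s.rp ` group_algebra H"
    then obtain b a where b: "b \<in> group_algebra H" "u.rp b = 0" "T = s.rp b" and a: "a \<in> group_algebra H" "A = s.rp a"
      by blast
    show "T o\<^sub>L A \<in> s.rp ` ?I"
      by (rule image_eqI[of _ _ "conv H b a"])
        (use a b in \<open>simp_all add: s.rp_conv u.rp_conv s.ga_conv compose_bilinear\<close>)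
    show "A o\<^sub>L T \<in> s.rp ` ?I"
      by (rule image_eqI[of _ _ "conv H a b"])
        (use a b in \<open>simp_all add: s.rp_conv u.rp_conv s.ga_conv compose_bilinear\<close>)
  qed
qed

lemma (in group) regular_coefficient:
  assumes a: "a \<in> group_algebra G" and g: "g \<in> carrier G"
  shows "ell2_apply (perm_lin (carrier G) (\<lambda>g h. g \<otimes> h) a (delta \<one>)) g = a g"
proof -
  interpret r: group_perm G "carrier G" "\<lambda>g h. g \<otimes> h" by (rule regular_group_perm)
  note A = group_algebraD[OF a]
  have "inv h \<otimes> g = \<one> \<longleftrightarrow> h = g" if "h \<in> {g. a g \<noteq> 0}" for h
  proof -
    have h: "h \<in> carrier G" using that A by blast
    show ?thesis
    proof
      assume "inv h \<otimes> g = \<one>"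
      then have "h \<otimes> (inv h \<otimes> g) = h" using h by simp
      then show "h = g" using h g by (simp add: cancel_inv)
    qed (use h in simp)
  qed
  then have "ell2_apply (r.rp a (delta \<one>)) g = (\<Sum>h | a h \<noteq> 0. if h = g then a h else 0)"
    using r.rp_apply[OF A(1) order_refl A(2)] g by (auto intro!: sum.cong)
  also have "\<dots> = a g" using A(1) by simp
  finally show ?thesis .
qed

text \<open>The coefficients of \<open>a\<close> are read off at \<open>delta \<one>\<close>. Hence
  an operator lying in several of the ideals comes from a single element of the group
  algebra.\<close>

lemma (in group) regular_inj:
  assumes a: "a \<in> group_algebra G" "b \<in> group_algebra G"
    and eq: "perm_lin (carrier G) (\<lambda>g h. g \<otimes> h) a = perm_lin (carrier G) (\<lambda>g h. g \<otimes> h) b"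
  shows "a = b"
proof
  fix g
  show "a g = b g"
  proof (cases "g \<in> carrier G")
    case True
    then show ?thesis using regular_coefficient[OF a(1) True] regular_coefficient[OF a(2) True] eq by simp
  next
    case False
    then have "a g = 0" "b g = 0" using group_algebraD(2)[OF a(1)] group_algebraD(2)[OF a(2)] by blast+
    then show ?thesis by simp
  qed
qed

section \<open>Restriction to subgroups\<close>

lemma group_algebra_restrict:
  assumes "\<Lambda> \<subseteq> carrier G" "a \<in> group_algebra (G\<lparr>carrier := \<Lambda>\<rparr>)"
  shows "a \<in> group_algebra G"
  using assms unfolding group_algebra_def by auto

lemma group_perm_restrict:
  assumes S: "group_perm G S act" and \<Lambda>: "subgroup \<Lambda> G"
  shows "group_perm (G\<lparr>carrier := \<Lambda>\<rparr>) S act"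
proof -
  interpret group_perm G S act by (rule S)
  interpret h: group "G\<lparr>carrier := \<Lambda>\<rparr>" by (rule subgroup_imp_group[OF \<Lambda>])
  have "g \<in> carrier G" if "g \<in> \<Lambda>" for g using that subgroup.subset[OF \<Lambda>] by blast
  then show ?thesis by unfold_locales (simp_all add: act_closed act_mult act_one)
qed

lemma coset_sum_restrict: "coset_sum (G\<lparr>carrier := \<Lambda>\<rparr>) f t Y = coset_sum G f t Y"
  by (simp add: coset_sum_def l_coset_def)

lemma (in group) conjugate_restrict:
  assumes \<Lambda>: "subgroup \<Lambda> G" and g: "g \<in> \<Lambda>"
  shows "group.conjugate (G\<lparr>carrier := \<Lambda>\<rparr>) g Y = conjugate g Y"
proof -
  interpret h: group "G\<lparr>carrier := \<Lambda>\<rparr>" by (rule subgroup_imp_group[OF \<Lambda>])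
  show ?thesis unfolding h.conjugate_def conjugate_def using m_inv_consistent[OF \<Lambda> g] by simp
qed

lemma (in group) conjugate_subgroup_Int:
  assumes \<Lambda>: "subgroup \<Lambda> G" and g: "g \<in> \<Lambda>" and X: "X \<subseteq> carrier G"
  shows "conjugate g (X \<inter> \<Lambda>) = conjugate g X \<inter> \<Lambda>"
proof
  have gc: "g \<in> carrier G" using g subgroup.subset[OF \<Lambda>] by blast
  show "conjugate g (X \<inter> \<Lambda>) \<subseteq> conjugate g X \<inter> \<Lambda>"
    unfolding conjugate_def
    using subgroup.m_closed[OF \<Lambda>] subgroup.m_inv_closed[OF \<Lambda>] g by auto
  show "conjugate g X \<inter> \<Lambda> \<subseteq> conjugate g (X \<inter> \<Lambda>)"
  proof
    fix z assume "z \<in> conjugate g X \<inter> \<Lambda>"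
    then obtain x where x: "x \<in> X" "z = g \<otimes> x \<otimes> inv g" "z \<in> \<Lambda>" unfolding conjugate_def by blast
    have xc: "x \<in> carrier G" using x X by blast
    have "x = inv g \<otimes> z \<otimes> g" unfolding x(2) using xc gc by (simp add: word_simps)
    also have "\<dots> \<in> \<Lambda>"
      by (intro subgroup.m_closed[OF \<Lambda>] subgroup.m_inv_closed[OF \<Lambda>] g x(3))
    finally show "z \<in> conjugate g (X \<inter> \<Lambda>)" using x unfolding conjugate_def by blast
  qed
qed

lemma (in group) finite_index_in_conjugate:
  assumes K: "K \<lhd> G" and fin: "finite_index_in Y K" and Y: "Y \<subseteq> carrier G" and g: "g \<in> carrier G"
  shows "finite_index_in (conjugate g Y) K"
proof -
  obtain R where R: "finite R" "R \<subseteq> Y" "\<And>y. y \<in> Y \<Longrightarrow> \<exists>r\<in>R. inv r \<otimes> y \<in> K"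
    using fin unfolding finite_index_in_def by blast
  show ?thesis unfolding finite_index_in_def
  proof (intro exI[of _ "conjugate g R"] conjI ballI)
    show "finite (conjugate g R)" unfolding conjugate_def using R(1) by simp
    show "conjugate g R \<subseteq> conjugate g Y" unfolding conjugate_def using R(2) by blast
    fix z assume "z \<in> conjugate g Y"
    then obtain y where y: "y \<in> Y" "z = g \<otimes> y \<otimes> inv g" unfolding conjugate_def by blast
    obtain r where r: "r \<in> R" "inv r \<otimes> y \<in> K" using R(3)[OF y(1)] by blast
    have c: "y \<in> carrier G" "r \<in> carrier G" using y r R(2) Y by auto
    have "inv (g \<otimes> r \<otimes> inv g) \<otimes> z = g \<otimes> (inv r \<otimes> y) \<otimes> inv g"
      unfolding y(2) using c g by (simp add: word_simps)
    also have "\<dots> \<in> K" using K g r(2) by (simp add: normal_inv_iff)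
    finally show "\<exists>r\<in>conjugate g R. inv r \<otimes> z \<in> K" unfolding conjugate_def using r(1) by blast
  qed
qed

text \<open>A coset of \<open>X\<close> splits into cosets of \<open>Y\<close>. Those meeting the
  support of \<open>b\<close> are represented by elements of \<open>\<Lambda>\<close>, so their sums
  vanish by hypothesis, and the others contribute nothing.\<close>

lemma (in group) coset_sum_supergroup:
  assumes b: "finite {g. b g \<noteq> 0}" "{g. b g \<noteq> 0} \<subseteq> \<Lambda>" and \<Lambda>: "\<Lambda> \<subseteq> carrier G"
    and Y: "subgroup Y G" and X: "subgroup X G" "Y \<subseteq> X" and t: "t \<in> carrier G"
    and 0: "\<And>s. s \<in> \<Lambda> \<Longrightarrow> coset_sum G b s Y = 0"
  shows "coset_sum G b t X = 0"
proof -
  let ?A = "{g. b g \<noteq> 0 \<and> g \<in> t <# X}" and ?\<phi> = "\<lambda>g. g <# Y"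
  have A: "finite ?A" by (rule finite_subset[OF _ b(1)]) blast
  have YG: "Y \<subseteq> carrier G" and XG: "X \<subseteq> carrier G" using subgroup.subset Y X by auto
  have "coset_sum G b t X = (\<Sum>D\<in>?\<phi> ` ?A. \<Sum>g\<in>{g \<in> ?A. ?\<phi> g = D}. b g)"
    unfolding coset_sum_def by (rule sum.group[symmetric, OF A finite_imageI[OF A] order_refl])
  also have "\<dots> = (\<Sum>D\<in>?\<phi> ` ?A. 0)"
  proof (intro sum.cong refl)
    fix D assume "D \<in> ?\<phi> ` ?A"
    then obtain s where s: "b s \<noteq> 0" "s \<in> t <# X" "D = s <# Y" by blast
    have sL: "s \<in> \<Lambda>" "s \<in> carrier G" using s(1) b(2) \<Lambda> by auto
    have sX: "inv t \<otimes> s \<in> X" using mem_lcoset_iff[OF XG sL(2) t] s(2) by simp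
    have "g \<in> t <# X \<and> g <# Y = s <# Y \<longleftrightarrow> g \<in> s <# Y" if "b g \<noteq> 0" for g
    proof -
      have g: "g \<in> carrier G" using that b(2) \<Lambda> by auto
      have "g \<in> t <# X" if "g \<in> s <# Y"
      proof -
        have "inv s \<otimes> g \<in> X" using mem_lcoset_iff[OF YG g sL(2)] that X(2) by blast
        then have "inv t \<otimes> s \<otimes> (inv s \<otimes> g) \<in> X" by (rule subgroup.m_closed[OF X(1) sX])
        also have "inv t \<otimes> s \<otimes> (inv s \<otimes> g) = inv t \<otimes> g" using t sL g by (simp add: word_simps)
        finally show ?thesis using mem_lcoset_iff[OF XG g t] by simp
      qed
      moreover have "g <# Y = s <# Y \<longleftrightarrow> g \<in> s <# Y"
        using lcoset_eq_iff[OF Y sL(2) g] mem_lcoset_iff[OF YG g sL(2)] by auto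
      ultimately show ?thesis by blast
    qed
    then have "{g \<in> ?A. ?\<phi> g = D} = {g. b g \<noteq> 0 \<and> g \<in> s <# Y}" unfolding s(3) by blast
    then show "(\<Sum>g\<in>{g \<in> ?A. ?\<phi> g = D}. b g) = 0"
      using 0[OF sL(1)] unfolding coset_sum_def by simp
  qed
  finally show ?thesis by simp
qed

section \<open>Extension to the reduced group C*-algebra\<close>

lemma lin_ext_regular_rep: "lin_ext (regular_rep G) a = perm_lin (carrier G) (\<lambda>g h. g \<otimes>\<^bsub>G\<^esub> h) a"
  unfolding perm_lin_def regular_rep_def[abs_def] ..

lemma lin_ext_quasi_regular_rep: "lin_ext (quasi_regular_rep G X) a = coset_rep G X a"
  unfolding perm_lin_def quasi_regular_rep_def[abs_def] ..

text \<open>On the group algebra the map is well defined by \<open>regular_inj\<close> and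
  contractive by weak containment, so it extends to the closure; uniqueness identifies the result
  with \<open>quasi_regular_ext\<close>.\<close>

lemma (in group) quasi_regular_ext_exists:
  assumes m: "invariant_mean G m" and X: "subgroup X G"
  shows "continuous_on (reduced_cstar G) (quasi_regular_ext G X)"
    and "\<forall>a\<in>group_algebra G. quasi_regular_ext G X (lin_ext (regular_rep G) a) = coset_rep G X a"
proof -
  interpret r: group_perm G "carrier G" "\<lambda>g h. g \<otimes> h" by (rule regular_group_perm)
  interpret k: group_perm G "lcosets X" "l_coset G" by (rule lcosets_group_perm[OF X])
  have inj: "inj_on r.rp (group_algebra G)" by (rule inj_onI) (rule regular_inj)
  let ?O = "group_algebra_ops G"
  have O: "?O = r.rp ` group_algebra G"
    unfolding group_algebra_ops_def by (simp add: lin_ext_regular_rep)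
  define f where "f T = k.rp (inv_into (group_algebra G) r.rp T)" for T
  have f: "f (r.rp a) = k.rp a" if "a \<in> group_algebra G" for a
    unfolding f_def by (simp only: inv_into_f_f[OF inj that])
  have "dist (f T) (f T') \<le> dist T T'" if T: "T \<in> ?O" "T' \<in> ?O" for T T'
  proof -
    obtain a a' where a: "a \<in> group_algebra G" "a' \<in> group_algebra G" "T = r.rp a" "T' = r.rp a'"
      using T unfolding O by blast
    have "norm (k.rp (\<lambda>x. a x - a' x)) \<le> norm (r.rp (\<lambda>x. a x - a' x))"
      by (rule norm_perm_lin_le_regular[OF m k.group_perm_axioms ga_diff[OF a(1,2)]])
    then show ?thesis
      unfolding a(3,4) f[OF a(1)] f[OF a(2)] dist_norm by (simp add: k.rp_diff[OF a(1,2)] r.rp_diff[OF a(1,2)])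
  qed
  then have "uniformly_continuous_on ?O f"
    unfolding uniformly_continuous_on_def by (meson le_less_trans)
  then obtain h where h: "uniformly_continuous_on (closure ?O) h" "\<And>T. T \<in> ?O \<Longrightarrow> f T = h T"
    using uniformly_continuous_on_extension_on_closure by metis
  define \<pi> where "\<pi> = restrict h (reduced_cstar G)"
  have sub: "?O \<subseteq> reduced_cstar G" unfolding reduced_cstar_def by (rule closure_subset)
  have cont: "continuous_on (reduced_cstar G) \<pi>"
    using uniformly_continuous_imp_continuous[OF h(1)] unfolding \<pi>_def reduced_cstar_def
    by (simp cong: continuous_on_cong)
  have val: "\<pi> (lin_ext (regular_rep G) a) = coset_rep G X a" if a: "a \<in> group_algebra G" for a
  proof -
    have "r.rp a \<in> ?O" unfolding O using a by blast
    then have "\<pi> (r.rp a) = f (r.rp a)" using h(2) sub unfolding \<pi>_def by auto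
    then show ?thesis unfolding lin_ext_regular_rep f[OF a] .
  qed
  have "quasi_regular_ext G X = \<pi>"
    by (rule quasi_regular_ext_eqI) (use cont val in \<open>auto simp: \<pi>_def lin_ext_quasi_regular_rep\<close>)
  then show "continuous_on (reduced_cstar G) (quasi_regular_ext G X)"
    "\<forall>a\<in>group_algebra G. quasi_regular_ext G X (lin_ext (regular_rep G) a) = coset_rep G X a"
    using cont val by auto
qed

text \<open>The extension remains contractive in the limit, and it sends \<open>T\<close> to
  0.\<close>

lemma (in group) norm_coset_rep_le_of_kernel:
  assumes m: "invariant_mean G m" and X: "subgroup X G"
    and T: "T \<in> reduced_cstar G" "quasi_regular_ext G X T = 0" and a: "a \<in> group_algebra G"
  shows "norm (coset_rep G X a) \<le> norm (T - lin_ext (regular_rep G) a)"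
proof -
  interpret r: group_perm G "carrier G" "\<lambda>g h. g \<otimes> h" by (rule regular_group_perm)
  interpret k: group_perm G "lcosets X" "l_coset G" by (rule lcosets_group_perm[OF X])
  note E = quasi_regular_ext_exists[OF m X]
  let ?q = "quasi_regular_ext G X" and ?a = "lin_ext (regular_rep G) a"
  have "norm (?q T - k.rp a) \<le> norm (T - ?a)"
  proof (rule continuous_le_on_closure[where S = "group_algebra_ops G" and f = "\<lambda>T. norm (?q T - k.rp a) - norm (T - ?a)" and a = 0, simplified])
    show "continuous_on (closure (group_algebra_ops G)) (\<lambda>T. norm (?q T - k.rp a) - norm (T - ?a))"
      using E(1) unfolding reduced_cstar_def by (intro continuous_intros)
    show "T \<in> closure (group_algebra_ops G)" using T(1) unfolding reduced_cstar_def .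
    fix T' assume "T' \<in> group_algebra_ops G"
    then obtain c where c: "c \<in> group_algebra G" "T' = lin_ext (regular_rep G) c"
      unfolding group_algebra_ops_def by blast
    have "norm (k.rp (\<lambda>x. c x - a x)) \<le> norm (r.rp (\<lambda>x. c x - a x))"
      by (rule norm_perm_lin_le_regular[OF m k.group_perm_axioms ga_diff[OF c(1) a]])
    then show "norm (?q T' - k.rp a) \<le> norm (T' - ?a)"
      using E(2) c a by (simp add: k.rp_diff[OF c(1) a] r.rp_diff[OF c(1) a] lin_ext_regular_rep)
  qed
  then show ?thesis using T(2) by simp
qed

section \<open>Kernel elements in the group algebra\<close>

text \<open>The two properties of the traces of a family on a subgroup \<open>\<Lambda>\<close> that the argument needs:
  the first gives finitely many minimal traces, the second makes each of them almost normal.\<close>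

definition tame_traces :: "('g, 'b) monoid_scheme \<Rightarrow> 'g set set \<Rightarrow> 'g set \<Rightarrow> bool"
  where "tame_traces G \<X> \<Lambda> \<longleftrightarrow>
    (\<forall>X\<in>\<X>. group.locally_finitely_determined (G\<lparr>carrier := \<Lambda>\<rparr>) (X \<inter> \<Lambda>)) \<and>
    (\<forall>\<M> Y. finite \<M> \<longrightarrow> \<M> \<subseteq> (\<lambda>X. X \<inter> \<Lambda>) ` \<X> \<longrightarrow>
      (\<forall>Z\<in>\<M>. \<forall>g\<in>\<Lambda>. group.conjugate G g Z \<in> \<M>) \<longrightarrow> Y \<in> \<M> \<longrightarrow>
      group.finite_index_in (G\<lparr>carrier := \<Lambda>\<rparr>) Y (group.normal_core (G\<lparr>carrier := \<Lambda>\<rparr>) Y))"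

context group
begin

text \<open>Finite traces determine themselves, and any core has finite index in them. For finite
  index, Schreier generators and the action on cosets serve. In the nilpotent case, finite
  generation comes from slenderness, and the core is reached through an exponent bound.\<close>

lemma tame_traces_cases:
  assumes sub: "\<And>X. X \<in> \<X> \<Longrightarrow> subgroup X G" and F: "finite F" "F \<subseteq> carrier G"
    and cases: "(\<forall>X\<in>\<X>. finite X) \<or> (\<forall>X\<in>\<X>. finite (lcosets X)) \<or> finite_by_nilpotent G"
  shows "tame_traces G \<X> (generate G F)"
proof -
  let ?L = "generate G F"
  let ?H = "G\<lparr>carrier := ?L\<rparr>"
  have L: "subgroup ?L G" by (rule generate_is_subgroup[OF F(2)])
  interpret h: group ?H by (rule subgroup_imp_group[OF L])
  have FL: "F \<subseteq> carrier ?H" using generate.incl[of _ F G] by auto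
  have gen: "generate ?H F = carrier ?H" using generate_consistent[OF _ L] FL by simp
  have subH: "subgroup (X \<inter> ?L) ?H" if "X \<in> \<X>" for X
    by (rule subgroup_incl) (use subgroups_Inter_pair[OF sub[OF that] L] L in auto)
  from cases consider (I) "\<forall>X\<in>\<X>. finite X" | (II) "\<forall>X\<in>\<X>. finite (lcosets X)"
    | (III) L c N where "central_chain L c N"
    using finite_by_nilpotent_central_chain by metis
  then show ?thesis
  proof cases
    case I
    show ?thesis unfolding tame_traces_def
    proof (intro conjI ballI allI impI)
      fix X assume "X \<in> \<X>"
      then have "finite (X \<inter> ?L)" using I by blast
      then show "h.locally_finitely_determined (X \<inter> ?L)" unfolding h.locally_finitely_determined_def by blast
    next
      fix \<M> Y assume "\<M> \<subseteq> (\<lambda>X. X \<inter> ?L) ` \<X>" "Y \<in> \<M>"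
      then obtain X where X: "X \<in> \<X>" "Y = X \<inter> ?L" by blast
      have fin: "finite Y" unfolding X(2) using I X(1) by blast
      have sY: "subgroup Y ?H" unfolding X(2) by (rule subH[OF X(1)])
      have "inv\<^bsub>?H\<^esub> y \<otimes>\<^bsub>?H\<^esub> y \<in> h.normal_core Y" if "y \<in> Y" for y
        using h.l_inv[of y] subgroup.subset[OF sY] that subgroup.one_closed[OF normal_imp_subgroup[OF h.normal_core_normal[OF sY]]]
        by auto
      then show "h.finite_index_in Y (h.normal_core Y)" unfolding h.finite_index_in_def using fin by blast
    qed
  next
    case II
    have fl: "finite (lcosets\<^bsub>?H\<^esub> (X \<inter> ?L))" if "X \<in> \<X>" for X
      by (rule finite_lcosets_Int[OF sub[OF that] _ L]) (use II that in blast)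
    show ?thesis unfolding tame_traces_def
    proof (intro conjI ballI allI impI)
      fix X assume X: "X \<in> \<X>"
      show "h.locally_finitely_determined (X \<inter> ?L)"
        by (rule h.finite_index_finitely_determined[OF F(1) FL gen subH[OF X] fl[OF X]])
    next
      fix \<M> Y assume "\<M> \<subseteq> (\<lambda>X. X \<inter> ?L) ` \<X>" "Y \<in> \<M>"
      then obtain X where X: "X \<in> \<X>" "Y = X \<inter> ?L" by blast
      show "h.finite_index_in Y (h.normal_core Y)"
        unfolding X(2) by (rule h.finite_index_core[OF subH[OF X(1)] fl[OF X(1)]])
    qed
  next
    case (III L c N)
    note ch = central_chain_subgroup[OF III \<open>subgroup ?L G\<close>]
    note good = h.good_carrier_of_central_chain[OF ch F(1) FL gen]
    show ?thesis unfolding tame_traces_def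
    proof (intro conjI ballI allI impI)
      fix X assume X: "X \<in> \<X>"
      show "h.locally_finitely_determined (X \<inter> ?L)"
        by (rule h.slender_finitely_determined[OF good(1) subH[OF X]])
    next
      fix \<M> Y assume M: "finite \<M>" "\<M> \<subseteq> (\<lambda>X. X \<inter> ?L) ` \<X>" "\<forall>Z\<in>\<M>. \<forall>g\<in>?L. conjugate g Z \<in> \<M>" and Y: "Y \<in> \<M>"
      then obtain X where X: "X \<in> \<X>" "Y = X \<inter> ?L" by blast
      have sY: "subgroup Y ?H" unfolding X(2) by (rule subH[OF X(1)])
      have conj: "h.conjugate g Z \<in> \<M>" if "Z \<in> \<M>" "g \<in> carrier ?H" for Z g
        using that M(3) conjugate_restrict[OF L] by simp
      \<comment> \<open>Here the finiteness of \<open>\<M>\<close> enters: it makes \<open>Y\<close>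
        almost normal, so that its powers of some fixed exponent lie in the core, and
        \<open>torsion_finite\<close> turns this into finite index.\<close>
      obtain e :: nat where e: "e > 0" "\<forall>g\<in>carrier ?H. \<forall>y\<in>Y. g [^]\<^bsub>?H\<^esub> e \<otimes>\<^bsub>?H\<^esub> y \<otimes>\<^bsub>?H\<^esub> inv\<^bsub>?H\<^esub> (g [^]\<^bsub>?H\<^esub> e) \<in> Y"
        using h.finite_conjugates_exponent[OF M(1) conj Y subgroup.subset[OF sY]] by blast
      have "\<exists>n>0. \<forall>y\<in>Y. y [^]\<^bsub>?H\<^esub> (n::nat) \<in> h.normal_core Y"
        by (rule h.almost_normal_exponent[OF ch sY e(1)]) (rule e(2)[rule_format])
      then show "h.finite_index_in Y (h.normal_core Y)"
        using good(2)[unfolded h.torsion_finite_def, rule_format, of "h.normal_core Y" Y]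
          normal_imp_subgroup[OF h.normal_core_normal[OF sY]] sY h.normal_core_subset subgroup.subset[OF sY] by blast
    qed
  qed
qed

text \<open>If a member of the family contains \<open>E X\<close>, its trace contains
  \<open>X \<inter> \<Lambda>\<close>. By compactness finitely many traces suffice to lie below all
  others, and every minimal trace is among them. Conjugation by \<open>\<Lambda>\<close> preserves
  inclusions of traces, hence minimality.\<close>

lemma finite_minimal_traces:
  assumes \<Lambda>: "subgroup \<Lambda> G" and cl: "closedin (chabauty G) \<X>"
    and conj: "\<And>X g. X \<in> \<X> \<Longrightarrow> g \<in> carrier G \<Longrightarrow> conjugate g X \<in> \<X>"
    and tame: "tame_traces G \<X> \<Lambda>"
  obtains \<M> where "finite \<M>" "\<M> \<subseteq> (\<lambda>X. X \<inter> \<Lambda>) ` \<X>" "\<And>Y g. Y \<in> \<M> \<Longrightarrow> g \<in> \<Lambda> \<Longrightarrow> conjugate g Y \<in> \<M>"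
    "\<And>X. X \<in> \<X> \<Longrightarrow> \<exists>Y\<in>\<M>. Y \<subseteq> X"
proof -
  interpret h: group "G\<lparr>carrier := \<Lambda>\<rparr>" by (rule subgroup_imp_group[OF \<Lambda>])
  have \<Lambda>G: "g \<in> carrier G" if "g \<in> \<Lambda>" for g using that subgroup.subset[OF \<Lambda>] by blast
  have sub: "subgroup X G" if "X \<in> \<X>" for X
    using closedin_subset[OF cl] that unfolding topspace_chabauty by blast
  let ?Z = "(\<lambda>X. X \<inter> \<Lambda>) ` \<X>"
  have "\<exists>E. finite E \<and> E \<subseteq> X \<inter> \<Lambda> \<and> (\<forall>Z. subgroup Z (G\<lparr>carrier := \<Lambda>\<rparr>) \<longrightarrow> E \<subseteq> Z \<longrightarrow> X \<inter> \<Lambda> \<subseteq> Z)" if "X \<in> \<X>" for X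
    using tame that unfolding tame_traces_def h.locally_finitely_determined_def by blast
  then obtain E where E: "\<And>X. X \<in> \<X> \<Longrightarrow> finite (E X)" "\<And>X. X \<in> \<X> \<Longrightarrow> E X \<subseteq> X \<inter> \<Lambda>"
    "\<And>X Z. X \<in> \<X> \<Longrightarrow> subgroup Z (G\<lparr>carrier := \<Lambda>\<rparr>) \<Longrightarrow> E X \<subseteq> Z \<Longrightarrow> X \<inter> \<Lambda> \<subseteq> Z" by metis
  have "finite (E X) \<and> E X \<subseteq> X" if "X \<in> \<X>" for X using E(1,2)[OF that] by blast
  then obtain \<X>0 where X0: "finite \<X>0" "\<X>0 \<subseteq> \<X>" "\<And>X'. X' \<in> \<X> \<Longrightarrow> \<exists>X\<in>\<X>0. E X \<subseteq> X'"
    using chabauty_finite_subcover[OF cl] by metis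
  let ?W = "(\<lambda>X. X \<inter> \<Lambda>) ` \<X>0"
  have Z0: "\<exists>Z\<in>?W. Z \<subseteq> Z'" if Z': "Z' \<in> ?Z" for Z'
  proof -
    obtain X' where X': "X' \<in> \<X>" "Z' = X' \<inter> \<Lambda>" using Z' by blast
    obtain X where X: "X \<in> \<X>0" "E X \<subseteq> X'" using X0(3)[OF X'(1)] by blast
    then have XX: "X \<in> \<X>" using X0(2) by blast
    have "subgroup (X' \<inter> \<Lambda>) (G\<lparr>carrier := \<Lambda>\<rparr>)"
      by (rule subgroup_incl) (use subgroups_Inter_pair[OF sub[OF X'(1)] \<Lambda>] \<Lambda> in auto)
    then have "X \<inter> \<Lambda> \<subseteq> X' \<inter> \<Lambda>" by (rule E(3)[OF XX]) (use E(2)[OF XX] X(2) in blast)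
    then show ?thesis using X(1) X'(2) by blast
  qed
  define \<M> where "\<M> = {Y \<in> ?Z. \<forall>Z\<in>?Z. Z \<subseteq> Y \<longrightarrow> Z = Y}"
  have MZ0: "\<M> \<subseteq> ?W"
  proof
    fix Y assume Y: "Y \<in> \<M>"
    then have "Y \<in> ?Z" unfolding \<M>_def by simp
    from Z0[OF this] obtain Z where Z: "Z \<in> ?W" "Z \<subseteq> Y" by blast
    have "Z \<in> ?Z" using Z(1) X0(2) by blast
    then have "Z = Y" using Y Z(2) unfolding \<M>_def by blast
    then show "Y \<in> ?W" using Z(1) by simp
  qed
  have Zconj: "conjugate g Y \<in> ?Z" if Y: "Y \<in> ?Z" and g: "g \<in> \<Lambda>" for Y g
  proof -
    obtain X where X: "X \<in> \<X>" "Y = X \<inter> \<Lambda>" using Y by blast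
    have "conjugate g Y = conjugate g X \<inter> \<Lambda>"
      unfolding X(2) by (rule conjugate_subgroup_Int[OF \<Lambda> g subgroup.subset[OF sub[OF X(1)]]])
    then show ?thesis using conj[OF X(1) \<Lambda>G[OF g]] by blast
  qed
  have Zc: "Y \<subseteq> carrier G" if "Y \<in> ?Z" for Y using that \<Lambda>G by blast
  show thesis
  proof (rule that)
    show "finite \<M>" by (rule finite_subset[OF MZ0]) (use X0(1) in simp)
    show "\<M> \<subseteq> ?Z" unfolding \<M>_def by blast
    fix Y g assume Y: "Y \<in> \<M>" and g: "g \<in> \<Lambda>"
    have YZ: "Y \<in> ?Z" using Y unfolding \<M>_def by simp
    have gi: "inv g \<in> \<Lambda>" by (rule subgroup.m_inv_closed[OF \<Lambda> g])
    have "Z = conjugate g Y" if Z: "Z \<in> ?Z" "Z \<subseteq> conjugate g Y" for Z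
    proof -
      have "conjugate (inv g) Z \<subseteq> conjugate (inv g) (conjugate g Y)"
        using Z(2) unfolding conjugate_def by blast
      also have "\<dots> = Y" using conjugate_mult[of "inv g" g Y] conjugate_one[OF Zc[OF YZ]] Zc[OF YZ] \<Lambda>G[OF g] by simp
      finally have "conjugate (inv g) Z = Y" using Y Zconj[OF Z(1) gi] unfolding \<M>_def by blast
      then have "conjugate g Y = conjugate g (conjugate (inv g) Z)" by simp
      also have "\<dots> = Z" using conjugate_mult[of g "inv g" Z] conjugate_one[OF Zc[OF Z(1)]] Zc[OF Z(1)] \<Lambda>G[OF g] by simp
      finally show ?thesis by simp
    qed
    then show "conjugate g Y \<in> \<M>" using Zconj[OF YZ g] unfolding \<M>_def by blast
  next
    fix X assume "X \<in> \<X>"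
    then have "X \<inter> \<Lambda> \<in> ?Z" by blast
    from Z0[OF this] obtain Z where Z: "Z \<in> ?W" "Z \<subseteq> X \<inter> \<Lambda>" by (rule bexE)
    from finite_has_minimal2[OF finite_imageI[OF X0(1)] Z(1)]
    obtain Y where YW: "Y \<in> ?W" and Y': "Y \<subseteq> Z \<and> (\<forall>W\<in>?W. W \<subseteq> Y \<longrightarrow> Y = W)" by (rule bexE)
    have Y: "Y \<subseteq> Z" "\<And>W. W \<in> ?W \<Longrightarrow> W \<subseteq> Y \<Longrightarrow> Y = W"
      using conjunct1[OF Y'] conjunct2[OF Y', rule_format] by - assumption+
    \<comment> \<open>Minimality in the finite \<open>?W\<close> upgrades to minimality among all
      traces, because every trace contains a member of \<open>?W\<close>.\<close>
    have min: "W = Y" if W: "W \<in> ?Z" "W \<subseteq> Y" for W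
    proof -
      from Z0[OF W(1)] obtain V where V: "V \<in> ?W" "V \<subseteq> W" by (rule bexE)
      have "Y = V" by (rule Y(2)[OF V(1) order_trans[OF V(2) W(2)]])
      then show ?thesis using V(2) W(2) by simp
    qed
    have "Y \<in> ?Z" using YW X0(2) by (rule subsetD[OF image_mono, rotated])
    then have "Y \<in> \<M>" unfolding \<M>_def by (intro CollectI conjI ballI impI min)
    then show "\<exists>Y\<in>\<M>. Y \<subseteq> X" using Y(1) Z(2) by (meson Int_lower1 order_trans)
  qed
qed

text \<open>The instance of \<open>finite_core_class\<close> for the conjugates of \<open>Y\<close>
  under \<open>\<Lambda>\<close>: distances are measured in the regular representation of
  \<open>G\<close>, and smallness is given in its quasi-regular representations, both restricted to
  \<open>\<Lambda>\<close>.\<close>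

lemma trace_class_approx:
  assumes mean: "invariant_mean G m" and \<Lambda>: "subgroup \<Lambda> G" and sub: "\<And>X. X \<in> \<X> \<Longrightarrow> subgroup X G"
    and tame: "tame_traces G \<X> \<Lambda>"
    and M: "finite \<M>" "\<M> \<subseteq> (\<lambda>X. X \<inter> \<Lambda>) ` \<X>" "\<And>Y g. Y \<in> \<M> \<Longrightarrow> g \<in> \<Lambda> \<Longrightarrow> conjugate g Y \<in> \<M>"
    and Y: "Y \<in> \<M>"
  shows "\<exists>C\<ge>0. \<forall>a\<in>group_algebra (G\<lparr>carrier := \<Lambda>\<rparr>). \<forall>s. (\<forall>X\<in>\<X>. norm (coset_rep G X a) \<le> s) \<longrightarrow> (\<forall>\<delta>>0.
    \<exists>b\<in>group_algebra (G\<lparr>carrier := \<Lambda>\<rparr>). coset_rep (G\<lparr>carrier := \<Lambda>\<rparr>) Y b = 0 \<and>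
      norm (perm_lin (carrier G) (\<lambda>g h. g \<otimes> h) a - perm_lin (carrier G) (\<lambda>g h. g \<otimes> h) b) \<le> C * s + \<delta>)"
proof -
  let ?H = "G\<lparr>carrier := \<Lambda>\<rparr>"
  interpret h: group ?H by (rule subgroup_imp_group[OF \<Lambda>])
  have \<Lambda>G: "g \<in> carrier G" if "g \<in> \<Lambda>" for g using that subgroup.subset[OF \<Lambda>] by blast
  obtain m' where m': "invariant_mean ?H m'" by (rule amenable_subgroup[OF mean \<Lambda>])
  have "\<exists>X\<in>\<X>. Z = X \<inter> \<Lambda>" if "Z \<in> \<M>" for Z using M(2) that by blast
  \<comment> \<open>One member of the family is chosen for each trace \<open>Z\<close>; its base
    coset has stabiliser \<open>Xof Z \<inter> \<Lambda> = Z\<close> in \<open>\<Lambda>\<close>, as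
    the locale demands.\<close>
  then obtain Xof where Xof: "\<And>Z. Z \<in> \<M> \<Longrightarrow> Xof Z \<in> \<X>" "\<And>Z. Z \<in> \<M> \<Longrightarrow> Z = Xof Z \<inter> \<Lambda>" by metis
  have subM: "subgroup Z ?H" if Z: "Z \<in> \<M>" for Z
  proof -
    have "subgroup (Xof Z \<inter> \<Lambda>) ?H"
      by (rule subgroup_incl) (use subgroups_Inter_pair[OF sub[OF Xof(1)[OF Z]] \<Lambda>] \<Lambda> in auto)
    then show ?thesis using Xof(2)[OF Z] by simp
  qed
  have YH: "Y \<subseteq> carrier ?H" by (rule subgroup.subset[OF subM[OF Y]])
  define K where "K = h.normal_core Y"
  have K: "K \<lhd> ?H" unfolding K_def by (rule h.normal_core_normal[OF subM[OF Y]])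
  have fin: "h.finite_index_in Y K"
    using tame M Y unfolding tame_traces_def K_def by blast
  define \<C> where "\<C> = (\<lambda>g. h.conjugate g Y) ` \<Lambda>"
  have CM: "Z \<in> \<M>" if "Z \<in> \<C>" for Z
    using that M(3)[OF Y] conjugate_restrict[OF \<Lambda>] unfolding \<C>_def by auto
  have YC: "Y \<in> \<C>"
    unfolding \<C>_def using h.conjugate_one[OF YH] h.one_closed by (metis imageI partial_object.simps(1) partial_object.surjective partial_object.update_convs(1))
  interpret f: finite_core_class ?H m' K \<C> "carrier G" "\<lambda>g h. g \<otimes> h" "\<lambda>Z. lcosets (Xof Z)" "l_coset G" Xof
  proof (intro finite_core_class.intro finite_core_class_axioms.intro)
    show "group ?H" by (rule h.is_group)
    show "invariant_mean ?H m'" by (rule m')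
    show "K \<lhd> ?H" by (rule K)
    show "finite \<C>" by (rule finite_subset[OF _ M(1)]) (use CM in blast)
    show "group_perm ?H (carrier G) (\<lambda>g h. g \<otimes> h)" by (rule group_perm_restrict[OF regular_group_perm \<Lambda>])
    fix Z assume Z: "Z \<in> \<C>"
    then obtain g where g: "g \<in> carrier ?H" "Z = h.conjugate g Y" unfolding \<C>_def by auto
    note s = sub[OF Xof(1)[OF CM[OF Z]]]
    show "subgroup Z ?H" by (rule subM[OF CM[OF Z]])
    have "K \<subseteq> Y" unfolding K_def by (rule h.normal_core_subset)
    then have "h.conjugate g K \<subseteq> Z" unfolding g(2) h.conjugate_def by blast
    then show "K \<subseteq> Z" unfolding h.conjugate_normal[OF K g(1)] .
    show "h.finite_index_in Z K" unfolding g(2) by (rule h.finite_index_in_conjugate[OF K fin YH g(1)])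
    show "h.conjugate x Z \<in> \<C>" if x: "x \<in> carrier ?H" for x
    proof -
      have "h.conjugate x Z = h.conjugate (x \<otimes>\<^bsub>?H\<^esub> g) Y" unfolding g(2) by (rule h.conjugate_mult[OF x g(1) YH, symmetric])
      then show ?thesis unfolding \<C>_def using h.m_closed[OF x g(1)] by auto
    qed
    show "group_perm ?H (lcosets (Xof Z)) (l_coset G)" by (rule group_perm_restrict[OF lcosets_group_perm[OF s] \<Lambda>])
    have "Xof Z = \<one> <# Xof Z" using lcos_mult_one[OF subgroup.subset[OF s]] by simp
    then show "Xof Z \<in> lcosets (Xof Z)" unfolding LCOSETS_def using one_closed by blast
    fix x y assume x: "x \<in> carrier ?H" and y: "y \<in> carrier ?H" and eq: "x <# Xof Z = y <# Xof Z"
    have "x \<in> carrier G" "y \<in> carrier G" using x y \<Lambda>G by auto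
    from lcoset_eq_iff[OF s this] eq have "inv x \<otimes> y \<in> Xof Z" by simp
    moreover have "inv x \<otimes> y \<in> \<Lambda>"
      by (intro subgroup.m_closed[OF \<Lambda>] subgroup.m_inv_closed[OF \<Lambda>]) (use x y in auto)
    ultimately have "inv x \<otimes> y \<in> Z" using Xof(2)[OF CM[OF Z]] by blast
    then show "inv\<^bsub>?H\<^esub> x \<otimes>\<^bsub>?H\<^esub> y \<in> Z" using m_inv_consistent[OF \<Lambda>, of x] x by simp
  qed
  obtain C where C: "C \<ge> 0" "\<And>a s \<delta>. a \<in> group_algebra ?H \<Longrightarrow> (\<forall>Z\<in>\<C>. norm (coset_rep G (Xof Z) a) \<le> s) \<Longrightarrow> \<delta> > 0 \<Longrightarrow>
    \<exists>b\<in>group_algebra ?H. (\<forall>Z\<in>\<C>. \<forall>t\<in>carrier ?H. coset_sum ?H b t Z = 0) \<and> norm (f.r.rp a - f.r.rp b) \<le> C * s + \<delta>"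
    using f.vanishing_approx by metis
  show ?thesis
  proof (intro exI[of _ C] conjI ballI allI impI C(1))
    fix a s and \<delta> :: real assume a: "a \<in> group_algebra ?H" and s: "\<forall>X\<in>\<X>. norm (coset_rep G X a) \<le> s" and \<delta>: "\<delta> > 0"
    have "\<forall>Z\<in>\<C>. norm (coset_rep G (Xof Z) a) \<le> s" using s Xof(1) CM by blast
    from C(2)[OF a this \<delta>] obtain b where b: "b \<in> group_algebra ?H"
      "\<forall>Z\<in>\<C>. \<forall>t\<in>carrier ?H. coset_sum ?H b t Z = 0" "norm (f.r.rp a - f.r.rp b) \<le> C * s + \<delta>" by blast
    have "coset_rep ?H Y b = 0"
    proof (rule h.coset_rep_eq_0[OF subM[OF Y] b(1)])
      fix x t assume x: "x \<in> carrier ?H" and t: "t \<in> carrier ?H"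
      have "h.conjugate x Y \<in> \<C>" using x unfolding \<C>_def by auto
      then show "coset_sum ?H b t (h.conjugate x Y) = 0" using b(2) t by blast
    qed
    then show "\<exists>b\<in>group_algebra ?H. coset_rep ?H Y b = 0 \<and> norm (f.r.rp a - f.r.rp b) \<le> C * s + \<delta>"
      using b by blast
  qed
qed

text \<open>The constants of the single classes and of the intersection of finitely many ideals are
  combined first and removed together afterwards. The coset sums over the minimal traces then
  control every member of the family.\<close>

lemma approx_by_kernel:
  assumes mean: "invariant_mean G m" and \<Lambda>: "subgroup \<Lambda> G" and cl: "closedin (chabauty G) \<X>"
    and conj: "\<And>X g. X \<in> \<X> \<Longrightarrow> g \<in> carrier G \<Longrightarrow> conjugate g X \<in> \<X>"
    and tame: "tame_traces G \<X> \<Lambda>" and ne: "\<X> \<noteq> {}"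
    and a: "a \<in> group_algebra (G\<lparr>carrier := \<Lambda>\<rparr>)" "\<forall>X\<in>\<X>. norm (coset_rep G X a) \<le> s" and d: "s < d"
  shows "\<exists>b\<in>group_algebra G. (\<forall>X\<in>\<X>. coset_rep G X b = 0) \<and>
    norm (perm_lin (carrier G) (\<lambda>g h. g \<otimes> h) a - perm_lin (carrier G) (\<lambda>g h. g \<otimes> h) b) \<le> d"
proof -
  let ?H = "G\<lparr>carrier := \<Lambda>\<rparr>"
  let ?A = "group_algebra ?H"
  interpret h: group ?H by (rule subgroup_imp_group[OF \<Lambda>])
  interpret r: group_perm ?H "carrier G" "\<lambda>g h. g \<otimes> h" by (rule group_perm_restrict[OF regular_group_perm \<Lambda>])
  have \<Lambda>G: "\<Lambda> \<subseteq> carrier G" by (rule subgroup.subset[OF \<Lambda>])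
  have sub: "subgroup X G" if "X \<in> \<X>" for X
    using closedin_subset[OF cl] that unfolding topspace_chabauty by blast
  obtain \<M> where M: "finite \<M>" "\<M> \<subseteq> (\<lambda>X. X \<inter> \<Lambda>) ` \<X>" "\<And>Y g. Y \<in> \<M> \<Longrightarrow> g \<in> \<Lambda> \<Longrightarrow> conjugate g Y \<in> \<M>"
    "\<And>X. X \<in> \<X> \<Longrightarrow> \<exists>Y\<in>\<M>. Y \<subseteq> X"
    by (rule finite_minimal_traces[OF \<Lambda> cl conj tame]) (assumption | rule that)+
  have Mne: "\<M> \<noteq> {}" using ne M(4) by blast
  have subM: "subgroup Y ?H" "subgroup Y G" "Y \<subseteq> \<Lambda>" if Y: "Y \<in> \<M>" for Y
  proof -
    obtain X where X: "X \<in> \<X>" "Y = X \<inter> \<Lambda>" using M(2) Y by blast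
    show YG: "subgroup Y G" unfolding X(2) by (rule subgroups_Inter_pair[OF sub[OF X(1)] \<Lambda>])
    show YL: "Y \<subseteq> \<Lambda>" unfolding X(2) by blast
    show "subgroup Y ?H" by (rule subgroup_incl[OF YG \<Lambda> YL])
  qed
  define I where "I Y = r.rp ` {b \<in> ?A. coset_rep ?H Y b = 0}" for Y
  have ideal: "op_ideal (r.rp ` ?A) (I Y)" if "Y \<in> \<M>" for Y
    unfolding I_def by (rule op_ideal_perm_lin_kernel[OF r.group_perm_axioms h.lcosets_group_perm[OF subM(1)[OF that]]])
  have sa: "selfadj_set (r.rp ` ?A)" by (rule selfadj_set_perm_lin[OF r.group_perm_axioms])
  note fia = finite_Int_approx[where I = I, OF sa M(1) Mne ideal]
  have "\<forall>Y\<in>\<M>. \<exists>C\<ge>0. \<forall>a\<in>?A. \<forall>s. (\<forall>X\<in>\<X>. norm (coset_rep G X a) \<le> s) \<longrightarrow> (\<forall>\<delta>>0.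
    \<exists>b\<in>?A. coset_rep ?H Y b = 0 \<and> norm (r.rp a - r.rp b) \<le> C * s + \<delta>)"
    by (intro ballI trace_class_approx[OF mean \<Lambda> sub tame M(1,2,3)])
  from bchoice[OF this] obtain C where C: "\<And>Y. Y \<in> \<M> \<Longrightarrow> C Y \<ge> 0"
    "\<And>Y a s \<delta>. Y \<in> \<M> \<Longrightarrow> a \<in> ?A \<Longrightarrow> (\<forall>X\<in>\<X>. norm (coset_rep G X a) \<le> s) \<Longrightarrow> \<delta> > 0 \<Longrightarrow>
      \<exists>b\<in>?A. coset_rep ?H Y b = 0 \<and> norm (r.rp a - r.rp b) \<le> C Y * s + \<delta>" by blast
  define C1 where "C1 = (\<Sum>Y\<in>\<M>. C Y)"
  have C1: "C Y \<le> C1" if "Y \<in> \<M>" for Y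
    unfolding C1_def by (rule member_le_sum[OF that _ M(1)]) (use C(1) in blast)
  have C1_0: "C1 \<ge> 0" unfolding C1_def by (rule sum_nonneg) (rule C(1))
  obtain C0 where C0: "C0 \<ge> 0" "\<And>T d. (\<forall>Y\<in>\<M>. \<exists>B\<in>I Y. norm (T - B) \<le> d) \<Longrightarrow> 0 < d \<Longrightarrow>
    \<exists>B\<in>(\<Inter>Y\<in>\<M>. I Y). norm (T - B) \<le> C0 * d" using fia(1) by blast
  \<comment> \<open>The second seminorm is the supremum of the norms in the quasi-regular
    representations, encoded by its upper bounds; squares are respected since each of these
    representations is compatible with products and adjoints.\<close>
  define R where "R T r \<longleftrightarrow> (\<exists>a\<in>?A. T = r.rp a \<and> 0 \<le> r \<and> (\<forall>X\<in>\<X>. norm (coset_rep G X a) \<le> r))" for T r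
  have "\<exists>B\<in>(\<Inter>Y\<in>\<M>. I Y). norm (r.rp a - B) \<le> d"
  proof (rule ideal_dist_uniq[where R = R, OF sa fia(2)])
    show "0 \<le> C0 * C1" using C0(1) C1_0 by simp
    show "T \<in> r.rp ` ?A \<and> 0 \<le> r" if "R T r" for T r using that unfolding R_def by blast
    show "\<exists>T'. adjoints T T' \<and> R (T' o\<^sub>L T) (r\<^sup>2)" if RT: "R T r" for T r
    proof -
      obtain c where c: "c \<in> ?A" "T = r.rp c" "0 \<le> r" "\<forall>X\<in>\<X>. norm (coset_rep G X c) \<le> r"
        using RT unfolding R_def by blast
      let ?c = "star ?H c"
      have gc: "?c \<in> ?A" by (rule h.ga_star[OF c(1)])
      have "norm (coset_rep G X (conv ?H ?c c)) \<le> r\<^sup>2" if X: "X \<in> \<X>" for X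
      proof -
        interpret k: group_perm ?H "lcosets X" "l_coset G"
          by (rule group_perm_restrict[OF lcosets_group_perm[OF sub[OF X]] \<Lambda>])
        have n: "norm (k.rp c) \<le> r" using c(4) X by blast
        have "norm (k.rp ?c) \<le> r" using adjoints_norm_le[OF k.rp_adj[OF c(1)]] n by linarith
        then have "norm (k.rp ?c) * norm (k.rp c) \<le> r * r" using n c(3) by (intro mult_mono) auto
        then show ?thesis
          unfolding k.rp_conv[OF gc c(1)] power2_eq_square
          using norm_blinfun_compose[of "k.rp ?c" "k.rp c"] by linarith
      qed
      then have "R (r.rp ?c o\<^sub>L T) (r\<^sup>2)"
        unfolding R_def c(2) using r.rp_conv[OF gc c(1)] h.ga_conv[OF gc c(1)] by force
      then show ?thesis using r.rp_adj[OF c(1)] c(2) by blast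
    qed
    show "\<exists>B\<in>(\<Inter>Y\<in>\<M>. I Y). norm (T - B) \<le> d'" if RT: "R T r" and d': "C0 * C1 * r < d'" for T r d'
    proof -
      obtain c where c: "c \<in> ?A" "T = r.rp c" "0 \<le> r" "\<forall>X\<in>\<X>. norm (coset_rep G X c) \<le> r"
        using RT unfolding R_def by blast
      \<comment> \<open>The gap between \<open>C0 * C1 * r\<close> and \<open>d'\<close> must still
        accommodate this slack after multiplication by \<open>C0\<close>.\<close>
      define \<delta> where "\<delta> = (d' - C0 * C1 * r) / (C0 + 1)"
      have \<delta>: "\<delta> > 0" unfolding \<delta>_def using d' C0(1) by simp
      have "\<exists>B\<in>I Y. norm (T - B) \<le> C1 * r + \<delta>" if Y: "Y \<in> \<M>" for Y
      proof -
        obtain b where b: "b \<in> ?A" "coset_rep ?H Y b = 0" "norm (r.rp c - r.rp b) \<le> C Y * r + \<delta>"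
          using C(2)[OF Y c(1,4) \<delta>] by blast
        have "C Y * r \<le> C1 * r" by (rule mult_right_mono[OF C1[OF Y] c(3)])
        then have "norm (T - r.rp b) \<le> C1 * r + \<delta>" using b(3) unfolding c(2) by linarith
        moreover have "r.rp b \<in> I Y" unfolding I_def using b by blast
        ultimately show ?thesis by blast
      qed
      moreover have "0 < C1 * r + \<delta>" using C1_0 c(3) \<delta> by (simp add: add_nonneg_pos)
      ultimately obtain B where B: "B \<in> (\<Inter>Y\<in>\<M>. I Y)" "norm (T - B) \<le> C0 * (C1 * r + \<delta>)"
        using C0(2) by blast
      have "C0 * \<delta> \<le> (C0 + 1) * \<delta>" using \<delta> by simp
      also have "\<dots> = d' - C0 * C1 * r" unfolding \<delta>_def using C0(1) by simp
      finally have "C0 * (C1 * r + \<delta>) \<le> d'" by (simp add: algebra_simps)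
      then show ?thesis using B by (meson order_trans)
    qed
    obtain X where X: "X \<in> \<X>" using ne by blast
    have "0 \<le> s" using a(2) X norm_ge_zero order_trans by blast
    then show "R (r.rp a) s" unfolding R_def using a by blast
  qed (rule d | assumption)+
  then obtain B where B: "\<And>Y. Y \<in> \<M> \<Longrightarrow> B \<in> I Y" "norm (r.rp a - B) \<le> d" by blast
  obtain Y1 where Y1: "Y1 \<in> \<M>" using Mne by blast
  obtain b where b: "b \<in> ?A" "B = r.rp b" using B(1)[OF Y1] unfolding I_def by blast
  have bG: "b \<in> group_algebra G" by (rule group_algebra_restrict[OF \<Lambda>G b(1)])
  \<comment> \<open>Membership in the ideal of \<open>Y\<close> provides its own preimage of
    \<open>B\<close>; injectivity of the regular representation identifies it with
    \<open>b\<close>.\<close>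
  have bY: "coset_rep ?H Y b = 0" if Y: "Y \<in> \<M>" for Y
  proof -
    obtain b' where b': "b' \<in> ?A" "coset_rep ?H Y b' = 0" "B = r.rp b'" using B(1)[OF Y] unfolding I_def by blast
    have "b' = b" by (rule regular_inj[OF group_algebra_restrict[OF \<Lambda>G b'(1)] bG]) (use b(2) b'(3) in simp)
    then show ?thesis using b'(2) by simp
  qed
  have cs: "coset_sum G b t Y = 0" if Y: "Y \<in> \<M>" and t: "t \<in> \<Lambda>" for Y t
    using h.coset_rep_delta[OF subM(1)[OF Y] b(1), of t] bY[OF Y] t by (simp add: coset_sum_restrict)
  have "coset_rep G X b = 0" if X: "X \<in> \<X>" for X
  proof (rule coset_rep_eq_0[OF sub[OF X] bG])
    fix x t assume x: "x \<in> carrier G" and t: "t \<in> carrier G"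
    have X': "conjugate x X \<in> \<X>" by (rule conj[OF X x])
    \<comment> \<open>The family is conjugation-invariant under all of \<open>G\<close>, so the
      conjugate \<open>conjugate x X\<close> also lies above a minimal trace.\<close>
    obtain Y where Y: "Y \<in> \<M>" "Y \<subseteq> conjugate x X" using M(4)[OF X'] by blast
    have "{g. b g \<noteq> 0} \<subseteq> \<Lambda>" using group_algebraD(2)[OF b(1)] by simp
    then show "coset_sum G b t (conjugate x X) = 0"
      by (rule coset_sum_supergroup[OF group_algebraD(1)[OF b(1)] _ \<Lambda>G subM(2)[OF Y(1)] sub[OF X'] Y(2) t cs[OF Y(1)]])
  qed
  then show ?thesis using bG B(2) b(2) by blast
qed

end

theorem theorem4p16:
  fixes G :: "('g, 'b) monoid_scheme" and \<X> :: "'g set set"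
  assumes "amenable_group G"
    and "closedin (chabauty G) \<X>"
    and "conjugation_invariant G \<X>"
    and "(\<forall>X\<in>\<X>. finite X) \<or>
         (\<forall>X\<in>\<X>. finite (lcosets\<^bsub>G\<^esub> X)) \<or>
         (countable (carrier G) \<and> finite_by_nilpotent G)"
  shows "\<X> \<in> D_set G"
proof -
  interpret group G using assms(1) unfolding amenable_group_def by blast
  obtain m where m: "invariant_mean G m" using assms(1) unfolding amenable_group_def by blast
  interpret r: group_perm G "carrier G" "\<lambda>g h. g \<otimes>\<^bsub>G\<^esub> h" by (rule regular_group_perm)
  have sub: "subgroup X G" if "X \<in> \<X>" for X
    using closedin_subset[OF assms(2)] that unfolding topspace_chabauty by blast
  have conj: "conjugate g X \<in> \<X>" if "X \<in> \<X>" "g \<in> carrier G" for X g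
    using assms(3)[unfolded conjugation_invariant_def, rule_format, OF that]
    unfolding conjugate_eq_cosets[OF that(2) subgroup.subset[OF sub[OF that(1)]]] .
  have cases: "(\<forall>X\<in>\<X>. finite X) \<or> (\<forall>X\<in>\<X>. finite (lcosets\<^bsub>G\<^esub> X)) \<or> finite_by_nilpotent G"
    using assms(4) by blast
  have "T \<in> closure (J_ideal G \<X> \<inter> group_algebra_ops G)" if T: "T \<in> J_ideal G \<X>" for T
    unfolding closure_approachable
  proof (intro allI impI)
    fix \<epsilon> :: real assume \<epsilon>: "0 < \<epsilon>"
    have Tr: "T \<in> reduced_cstar G" and T0: "\<And>X. X \<in> \<X> \<Longrightarrow> quasi_regular_ext G X T = 0"
      using T unfolding J_ideal_def by auto
    \<comment> \<open>A quarter of \<open>\<epsilon>\<close> bounds the distance to \<open>T\<close>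
      and thereby \<open>a\<close> in every quasi-regular representation. The strict increase
      required by \<open>approx_by_kernel\<close> is met by \<open>\<epsilon> / 2\<close>, for a
      total below \<open>\<epsilon>\<close>.\<close>
    obtain S where S: "S \<in> group_algebra_ops G" "dist S T < \<epsilon> / 4"
      using Tr \<epsilon> unfolding reduced_cstar_def closure_approachable by (metis divide_pos_pos zero_less_numeral)
    obtain a where a: "a \<in> group_algebra G" "S = r.rp a"
      using S(1) unfolding group_algebra_ops_def by (auto simp: lin_ext_regular_rep)
    have near: "norm (T - r.rp a) < \<epsilon> / 4" using S(2) unfolding a(2) by (simp add: dist_norm norm_minus_commute)
    have bound: "norm (coset_rep G X a) \<le> \<epsilon> / 4" if X: "X \<in> \<X>" for X
      using norm_coset_rep_le_of_kernel[OF m sub[OF X] Tr T0[OF X] a(1)] near by (simp add: lin_ext_regular_rep)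
    have "\<exists>b\<in>group_algebra G. (\<forall>X\<in>\<X>. coset_rep G X b = 0) \<and> norm (r.rp a - r.rp b) \<le> \<epsilon> / 2"
    proof (cases "\<X> = {}")
      \<comment> \<open>For the empty family the ideal is the whole algebra, and \<open>a\<close>
        itself serves.\<close>
      case True
      then show ?thesis using a(1) \<epsilon> by (intro bexI[of _ a]) auto
    next
      case False
      \<comment> \<open>The support of \<open>a\<close> generates the subgroup to which the whole
        argument is restricted.\<close>
      let ?F = "{g. a g \<noteq> 0}"
      note F = group_algebraD[OF a(1)]
      have a': "a \<in> group_algebra (G\<lparr>carrier := generate G ?F\<rparr>)"
        by (rule group_algebraI[OF F(1)]) (auto intro: generate.incl)
      have tame: "tame_traces G \<X> (generate G ?F)"
        by (rule tame_traces_cases[OF _ F cases]) (rule sub)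
      show ?thesis
      proof (rule approx_by_kernel[OF m generate_is_subgroup[OF F(2)] assms(2) _ tame False a'])
        show "\<forall>X\<in>\<X>. norm (coset_rep G X a) \<le> \<epsilon> / 4" using bound by blast
        show "\<epsilon> / 4 < \<epsilon> / 2" using \<epsilon> by simp
      qed (rule conj)
    qed
    then obtain b where b: "b \<in> group_algebra G" "\<And>X. X \<in> \<X> \<Longrightarrow> coset_rep G X b = 0" "norm (r.rp a - r.rp b) \<le> \<epsilon> / 2"
      by blast
    have ops: "r.rp b \<in> group_algebra_ops G"
      unfolding group_algebra_ops_def using b(1) by (auto simp: lin_ext_regular_rep)
    then have "r.rp b \<in> reduced_cstar G" unfolding reduced_cstar_def using closure_subset by blast
    moreover have "quasi_regular_ext G X (r.rp b) = 0" if X: "X \<in> \<X>" for X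
      using quasi_regular_ext_exists(2)[OF m sub[OF X]] b(1) b(2)[OF X] by (auto simp: lin_ext_regular_rep)
    ultimately have "r.rp b \<in> J_ideal G \<X>" unfolding J_ideal_def by blast
    moreover have "dist (r.rp b) T < \<epsilon>"
    proof -
      have "norm (T - r.rp b) \<le> norm (T - r.rp a) + norm (r.rp a - r.rp b)"
        using norm_triangle_ineq[of "T - r.rp a" "r.rp a - r.rp b"] by simp
      then show ?thesis using near b(3) \<epsilon> by (simp add: dist_norm norm_minus_commute)
    qed
    ultimately show "\<exists>y\<in>J_ideal G \<X> \<inter> group_algebra_ops G. dist y T < \<epsilon>" using ops by blast
  qed
  then show ?thesis unfolding D_set_def using assms(2,3) by blast
qed

end
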